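(* Let $\mathrm{Ricci}=\mathrm{Ricci}_{+-}+\mathrm{Ricci}_{-+}$ be the decomposition of the Ricci tensor of the quantum projective space corresponding to $g=g_{+-}+g_{-+}$, defined with the splitting map $s_\wedge$ depending on scalars $c_{+-},c_{-+}$ with $c_{+-}+c_{-+}=1$. Then $$\mathrm{Ricci}_{+-}=-c_{-+}\,q^{-2(\omega_s,2\rho)}\,\mathrm{qdim}(V)\,g_{+-}.$$
   Context: **Quantum group data.** Fix an integer $r\ge 1$, a real number $0<q<1$ and $s\in\{1,r\}$. $U_q(\mathfrak{sl}_{r+1})$ is the quantized enveloping algebra with generators $K_i^{\pm1},E_i,F_i$, $1\le i\le r$ (Klimyk–Schmüdgen conventions: $\Delta(K_i)=K_i\otimes K_i$, $\Delta(E_i)=E_i\otimes K_i+1\otimes E_i$, $\Delta(F_i)=F_i\otimes 1+K_i^{-1}\otimes F_i$; $K_i$ acts on a vector of weight $\mu$ by $q^{(\alpha_i,\mu)}$). Here $\alpha_i$ are the simple roots, $\omega_i$ the fundamental weights, $\rho=\sum_i\omega_i$, $w_0$ the longest Weyl group element, $(\cdot,\cdot)$ on weights is the invariant form with $(\alpha_i,\alpha_i)=2$. Put $a=(\alpha_s,\alpha_s)=2$, $w=(\omega_s,\omega_s)$, $m=(\omega_s,2\rho)=r$. $V(\lambda)$ is the simple type 1 module of highest weight $\lambda$, $V=V(\omega_s)$, and $V^*$ is its dual with $(Xf)(v)=f(S(X)v)$, $S$ the antipode. $\hat{R}_{X,Y}:X\otimes Y\to Y\otimes X$ is the braiding on finite-dimensional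 type 1 modules determined by being a module map with $\hat{R}_{V(\lambda),V(\mu)}(v\otimes u)=q^{(\lambda,w_0\mu)}u\otimes v$ for $v$ a highest weight vector of $V(\lambda)$ and $u$ a lowest weight vector of $V(\mu)$. Let $(v_i)$ be a weight basis of $V$ with weights $\lambda_i$ and dual basis $(f^i)$ of $V^*$. Define $\mathsf{E}(f^i\otimes v_j)=\delta_{ij}$, $\mathsf{E}'(v_i\otimes f^j)=q^{(\lambda_i,2\rho)}\delta_{ij}$, $\mathsf{C}=\sum_i v_i\otimes f^i$, $\mathsf{C}'=\sum_i q^{-(\lambda_i,2\rho)}f^i\otimes v_i$. Also $\mathrm{qdim}(V)=\sum_i q^{(\lambda_i,2\rho)}$. Subscripts indicate the tensor legs on which a map acts ($\mathsf{C}_n,\mathsf{C}'_n$ insert the element at legs $n,n+1$); products of maps are compositions (rightmost first), legs being renumbered after each contraction or insertion. Put $$\mathsf{S}_{123}=(\hat{R}_{V,V^*})_{23}(\hat{R}_{V,V})_{12}(\hat{R}_{V,V^*}^{-1})_{23},\quad \tilde{\mathsf{S}}_{234}=(\hat{R}_{V,V^*})_{23}(\hat{R}_{V^*,V^*}^{-1})_{34}(\hat{R}_{V,V^*}^{-1})_{23},\quad \mathsf{T}_{1234}=\mathsf{S}_{123}\tilde{\mathsf{S}}_{234}=\tilde{\mathsf{S}}_{234}\mathsf{S}_{123}$$ (acting on $V\otimes V^*\otimes V$, $V^*\otimes V\otimes V^*$, $V\otimes V^*\otimes V\otimes V^*$ at the indicated legs). **Index-free notation.** A family $x=(x^{ij})_{1\le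 i,j\le r+1}$ is identified with $\sum_{i,j}v_i\otimes f^j\otimes x^{ij}$; products of families $xy$ (also $x\otimes y$, $x\wedge y$, $(x,y)$) denote $\sum v_i\otimes f^j\otimes v_k\otimes f^l\otimes x^{ij}y^{kl}$ (resp. with $\otimes_{\mathcal{B}}$, $\wedge$, the inverse metric), and similarly for more factors. The maps above act on the $V,V^*$ legs; other maps act on components. Elements such as $g_{+-}$ below carry no legs. **Algebra and first-order calculus.** $\mathcal{B}$ is the unital algebra generated by $p^{ij}$, $1\le i,j\le r+1$, with relations $\mathsf{S}_{123}pp=q^{w}pp$, $\tilde{\mathsf{S}}_{234}pp=q^{-w}pp$, $\mathsf{E}'_{12}p=q^{m}$. The Heckenberger–Kolb first-order differential calculus is $\Omega=\Omega_+\oplus\Omega_-$, with $\Omega_+,\Omega_-$ generated as left $\mathcal{B}$-modules by $\partial p^{ij}$, resp. $\bar\partial p^{ij}$, with relations $$\tilde{\mathsf{S}}_{234}p\,\partial p=q^{-w}p\,\partial p,\quad \mathsf{E}'_{12}\partial p=0,\qquad \mathsf{S}_{123}p\,\bar\partial p=q^{w}p\,\bar\partial p,\quad \mathsf{E}'_{12}\bar\partial p=0,$$ right module structure $\partial p\,p=q^{a}\mathsf{T}_{1234}p\,\partial p$, $\bar\partial p\,p=q^{-a}\mathsf{T}_{1234}p\,\bar\partial p$, and differential $\mathrm{d}=\partial+\bar\partial$, where $\partial,\bar\partial:\mathcal{B}\to\Omega_\pm$ are the derivations with $p^{ij}\mapsto\partial p^{ij},\bar\partial p^{ij}$. **Universal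 calculus.** $\Omega^\bullet$ is the quotient of the tensor algebra $T_{\mathcal{B}}(\Omega)$ by the two-sided ideal generated by $\{\sum_i\mathrm{d}a_i\otimes\mathrm{d}b_i:\sum_i a_i\mathrm{d}b_i=0\}\subset\Omega\otimes_{\mathcal{B}}\Omega$; its product is $\wedge$, and $\mathrm{d}(a\,\mathrm{d}b)=\mathrm{d}a\wedge\mathrm{d}b$. **Metric and inverse metric.** $g=g_{+-}+g_{-+}$ with $g_{+-}=\mathsf{E}'_{12}\mathsf{E}_{23}\,\partial p\otimes\bar\partial p$ and $g_{-+}=\mathsf{E}'_{12}\mathsf{E}_{23}\,\bar\partial p\otimes\partial p$ in $\Omega\otimes_{\mathcal{B}}\Omega$ (central elements). The inverse metric is the (well-defined) $\mathcal{B}$-bimodule map $(\cdot,\cdot):\Omega\otimes_{\mathcal{B}}\Omega\to\mathcal{B}$ with $(\partial p,\partial p)=(\bar\partial p,\bar\partial p)=0$, $(\partial p,\bar\partial p)=q^{a}q^{-w-m}\mathsf{S}_{123}\mathsf{C}_3p-q^{a}q^{-m}pp$, $(\bar\partial p,\partial p)=\mathsf{C}'_2p-q^{-m}pp$. **Connection and Riemann tensor.** The quantum Levi-Civita connection is the (well-defined) linear map $\nabla:\Omega\to\Omega\otimes_{\mathcal{B}}\Omega$ with $\nabla(b\omega)=\mathrm{d}b\otimes\omega+b\nabla(\omega)$ and $$\nabla(\partial p)=q^{a}\mathsf{E}_{23}\mathsf{T}_{1234}\,\bar\partial p\otimes\partial p-q^{a}q^{-m}\,p\,g_{-+},\qquad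 \nabla(\bar\partial p)=\mathsf{E}_{23}\,\partial p\otimes\bar\partial p-q^{-m}\,p\,g_{+-}.$$ The Riemann tensor is $R_\nabla:=(\mathrm{d}\otimes\mathrm{id}-(\wedge\otimes\mathrm{id})\circ(\mathrm{id}\otimes\nabla))\circ\nabla:\Omega\to\Omega^2\otimes_{\mathcal{B}}\Omega$. **Generalized braiding.** $\sigma$ is the (well-defined) $\mathcal{B}$-bimodule map $\Omega\otimes_{\mathcal{B}}\Omega\to\Omega\otimes_{\mathcal{B}}\Omega$ given by $$\sigma(\partial p\otimes\partial p)=q^{a}\mathsf{S}_{123}\tilde{\mathsf{S}}_{234}\,\partial p\otimes\partial p,\qquad \sigma(\bar\partial p\otimes\bar\partial p)=q^{-a}\mathsf{S}_{123}\tilde{\mathsf{S}}_{234}\,\bar\partial p\otimes\bar\partial p,$$ $$\sigma(\partial p\otimes\bar\partial p)=q^{2a-2w}\mathsf{S}_{123}\tilde{\mathsf{S}}_{234}^{-1}\,\bar\partial p\otimes\partial p+(1-q^{a})q^{a}q^{-m}\,p\,g_{-+}\,p,$$ $$\sigma(\bar\partial p\otimes\partial p)=q^{2w-2a}\mathsf{S}_{123}^{-1}\tilde{\mathsf{S}}_{234}\,\partial p\otimes\bar\partial p+(1-q^{-a})q^{-m}\,p\,g_{+-}\,p.$$ **Splitting map.** For scalars with $c_{+-}+c_{-+}=1$, the $\mathcal{B}$-bimodule map $s_\wedge:\Omega^2\to\Omega\otimes_{\mathcal{B}}\Omega$ (satisfying $\wedge\circ s_\wedge=\mathrm{id}$)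 is induced from $\Omega\otimes_{\mathcal{B}}\Omega$ by: $\frac{1}{1+q^{-a}}(\mathrm{id}-q^{-a}\sigma)$ on $\Omega_+\otimes_{\mathcal{B}}\Omega_+$, $\frac{1}{1+q^{a}}(\mathrm{id}-q^{a}\sigma)$ on $\Omega_-\otimes_{\mathcal{B}}\Omega_-$, $c_{+-}\mathrm{id}-c_{-+}\sigma$ on $\Omega_+\otimes_{\mathcal{B}}\Omega_-$, $c_{-+}\mathrm{id}-c_{+-}\sigma$ on $\Omega_-\otimes_{\mathcal{B}}\Omega_+$. **Ricci tensor.** With $\Phi:=((\cdot,\cdot)\otimes\mathrm{id}\otimes\mathrm{id})\circ(\mathrm{id}\otimes s_\wedge\otimes\mathrm{id})\circ(\mathrm{id}\otimes R_\nabla)$, one puts $\mathrm{Ricci}:=\Phi(g)\in\Omega\otimes_{\mathcal{B}}\Omega$, $\mathrm{Ricci}_{+-}:=\Phi(g_{+-})$, $\mathrm{Ricci}_{-+}:=\Phi(g_{-+})$. *)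

theory Defs
  imports
    "HOL-Algebra.QuotRing"
    "HOL-Algebra.Module"
    "HOL-Algebra.Free_Abelian_Groups"
    "HOL-Analysis.Analysis"
begin

section \<open>Weights of $\mathfrak{sl}_{r+1}$\<close>

text \<open>Weights are realised in the usual way as vectors
  $(\lambda_1,\dots,\lambda_{r+1})$ with coordinate sum zero (extended by zero to all
  indices), the invariant form being the dot product, so that $(\alpha_i,\alpha_i)=2$. The
  longest Weyl group element reverses the coordinates.\<close>

type_synonym weight = "nat \<Rightarrow> real"

definition wform :: "nat \<Rightarrow> weight \<Rightarrow> weight \<Rightarrow> real" where
  "wform r \<mu> \<nu> = (\<Sum>k = 1..r + 1. \<mu> k * \<nu> k)"

definition simple_root :: "nat \<Rightarrow> weight" where
  "simple_root i = (\<lambda>k. if k = i then 1 else if k = i + 1 then - 1 else 0)"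

definition fund_weight :: "nat \<Rightarrow> nat \<Rightarrow> weight" where
  "fund_weight r i =
     (\<lambda>k. if k \<in> {1..r + 1} then (if k \<le> i then 1 else 0) - real i / real (r + 1) else 0)"

definition rho :: "nat \<Rightarrow> weight" where
  "rho r = (\<lambda>k. \<Sum>i = 1..r. fund_weight r i k)"

definition two_rho :: "nat \<Rightarrow> weight" where
  "two_rho r = (\<lambda>k. 2 * rho r k)"

definition longest :: "nat \<Rightarrow> weight \<Rightarrow> weight" where
  "longest r \<mu> = (\<lambda>k. if k \<in> {1..r + 1} then \<mu> (r + 2 - k) else 0)"

definition weight_lattice :: "nat \<Rightarrow> weight set" where
  "weight_lattice r = {\<mu>. \<exists>n :: nat \<Rightarrow> int. \<mu> = (\<lambda>k. \<Sum>i = 1..r. of_int (n i) * fund_weight r i k)}"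

lemma simple_root_fund_weight:
  assumes "i \<in> {1..r}" "j \<in> {1..r}"
  shows "wform r (simple_root i) (fund_weight r j) = (if i = j then 1 else 0)"
proof -
  have "wform r (simple_root i) (fund_weight r j)
      = (\<Sum>k = 1..r + 1. (if k = i then fund_weight r j k else 0)
          - (if k = i + 1 then fund_weight r j k else 0))"
    unfolding wform_def simple_root_def by (intro sum.cong) auto
  also have "\<dots> = fund_weight r j i - fund_weight r j (i + 1)"
    using assms by (simp add: sum_subtractf)
  also have "\<dots> = (if i = j then 1 else 0)"
    using assms unfolding fund_weight_def by auto
  finally show ?thesis .
qed

section \<open>Finite-dimensional modules over $U_q(\mathfrak{sl}_{r+1})$\<close>

text \<open>A module structure on the space of column vectors \<^typ>\<open>complex ^ 'n\<close> is given by
  the matrices by which the generators $K_i, K_i^{-1}, E_i, F_i$, $1\le i\le r$, act.\<close>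

record 'n uq_rep =
  Kact :: "nat \<Rightarrow> complex ^ 'n ^ 'n"
  Kinv :: "nat \<Rightarrow> complex ^ 'n ^ 'n"
  Eact :: "nat \<Rightarrow> complex ^ 'n ^ 'n"
  Fact :: "nat \<Rightarrow> complex ^ 'n ^ 'n"

definition qpow :: "real \<Rightarrow> real \<Rightarrow> complex" where
  "qpow q x = complex_of_real (q powr x)"

definition serre :: "real \<Rightarrow> real \<Rightarrow> complex ^ 'n ^ 'n \<Rightarrow> complex ^ 'n ^ 'n \<Rightarrow> bool" where
  "serre q a X Y \<longleftrightarrow>
     (a = 0 \<longrightarrow> X ** Y = Y ** X) \<and>
     (a = - 1 \<longrightarrow> X ** X ** Y - mat (qpow q 1 + qpow q (- 1)) ** X ** Y ** X + Y ** X ** X = 0)"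

definition is_uq_rep :: "nat \<Rightarrow> real \<Rightarrow> ('n::finite) uq_rep \<Rightarrow> bool" where
  "is_uq_rep r q X \<longleftrightarrow> (\<forall>i\<in>{1..r}. \<forall>j\<in>{1..r}.
     let a = wform r (simple_root i) (simple_root j) in
     Kact X i ** Kinv X i = mat 1 \<and> Kinv X i ** Kact X i = mat 1 \<and>
     Kact X i ** Kact X j = Kact X j ** Kact X i \<and>
     Kact X i ** Eact X j ** Kinv X i = mat (qpow q a) ** Eact X j \<and>
     Kact X i ** Fact X j ** Kinv X i = mat (qpow q (- a)) ** Fact X j \<and>
     Eact X i ** Fact X j - Fact X j ** Eact X i =
       (if i = j then mat (1 / (qpow q 1 - qpow q (- 1))) ** (Kact X i - Kinv X i) else 0) \<and>
     serre q a (Eact X i) (Eact X j) \<and> serre q a (Fact X i) (Fact X j))"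

definition kron :: "complex ^ 'n ^ 'n \<Rightarrow> complex ^ 'm ^ 'm \<Rightarrow> complex ^ ('n \<times> 'm) ^ ('n \<times> 'm)" where
  "kron A B = (\<chi> i j. A $ fst i $ fst j * B $ snd i $ snd j)"

definition vkron :: "complex ^ 'n \<Rightarrow> complex ^ 'm \<Rightarrow> complex ^ ('n \<times> 'm)" where
  "vkron x y = (\<chi> i. x $ fst i * y $ snd i)"

definition rep_tensor :: "('n::finite) uq_rep \<Rightarrow> ('m::finite) uq_rep \<Rightarrow> ('n \<times> 'm) uq_rep" where
  "rep_tensor X Y = \<lparr>
     Kact = (\<lambda>i. kron (Kact X i) (Kact Y i)),
     Kinv = (\<lambda>i. kron (Kinv X i) (Kinv Y i)),
     Eact = (\<lambda>i. kron (Eact X i) (Kact Y i) + kron (mat 1) (Eact Y i)),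
     Fact = (\<lambda>i. kron (Fact X i) (mat 1) + kron (Kinv X i) (Fact Y i))\<rparr>"

text \<open>Since $(Xf)(v)=f(S(X)v)$, in the dual basis $X$ acts by the transpose of the matrix of
  $S(X)$. For the coproduct above $S(K_i)=K_i^{-1}$, $S(E_i)=-E_iK_i^{-1}$ and
  $S(F_i)=-K_iF_i$.\<close>

definition rep_dual :: "('n::finite) uq_rep \<Rightarrow> 'n uq_rep" where
  "rep_dual X = \<lparr>
     Kact = (\<lambda>i. transpose (Kinv X i)),
     Kinv = (\<lambda>i. transpose (Kact X i)),
     Eact = (\<lambda>i. transpose (- (Eact X i ** Kinv X i))),
     Fact = (\<lambda>i. transpose (- (Kact X i ** Fact X i)))\<rparr>"

definition weight_vector :: "nat \<Rightarrow> real \<Rightarrow> ('n::finite) uq_rep \<Rightarrow> weight \<Rightarrow> complex ^ 'n \<Rightarrow> bool" where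
  "weight_vector r q X \<mu> v \<longleftrightarrow> v \<noteq> 0 \<and> \<mu> \<in> weight_lattice r \<and>
     (\<forall>i\<in>{1..r}. Kact X i *v v = qpow q (wform r (simple_root i) \<mu>) *s v)"

definition highest_weight_vector :: "nat \<Rightarrow> real \<Rightarrow> ('n::finite) uq_rep \<Rightarrow> weight \<Rightarrow> complex ^ 'n \<Rightarrow> bool" where
  "highest_weight_vector r q X \<mu> v \<longleftrightarrow> weight_vector r q X \<mu> v \<and> (\<forall>i\<in>{1..r}. Eact X i *v v = 0)"

definition lowest_weight_vector :: "nat \<Rightarrow> real \<Rightarrow> ('n::finite) uq_rep \<Rightarrow> complex ^ 'n \<Rightarrow> bool" where
  "lowest_weight_vector r q X u \<longleftrightarrow>
     (\<exists>\<nu>. weight_vector r q X \<nu> u) \<and> (\<forall>i\<in>{1..r}. Fact X i *v u = 0)"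

definition simple_rep :: "nat \<Rightarrow> ('n::finite) uq_rep \<Rightarrow> bool" where
  "simple_rep r X \<longleftrightarrow> (\<forall>W. vec.subspace W \<and>
     (\<forall>i\<in>{1..r}. \<forall>w\<in>W. Kact X i *v w \<in> W \<and> Kinv X i *v w \<in> W \<and>
        Eact X i *v w \<in> W \<and> Fact X i *v w \<in> W) \<longrightarrow> W = {0} \<or> W = UNIV)"

definition is_simple_highest_weight_rep :: "nat \<Rightarrow> real \<Rightarrow> weight \<Rightarrow> ('n::finite) uq_rep \<Rightarrow> bool" where
  "is_simple_highest_weight_rep r q \<mu> X \<longleftrightarrow>
     is_uq_rep r q X \<and> simple_rep r X \<and> (\<exists>v. highest_weight_vector r q X \<mu> v)"

definition is_rep_hom :: "nat \<Rightarrow> ('n::finite) uq_rep \<Rightarrow> ('m::finite) uq_rep \<Rightarrow> complex ^ 'n ^ 'm \<Rightarrow> bool" where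
  "is_rep_hom r X Y A \<longleftrightarrow> (\<forall>i\<in>{1..r}.
     A ** Kact X i = Kact Y i ** A \<and> A ** Kinv X i = Kinv Y i ** A \<and>
     A ** Eact X i = Eact Y i ** A \<and> A ** Fact X i = Fact Y i ** A)"

text \<open>The braiding $X\otimes Y\to Y\otimes X$ for simple $X=V(\lambda)$, $Y=V(\mu)$; it is
  used only for $X,Y\in\{V,V^*\}$.\<close>

definition braiding ::
    "nat \<Rightarrow> real \<Rightarrow> ('n::finite) uq_rep \<Rightarrow> ('m::finite) uq_rep \<Rightarrow> complex ^ ('n \<times> 'm) ^ ('m \<times> 'n)" where
  "braiding r q X Y = (THE R. is_rep_hom r (rep_tensor X Y) (rep_tensor Y X) R \<and>
     (\<forall>\<nu> \<mu> v v' u. highest_weight_vector r q X \<nu> v \<and> highest_weight_vector r q Y \<mu> v' \<and>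
        lowest_weight_vector r q Y u \<longrightarrow>
        R *v vkron v u = qpow q (wform r \<nu> (longest r \<mu>)) *s vkron u v))"

section \<open>The quantum group data\<close>

text \<open>The simple module $V=V(\omega_s)$ is given in an arbitrary weight basis $(v_i)$, labelled
  by a type of cardinality $r+1$: the $i$-th standard basis vector of \<^typ>\<open>complex ^ 'n\<close>
  is $v_i$, and \<open>wts i\<close> is its weight $\lambda_i$.\<close>

record 'n qdata =
  rank :: nat
  node :: nat
  qpar :: real
  Vmod :: "'n uq_rep"
  wts :: "'n \<Rightarrow> weight"

definition omega_s :: "'n qdata \<Rightarrow> weight" where
  "omega_s D = fund_weight (rank D) (node D)"

definition quantum_data :: "('n::finite) qdata \<Rightarrow> bool" where
  "quantum_data D \<longleftrightarrow>
     rank D \<ge> 1 \<and> node D \<in> {1, rank D} \<and> 0 < qpar D \<and> qpar D < 1 \<and>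
     CARD('n) = rank D + 1 \<and>
     is_simple_highest_weight_rep (rank D) (qpar D) (omega_s D) (Vmod D) \<and>
     (\<forall>i. weight_vector (rank D) (qpar D) (Vmod D) (wts D i) (axis i 1))"

definition exp_a :: "'n qdata \<Rightarrow> real" where
  "exp_a D = wform (rank D) (simple_root (node D)) (simple_root (node D))"

definition exp_w :: "'n qdata \<Rightarrow> real" where
  "exp_w D = wform (rank D) (omega_s D) (omega_s D)"

definition exp_m :: "'n qdata \<Rightarrow> real" where
  "exp_m D = wform (rank D) (omega_s D) (two_rho (rank D))"

definition qq :: "'n qdata \<Rightarrow> real \<Rightarrow> complex" where
  "qq D x = qpow (qpar D) x"

text \<open>\<open>q2rho D i\<close> is $q^{(\lambda_i,2\rho)}$.\<close>

definition q2rho :: "'n qdata \<Rightarrow> 'n \<Rightarrow> complex" where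
  "q2rho D i = qq D (wform (rank D) (wts D i) (two_rho (rank D)))"

definition qdim :: "('n::finite) qdata \<Rightarrow> complex" where
  "qdim D = (\<Sum>i\<in>UNIV. q2rho D i)"

definition R_VV :: "('n::finite) qdata \<Rightarrow> complex ^ ('n \<times> 'n) ^ ('n \<times> 'n)" where
  "R_VV D = braiding (rank D) (qpar D) (Vmod D) (Vmod D)"

definition R_VVd :: "('n::finite) qdata \<Rightarrow> complex ^ ('n \<times> 'n) ^ ('n \<times> 'n)" where
  "R_VVd D = braiding (rank D) (qpar D) (Vmod D) (rep_dual (Vmod D))"

definition R_VdVd :: "('n::finite) qdata \<Rightarrow> complex ^ ('n \<times> 'n) ^ ('n \<times> 'n)" where
  "R_VdVd D = braiding (rank D) (qpar D) (rep_dual (Vmod D)) (rep_dual (Vmod D))"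

section \<open>Index-free notation\<close>

text \<open>A family is the function of its indices giving its components in a complex vector space
  \<open>M\<close>; for instance \<open>x i j k l\<close> is the component at
  $v_i\otimes f^j\otimes v_k\otimes f^l$. A map of the tensor legs acts on the labelling basis
  vectors, hence on components by its matrix. All modules over algebras below, and the algebras
  themselves, are HOL-Algebra \<open>module\<close> records with scalars \<^typ>\<open>complex\<close>; the ring
  multiplication fields \<open>mult\<close> and \<open>one\<close> are meaningful for the algebras only.\<close>

type_synonym ('n, 'm) fam2 = "'n \<Rightarrow> 'n \<Rightarrow> 'm"
type_synonym ('n, 'm) fam4 = "'n \<Rightarrow> 'n \<Rightarrow> 'n \<Rightarrow> 'n \<Rightarrow> 'm"

definition leg12 :: "(complex, 'm, 'z) module_scheme \<Rightarrow> complex ^ ('n::finite \<times> 'n) ^ ('n \<times> 'n) \<Rightarrow>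
    ('n, 'm) fam4 \<Rightarrow> ('n, 'm) fam4" where
  "leg12 M R x = (\<lambda>i j k l. \<Oplus>\<^bsub>M\<^esub>c\<in>UNIV. (R $ (i, j) $ c) \<odot>\<^bsub>M\<^esub> x (fst c) (snd c) k l)"

definition leg23 :: "(complex, 'm, 'z) module_scheme \<Rightarrow> complex ^ ('n::finite \<times> 'n) ^ ('n \<times> 'n) \<Rightarrow>
    ('n, 'm) fam4 \<Rightarrow> ('n, 'm) fam4" where
  "leg23 M R x = (\<lambda>i j k l. \<Oplus>\<^bsub>M\<^esub>c\<in>UNIV. (R $ (j, k) $ c) \<odot>\<^bsub>M\<^esub> x i (fst c) (snd c) l)"

definition leg34 :: "(complex, 'm, 'z) module_scheme \<Rightarrow> complex ^ ('n::finite \<times> 'n) ^ ('n \<times> 'n) \<Rightarrow>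
    ('n, 'm) fam4 \<Rightarrow> ('n, 'm) fam4" where
  "leg34 M R x = (\<lambda>i j k l. \<Oplus>\<^bsub>M\<^esub>c\<in>UNIV. (R $ (k, l) $ c) \<odot>\<^bsub>M\<^esub> x i j (fst c) (snd c))"

definition S123 :: "('n::finite) qdata \<Rightarrow> (complex, 'm, 'z) module_scheme \<Rightarrow>
    ('n, 'm) fam4 \<Rightarrow> ('n, 'm) fam4" where
  "S123 D M x = leg23 M (R_VVd D) (leg12 M (R_VV D) (leg23 M (matrix_inv (R_VVd D)) x))"

definition St234 :: "('n::finite) qdata \<Rightarrow> (complex, 'm, 'z) module_scheme \<Rightarrow>
    ('n, 'm) fam4 \<Rightarrow> ('n, 'm) fam4" where
  "St234 D M x = leg23 M (R_VVd D) (leg34 M (matrix_inv (R_VdVd D)) (leg23 M (matrix_inv (R_VVd D)) x))"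

definition S123_inv :: "('n::finite) qdata \<Rightarrow> (complex, 'm, 'z) module_scheme \<Rightarrow>
    ('n, 'm) fam4 \<Rightarrow> ('n, 'm) fam4" where
  "S123_inv D M x = leg23 M (R_VVd D) (leg12 M (matrix_inv (R_VV D)) (leg23 M (matrix_inv (R_VVd D)) x))"

definition St234_inv :: "('n::finite) qdata \<Rightarrow> (complex, 'm, 'z) module_scheme \<Rightarrow>
    ('n, 'm) fam4 \<Rightarrow> ('n, 'm) fam4" where
  "St234_inv D M x = leg23 M (R_VVd D) (leg34 M (R_VdVd D) (leg23 M (matrix_inv (R_VVd D)) x))"

definition T1234 :: "('n::finite) qdata \<Rightarrow> (complex, 'm, 'z) module_scheme \<Rightarrow>
    ('n, 'm) fam4 \<Rightarrow> ('n, 'm) fam4" where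
  "T1234 D M x = S123 D M (St234 D M x)"

definition E23 :: "(complex, 'm, 'z) module_scheme \<Rightarrow> ('n::finite, 'm) fam4 \<Rightarrow> ('n, 'm) fam2" where
  "E23 M x = (\<lambda>i l. \<Oplus>\<^bsub>M\<^esub>j\<in>UNIV. x i j j l)"

definition E'12 :: "('n::finite) qdata \<Rightarrow> (complex, 'm, 'z) module_scheme \<Rightarrow> ('n, 'm) fam2 \<Rightarrow> 'm" where
  "E'12 D M x = (\<Oplus>\<^bsub>M\<^esub>i\<in>UNIV. q2rho D i \<odot>\<^bsub>M\<^esub> x i i)"

definition C3 :: "(complex, 'm, 'z) module_scheme \<Rightarrow> ('n, 'm) fam2 \<Rightarrow> ('n, 'm) fam4" where
  "C3 M x = (\<lambda>i j k l. if k = l then x i j else \<zero>\<^bsub>M\<^esub>)"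

definition C'2 :: "('n::finite) qdata \<Rightarrow> (complex, 'm, 'z) module_scheme \<Rightarrow> ('n, 'm) fam2 \<Rightarrow> ('n, 'm) fam4" where
  "C'2 D M x = (\<lambda>i j k l. if j = k then inverse (q2rho D j) \<odot>\<^bsub>M\<^esub> x i l else \<zero>\<^bsub>M\<^esub>)"

definition fscale2 :: "(complex, 'm, 'z) module_scheme \<Rightarrow> complex \<Rightarrow> ('n, 'm) fam2 \<Rightarrow> ('n, 'm) fam2" where
  "fscale2 M c x = (\<lambda>i j. c \<odot>\<^bsub>M\<^esub> x i j)"

definition fscale4 :: "(complex, 'm, 'z) module_scheme \<Rightarrow> complex \<Rightarrow> ('n, 'm) fam4 \<Rightarrow> ('n, 'm) fam4" where
  "fscale4 M c x = (\<lambda>i j k l. c \<odot>\<^bsub>M\<^esub> x i j k l)"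

definition fadd4 :: "(complex, 'm, 'z) module_scheme \<Rightarrow> ('n, 'm) fam4 \<Rightarrow> ('n, 'm) fam4 \<Rightarrow> ('n, 'm) fam4" where
  "fadd4 M x y = (\<lambda>i j k l. x i j k l \<oplus>\<^bsub>M\<^esub> y i j k l)"

definition fminus2 :: "(complex, 'm, 'z) module_scheme \<Rightarrow> ('n, 'm) fam2 \<Rightarrow> ('n, 'm) fam2 \<Rightarrow> ('n, 'm) fam2" where
  "fminus2 M x y = (\<lambda>i j. x i j \<ominus>\<^bsub>M\<^esub> y i j)"

definition fminus4 :: "(complex, 'm, 'z) module_scheme \<Rightarrow> ('n, 'm) fam4 \<Rightarrow> ('n, 'm) fam4 \<Rightarrow> ('n, 'm) fam4" where
  "fminus4 M x y = (\<lambda>i j k l. x i j k l \<ominus>\<^bsub>M\<^esub> y i j k l)"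

definition fprod :: "('a \<Rightarrow> 'b \<Rightarrow> 'c) \<Rightarrow> ('n, 'a) fam2 \<Rightarrow> ('n, 'b) fam2 \<Rightarrow> ('n, 'c) fam4" where
  "fprod f x y = (\<lambda>i j k l. f (x i j) (y k l))"

definition entries4 :: "('n, 'm) fam4 \<Rightarrow> 'm set" where
  "entries4 x = {x i j k l | i j k l. True}"

section \<open>The algebra\<close>

text \<open>The free unital algebra on generators of type \<open>'x\<close> consists of the finitely supported
  functions on the free monoid of words, multiplied by convolution.\<close>

datatype 'x free_word = Letters (letters: "'x list")

instantiation free_word :: (type) monoid_add
begin
definition zero_free_word :: "'a free_word" where "0 = Letters []"
definition plus_free_word :: "'a free_word \<Rightarrow> 'a free_word \<Rightarrow> 'a free_word" where
  "u + v = Letters (letters u @ letters v)"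
instance
  by standard (simp_all add: zero_free_word_def plus_free_word_def)
end

definition free_algebra :: "(complex, 'x free_word \<Rightarrow>\<^sub>0 complex) module" where
  "free_algebra = \<lparr>carrier = UNIV, monoid.mult = (*), monoid.one = 1, ring.zero = 0, ring.add = (+),
     module.smult = (\<lambda>c f. Poly_Mapping.single 0 c * f)\<rparr>"

type_synonym 'n free_alg = "('n \<times> 'n) free_word \<Rightarrow>\<^sub>0 complex"
type_synonym 'n alg = "'n free_alg set"

definition gen0 :: "'n \<Rightarrow> 'n \<Rightarrow> 'n free_alg" where
  "gen0 i j = Poly_Mapping.single (Letters [(i, j)]) 1"

definition alg_relations :: "('n::finite) qdata \<Rightarrow> 'n free_alg set" where
  "alg_relations D = (let F = free_algebra; pp = fprod (\<otimes>\<^bsub>F\<^esub>) gen0 gen0 in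
     entries4 (fminus4 F (S123 D F pp) (fscale4 F (qq D (exp_w D)) pp)) \<union>
     entries4 (fminus4 F (St234 D F pp) (fscale4 F (qq D (- exp_w D)) pp)) \<union>
     {E'12 D F gen0 \<ominus>\<^bsub>F\<^esub> qq D (exp_m D) \<odot>\<^bsub>F\<^esub> \<one>\<^bsub>F\<^esub>})"

definition alg_ideal :: "('n::finite) qdata \<Rightarrow> 'n free_alg set" where
  "alg_ideal D = Idl\<^bsub>free_algebra\<^esub> (alg_relations D)"

definition BB :: "('n::finite) qdata \<Rightarrow> (complex, 'n alg) module" where
  "BB D = (let F = free_algebra; I = alg_ideal D; Q = F Quot I in
     \<lparr>carrier = carrier Q, monoid.mult = monoid.mult Q, monoid.one = \<one>\<^bsub>Q\<^esub>, ring.zero = \<zero>\<^bsub>Q\<^esub>, ring.add = ring.add Q,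
      module.smult = (\<lambda>c X. \<Union>x\<in>X. I +>\<^bsub>F\<^esub> (c \<odot>\<^bsub>F\<^esub> x))\<rparr>)"

definition pgen :: "('n::finite) qdata \<Rightarrow> ('n, 'n alg) fam2" where
  "pgen D i j = alg_ideal D +>\<^bsub>free_algebra\<^esub> gen0 i j"

section \<open>Bimodules and their tensor products\<close>

record ('b, 'm) bimod = "(complex, 'm) module" +
  lact :: "'b \<Rightarrow> 'm \<Rightarrow> 'm" (infixr "\<rhd>\<index>" 75)
  ract :: "'m \<Rightarrow> 'b \<Rightarrow> 'm" (infixl "\<lhd>\<index>" 75)

definition lin_map ::
    "(complex, 'm, 'y) module_scheme \<Rightarrow> (complex, 'k, 'z) module_scheme \<Rightarrow> ('m \<Rightarrow> 'k) \<Rightarrow> bool" where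
  "lin_map M N f \<longleftrightarrow> f \<in> carrier M \<rightarrow> carrier N \<and>
     (\<forall>x\<in>carrier M. \<forall>y\<in>carrier M. f (x \<oplus>\<^bsub>M\<^esub> y) = f x \<oplus>\<^bsub>N\<^esub> f y) \<and>
     (\<forall>c. \<forall>x\<in>carrier M. f (c \<odot>\<^bsub>M\<^esub> x) = c \<odot>\<^bsub>N\<^esub> f x)"

definition bimod_hom :: "(complex, 'b) module \<Rightarrow> ('b, 'm) bimod \<Rightarrow> ('b, 'k) bimod \<Rightarrow> ('m \<Rightarrow> 'k) \<Rightarrow> bool" where
  "bimod_hom B M N f \<longleftrightarrow> lin_map M N f \<and>
     (\<forall>b\<in>carrier B. \<forall>x\<in>carrier M. f (b \<rhd>\<^bsub>M\<^esub> x) = b \<rhd>\<^bsub>N\<^esub> f x \<and> f (x \<lhd>\<^bsub>M\<^esub> b) = f x \<lhd>\<^bsub>N\<^esub> b)"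

definition is_right_action :: "(complex, 'b) module \<Rightarrow> ('b, 'm) bimod \<Rightarrow> bool" where
  "is_right_action B M \<longleftrightarrow> (\<forall>x\<in>carrier M. \<forall>y\<in>carrier M. \<forall>b\<in>carrier B. \<forall>b'\<in>carrier B. \<forall>c.
     x \<lhd>\<^bsub>M\<^esub> b \<in> carrier M \<and>
     x \<lhd>\<^bsub>M\<^esub> \<one>\<^bsub>B\<^esub> = x \<and>
     x \<lhd>\<^bsub>M\<^esub> (b \<otimes>\<^bsub>B\<^esub> b') = (x \<lhd>\<^bsub>M\<^esub> b) \<lhd>\<^bsub>M\<^esub> b' \<and>
     (x \<oplus>\<^bsub>M\<^esub> y) \<lhd>\<^bsub>M\<^esub> b = x \<lhd>\<^bsub>M\<^esub> b \<oplus>\<^bsub>M\<^esub> y \<lhd>\<^bsub>M\<^esub> b \<and>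
     x \<lhd>\<^bsub>M\<^esub> (b \<oplus>\<^bsub>B\<^esub> b') = x \<lhd>\<^bsub>M\<^esub> b \<oplus>\<^bsub>M\<^esub> x \<lhd>\<^bsub>M\<^esub> b' \<and>
     (c \<odot>\<^bsub>M\<^esub> x) \<lhd>\<^bsub>M\<^esub> b = c \<odot>\<^bsub>M\<^esub> (x \<lhd>\<^bsub>M\<^esub> b) \<and>
     x \<lhd>\<^bsub>M\<^esub> (c \<odot>\<^bsub>B\<^esub> b) = c \<odot>\<^bsub>M\<^esub> (x \<lhd>\<^bsub>M\<^esub> b) \<and>
     (b \<rhd>\<^bsub>M\<^esub> x) \<lhd>\<^bsub>M\<^esub> b' = b \<rhd>\<^bsub>M\<^esub> (x \<lhd>\<^bsub>M\<^esub> b'))"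

definition self_bimod :: "(complex, 'b) module \<Rightarrow> ('b, 'b) bimod" where
  "self_bimod B = \<lparr>carrier = carrier B, monoid.mult = monoid.mult B, monoid.one = \<one>\<^bsub>B\<^esub>, ring.zero = \<zero>\<^bsub>B\<^esub>, ring.add = ring.add B,
     module.smult = module.smult B, lact = monoid.mult B, ract = monoid.mult B\<rparr>"

text \<open>Left submodules and sub-bimodules generated by a set, and quotients by them. For modules
  that only have a left action the \<open>ract\<close> field is irrelevant.\<close>

definition left_submodule :: "(complex, 'b) module \<Rightarrow> ('b, 'm) bimod \<Rightarrow> 'm set \<Rightarrow> bool" where
  "left_submodule B M W \<longleftrightarrow> W \<subseteq> carrier M \<and> \<zero>\<^bsub>M\<^esub> \<in> W \<and>
     (\<forall>x\<in>W. \<forall>y\<in>W. x \<oplus>\<^bsub>M\<^esub> y \<in> W) \<and> (\<forall>x\<in>W. \<ominus>\<^bsub>M\<^esub> x \<in> W) \<and>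
     (\<forall>c. \<forall>x\<in>W. c \<odot>\<^bsub>M\<^esub> x \<in> W) \<and> (\<forall>b\<in>carrier B. \<forall>x\<in>W. b \<rhd>\<^bsub>M\<^esub> x \<in> W)"

definition sub_bimodule :: "(complex, 'b) module \<Rightarrow> ('b, 'm) bimod \<Rightarrow> 'm set \<Rightarrow> bool" where
  "sub_bimodule B M W \<longleftrightarrow> left_submodule B M W \<and> (\<forall>b\<in>carrier B. \<forall>x\<in>W. x \<lhd>\<^bsub>M\<^esub> b \<in> W)"

definition left_span :: "(complex, 'b) module \<Rightarrow> ('b, 'm) bimod \<Rightarrow> 'm set \<Rightarrow> 'm set" where
  "left_span B M X = \<Inter>{W. left_submodule B M W \<and> X \<subseteq> W}"

definition bimod_span :: "(complex, 'b) module \<Rightarrow> ('b, 'm) bimod \<Rightarrow> 'm set \<Rightarrow> 'm set" where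
  "bimod_span B M X = \<Inter>{W. sub_bimodule B M W \<and> X \<subseteq> W}"

definition bimod_quot :: "('b, 'm) bimod \<Rightarrow> 'm set \<Rightarrow> ('b, 'm set) bimod" where
  "bimod_quot M W = \<lparr>carrier = a_rcosets\<^bsub>M\<^esub> W, monoid.mult = undefined, monoid.one = undefined,
     ring.zero = W, ring.add = set_add M,
     module.smult = (\<lambda>c X. \<Union>x\<in>X. W +>\<^bsub>M\<^esub> (c \<odot>\<^bsub>M\<^esub> x)),
     lact = (\<lambda>b X. \<Union>x\<in>X. W +>\<^bsub>M\<^esub> (b \<rhd>\<^bsub>M\<^esub> x)),
     ract = (\<lambda>X b. \<Union>x\<in>X. W +>\<^bsub>M\<^esub> (x \<lhd>\<^bsub>M\<^esub> b))\<rparr>"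

definition free_left_module :: "(complex, 'b) module \<Rightarrow> ('b, 'g \<Rightarrow> 'b) bimod" where
  "free_left_module B = \<lparr>carrier = UNIV \<rightarrow> carrier B, monoid.mult = undefined, monoid.one = undefined,
     ring.zero = (\<lambda>g. \<zero>\<^bsub>B\<^esub>), ring.add = (\<lambda>f h g. f g \<oplus>\<^bsub>B\<^esub> h g),
     module.smult = (\<lambda>c f g. c \<odot>\<^bsub>B\<^esub> f g),
     lact = (\<lambda>b f g. b \<otimes>\<^bsub>B\<^esub> f g), ract = undefined\<rparr>"

definition dsum :: "('b, 'm) bimod \<Rightarrow> ('b, 'k) bimod \<Rightarrow> ('b, 'm \<times> 'k) bimod" where
  "dsum M N = \<lparr>carrier = carrier M \<times> carrier N, monoid.mult = undefined, monoid.one = undefined,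
     ring.zero = (\<zero>\<^bsub>M\<^esub>, \<zero>\<^bsub>N\<^esub>), ring.add = (\<lambda>x y. (fst x \<oplus>\<^bsub>M\<^esub> fst y, snd x \<oplus>\<^bsub>N\<^esub> snd y)),
     module.smult = (\<lambda>c x. (c \<odot>\<^bsub>M\<^esub> fst x, c \<odot>\<^bsub>N\<^esub> snd x)),
     lact = (\<lambda>b x. (b \<rhd>\<^bsub>M\<^esub> fst x, b \<rhd>\<^bsub>N\<^esub> snd x)),
     ract = (\<lambda>x b. (fst x \<lhd>\<^bsub>M\<^esub> b, snd x \<lhd>\<^bsub>N\<^esub> b))\<rparr>"

text \<open>The tensor product $M\otimes_B N$ is the free abelian group on the set $M\times N$ modulo
  the subgroup generated by biadditivity and $B$-balancing.\<close>

type_synonym ('m, 'k) tens = "('m \<times> 'k \<Rightarrow>\<^sub>0 int) set"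

definition balancing :: "(complex, 'b) module \<Rightarrow> ('b, 'm) bimod \<Rightarrow> ('b, 'k) bimod \<Rightarrow> ('m \<times> 'k \<Rightarrow>\<^sub>0 int) set" where
  "balancing B M N =
     {frag_of (x \<oplus>\<^bsub>M\<^esub> y, z) - frag_of (x, z) - frag_of (y, z) | x y z.
        x \<in> carrier M \<and> y \<in> carrier M \<and> z \<in> carrier N} \<union>
     {frag_of (x, y \<oplus>\<^bsub>N\<^esub> z) - frag_of (x, y) - frag_of (x, z) | x y z.
        x \<in> carrier M \<and> y \<in> carrier N \<and> z \<in> carrier N} \<union>
     {frag_of (x \<lhd>\<^bsub>M\<^esub> b, z) - frag_of (x, b \<rhd>\<^bsub>N\<^esub> z) | x b z.
        x \<in> carrier M \<and> b \<in> carrier B \<and> z \<in> carrier N}"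

definition balancing_subgroup :: "(complex, 'b) module \<Rightarrow> ('b, 'm) bimod \<Rightarrow> ('b, 'k) bimod \<Rightarrow> ('m \<times> 'k \<Rightarrow>\<^sub>0 int) set" where
  "balancing_subgroup B M N = generate (free_Abelian_group (carrier M \<times> carrier N)) (balancing B M N)"

definition ptens :: "(complex, 'b) module \<Rightarrow> ('b, 'm) bimod \<Rightarrow> ('b, 'k) bimod \<Rightarrow> 'm \<Rightarrow> 'k \<Rightarrow> ('m, 'k) tens" where
  "ptens B M N x y =
     balancing_subgroup B M N #>\<^bsub>free_Abelian_group (carrier M \<times> carrier N)\<^esub> frag_of (x, y)"

text \<open>The additive map \<open>M \<otimes>\<^sub>B N \<rightarrow> P\<close> induced by a biadditive balanced map \<open>f\<close>: it is computed
  on any representative.\<close>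

definition tens_lift :: "('p, 'z) ring_scheme \<Rightarrow> ('m \<Rightarrow> 'k \<Rightarrow> 'p) \<Rightarrow> ('m, 'k) tens \<Rightarrow> 'p" where
  "tens_lift P f X = the_elem ((\<lambda>x. \<Oplus>\<^bsub>P\<^esub>z\<in>Poly_Mapping.keys x.
     [Poly_Mapping.lookup x z] \<cdot>\<^bsub>P\<^esub> f (fst z) (snd z)) ` X)"

definition tens_add_group :: "(complex, 'b) module \<Rightarrow> ('b, 'm) bimod \<Rightarrow> ('b, 'k) bimod \<Rightarrow> ('m, 'k) tens ring" where
  "tens_add_group B M N =
     (let Q = free_Abelian_group (carrier M \<times> carrier N) Mod balancing_subgroup B M N in
      \<lparr>carrier = carrier Q, monoid.mult = undefined, monoid.one = undefined, ring.zero = \<one>\<^bsub>Q\<^esub>, ring.add = monoid.mult Q\<rparr>)"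

definition tensor :: "(complex, 'b) module \<Rightarrow> ('b, 'm) bimod \<Rightarrow> ('b, 'k) bimod \<Rightarrow> ('b, ('m, 'k) tens) bimod" where
  "tensor B M N = (let A = tens_add_group B M N in
     \<lparr>carrier = carrier A, monoid.mult = undefined, monoid.one = undefined, ring.zero = \<zero>\<^bsub>A\<^esub>, ring.add = ring.add A,
      module.smult = (\<lambda>c. tens_lift A (\<lambda>x y. ptens B M N (c \<odot>\<^bsub>M\<^esub> x) y)),
      lact = (\<lambda>b. tens_lift A (\<lambda>x y. ptens B M N (b \<rhd>\<^bsub>M\<^esub> x) y)),
      ract = (\<lambda>X b. tens_lift A (\<lambda>x y. ptens B M N x (y \<lhd>\<^bsub>N\<^esub> b)) X)\<rparr>)"

section \<open>The first-order differential calculus\<close>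

type_synonym 'n half_forms = "('n \<times> 'n \<Rightarrow> 'n alg) set"
type_synonym 'n forms1 = "'n half_forms \<times> 'n half_forms"

definition free_gen :: "('n::finite) qdata \<Rightarrow> ('n, 'n \<times> 'n \<Rightarrow> 'n alg) fam2" where
  "free_gen D i j = (\<lambda>g. if g = (i, j) then \<one>\<^bsub>BB D\<^esub> else \<zero>\<^bsub>BB D\<^esub>)"

definition relations_plus :: "('n::finite) qdata \<Rightarrow> ('n \<times> 'n \<Rightarrow> 'n alg) set" where
  "relations_plus D = (let F = free_left_module (BB D); pdp = fprod (\<rhd>\<^bsub>F\<^esub>) (pgen D) (free_gen D) in
     left_span (BB D) F (
       entries4 (fminus4 F (St234 D F pdp) (fscale4 F (qq D (- exp_w D)) pdp)) \<union>
       {E'12 D F (free_gen D)}))"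

definition relations_minus :: "('n::finite) qdata \<Rightarrow> ('n \<times> 'n \<Rightarrow> 'n alg) set" where
  "relations_minus D = (let F = free_left_module (BB D); pdp = fprod (\<rhd>\<^bsub>F\<^esub>) (pgen D) (free_gen D) in
     left_span (BB D) F (
       entries4 (fminus4 F (S123 D F pdp) (fscale4 F (qq D (exp_w D)) pdp)) \<union>
       {E'12 D F (free_gen D)}))"

definition Omega_plus :: "('n::finite) qdata \<Rightarrow> ('n alg, 'n half_forms) bimod" where
  "Omega_plus D = bimod_quot (free_left_module (BB D)) (relations_plus D)"

definition Omega_minus :: "('n::finite) qdata \<Rightarrow> ('n alg, 'n half_forms) bimod" where
  "Omega_minus D = bimod_quot (free_left_module (BB D)) (relations_minus D)"

text \<open>The right action is the parameter \<open>\<rho>\<close> of \<open>Omega\<close>; it is determined by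
  \<open>hk_right_action\<close> below.\<close>

definition Omega :: "('n::finite) qdata \<Rightarrow> ('n forms1 \<Rightarrow> 'n alg \<Rightarrow> 'n forms1) \<Rightarrow> ('n alg, 'n forms1) bimod" where
  "Omega D \<rho> = (dsum (Omega_plus D) (Omega_minus D))\<lparr>ract := \<rho>\<rparr>"

definition plus_part :: "('n::finite) qdata \<Rightarrow> 'n forms1 set" where
  "plus_part D = carrier (Omega_plus D) \<times> {\<zero>\<^bsub>Omega_minus D\<^esub>}"

definition minus_part :: "('n::finite) qdata \<Rightarrow> 'n forms1 set" where
  "minus_part D = {\<zero>\<^bsub>Omega_plus D\<^esub>} \<times> carrier (Omega_minus D)"

definition dp :: "('n::finite) qdata \<Rightarrow> ('n, 'n forms1) fam2" where
  "dp D i j = (relations_plus D +>\<^bsub>free_left_module (BB D)\<^esub> free_gen D i j, \<zero>\<^bsub>Omega_minus D\<^esub>)"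

definition dbp :: "('n::finite) qdata \<Rightarrow> ('n, 'n forms1) fam2" where
  "dbp D i j = (\<zero>\<^bsub>Omega_plus D\<^esub>, relations_minus D +>\<^bsub>free_left_module (BB D)\<^esub> free_gen D i j)"

definition hk_right_action :: "('n::finite) qdata \<Rightarrow> ('n forms1 \<Rightarrow> 'n alg \<Rightarrow> 'n forms1) \<Rightarrow> bool" where
  "hk_right_action D \<rho> \<longleftrightarrow> (let \<Omega> = Omega D \<rho>; p = pgen D in
     is_right_action (BB D) \<Omega> \<and>
     fprod (\<lhd>\<^bsub>\<Omega>\<^esub>) (dp D) p = fscale4 \<Omega> (qq D (exp_a D)) (T1234 D \<Omega> (fprod (\<rhd>\<^bsub>\<Omega>\<^esub>) p (dp D))) \<and>
     fprod (\<lhd>\<^bsub>\<Omega>\<^esub>) (dbp D) p = fscale4 \<Omega> (qq D (- exp_a D)) (T1234 D \<Omega> (fprod (\<rhd>\<^bsub>\<Omega>\<^esub>) p (dbp D))))"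

definition is_derivation :: "(complex, 'b) module \<Rightarrow> ('b, 'm) bimod \<Rightarrow> ('b \<Rightarrow> 'm) \<Rightarrow> bool" where
  "is_derivation B M \<delta> \<longleftrightarrow> lin_map B M \<delta> \<and>
     (\<forall>a\<in>carrier B. \<forall>b\<in>carrier B. \<delta> (a \<otimes>\<^bsub>B\<^esub> b) = \<delta> a \<lhd>\<^bsub>M\<^esub> b \<oplus>\<^bsub>M\<^esub> a \<rhd>\<^bsub>M\<^esub> \<delta> b)"

definition hk_del :: "('n::finite) qdata \<Rightarrow> ('n forms1 \<Rightarrow> 'n alg \<Rightarrow> 'n forms1) \<Rightarrow>
    ('n alg \<Rightarrow> 'n forms1) \<Rightarrow> ('n alg \<Rightarrow> 'n forms1) \<Rightarrow> bool" where
  "hk_del D \<rho> del delbar \<longleftrightarrow>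
     is_derivation (BB D) (Omega D \<rho>) del \<and> (\<forall>i j. del (pgen D i j) = dp D i j) \<and>
     is_derivation (BB D) (Omega D \<rho>) delbar \<and> (\<forall>i j. delbar (pgen D i j) = dbp D i j)"

section \<open>Two-forms of the universal calculus\<close>

type_synonym 'n forms1_1 = "('n forms1, 'n forms1) tens"
type_synonym 'n forms2 = "'n forms1_1 set"

definition Omega11 :: "('n::finite) qdata \<Rightarrow> ('n forms1 \<Rightarrow> 'n alg \<Rightarrow> 'n forms1) \<Rightarrow> ('n alg, 'n forms1_1) bimod" where
  "Omega11 D \<rho> = tensor (BB D) (Omega D \<rho>) (Omega D \<rho>)"

definition ot :: "('n::finite) qdata \<Rightarrow> ('n forms1 \<Rightarrow> 'n alg \<Rightarrow> 'n forms1) \<Rightarrow> 'n forms1 \<Rightarrow> 'n forms1 \<Rightarrow> 'n forms1_1" where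
  "ot D \<rho> = ptens (BB D) (Omega D \<rho>) (Omega D \<rho>)"

text \<open>The differential $\mathrm{d}=\partial+\bar\partial$ on functions is passed as the argument
  \<open>d\<close> below. The degree two part of the two-sided ideal of $T_{\mathcal B}(\Omega)$ generated by
  elements of $\Omega\otimes_{\mathcal B}\Omega$ is the sub-bimodule they generate.\<close>

definition total_d :: "('n::finite) qdata \<Rightarrow> ('n forms1 \<Rightarrow> 'n alg \<Rightarrow> 'n forms1) \<Rightarrow>
    ('n alg \<Rightarrow> 'n forms1) \<Rightarrow> ('n alg \<Rightarrow> 'n forms1) \<Rightarrow> 'n alg \<Rightarrow> 'n forms1" where
  "total_d D \<rho> del delbar b = del b \<oplus>\<^bsub>Omega D \<rho>\<^esub> delbar b"

definition universal_relations :: "('n::finite) qdata \<Rightarrow> ('n forms1 \<Rightarrow> 'n alg \<Rightarrow> 'n forms1) \<Rightarrow>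
    ('n alg \<Rightarrow> 'n forms1) \<Rightarrow> 'n forms1_1 set" where
  "universal_relations D \<rho> d = bimod_span (BB D) (Omega11 D \<rho>)
     {(\<Oplus>\<^bsub>Omega11 D \<rho>\<^esub>i\<in>{..<n}. ot D \<rho> (d (a i)) (d (b i))) | (n :: nat) a b.
        (\<forall>i<n. a i \<in> carrier (BB D) \<and> b i \<in> carrier (BB D)) \<and>
        (\<Oplus>\<^bsub>Omega D \<rho>\<^esub>i\<in>{..<n}. a i \<rhd>\<^bsub>Omega D \<rho>\<^esub> d (b i)) = \<zero>\<^bsub>Omega D \<rho>\<^esub>}"

definition Omega2 :: "('n::finite) qdata \<Rightarrow> ('n forms1 \<Rightarrow> 'n alg \<Rightarrow> 'n forms1) \<Rightarrow>
    ('n alg \<Rightarrow> 'n forms1) \<Rightarrow> ('n alg, 'n forms2) bimod" where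
  "Omega2 D \<rho> d = bimod_quot (Omega11 D \<rho>) (universal_relations D \<rho> d)"

definition wedge :: "('n::finite) qdata \<Rightarrow> ('n forms1 \<Rightarrow> 'n alg \<Rightarrow> 'n forms1) \<Rightarrow>
    ('n alg \<Rightarrow> 'n forms1) \<Rightarrow> 'n forms1 \<Rightarrow> 'n forms1 \<Rightarrow> 'n forms2" where
  "wedge D \<rho> d \<omega> \<eta> = universal_relations D \<rho> d +>\<^bsub>Omega11 D \<rho>\<^esub> ot D \<rho> \<omega> \<eta>"

definition is_exterior_d :: "('n::finite) qdata \<Rightarrow> ('n forms1 \<Rightarrow> 'n alg \<Rightarrow> 'n forms1) \<Rightarrow>
    ('n alg \<Rightarrow> 'n forms1) \<Rightarrow> ('n forms1 \<Rightarrow> 'n forms2) \<Rightarrow> bool" where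
  "is_exterior_d D \<rho> d d1 \<longleftrightarrow> lin_map (Omega D \<rho>) (Omega2 D \<rho> d) d1 \<and>
     (\<forall>a\<in>carrier (BB D). \<forall>b\<in>carrier (BB D).
        d1 (a \<rhd>\<^bsub>Omega D \<rho>\<^esub> d b) = wedge D \<rho> d (d a) (d b))"

section \<open>Metric, connection, generalized braiding and splitting map\<close>

definition g_pm :: "('n::finite) qdata \<Rightarrow> ('n forms1 \<Rightarrow> 'n alg \<Rightarrow> 'n forms1) \<Rightarrow> 'n forms1_1" where
  "g_pm D \<rho> = E'12 D (Omega11 D \<rho>) (E23 (Omega11 D \<rho>) (fprod (ot D \<rho>) (dp D) (dbp D)))"

definition g_mp :: "('n::finite) qdata \<Rightarrow> ('n forms1 \<Rightarrow> 'n alg \<Rightarrow> 'n forms1) \<Rightarrow> 'n forms1_1" where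
  "g_mp D \<rho> = E'12 D (Omega11 D \<rho>) (E23 (Omega11 D \<rho>) (fprod (ot D \<rho>) (dbp D) (dp D)))"

definition is_inverse_metric :: "('n::finite) qdata \<Rightarrow> ('n forms1 \<Rightarrow> 'n alg \<Rightarrow> 'n forms1) \<Rightarrow>
    ('n forms1_1 \<Rightarrow> 'n alg) \<Rightarrow> bool" where
  "is_inverse_metric D \<rho> ip \<longleftrightarrow>
     (let B = BB D; p = pgen D; a = exp_a D; w = exp_w D; m = exp_m D;
          pair = fprod (\<lambda>\<omega> \<eta>. ip (ot D \<rho> \<omega> \<eta>)); pp = fprod (\<otimes>\<^bsub>B\<^esub>) p p in
      bimod_hom B (Omega11 D \<rho>) (self_bimod B) ip \<and>
      pair (dp D) (dp D) = (\<lambda>i j k l. \<zero>\<^bsub>B\<^esub>) \<and>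
      pair (dbp D) (dbp D) = (\<lambda>i j k l. \<zero>\<^bsub>B\<^esub>) \<and>
      pair (dp D) (dbp D) =
        fminus4 B (fscale4 B (qq D a * qq D (- w - m)) (S123 D B (C3 B p)))
                  (fscale4 B (qq D a * qq D (- m)) pp) \<and>
      pair (dbp D) (dp D) = fminus4 B (C'2 D B p) (fscale4 B (qq D (- m)) pp))"

definition is_levi_civita :: "('n::finite) qdata \<Rightarrow> ('n forms1 \<Rightarrow> 'n alg \<Rightarrow> 'n forms1) \<Rightarrow>
    ('n alg \<Rightarrow> 'n forms1) \<Rightarrow> ('n forms1 \<Rightarrow> 'n forms1_1) \<Rightarrow> bool" where
  "is_levi_civita D \<rho> d nab \<longleftrightarrow>
     (let B = BB D; \<Omega> = Omega D \<rho>; \<Omega>\<Omega> = Omega11 D \<rho>; p = pgen D; a = exp_a D; m = exp_m D in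
      lin_map \<Omega> \<Omega>\<Omega> nab \<and>
      (\<forall>b\<in>carrier B. \<forall>\<omega>\<in>carrier \<Omega>.
         nab (b \<rhd>\<^bsub>\<Omega>\<^esub> \<omega>) = ot D \<rho> (d b) \<omega> \<oplus>\<^bsub>\<Omega>\<Omega>\<^esub> b \<rhd>\<^bsub>\<Omega>\<Omega>\<^esub> nab \<omega>) \<and>
      (\<lambda>i j. nab (dp D i j)) =
        fminus2 \<Omega>\<Omega>
          (fscale2 \<Omega>\<Omega> (qq D a) (E23 \<Omega>\<Omega> (T1234 D \<Omega>\<Omega> (fprod (ot D \<rho>) (dbp D) (dp D)))))
          (fscale2 \<Omega>\<Omega> (qq D a * qq D (- m)) (\<lambda>i j. p i j \<rhd>\<^bsub>\<Omega>\<Omega>\<^esub> g_mp D \<rho>)) \<and>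
      (\<lambda>i j. nab (dbp D i j)) =
        fminus2 \<Omega>\<Omega>
          (E23 \<Omega>\<Omega> (fprod (ot D \<rho>) (dp D) (dbp D)))
          (fscale2 \<Omega>\<Omega> (qq D (- m)) (\<lambda>i j. p i j \<rhd>\<^bsub>\<Omega>\<Omega>\<^esub> g_pm D \<rho>)))"

definition is_generalized_braiding :: "('n::finite) qdata \<Rightarrow> ('n forms1 \<Rightarrow> 'n alg \<Rightarrow> 'n forms1) \<Rightarrow>
    ('n forms1_1 \<Rightarrow> 'n forms1_1) \<Rightarrow> bool" where
  "is_generalized_braiding D \<rho> \<sigma> \<longleftrightarrow>
     (let \<Omega>\<Omega> = Omega11 D \<rho>; p = pgen D; a = exp_a D; w = exp_w D; m = exp_m D;
          tt = fprod (ot D \<rho>); sig = fprod (\<lambda>\<omega> \<eta>. \<sigma> (ot D \<rho> \<omega> \<eta>)) in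
      bimod_hom (BB D) \<Omega>\<Omega> \<Omega>\<Omega> \<sigma> \<and>
      sig (dp D) (dp D) =
        fscale4 \<Omega>\<Omega> (qq D a) (S123 D \<Omega>\<Omega> (St234 D \<Omega>\<Omega> (tt (dp D) (dp D)))) \<and>
      sig (dbp D) (dbp D) =
        fscale4 \<Omega>\<Omega> (qq D (- a)) (S123 D \<Omega>\<Omega> (St234 D \<Omega>\<Omega> (tt (dbp D) (dbp D)))) \<and>
      sig (dp D) (dbp D) = fadd4 \<Omega>\<Omega>
        (fscale4 \<Omega>\<Omega> (qq D (2 * a - 2 * w)) (S123 D \<Omega>\<Omega> (St234_inv D \<Omega>\<Omega> (tt (dbp D) (dp D)))))
        (fscale4 \<Omega>\<Omega> ((1 - qq D a) * qq D a * qq D (- m))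
          (\<lambda>i j k l. (p i j \<rhd>\<^bsub>\<Omega>\<Omega>\<^esub> g_mp D \<rho>) \<lhd>\<^bsub>\<Omega>\<Omega>\<^esub> p k l)) \<and>
      sig (dbp D) (dp D) = fadd4 \<Omega>\<Omega>
        (fscale4 \<Omega>\<Omega> (qq D (2 * w - 2 * a)) (S123_inv D \<Omega>\<Omega> (St234 D \<Omega>\<Omega> (tt (dp D) (dbp D)))))
        (fscale4 \<Omega>\<Omega> ((1 - qq D (- a)) * qq D (- m))
          (\<lambda>i j k l. (p i j \<rhd>\<^bsub>\<Omega>\<Omega>\<^esub> g_pm D \<rho>) \<lhd>\<^bsub>\<Omega>\<Omega>\<^esub> p k l)))"

definition is_splitting :: "('n::finite) qdata \<Rightarrow> ('n forms1 \<Rightarrow> 'n alg \<Rightarrow> 'n forms1) \<Rightarrow>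
    ('n alg \<Rightarrow> 'n forms1) \<Rightarrow> ('n forms1_1 \<Rightarrow> 'n forms1_1) \<Rightarrow> complex \<Rightarrow> complex \<Rightarrow>
    ('n forms2 \<Rightarrow> 'n forms1_1) \<Rightarrow> bool" where
  "is_splitting D \<rho> d \<sigma> cpm cmp s \<longleftrightarrow>
     (let \<Omega>\<Omega> = Omega11 D \<rho>; a = exp_a D;
          comb = (\<lambda>c c' t. c \<odot>\<^bsub>\<Omega>\<Omega>\<^esub> t \<ominus>\<^bsub>\<Omega>\<Omega>\<^esub> c' \<odot>\<^bsub>\<Omega>\<Omega>\<^esub> \<sigma> t) in
      bimod_hom (BB D) (Omega2 D \<rho> d) \<Omega>\<Omega> s \<and>
      (\<forall>\<omega>\<in>plus_part D. \<forall>\<eta>\<in>plus_part D. s (wedge D \<rho> d \<omega> \<eta>) =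
         comb (1 / (1 + qq D (- a))) (qq D (- a) / (1 + qq D (- a))) (ot D \<rho> \<omega> \<eta>)) \<and>
      (\<forall>\<omega>\<in>minus_part D. \<forall>\<eta>\<in>minus_part D. s (wedge D \<rho> d \<omega> \<eta>) =
         comb (1 / (1 + qq D a)) (qq D a / (1 + qq D a)) (ot D \<rho> \<omega> \<eta>)) \<and>
      (\<forall>\<omega>\<in>plus_part D. \<forall>\<eta>\<in>minus_part D. s (wedge D \<rho> d \<omega> \<eta>) = comb cpm cmp (ot D \<rho> \<omega> \<eta>)) \<and>
      (\<forall>\<omega>\<in>minus_part D. \<forall>\<eta>\<in>plus_part D. s (wedge D \<rho> d \<omega> \<eta>) = comb cmp cpm (ot D \<rho> \<omega> \<eta>)))"

section \<open>Riemann and Ricci tensors\<close>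

type_synonym 'n forms2_1 = "('n forms2, 'n forms1) tens"

definition Omega21 :: "('n::finite) qdata \<Rightarrow> ('n forms1 \<Rightarrow> 'n alg \<Rightarrow> 'n forms1) \<Rightarrow>
    ('n alg \<Rightarrow> 'n forms1) \<Rightarrow> ('n alg, 'n forms2_1) bimod" where
  "Omega21 D \<rho> d = tensor (BB D) (Omega2 D \<rho> d) (Omega D \<rho>)"

text \<open>\<open>wedge_id \<omega>\<close> is $\alpha\otimes\beta\mapsto(\omega\wedge\alpha)\otimes\beta$, so that
  \<open>wedge_id \<omega> (nab \<eta>)\<close> is $(\wedge\otimes\mathrm{id})(\omega\otimes\nabla\eta)$. Separately,
  $\mathrm{d}\otimes\mathrm{id}$ and $(\wedge\otimes\mathrm{id})(\mathrm{id}\otimes\nabla)$ are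
  not balanced; only their difference descends to $\Omega\otimes_{\mathcal B}\Omega$, and it is
  the difference that is induced in \<open>riemann\<close>.\<close>

definition wedge_id :: "('n::finite) qdata \<Rightarrow> ('n forms1 \<Rightarrow> 'n alg \<Rightarrow> 'n forms1) \<Rightarrow>
    ('n alg \<Rightarrow> 'n forms1) \<Rightarrow> 'n forms1 \<Rightarrow> 'n forms1_1 \<Rightarrow> 'n forms2_1" where
  "wedge_id D \<rho> d \<omega> = tens_lift (Omega21 D \<rho> d)
     (\<lambda>\<alpha> \<beta>. ptens (BB D) (Omega2 D \<rho> d) (Omega D \<rho>) (wedge D \<rho> d \<omega> \<alpha>) \<beta>)"

definition riemann :: "('n::finite) qdata \<Rightarrow> ('n forms1 \<Rightarrow> 'n alg \<Rightarrow> 'n forms1) \<Rightarrow>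
    ('n alg \<Rightarrow> 'n forms1) \<Rightarrow> ('n forms1 \<Rightarrow> 'n forms2) \<Rightarrow> ('n forms1 \<Rightarrow> 'n forms1_1) \<Rightarrow>
    'n forms1 \<Rightarrow> 'n forms2_1" where
  "riemann D \<rho> d d1 nab \<omega> = tens_lift (Omega21 D \<rho> d)
     (\<lambda>\<alpha> \<beta>. ptens (BB D) (Omega2 D \<rho> d) (Omega D \<rho>) (d1 \<alpha>) \<beta>
        \<ominus>\<^bsub>Omega21 D \<rho> d\<^esub> wedge_id D \<rho> d \<alpha> (nab \<beta>))
     (nab \<omega>)"

definition Omega1_21 :: "('n::finite) qdata \<Rightarrow> ('n forms1 \<Rightarrow> 'n alg \<Rightarrow> 'n forms1) \<Rightarrow>
    ('n alg \<Rightarrow> 'n forms1) \<Rightarrow> ('n alg, ('n forms1, 'n forms2_1) tens) bimod" where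
  "Omega1_21 D \<rho> d = tensor (BB D) (Omega D \<rho>) (Omega21 D \<rho> d)"

definition Omega11_1 :: "('n::finite) qdata \<Rightarrow> ('n forms1 \<Rightarrow> 'n alg \<Rightarrow> 'n forms1) \<Rightarrow>
    ('n alg, ('n forms1_1, 'n forms1) tens) bimod" where
  "Omega11_1 D \<rho> = tensor (BB D) (Omega11 D \<rho>) (Omega D \<rho>)"

definition Omega1_11_1 :: "('n::finite) qdata \<Rightarrow> ('n forms1 \<Rightarrow> 'n alg \<Rightarrow> 'n forms1) \<Rightarrow>
    ('n alg, ('n forms1, ('n forms1_1, 'n forms1) tens) tens) bimod" where
  "Omega1_11_1 D \<rho> = tensor (BB D) (Omega D \<rho>) (Omega11_1 D \<rho>)"

text \<open>The three factors of \<open>\<Phi>\<close>. Threefold products are bracketed to the right, and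
  \<open>ip_id_id\<close> includes the reassociation and the identification
  $\mathcal B\otimes_{\mathcal B}\Omega=\Omega$: it maps
  $\omega\otimes((\alpha\otimes\beta)\otimes\gamma)$ to $(\omega,\alpha)\beta\otimes\gamma$.\<close>

definition id_riemann :: "('n::finite) qdata \<Rightarrow> ('n forms1 \<Rightarrow> 'n alg \<Rightarrow> 'n forms1) \<Rightarrow>
    ('n alg \<Rightarrow> 'n forms1) \<Rightarrow> ('n forms1 \<Rightarrow> 'n forms2) \<Rightarrow> ('n forms1 \<Rightarrow> 'n forms1_1) \<Rightarrow>
    'n forms1_1 \<Rightarrow> ('n forms1, 'n forms2_1) tens" where
  "id_riemann D \<rho> d d1 nab = tens_lift (Omega1_21 D \<rho> d)
     (\<lambda>\<omega> \<eta>. ptens (BB D) (Omega D \<rho>) (Omega21 D \<rho> d) \<omega> (riemann D \<rho> d d1 nab \<eta>))"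

definition split_id :: "('n::finite) qdata \<Rightarrow> ('n forms1 \<Rightarrow> 'n alg \<Rightarrow> 'n forms1) \<Rightarrow>
    ('n forms2 \<Rightarrow> 'n forms1_1) \<Rightarrow> 'n forms2_1 \<Rightarrow> ('n forms1_1, 'n forms1) tens" where
  "split_id D \<rho> s = tens_lift (Omega11_1 D \<rho>)
     (\<lambda>\<theta> \<gamma>. ptens (BB D) (Omega11 D \<rho>) (Omega D \<rho>) (s \<theta>) \<gamma>)"

definition id_split_id :: "('n::finite) qdata \<Rightarrow> ('n forms1 \<Rightarrow> 'n alg \<Rightarrow> 'n forms1) \<Rightarrow>
    ('n forms2 \<Rightarrow> 'n forms1_1) \<Rightarrow> ('n forms1, 'n forms2_1) tens \<Rightarrow>
    ('n forms1, ('n forms1_1, 'n forms1) tens) tens" where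
  "id_split_id D \<rho> s = tens_lift (Omega1_11_1 D \<rho>)
     (\<lambda>\<omega> X. ptens (BB D) (Omega D \<rho>) (Omega11_1 D \<rho>) \<omega> (split_id D \<rho> s X))"

definition ip_id_id :: "('n::finite) qdata \<Rightarrow> ('n forms1 \<Rightarrow> 'n alg \<Rightarrow> 'n forms1) \<Rightarrow>
    ('n forms1_1 \<Rightarrow> 'n alg) \<Rightarrow> ('n forms1, ('n forms1_1, 'n forms1) tens) tens \<Rightarrow> 'n forms1_1" where
  "ip_id_id D \<rho> ip = tens_lift (Omega11 D \<rho>) (\<lambda>\<omega>. tens_lift (Omega11 D \<rho>) (\<lambda>Y \<gamma>.
     tens_lift (Omega11 D \<rho>) (\<lambda>\<alpha> \<beta>. ot D \<rho> (ip (ot D \<rho> \<omega> \<alpha>) \<rhd>\<^bsub>Omega D \<rho>\<^esub> \<beta>) \<gamma>) Y))"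

definition Phi :: "('n::finite) qdata \<Rightarrow> ('n forms1 \<Rightarrow> 'n alg \<Rightarrow> 'n forms1) \<Rightarrow>
    ('n alg \<Rightarrow> 'n forms1) \<Rightarrow> ('n forms1 \<Rightarrow> 'n forms2) \<Rightarrow> ('n forms1_1 \<Rightarrow> 'n alg) \<Rightarrow>
    ('n forms1 \<Rightarrow> 'n forms1_1) \<Rightarrow> ('n forms2 \<Rightarrow> 'n forms1_1) \<Rightarrow> 'n forms1_1 \<Rightarrow> 'n forms1_1" where
  "Phi D \<rho> d d1 ip nab s = ip_id_id D \<rho> ip \<circ> id_split_id D \<rho> s \<circ> id_riemann D \<rho> d d1 nab"

definition Ricci_pm :: "('n::finite) qdata \<Rightarrow> ('n forms1 \<Rightarrow> 'n alg \<Rightarrow> 'n forms1) \<Rightarrow>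
    ('n alg \<Rightarrow> 'n forms1) \<Rightarrow> ('n forms1 \<Rightarrow> 'n forms2) \<Rightarrow> ('n forms1_1 \<Rightarrow> 'n alg) \<Rightarrow>
    ('n forms1 \<Rightarrow> 'n forms1_1) \<Rightarrow> ('n forms2 \<Rightarrow> 'n forms1_1) \<Rightarrow> 'n forms1_1" where
  "Ricci_pm D \<rho> d d1 ip nab s = Phi D \<rho> d d1 ip nab s (g_pm D \<rho>)"

end

theory Submission imports Defs begin

text \<open>
  Write \<open>\<partial>p\<close>, \<open>\<partial>'p\<close> for the two halves of the differential of the generating family \<open>p\<close>,
  \<open>m = (\<omega>\<^sub>s, 2\<rho>)\<close>, \<open>w = (\<omega>\<^sub>s, \<omega>\<^sub>s)\<close>, and \<open>E\<close>, \<open>E'\<close> for the two evaluations of adjacent legs.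
  Both the Riemann tensor and the metric are built by contracting inner legs with \<open>E\<close>, so that
  everything reduces to one question: what does contracting the legs 2 and 3 do to \<open>S\<close> and to
  \<open>S~\<close>?  The answer is
    \<open>E\<^sub>2\<^sub>3 S = q^(w-2-m) E'\<^sub>1\<^sub>2 + (q^w - q^(w-2)) E\<^sub>2\<^sub>3\<close> and \<open>E\<^sub>2\<^sub>3 S~ = q^(-w-m) E'\<^sub>3\<^sub>4\<close>
  (\<open>E23_S123\<close>, \<open>E23_St234\<close>).  Graphically a strand is pulled through a cap; the second
  term of the first identity comes from the Hecke relation of the braiding of \<open>V \<otimes> V\<close>.

  These two identities rest on explicit braidings.  The module \<open>V\<close> is determined by its
  highest weight: its weight basis is a single chain \<open>v, F v, F F v, \<dots>\<close>
  (\<open>quantum_data_chain\<close>).  A highest weight vector tensored with a lowest weight vector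
  generates a tensor product of two chains (\<open>chain_intertwiner_zero\<close>), hence the normalisation
  singles out one intertwiner, and it is enough to exhibit matrices that intertwine
  (\<open>quantum_data_R_matrices\<close>).

  Contracting the defining relations of the calculus then gives
    \<open>E\<^sub>2\<^sub>3 p p = p\<close>, \<open>E\<^sub>2\<^sub>3 p \<partial>'p = \<partial>'p\<close>, \<open>E\<^sub>2\<^sub>3 p \<partial>p = 0\<close>, \<open>E\<^sub>2\<^sub>3 (\<partial>p) p = \<partial>p\<close>, \<open>E\<^sub>2\<^sub>3 (\<partial>'p) p = 0\<close>,
  and for the inverse metric \<open>E\<^sub>2\<^sub>3 (\<partial>p, \<partial>'p) = q^(-m) (1 - p)\<close> (\<open>metric_contraction\<close>).
  In particular \<open>\<partial>'p = E\<^sub>2\<^sub>3 p dp\<close>, so \<open>d(\<partial>'p) = E\<^sub>2\<^sub>3 dp \<and> dp\<close>, and \<open>d(\<partial>p)\<close> is its negative.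

  The Riemann tensor is \<open>K \<circ> \<nabla>\<close> for the map \<open>K(\<alpha> \<otimes> \<beta>) = d\<alpha> \<otimes> \<beta> - \<alpha> \<and> \<nabla>\<beta>\<close>, which satisfies
  \<open>K(b X) = db \<and> X + b K(X)\<close>.  Apply it to \<open>\<nabla>(\<partial>'p) = E\<^sub>2\<^sub>3 \<partial>p \<otimes> \<partial>'p - q^(-m) p g\<close>, where \<open>g\<close>
  denotes the half \<open>g\<^sub>+\<^sub>-\<close> of the metric, split with \<open>s\<close>, and pair with \<open>\<partial>p\<close> from the left.
  Most terms disappear:
  \<^item> whatever starts with \<open>\<partial>p \<and>\<close> followed by \<open>\<partial>p\<close>, because the braiding keeps \<open>\<partial>p \<otimes> \<partial>p\<close> among
    tensors of the same type and \<open>(\<partial>p, \<partial>p) = 0\<close>;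
  \<^item> the half of a mixed product \<open>\<partial>'p \<and> \<partial>p\<close> that \<open>s\<close> braids, because the braiding moves \<open>\<partial>p\<close> to
    the front; thus \<open>s\<close> contributes only the scalar \<open>c\<^sub>-\<^sub>+\<close> (\<open>contract_dbp_dp\<close>);
  \<^item> the products in \<open>d(\<partial>p) \<otimes> \<partial>'p\<close> whose second factor is \<open>\<partial>'p\<close>, which cancel in the sum over the
    inner leg since \<open>E\<^sub>2\<^sub>3 (\<partial>'p) p = 0\<close>;
  \<^item> the term \<open>p K(g)\<close>: moving \<open>p\<close> to the left turns \<open>\<partial>p\<close> into \<open>E\<^sub>2\<^sub>3 (\<partial>p) p = \<partial>p\<close>, and the outer
    contraction \<open>E'\<^sub>1\<^sub>2 \<partial>p\<close> is zero.
  There remain two terms, both with the coefficient \<open>-c\<^sub>-\<^sub>+\<close> and both containing the contracted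
  inverse metric.  In the first, \<open>q^(-m)(1 - p)\<close> acts on \<open>\<partial>p\<close> and leaves \<open>q^(-m) g\<close>.  In the
  second, with an extra factor \<open>q^(-m)\<close>, both free legs are closed up by \<open>E'\<close>, giving
  \<open>q^(-2m) (qdim V - q^m) g\<close> because \<open>E'\<^sub>1\<^sub>2 p = q^m\<close>.  The multiples \<open>q^(-m) g\<close> cancel and
  \<open>-c\<^sub>-\<^sub>+ q^(-2m) qdim(V) g\<close> is left.
\<close>

section \<open>Bimodules over a complex algebra and their tensor products\<close>

text \<open>
  Complex vector spaces in the weak sense in which they are needed here: the additive structure
  of a module record together with its scalar multiplication.  The other record fields are left
  open, so that algebras, left modules and bimodules are all instances.
\<close>

locale cspace = abelian_group M for M :: "(complex, 'm, 'z) module_scheme" +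
  assumes smult_closed [simp, intro]: "x \<in> carrier M \<Longrightarrow> c \<odot>\<^bsub>M\<^esub> x \<in> carrier M"
    and smult_r_distr: "x \<in> carrier M \<Longrightarrow> y \<in> carrier M \<Longrightarrow>
          c \<odot>\<^bsub>M\<^esub> (x \<oplus>\<^bsub>M\<^esub> y) = c \<odot>\<^bsub>M\<^esub> x \<oplus>\<^bsub>M\<^esub> c \<odot>\<^bsub>M\<^esub> y"
    and smult_l_distr: "x \<in> carrier M \<Longrightarrow> (c + d) \<odot>\<^bsub>M\<^esub> x = c \<odot>\<^bsub>M\<^esub> x \<oplus>\<^bsub>M\<^esub> d \<odot>\<^bsub>M\<^esub> x"
    and smult_assoc: "x \<in> carrier M \<Longrightarrow> (c * d) \<odot>\<^bsub>M\<^esub> x = c \<odot>\<^bsub>M\<^esub> (d \<odot>\<^bsub>M\<^esub> x)"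
    and smult_one [simp]: "x \<in> carrier M \<Longrightarrow> 1 \<odot>\<^bsub>M\<^esub> x = x"
begin

lemma smult_zero_left [simp]: "x \<in> carrier M \<Longrightarrow> 0 \<odot>\<^bsub>M\<^esub> x = \<zero>\<^bsub>M\<^esub>"
  using smult_l_distr[of x 0 0] smult_closed[of x 0]
  by (metis add.l_cancel_one' add_0)

lemma smult_zero_right [simp]: "c \<odot>\<^bsub>M\<^esub> \<zero>\<^bsub>M\<^esub> = \<zero>\<^bsub>M\<^esub>"
  using smult_assoc[of "\<zero>\<^bsub>M\<^esub>" c 0] by simp

lemma smult_minus_one: "x \<in> carrier M \<Longrightarrow> (- 1) \<odot>\<^bsub>M\<^esub> x = \<ominus>\<^bsub>M\<^esub> x"
  using smult_l_distr[of x "-1" 1] by (simp add: minus_equality)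

lemma minus_eq_smult: "x \<in> carrier M \<Longrightarrow> y \<in> carrier M \<Longrightarrow> x \<ominus>\<^bsub>M\<^esub> y = x \<oplus>\<^bsub>M\<^esub> (- 1) \<odot>\<^bsub>M\<^esub> y"
  by (simp add: smult_minus_one a_minus_def)

lemma smult_finsum:
  assumes "finite A" "\<And>i. i \<in> A \<Longrightarrow> x i \<in> carrier M"
  shows "c \<odot>\<^bsub>M\<^esub> (\<Oplus>\<^bsub>M\<^esub>i\<in>A. x i) = (\<Oplus>\<^bsub>M\<^esub>i\<in>A. c \<odot>\<^bsub>M\<^esub> x i)"
  using assms
proof (induction A rule: finite_induct)
  case (insert a F)
  then have "finsum M x F \<in> carrier M" by (intro finsum_closed) auto
  with insert show ?case
    by (simp add: Pi_def smult_r_distr)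
qed simp

end

text \<open>
  A complex algebra, with scalar multiplication expressed through the central elements
  \<open>c \<odot> \<one>\<close>.  In this form the axioms pass to quotient rings.
\<close>

locale calg = ring B for B :: "(complex, 'b) module" +
  assumes sc_closed [simp, intro]: "c \<odot>\<^bsub>B\<^esub> \<one>\<^bsub>B\<^esub> \<in> carrier B"
    and smult_sc: "b \<in> carrier B \<Longrightarrow> c \<odot>\<^bsub>B\<^esub> b = (c \<odot>\<^bsub>B\<^esub> \<one>\<^bsub>B\<^esub>) \<otimes>\<^bsub>B\<^esub> b"
    and sc_central: "b \<in> carrier B \<Longrightarrow> b \<otimes>\<^bsub>B\<^esub> (c \<odot>\<^bsub>B\<^esub> \<one>\<^bsub>B\<^esub>) = (c \<odot>\<^bsub>B\<^esub> \<one>\<^bsub>B\<^esub>) \<otimes>\<^bsub>B\<^esub> b"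
    and sc_add: "(c + c') \<odot>\<^bsub>B\<^esub> \<one>\<^bsub>B\<^esub> = (c \<odot>\<^bsub>B\<^esub> \<one>\<^bsub>B\<^esub>) \<oplus>\<^bsub>B\<^esub> (c' \<odot>\<^bsub>B\<^esub> \<one>\<^bsub>B\<^esub>)"
    and sc_mult: "(c * c') \<odot>\<^bsub>B\<^esub> \<one>\<^bsub>B\<^esub> = (c \<odot>\<^bsub>B\<^esub> \<one>\<^bsub>B\<^esub>) \<otimes>\<^bsub>B\<^esub> (c' \<odot>\<^bsub>B\<^esub> \<one>\<^bsub>B\<^esub>)"
    and sc_one: "1 \<odot>\<^bsub>B\<^esub> \<one>\<^bsub>B\<^esub> = \<one>\<^bsub>B\<^esub>"

locale lmod = B: calg B + M: abelian_group M
  for B :: "(complex, 'b) module" and M :: "('b, 'm) bimod" +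
  assumes lact_closed [simp, intro]: "b \<in> carrier B \<Longrightarrow> x \<in> carrier M \<Longrightarrow> b \<rhd>\<^bsub>M\<^esub> x \<in> carrier M"
    and lact_add_r: "b \<in> carrier B \<Longrightarrow> x \<in> carrier M \<Longrightarrow> y \<in> carrier M \<Longrightarrow>
          b \<rhd>\<^bsub>M\<^esub> (x \<oplus>\<^bsub>M\<^esub> y) = b \<rhd>\<^bsub>M\<^esub> x \<oplus>\<^bsub>M\<^esub> b \<rhd>\<^bsub>M\<^esub> y"
    and lact_add_l: "b \<in> carrier B \<Longrightarrow> b' \<in> carrier B \<Longrightarrow> x \<in> carrier M \<Longrightarrow>
          (b \<oplus>\<^bsub>B\<^esub> b') \<rhd>\<^bsub>M\<^esub> x = b \<rhd>\<^bsub>M\<^esub> x \<oplus>\<^bsub>M\<^esub> b' \<rhd>\<^bsub>M\<^esub> x"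
    and lact_assoc: "b \<in> carrier B \<Longrightarrow> b' \<in> carrier B \<Longrightarrow> x \<in> carrier M \<Longrightarrow>
          (b \<otimes>\<^bsub>B\<^esub> b') \<rhd>\<^bsub>M\<^esub> x = b \<rhd>\<^bsub>M\<^esub> (b' \<rhd>\<^bsub>M\<^esub> x)"
    and lact_one [simp]: "x \<in> carrier M \<Longrightarrow> \<one>\<^bsub>B\<^esub> \<rhd>\<^bsub>M\<^esub> x = x"
    and smult_lact: "x \<in> carrier M \<Longrightarrow> c \<odot>\<^bsub>M\<^esub> x = (c \<odot>\<^bsub>B\<^esub> \<one>\<^bsub>B\<^esub>) \<rhd>\<^bsub>M\<^esub> x"

lemma (in lmod) is_cspace: "cspace M"
  by unfold_locales
    (simp_all add: smult_lact lact_add_r lact_add_l lact_assoc B.sc_add B.sc_mult B.sc_one)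

sublocale lmod \<subseteq> M: cspace M by (rule is_cspace)

lemma (in calg) is_cspace: "cspace B"
proof
  show "c \<odot>\<^bsub>B\<^esub> x \<in> carrier B" if "x \<in> carrier B" for x c using that by (simp add: smult_sc[of x])
  show "c \<odot>\<^bsub>B\<^esub> (x \<oplus>\<^bsub>B\<^esub> y) = c \<odot>\<^bsub>B\<^esub> x \<oplus>\<^bsub>B\<^esub> c \<odot>\<^bsub>B\<^esub> y"
    if "x \<in> carrier B" "y \<in> carrier B" for x y c
    using that by (simp add: smult_sc[of x] smult_sc[of y] smult_sc[of "x \<oplus>\<^bsub>B\<^esub> y"] r_distr)
  show "(c + d) \<odot>\<^bsub>B\<^esub> x = c \<odot>\<^bsub>B\<^esub> x \<oplus>\<^bsub>B\<^esub> d \<odot>\<^bsub>B\<^esub> x" if "x \<in> carrier B" for x c d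
    using that by (simp add: smult_sc[of x] sc_add l_distr)
  show "(c * d) \<odot>\<^bsub>B\<^esub> x = c \<odot>\<^bsub>B\<^esub> (d \<odot>\<^bsub>B\<^esub> x)" if "x \<in> carrier B" for x c d
    using that by (simp add: smult_sc[of x] smult_sc[of "(d \<odot>\<^bsub>B\<^esub> \<one>\<^bsub>B\<^esub>) \<otimes>\<^bsub>B\<^esub> x"] sc_mult m_assoc)
  show "1 \<odot>\<^bsub>B\<^esub> x = x" if "x \<in> carrier B" for x
    using that by (simp add: smult_sc[of x] sc_one)
qed

context lmod begin

lemma lact_zero_r [simp]: "b \<in> carrier B \<Longrightarrow> b \<rhd>\<^bsub>M\<^esub> \<zero>\<^bsub>M\<^esub> = \<zero>\<^bsub>M\<^esub>"
  using lact_add_r[of b "\<zero>\<^bsub>M\<^esub>" "\<zero>\<^bsub>M\<^esub>"] lact_closed[of b "\<zero>\<^bsub>M\<^esub>"]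
  by (metis M.add.r_cancel_one' M.add.l_cancel_one' M.r_zero M.zero_closed)

lemma lact_smult: "b \<in> carrier B \<Longrightarrow> x \<in> carrier M \<Longrightarrow> b \<rhd>\<^bsub>M\<^esub> (c \<odot>\<^bsub>M\<^esub> x) = c \<odot>\<^bsub>M\<^esub> (b \<rhd>\<^bsub>M\<^esub> x)"
  by (simp add: smult_lact flip: lact_assoc) (simp add: B.sc_central)

lemma smult_B_lact: "b \<in> carrier B \<Longrightarrow> x \<in> carrier M \<Longrightarrow> (c \<odot>\<^bsub>B\<^esub> b) \<rhd>\<^bsub>M\<^esub> x = c \<odot>\<^bsub>M\<^esub> (b \<rhd>\<^bsub>M\<^esub> x)"
  by (simp add: smult_lact B.smult_sc[of b] lact_assoc)

lemma lact_minus: "b \<in> carrier B \<Longrightarrow> x \<in> carrier M \<Longrightarrow> b \<rhd>\<^bsub>M\<^esub> (\<ominus>\<^bsub>M\<^esub> x) = \<ominus>\<^bsub>M\<^esub> (b \<rhd>\<^bsub>M\<^esub> x)"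
  by (simp add: lact_smult flip: M.smult_minus_one)

end

text \<open>
  The two sides of a bimodule induce the same complex structure, by the last axiom.
\<close>

locale bimd = lmod B M for B :: "(complex, 'b) module" and M :: "('b, 'm) bimod" +
  assumes ract_closed [simp, intro]: "b \<in> carrier B \<Longrightarrow> x \<in> carrier M \<Longrightarrow> x \<lhd>\<^bsub>M\<^esub> b \<in> carrier M"
    and ract_add_l: "b \<in> carrier B \<Longrightarrow> x \<in> carrier M \<Longrightarrow> y \<in> carrier M \<Longrightarrow>
          (x \<oplus>\<^bsub>M\<^esub> y) \<lhd>\<^bsub>M\<^esub> b = x \<lhd>\<^bsub>M\<^esub> b \<oplus>\<^bsub>M\<^esub> y \<lhd>\<^bsub>M\<^esub> b"
    and ract_add_r: "b \<in> carrier B \<Longrightarrow> b' \<in> carrier B \<Longrightarrow> x \<in> carrier M \<Longrightarrow>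
          x \<lhd>\<^bsub>M\<^esub> (b \<oplus>\<^bsub>B\<^esub> b') = x \<lhd>\<^bsub>M\<^esub> b \<oplus>\<^bsub>M\<^esub> x \<lhd>\<^bsub>M\<^esub> b'"
    and ract_assoc: "b \<in> carrier B \<Longrightarrow> b' \<in> carrier B \<Longrightarrow> x \<in> carrier M \<Longrightarrow>
          x \<lhd>\<^bsub>M\<^esub> (b \<otimes>\<^bsub>B\<^esub> b') = (x \<lhd>\<^bsub>M\<^esub> b) \<lhd>\<^bsub>M\<^esub> b'"
    and ract_one [simp]: "x \<in> carrier M \<Longrightarrow> x \<lhd>\<^bsub>M\<^esub> \<one>\<^bsub>B\<^esub> = x"
    and lact_ract: "b \<in> carrier B \<Longrightarrow> b' \<in> carrier B \<Longrightarrow> x \<in> carrier M \<Longrightarrow>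
          (b \<rhd>\<^bsub>M\<^esub> x) \<lhd>\<^bsub>M\<^esub> b' = b \<rhd>\<^bsub>M\<^esub> (x \<lhd>\<^bsub>M\<^esub> b')"
    and ract_sc: "x \<in> carrier M \<Longrightarrow> x \<lhd>\<^bsub>M\<^esub> (c \<odot>\<^bsub>B\<^esub> \<one>\<^bsub>B\<^esub>) = (c \<odot>\<^bsub>B\<^esub> \<one>\<^bsub>B\<^esub>) \<rhd>\<^bsub>M\<^esub> x"

lemma abelian_group_transfer:
  assumes "abelian_group A" "carrier M = carrier A" "\<zero>\<^bsub>M\<^esub> = \<zero>\<^bsub>A\<^esub>"
    "\<And>x y. x \<in> carrier A \<Longrightarrow> y \<in> carrier A \<Longrightarrow> x \<oplus>\<^bsub>M\<^esub> y = x \<oplus>\<^bsub>A\<^esub> y"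
  shows "abelian_group M"
proof -
  interpret A: abelian_group A by fact
  show ?thesis
  proof (rule abelian_groupI)
    show "\<exists>y\<in>carrier M. y \<oplus>\<^bsub>M\<^esub> x = \<zero>\<^bsub>M\<^esub>" if "x \<in> carrier M" for x
      using that assms A.l_neg[of x] by (intro bexI[of _ "\<ominus>\<^bsub>A\<^esub> x"]) auto
  qed (auto simp: assms A.a_ac)
qed

definition add_map :: "('m, 'y) ring_scheme \<Rightarrow> ('k, 'z) ring_scheme \<Rightarrow> ('m \<Rightarrow> 'k) \<Rightarrow> bool" where
  "add_map M N f \<longleftrightarrow> f \<in> carrier M \<rightarrow> carrier N \<and>
     (\<forall>x\<in>carrier M. \<forall>y\<in>carrier M. f (x \<oplus>\<^bsub>M\<^esub> y) = f x \<oplus>\<^bsub>N\<^esub> f y)"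

definition balanced :: "(complex, 'b) module \<Rightarrow> ('b, 'm) bimod \<Rightarrow> ('b, 'k) bimod \<Rightarrow>
    ('p, 'z) ring_scheme \<Rightarrow> ('m \<Rightarrow> 'k \<Rightarrow> 'p) \<Rightarrow> bool" where
  "balanced B M N P f \<longleftrightarrow> (\<forall>x\<in>carrier M. add_map N P (f x)) \<and>
     (\<forall>y\<in>carrier N. add_map M P (\<lambda>x. f x y)) \<and>
     (\<forall>x\<in>carrier M. \<forall>b\<in>carrier B. \<forall>y\<in>carrier N. f (x \<lhd>\<^bsub>M\<^esub> b) y = f x (b \<rhd>\<^bsub>N\<^esub> y))"

lemma add_map_closed: "add_map M N f \<Longrightarrow> x \<in> carrier M \<Longrightarrow> f x \<in> carrier N"
  by (auto simp: add_map_def)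

lemma add_map_add: "add_map M N f \<Longrightarrow> x \<in> carrier M \<Longrightarrow> y \<in> carrier M \<Longrightarrow> f (x \<oplus>\<^bsub>M\<^esub> y) = f x \<oplus>\<^bsub>N\<^esub> f y"
  by (auto simp: add_map_def)

lemma add_map_ident: "add_map M M (\<lambda>x. x)"
  by (simp add: add_map_def)

lemma add_map_comp: "add_map M N f \<Longrightarrow> add_map N P g \<Longrightarrow> add_map M P (\<lambda>x. g (f x))"
  by (auto simp: add_map_def Pi_iff)

lemma add_map_add_maps:
  assumes "abelian_group N" "add_map M N f" "add_map M N g"
  shows "add_map M N (\<lambda>x. f x \<oplus>\<^bsub>N\<^esub> g x)"
proof -
  interpret N: abelian_group N by fact
  show ?thesis using assms(2,3) by (auto simp: add_map_def Pi_iff N.a_ac)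
qed

lemma add_map_hom:
  assumes "abelian_group M" "abelian_group N" "add_map M N f"
  shows "abelian_group_hom M N f"
  using assms by (intro abelian_group_homI) (auto simp: add_map_def hom_def group_hom_def group_hom_axioms_def abelian_group.a_group)

lemma add_map_zero: "abelian_group M \<Longrightarrow> abelian_group N \<Longrightarrow> add_map M N f \<Longrightarrow> f \<zero>\<^bsub>M\<^esub> = \<zero>\<^bsub>N\<^esub>"
  using abelian_group_hom.hom_zero[OF add_map_hom] .

lemma add_map_minus: "abelian_group M \<Longrightarrow> abelian_group N \<Longrightarrow> add_map M N f \<Longrightarrow> x \<in> carrier M \<Longrightarrow>
    f (\<ominus>\<^bsub>M\<^esub> x) = \<ominus>\<^bsub>N\<^esub> f x"
  using abelian_group_hom.hom_a_inv[OF add_map_hom] .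

lemma add_map_diff: "abelian_group M \<Longrightarrow> abelian_group N \<Longrightarrow> add_map M N f \<Longrightarrow> x \<in> carrier M \<Longrightarrow>
    y \<in> carrier M \<Longrightarrow> f (x \<ominus>\<^bsub>M\<^esub> y) = f x \<ominus>\<^bsub>N\<^esub> f y"
  by (simp add: a_minus_def add_map_minus add_map_add abelian_group.a_inv_closed)

lemma add_map_finsum:
  assumes "abelian_group M" "abelian_group N" "add_map M N f" "finite A"
    "\<And>i. i \<in> A \<Longrightarrow> x i \<in> carrier M"
  shows "f (\<Oplus>\<^bsub>M\<^esub>i\<in>A. x i) = (\<Oplus>\<^bsub>N\<^esub>i\<in>A. f (x i))"
  using assms(4,5)
proof (induction A rule: finite_induct)
  interpret M: abelian_group M by fact
  interpret N: abelian_group N by fact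
  case empty
  show ?case using add_map_zero[OF assms(1,2,3)] by simp
next
  interpret M: abelian_group M by fact
  interpret N: abelian_group N by fact
  case (insert a F)
  then have "finsum M x F \<in> carrier M" by (intro M.finsum_closed) auto
  with insert show ?case
    by (simp add: Pi_def add_map_add[OF assms(3)] add_map_closed[OF assms(3)])
qed

text \<open>
  The homomorphism out of a free abelian group that extends a function of two variables; the
  tensor product is a quotient of such a group.
\<close>

definition frag_sum :: "('p, 'z) ring_scheme \<Rightarrow> ('m \<Rightarrow> 'k \<Rightarrow> 'p) \<Rightarrow> ('m \<times> 'k \<Rightarrow>\<^sub>0 int) \<Rightarrow> 'p" where
  "frag_sum P f x = (\<Oplus>\<^bsub>P\<^esub>z\<in>Poly_Mapping.keys x.
     [Poly_Mapping.lookup x z] \<cdot>\<^bsub>P\<^esub> f (fst z) (snd z))"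

lemma add_pow_int_0: "[(0::int)] \<cdot>\<^bsub>P\<^esub> x = \<zero>\<^bsub>P\<^esub>"
  by (simp add: add_pow_def)

lemma frag_sum_superset:
  assumes "abelian_group P" "finite T" "Poly_Mapping.keys x \<subseteq> T" "\<And>z. z \<in> T \<Longrightarrow> f (fst z) (snd z) \<in> carrier P"
  shows "frag_sum P f x = (\<Oplus>\<^bsub>P\<^esub>z\<in>T. [Poly_Mapping.lookup x z] \<cdot>\<^bsub>P\<^esub> f (fst z) (snd z))"
proof -
  interpret P: abelian_group P by fact
  show ?thesis unfolding frag_sum_def
    using assms(2-4)
    by (intro P.add.finprod_mono_neutral_cong_left)
      (force intro: P.add.int_pow_closed simp: in_keys_iff add_pow_int_0)+
qed

lemma frag_sum_add:
  assumes "abelian_group P" "Poly_Mapping.keys x \<subseteq> A \<times> C" "Poly_Mapping.keys y \<subseteq> A \<times> C"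
    "\<And>a c. a \<in> A \<Longrightarrow> c \<in> C \<Longrightarrow> f a c \<in> carrier P"
  shows "frag_sum P f (x + y) = frag_sum P f x \<oplus>\<^bsub>P\<^esub> frag_sum P f y"
proof -
  interpret P: abelian_group P by fact
  let ?T = "Poly_Mapping.keys x \<union> Poly_Mapping.keys y"
  have f: "f (fst z) (snd z) \<in> carrier P" if "z \<in> ?T" for z using that assms(2-4) by auto
  have "Poly_Mapping.keys (x + y) \<subseteq> ?T" by (rule Poly_Mapping.keys_add)
  then have "frag_sum P f (x + y) = (\<Oplus>\<^bsub>P\<^esub>z\<in>?T. [Poly_Mapping.lookup (x + y) z] \<cdot>\<^bsub>P\<^esub> f (fst z) (snd z))"
    using f assms(1) by (intro frag_sum_superset) auto
  also have "\<dots> = (\<Oplus>\<^bsub>P\<^esub>z\<in>?T. [Poly_Mapping.lookup x z] \<cdot>\<^bsub>P\<^esub> f (fst z) (snd z)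
      \<oplus>\<^bsub>P\<^esub> [Poly_Mapping.lookup y z] \<cdot>\<^bsub>P\<^esub> f (fst z) (snd z))"
    using f by (intro P.finsum_cong') (auto simp: lookup_add P.add.int_pow_mult)
  also have "\<dots> = frag_sum P f x \<oplus>\<^bsub>P\<^esub> frag_sum P f y"
    using f by (subst (1 2) frag_sum_superset[of P ?T]) (auto intro!: P.finsum_addf assms(1))
  finally show ?thesis .
qed

lemma frag_sum_of:
  assumes "abelian_group P" "f a c \<in> carrier P"
  shows "frag_sum P f (frag_of (a, c)) = f a c"
proof -
  interpret P: abelian_group P by fact
  show ?thesis using assms(2) by (simp add: frag_sum_def)
qed

locale tensp = M: bimd B M + N: bimd B N
  for B :: "(complex, 'b) module" and M :: "('b, 'm) bimod" and N :: "('b, 'k) bimod"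
begin

abbreviation "S \<equiv> carrier M \<times> carrier N"
abbreviation "G \<equiv> free_Abelian_group S"
abbreviation "H \<equiv> balancing_subgroup B M N"
abbreviation "MN \<equiv> tensor B M N"
abbreviation pt (infixl "\<^bold>\<otimes>" 72) where "pt \<equiv> ptens B M N"

lemma balancing_sub: "balancing B M N \<subseteq> carrier G"
  unfolding balancing_def
  by (auto dest!: subsetD[OF keys_diff])

lemma subgroup_H: "subgroup H G"
  unfolding balancing_subgroup_def
  by (rule group.generate_is_subgroup) (use balancing_sub in auto)

lemma normal_H: "H \<lhd> G"
  using subgroup_H abelian_free_Abelian_group comm_group.normal_iff_subgroup by blast

lemma comm_group_quot: "comm_group (G Mod H)"
  by (rule comm_group.abelian_FactGroup) (use subgroup_H abelian_free_Abelian_group in auto)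

lemma abelian_tens: "abelian_group (tens_add_group B M N)"
proof -
  have *: "add_monoid (tens_add_group B M N) = G Mod H \<Longrightarrow> ?thesis"
    using comm_group_quot by (simp add: abelian_group_def abelian_group_axioms_def abelian_monoid_def comm_group_def)
  show ?thesis
    by (rule *) (simp add: tens_add_group_def Let_def FactGroup_def)
qed

lemma abelian_MN: "abelian_group MN"
proof -
  show ?thesis
    by (rule abelian_group_transfer[OF abelian_tens]) (simp_all add: tensor_def Let_def)
qed

sublocale MN: abelian_group MN by (rule abelian_MN)

definition cls where "cls x = H #>\<^bsub>G\<^esub> x"

lemma pt_cls: "x \<^bold>\<otimes> y = cls (frag_of (x, y))"
  by (simp add: ptens_def cls_def)

lemma carrier_A: "carrier (tens_add_group B M N) = cls ` carrier G"
  by (auto simp: tens_add_group_def Let_def FactGroup_def RCOSETS_def cls_def)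

lemma carrier_MN: "carrier MN = cls ` carrier G"
  using carrier_A by (simp add: tensor_def Let_def)

lemma add_A: "x \<in> carrier G \<Longrightarrow> y \<in> carrier G \<Longrightarrow> cls x \<oplus>\<^bsub>tens_add_group B M N\<^esub> cls y = cls (x + y)"
  unfolding cls_def using normal.rcos_sum[OF normal_H, of x y]
  by (simp add: tens_add_group_def Let_def FactGroup_def)

lemma add_MN: "x \<in> carrier G \<Longrightarrow> y \<in> carrier G \<Longrightarrow> cls x \<oplus>\<^bsub>MN\<^esub> cls y = cls (x + y)"
  using add_A by (simp add: tensor_def Let_def)

lemma cls_eqI: "x \<in> carrier G \<Longrightarrow> y \<in> carrier G \<Longrightarrow> x - y \<in> H \<Longrightarrow> cls x = cls y"
proof -
  assume *: "x \<in> carrier G" "y \<in> carrier G" "x - y \<in> H"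
  have "x \<in> H #>\<^bsub>G\<^esub> y"
    unfolding r_coset_def using * by (auto intro!: bexI[of _ "x - y"])
  then show "cls x = cls y" unfolding cls_def
    using group.repr_independence[OF group_free_Abelian_group _ _ subgroup_H, of x y] *(2) by auto
qed

lemma cls_diff: "x \<in> carrier G \<Longrightarrow> y \<in> carrier G \<Longrightarrow> cls (x - y) = cls x \<ominus>\<^bsub>MN\<^esub> cls y"
proof -
  assume x: "x \<in> carrier G" and y: "y \<in> carrier G"
  then have xy: "x - y \<in> carrier G" by (auto dest!: subsetD[OF keys_diff])
  have "cls (x - y) \<oplus>\<^bsub>MN\<^esub> cls y = cls x" using add_MN[OF xy y] by simp
  moreover have "cls (x - y) \<in> carrier MN" "cls y \<in> carrier MN" "cls x \<in> carrier MN"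
    using x y xy by (auto simp: carrier_MN)
  ultimately show ?thesis
    by (metis MN.add.inv_solve_right a_minus_def)
qed

lemma cls_zero: "cls 0 = \<zero>\<^bsub>MN\<^esub>"
  using cls_diff[of 0 0] by (simp add: carrier_MN MN.r_neg a_minus_def)

lemma pt_closed [simp, intro]: "x \<in> carrier M \<Longrightarrow> y \<in> carrier N \<Longrightarrow> x \<^bold>\<otimes> y \<in> carrier MN"
  by (auto simp: carrier_MN pt_cls)

lemma pt_add_l: "x \<in> carrier M \<Longrightarrow> x' \<in> carrier M \<Longrightarrow> y \<in> carrier N \<Longrightarrow>
    (x \<oplus>\<^bsub>M\<^esub> x') \<^bold>\<otimes> y = x \<^bold>\<otimes> y \<oplus>\<^bsub>MN\<^esub> x' \<^bold>\<otimes> y"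
proof -
  assume *: "x \<in> carrier M" "x' \<in> carrier M" "y \<in> carrier N"
  have "frag_of (x \<oplus>\<^bsub>M\<^esub> x', y) - frag_of (x, y) - frag_of (x', y) \<in> H"
    unfolding balancing_subgroup_def balancing_def using * by (intro generate.incl) blast
  then show ?thesis unfolding pt_cls using *
    by (subst add_MN, simp, simp, intro cls_eqI)
      (auto simp: diff_diff_eq dest!: subsetD[OF Poly_Mapping.keys_add])
qed

lemma pt_add_r: "x \<in> carrier M \<Longrightarrow> y \<in> carrier N \<Longrightarrow> y' \<in> carrier N \<Longrightarrow>
    x \<^bold>\<otimes> (y \<oplus>\<^bsub>N\<^esub> y') = x \<^bold>\<otimes> y \<oplus>\<^bsub>MN\<^esub> x \<^bold>\<otimes> y'"
proof -
  assume *: "x \<in> carrier M" "y \<in> carrier N" "y' \<in> carrier N"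
  have "frag_of (x, y \<oplus>\<^bsub>N\<^esub> y') - frag_of (x, y) - frag_of (x, y') \<in> H"
    unfolding balancing_subgroup_def balancing_def using * by (intro generate.incl) blast
  then show ?thesis unfolding pt_cls using *
    by (subst add_MN, simp, simp, intro cls_eqI)
      (auto simp: diff_diff_eq dest!: subsetD[OF Poly_Mapping.keys_add])
qed

lemma pt_bal: "x \<in> carrier M \<Longrightarrow> b \<in> carrier B \<Longrightarrow> y \<in> carrier N \<Longrightarrow> (x \<lhd>\<^bsub>M\<^esub> b) \<^bold>\<otimes> y = x \<^bold>\<otimes> (b \<rhd>\<^bsub>N\<^esub> y)"
proof -
  assume *: "x \<in> carrier M" "b \<in> carrier B" "y \<in> carrier N"
  have "frag_of (x \<lhd>\<^bsub>M\<^esub> b, y) - frag_of (x, b \<rhd>\<^bsub>N\<^esub> y) \<in> H"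
    unfolding balancing_subgroup_def balancing_def using * by (intro generate.incl) blast
  with * show ?thesis unfolding pt_cls by (intro cls_eqI) auto
qed

text \<open>
  Pure tensors generate the tensor product as a group.  Differences are used because the
  free abelian group has integer coefficients.
\<close>

lemma tens_induct [consumes 1, case_names zero pt diff]:
  assumes "X \<in> carrier MN" "P \<zero>\<^bsub>MN\<^esub>" "\<And>x y. x \<in> carrier M \<Longrightarrow> y \<in> carrier N \<Longrightarrow> P (x \<^bold>\<otimes> y)"
    "\<And>X Y. X \<in> carrier MN \<Longrightarrow> Y \<in> carrier MN \<Longrightarrow> P X \<Longrightarrow> P Y \<Longrightarrow> P (X \<ominus>\<^bsub>MN\<^esub> Y)"
  shows "P X"
proof -
  obtain x where x: "Poly_Mapping.keys x \<subseteq> S" "X = cls x" using assms(1) by (auto simp: carrier_MN)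
  have "P (cls x)"
  proof (rule free_Abelian_group_induct[of x S "\<lambda>x. P (cls x)"])
    show "P (cls (a - b))"
      if "Poly_Mapping.keys a \<subseteq> S" "Poly_Mapping.keys b \<subseteq> S" "P (cls a)" "P (cls b)" for a b
      using that assms(4)[of "cls a" "cls b"] by (simp add: cls_diff carrier_MN)
    show "P (cls (frag_of a))" if "a \<in> S" for a
      using that assms(3) by (auto simp: pt_cls)
  qed (use x assms(2) in \<open>auto simp: cls_zero\<close>)
  then show ?thesis by (simp add: x)
qed

text \<open>
  A balanced map kills the generators of the balancing subgroup, hence it descends to the tensor
  product.
\<close>

lemma frag_sum_H:
  assumes P: "abelian_group P" and f: "balanced B M N P f" and x: "x \<in> H"
  shows "frag_sum P f x = \<zero>\<^bsub>P\<^esub>"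
proof -
  interpret P: abelian_group P by fact
  have cl: "f a c \<in> carrier P" if "a \<in> carrier M" "c \<in> carrier N" for a c
    using f that by (auto simp: balanced_def add_map_def)
  have zero: "frag_sum P f 0 = \<zero>\<^bsub>P\<^esub>" by (simp add: frag_sum_def)
  have minus: "frag_sum P f (x - y) = frag_sum P f x \<ominus>\<^bsub>P\<^esub> frag_sum P f y"
    if "x \<in> carrier G" "y \<in> carrier G" for x y
  proof -
    have xy: "x - y \<in> carrier G" using that by (auto dest!: subsetD[OF keys_diff])
    have c: "frag_sum P f z \<in> carrier P" if "z \<in> carrier G" for z
      unfolding frag_sum_def using that cl by (intro P.finsum_closed) (auto intro!: P.add.int_pow_closed)
    have "frag_sum P f (x - y) \<oplus>\<^bsub>P\<^esub> frag_sum P f y = frag_sum P f x"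
      using frag_sum_add[OF P, of "x - y" "carrier M" "carrier N" y f] that xy cl by simp
    then show ?thesis using c[OF xy] c[OF that(1)] c[OF that(2)] by (metis P.add.inv_solve_right a_minus_def)
  qed
  have in_G: "h \<in> carrier G" if "h \<in> H" for h using subgroup.subset[OF subgroup_H] that by blast
  have bal: "frag_sum P f h = \<zero>\<^bsub>P\<^esub>" if h: "h \<in> balancing B M N" for h
  proof -
    have fl: "f (a \<oplus>\<^bsub>M\<^esub> a') c = f a c \<oplus>\<^bsub>P\<^esub> f a' c"
      if "a \<in> carrier M" "a' \<in> carrier M" "c \<in> carrier N" for a a' c
      using f that by (auto simp: balanced_def add_map_def)
    have fr: "f a (c \<oplus>\<^bsub>N\<^esub> c') = f a c \<oplus>\<^bsub>P\<^esub> f a c'"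
      if "a \<in> carrier M" "c \<in> carrier N" "c' \<in> carrier N" for a c c'
      using f that by (auto simp: balanced_def add_map_def)
    have fb: "f (a \<lhd>\<^bsub>M\<^esub> b) c = f a (b \<rhd>\<^bsub>N\<^esub> c)"
      if "a \<in> carrier M" "b \<in> carrier B" "c \<in> carrier N" for a b c
      using f that by (auto simp: balanced_def)
    have d: "Poly_Mapping.keys (frag_of u - frag_of v) \<subseteq> S" if "u \<in> S" "v \<in> S" for u v
      using that by (auto dest!: subsetD[OF keys_diff])
    have canc: "a \<oplus>\<^bsub>P\<^esub> b \<ominus>\<^bsub>P\<^esub> a \<ominus>\<^bsub>P\<^esub> b = \<zero>\<^bsub>P\<^esub>" if "a \<in> carrier P" "b \<in> carrier P" for a b
      using that P.r_neg[of "a \<oplus>\<^bsub>P\<^esub> b"] by (simp add: P.minus_eq P.a_assoc P.minus_add)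
    from h show ?thesis unfolding balancing_def
      by (elim UnE CollectE exE conjE)
        (simp_all add: minus d frag_sum_of[OF P] cl fl fr fb canc, simp_all add: cl P.minus_eq P.r_neg)
  qed
  from x[unfolded balancing_subgroup_def] show ?thesis
  proof (induction rule: generate.induct)
    case one then show ?case by (simp add: zero)
  next
    case (incl h) then show ?case by (rule bal)
  next
    case (inv h)
    then have "h \<in> carrier G" using balancing_sub by blast
    then show ?case using minus[of 0 h] bal[OF inv] by (simp add: zero P.minus_eq)
  next
    case (eng h1 h2)
    then have "h1 \<in> carrier G" "h2 \<in> carrier G" using in_G by (auto simp: balancing_subgroup_def)
    with eng show ?case using frag_sum_add[OF P, of h1 "carrier M" "carrier N" h2 f] cl by simp
  qed
qed

lemma tens_lift_cls:
  assumes P: "abelian_group P" and f: "balanced B M N P f" and x: "x \<in> carrier G"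
  shows "tens_lift P f (cls x) = frag_sum P f x"
proof -
  interpret P: abelian_group P by fact
  have cl: "f a c \<in> carrier P" if "a \<in> carrier M" "c \<in> carrier N" for a c
    using f that by (auto simp: balanced_def add_map_def)
  have c: "frag_sum P f z \<in> carrier P" if "z \<in> carrier G" for z
    unfolding frag_sum_def using that cl by (intro P.finsum_closed) (auto intro!: P.add.int_pow_closed)
  have *: "frag_sum P f (h + x) = frag_sum P f x" if "h \<in> H" for h
  proof -
    have "h \<in> carrier G" using subgroup.subset[OF subgroup_H] that by blast
    then have "frag_sum P f (h + x) = frag_sum P f h \<oplus>\<^bsub>P\<^esub> frag_sum P f x"
      using x cl by (intro frag_sum_add[OF P, of _ "carrier M" "carrier N"]) auto
    then show ?thesis using frag_sum_H[OF P f that] c[OF x] by simp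
  qed
  have "frag_sum P f ` cls x = {frag_sum P f x}"
    unfolding cls_def r_coset_def using * subgroup.one_closed[OF subgroup_H] by (auto simp: image_iff) 
  then show ?thesis by (simp add: tens_lift_def frag_sum_def[symmetric] cong: image_cong)
qed

text \<open>
  The universal property of the tensor product.
\<close>

lemma tens_lift_pt:
  assumes P: "abelian_group P" and f: "balanced B M N P f" and "x \<in> carrier M" "y \<in> carrier N"
  shows "tens_lift P f (x \<^bold>\<otimes> y) = f x y"
  using assms(3,4) f tens_lift_cls[OF P f, of "frag_of (x, y)"]
  by (simp add: pt_cls frag_sum_of[OF P] balanced_def add_map_def Pi_iff)

lemma tens_lift_add_map:
  assumes P: "abelian_group P" and f: "balanced B M N P f"
  shows "add_map MN P (tens_lift P f)"
proof -
  interpret P: abelian_group P by fact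
  have cl: "f a c \<in> carrier P" if "a \<in> carrier M" "c \<in> carrier N" for a c
    using f that by (auto simp: balanced_def add_map_def)
  have c: "frag_sum P f z \<in> carrier P" if "z \<in> carrier G" for z
    unfolding frag_sum_def using that cl by (intro P.finsum_closed) (auto intro!: P.add.int_pow_closed)
  have ad: "tens_lift P f (X \<oplus>\<^bsub>MN\<^esub> Y) = tens_lift P f X \<oplus>\<^bsub>P\<^esub> tens_lift P f Y"
    if XY: "X \<in> carrier MN" "Y \<in> carrier MN" for X Y
  proof -
    obtain x y where xy: "x \<in> carrier G" "y \<in> carrier G" "X = cls x" "Y = cls y"
      using XY unfolding carrier_MN by blast
    then have "x + y \<in> carrier G" by (auto dest!: subsetD[OF Poly_Mapping.keys_add])
    with xy show ?thesis using cl
      by (simp add: add_MN tens_lift_cls[OF P f] frag_sum_add[OF P, of _ "carrier M" "carrier N"])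
  qed
  show ?thesis unfolding add_map_def using ad c by (auto simp: carrier_MN tens_lift_cls[OF P f])
qed

lemma tens_ext:
  assumes P: "abelian_group P" and F: "add_map MN P F" and F': "add_map MN P F'"
    and eq: "\<And>x y. x \<in> carrier M \<Longrightarrow> y \<in> carrier N \<Longrightarrow> F (x \<^bold>\<otimes> y) = F' (x \<^bold>\<otimes> y)"
    and X: "X \<in> carrier MN"
  shows "F X = F' X"
  using X
proof (induction X rule: tens_induct)
  case zero
  show ?case using add_map_zero[OF abelian_MN P F] add_map_zero[OF abelian_MN P F'] by simp
next
  case (pt x y) then show ?case by (rule eq)
next
  case (diff X Y)
  then show ?case
    using add_map_diff[OF abelian_MN P F] add_map_diff[OF abelian_MN P F'] by simp
qed

lemma tens_add_group_eq: "carrier (tens_add_group B M N) = carrier MN"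
  "ring.add (tens_add_group B M N) = ring.add MN" "ring.zero (tens_add_group B M N) = ring.zero MN"
  by (simp_all add: tensor_def Let_def)

lemma lact_lift: "b \<in> carrier B \<Longrightarrow> balanced B M N (tens_add_group B M N) (\<lambda>x y. (b \<rhd>\<^bsub>M\<^esub> x) \<^bold>\<otimes> y)"
  unfolding balanced_def add_map_def
  by (auto simp: tens_add_group_eq pt_add_l pt_add_r M.lact_add_r M.lact_ract simp flip: pt_bal)

lemma ract_lift: "b \<in> carrier B \<Longrightarrow> balanced B M N (tens_add_group B M N) (\<lambda>x y. x \<^bold>\<otimes> (y \<lhd>\<^bsub>N\<^esub> b))"
  unfolding balanced_def add_map_def
  by (auto simp: tens_add_group_eq pt_add_l pt_add_r N.ract_add_l N.lact_ract pt_bal)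

lemma smult_lift: "balanced B M N (tens_add_group B M N) (\<lambda>x y. (c \<odot>\<^bsub>M\<^esub> x) \<^bold>\<otimes> y)"
  unfolding balanced_def add_map_def
  by (auto simp: tens_add_group_eq pt_add_l pt_add_r M.lact_add_r M.lact_ract M.smult_lact simp flip: pt_bal)

lemma lact_MN: "b \<rhd>\<^bsub>MN\<^esub> X = tens_lift (tens_add_group B M N) (\<lambda>x y. (b \<rhd>\<^bsub>M\<^esub> x) \<^bold>\<otimes> y) X"
  by (simp add: tensor_def Let_def)

lemma ract_MN: "X \<lhd>\<^bsub>MN\<^esub> b = tens_lift (tens_add_group B M N) (\<lambda>x y. x \<^bold>\<otimes> (y \<lhd>\<^bsub>N\<^esub> b)) X"
  by (simp add: tensor_def Let_def)

lemma smult_MN: "c \<odot>\<^bsub>MN\<^esub> X = tens_lift (tens_add_group B M N) (\<lambda>x y. (c \<odot>\<^bsub>M\<^esub> x) \<^bold>\<otimes> y) X"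
  by (simp add: tensor_def Let_def)

lemma add_map_A: "add_map MN (tens_add_group B M N) f = add_map MN MN f"
  by (simp add: add_map_def tens_add_group_eq)

lemma lact_pt: "b \<in> carrier B \<Longrightarrow> x \<in> carrier M \<Longrightarrow> y \<in> carrier N \<Longrightarrow>
    b \<rhd>\<^bsub>MN\<^esub> (x \<^bold>\<otimes> y) = (b \<rhd>\<^bsub>M\<^esub> x) \<^bold>\<otimes> y"
  by (simp add: lact_MN tens_lift_pt[OF abelian_tens lact_lift])

lemma ract_pt: "b \<in> carrier B \<Longrightarrow> x \<in> carrier M \<Longrightarrow> y \<in> carrier N \<Longrightarrow>
    (x \<^bold>\<otimes> y) \<lhd>\<^bsub>MN\<^esub> b = x \<^bold>\<otimes> (y \<lhd>\<^bsub>N\<^esub> b)"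
  by (simp add: ract_MN tens_lift_pt[OF abelian_tens ract_lift])

lemma smult_pt: "x \<in> carrier M \<Longrightarrow> y \<in> carrier N \<Longrightarrow> c \<odot>\<^bsub>MN\<^esub> (x \<^bold>\<otimes> y) = (c \<odot>\<^bsub>M\<^esub> x) \<^bold>\<otimes> y"
  by (simp add: smult_MN tens_lift_pt[OF abelian_tens smult_lift])

lemma add_map_lact: "b \<in> carrier B \<Longrightarrow> add_map MN MN (\<lambda>X. b \<rhd>\<^bsub>MN\<^esub> X)"
  unfolding lact_MN add_map_A[symmetric] by (rule tens_lift_add_map[OF abelian_tens lact_lift])

lemma add_map_ract: "b \<in> carrier B \<Longrightarrow> add_map MN MN (\<lambda>X. X \<lhd>\<^bsub>MN\<^esub> b)"
  unfolding ract_MN add_map_A[symmetric] by (rule tens_lift_add_map[OF abelian_tens ract_lift])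

lemma add_map_smult: "add_map MN MN (\<lambda>X. c \<odot>\<^bsub>MN\<^esub> X)"
  unfolding smult_MN add_map_A[symmetric] by (rule tens_lift_add_map[OF abelian_tens smult_lift])

lemmas add_maps_MN = add_map_lact add_map_ract add_map_smult

text \<open>
  Both actions and the scalars are lifts of balanced maps, so every axiom may be checked on pure
  tensors.
\<close>

lemma bimd_MN: "bimd B MN"
proof unfold_locales
  note ext = tens_ext[OF abelian_MN]
  show "b \<rhd>\<^bsub>MN\<^esub> X \<in> carrier MN" if "b \<in> carrier B" "X \<in> carrier MN" for b X
    using add_map_closed[OF add_map_lact] that by blast
  show "X \<lhd>\<^bsub>MN\<^esub> b \<in> carrier MN" if "b \<in> carrier B" "X \<in> carrier MN" for b X
    using add_map_closed[OF add_map_ract] that by blast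
  show "b \<rhd>\<^bsub>MN\<^esub> (X \<oplus>\<^bsub>MN\<^esub> Y) = b \<rhd>\<^bsub>MN\<^esub> X \<oplus>\<^bsub>MN\<^esub> b \<rhd>\<^bsub>MN\<^esub> Y"
    if "b \<in> carrier B" "X \<in> carrier MN" "Y \<in> carrier MN" for b X Y
    using add_map_add[OF add_map_lact] that by blast
  show "(X \<oplus>\<^bsub>MN\<^esub> Y) \<lhd>\<^bsub>MN\<^esub> b = X \<lhd>\<^bsub>MN\<^esub> b \<oplus>\<^bsub>MN\<^esub> Y \<lhd>\<^bsub>MN\<^esub> b"
    if "b \<in> carrier B" "X \<in> carrier MN" "Y \<in> carrier MN" for b X Y
    using add_map_add[OF add_map_ract] that by blast
  show "(b \<oplus>\<^bsub>B\<^esub> b') \<rhd>\<^bsub>MN\<^esub> X = b \<rhd>\<^bsub>MN\<^esub> X \<oplus>\<^bsub>MN\<^esub> b' \<rhd>\<^bsub>MN\<^esub> X"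
    if "b \<in> carrier B" "b' \<in> carrier B" "X \<in> carrier MN" for b b' X
    using that
    by (intro tens_ext[where X = X and P = MN and F = "\<lambda>X. (b \<oplus>\<^bsub>B\<^esub> b') \<rhd>\<^bsub>MN\<^esub> X" and F' = "\<lambda>X. b \<rhd>\<^bsub>MN\<^esub> X \<oplus>\<^bsub>MN\<^esub> b' \<rhd>\<^bsub>MN\<^esub> X"] abelian_MN
        add_map_add_maps add_maps_MN)
      (auto simp: lact_pt M.lact_add_l pt_add_l)
  show "X \<lhd>\<^bsub>MN\<^esub> (b \<oplus>\<^bsub>B\<^esub> b') = X \<lhd>\<^bsub>MN\<^esub> b \<oplus>\<^bsub>MN\<^esub> X \<lhd>\<^bsub>MN\<^esub> b'"
    if "b \<in> carrier B" "b' \<in> carrier B" "X \<in> carrier MN" for b b' X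
    using that
    by (intro tens_ext[where X = X and P = MN and F = "\<lambda>X. X \<lhd>\<^bsub>MN\<^esub> (b \<oplus>\<^bsub>B\<^esub> b')" and F' = "\<lambda>X. X \<lhd>\<^bsub>MN\<^esub> b \<oplus>\<^bsub>MN\<^esub> X \<lhd>\<^bsub>MN\<^esub> b'"] abelian_MN
        add_map_add_maps add_maps_MN)
      (auto simp: ract_pt N.ract_add_r pt_add_r)
  show "(b \<otimes>\<^bsub>B\<^esub> b') \<rhd>\<^bsub>MN\<^esub> X = b \<rhd>\<^bsub>MN\<^esub> (b' \<rhd>\<^bsub>MN\<^esub> X)"
    if "b \<in> carrier B" "b' \<in> carrier B" "X \<in> carrier MN" for b b' X
    using that
    by (intro tens_ext[where X = X and P = MN and F = "\<lambda>X. (b \<otimes>\<^bsub>B\<^esub> b') \<rhd>\<^bsub>MN\<^esub> X" and F' = "\<lambda>X. b \<rhd>\<^bsub>MN\<^esub> (b' \<rhd>\<^bsub>MN\<^esub> X)"] abelian_MN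
        add_map_comp[OF add_map_lact add_map_lact] add_maps_MN)
      (auto simp: lact_pt M.lact_assoc)
  show "X \<lhd>\<^bsub>MN\<^esub> (b \<otimes>\<^bsub>B\<^esub> b') = (X \<lhd>\<^bsub>MN\<^esub> b) \<lhd>\<^bsub>MN\<^esub> b'"
    if "b \<in> carrier B" "b' \<in> carrier B" "X \<in> carrier MN" for b b' X
    using that
    by (intro tens_ext[where X = X and P = MN and F = "\<lambda>X. X \<lhd>\<^bsub>MN\<^esub> (b \<otimes>\<^bsub>B\<^esub> b')" and F' = "\<lambda>X. (X \<lhd>\<^bsub>MN\<^esub> b) \<lhd>\<^bsub>MN\<^esub> b'"] abelian_MN
        add_map_comp[OF add_map_ract add_map_ract] add_maps_MN)
      (auto simp: ract_pt N.ract_assoc)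
  show "(b \<rhd>\<^bsub>MN\<^esub> X) \<lhd>\<^bsub>MN\<^esub> b' = b \<rhd>\<^bsub>MN\<^esub> (X \<lhd>\<^bsub>MN\<^esub> b')"
    if "b \<in> carrier B" "b' \<in> carrier B" "X \<in> carrier MN" for b b' X
    using that
    by (intro tens_ext[where X = X and P = MN and F = "\<lambda>X. (b \<rhd>\<^bsub>MN\<^esub> X) \<lhd>\<^bsub>MN\<^esub> b'" and F' = "\<lambda>X. b \<rhd>\<^bsub>MN\<^esub> (X \<lhd>\<^bsub>MN\<^esub> b')"] abelian_MN
        add_map_comp[OF add_map_lact add_map_ract] add_map_comp[OF add_map_ract add_map_lact])
      (auto simp: ract_pt lact_pt)
  show "\<one>\<^bsub>B\<^esub> \<rhd>\<^bsub>MN\<^esub> X = X" if "X \<in> carrier MN" for X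
    by (rule ext[OF add_map_lact add_map_ident _ that]) (simp_all add: lact_pt)
  show "X \<lhd>\<^bsub>MN\<^esub> \<one>\<^bsub>B\<^esub> = X" if "X \<in> carrier MN" for X
    by (rule ext[OF add_map_ract add_map_ident _ that]) (simp_all add: ract_pt)
  show "c \<odot>\<^bsub>MN\<^esub> X = (c \<odot>\<^bsub>B\<^esub> \<one>\<^bsub>B\<^esub>) \<rhd>\<^bsub>MN\<^esub> X" if "X \<in> carrier MN" for X c
    by (rule ext[OF add_map_smult add_map_lact _ that]) (simp_all add: smult_pt lact_pt M.smult_lact)
  show "X \<lhd>\<^bsub>MN\<^esub> (c \<odot>\<^bsub>B\<^esub> \<one>\<^bsub>B\<^esub>) = (c \<odot>\<^bsub>B\<^esub> \<one>\<^bsub>B\<^esub>) \<rhd>\<^bsub>MN\<^esub> X" if "X \<in> carrier MN" for X c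
    by (rule ext[OF add_map_ract add_map_lact _ that])
      (simp_all add: ract_pt lact_pt N.ract_sc flip: pt_bal M.ract_sc)
qed

end

section \<open>Quotients and generated submodules\<close>

locale lquot = M: lmod B M for B :: "(complex, 'b) module" and M :: "('b, 'm) bimod" +
  fixes W :: "'m set"
  assumes W: "left_submodule B M W"
begin

abbreviation "Q \<equiv> bimod_quot M W"

definition qc where "qc x = W +>\<^bsub>M\<^esub> x"

lemma abelian_subgroup_W: "abelian_subgroup W M"
proof (rule abelian_subgroupI3[OF additive_subgroupI])
  show "subgroup W (add_monoid M)"
    using W by (intro M.M.add.subgroupI) (auto simp: left_submodule_def)
qed (rule M.M.abelian_group_axioms)

sublocale WM: abelian_subgroup W M by (rule abelian_subgroup_W)

lemma W_lact: "b \<in> carrier B \<Longrightarrow> x \<in> W \<Longrightarrow> b \<rhd>\<^bsub>M\<^esub> x \<in> W"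
  using W by (auto simp: left_submodule_def)

lemma W_smult: "x \<in> W \<Longrightarrow> c \<odot>\<^bsub>M\<^esub> x \<in> W"
  using W by (auto simp: left_submodule_def)

lemma carrier_Q: "carrier Q = qc ` carrier M"
  by (auto simp: bimod_quot_def A_RCOSETS_def' qc_def)

lemma qc_closed [simp, intro]: "x \<in> carrier M \<Longrightarrow> qc x \<in> carrier Q"
  by (simp add: carrier_Q)

lemma add_Q: "x \<in> carrier M \<Longrightarrow> y \<in> carrier M \<Longrightarrow> qc x \<oplus>\<^bsub>Q\<^esub> qc y = qc (x \<oplus>\<^bsub>M\<^esub> y)"
  using WM.a_rcos_sum by (simp add: bimod_quot_def qc_def)

lemma zero_Q: "\<zero>\<^bsub>Q\<^esub> = qc \<zero>\<^bsub>M\<^esub>"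
  by (simp add: bimod_quot_def qc_def WM.a_subset)

lemma abelian_Q: "abelian_group Q"
proof (rule abelian_groupI)
  show "x \<oplus>\<^bsub>Q\<^esub> y \<in> carrier Q" if "x \<in> carrier Q" "y \<in> carrier Q" for x y
    using that unfolding carrier_Q by (elim imageE) (simp add: add_Q)
  show "\<zero>\<^bsub>Q\<^esub> \<in> carrier Q" unfolding carrier_Q by (simp add: zero_Q)
  show "x \<oplus>\<^bsub>Q\<^esub> y \<oplus>\<^bsub>Q\<^esub> z = x \<oplus>\<^bsub>Q\<^esub> (y \<oplus>\<^bsub>Q\<^esub> z)" if "x \<in> carrier Q" "y \<in> carrier Q" "z \<in> carrier Q" for x y z
    using that unfolding carrier_Q by (elim imageE) (simp add: add_Q M.M.a_assoc)
  show "x \<oplus>\<^bsub>Q\<^esub> y = y \<oplus>\<^bsub>Q\<^esub> x" if "x \<in> carrier Q" "y \<in> carrier Q" for x y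
    using that unfolding carrier_Q by (elim imageE) (simp add: add_Q M.M.a_comm)
  show "\<zero>\<^bsub>Q\<^esub> \<oplus>\<^bsub>Q\<^esub> x = x" if "x \<in> carrier Q" for x
    using that unfolding carrier_Q by (elim imageE) (simp add: add_Q zero_Q)
  show "\<exists>y\<in>carrier Q. y \<oplus>\<^bsub>Q\<^esub> x = \<zero>\<^bsub>Q\<^esub>" if x: "x \<in> carrier Q" for x
  proof -
    obtain y where "y \<in> carrier M" "x = qc y" using x by (auto simp: carrier_Q)
    then show ?thesis
      by (intro bexI[of _ "qc (\<ominus>\<^bsub>M\<^esub> y)"]) (simp_all add: add_Q zero_Q M.M.l_neg)
  qed
qed

sublocale Q: abelian_group Q by (rule abelian_Q)

lemma qc_self: "x \<in> carrier M \<Longrightarrow> x \<in> qc x"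
  unfolding qc_def by (rule WM.a_rcos_self)

lemma qc_rep: "x \<in> carrier M \<Longrightarrow> y \<in> qc x \<Longrightarrow> \<exists>h\<in>W. y = h \<oplus>\<^bsub>M\<^esub> x"
  by (auto simp: qc_def a_r_coset_def')

lemma qc_W: "h \<in> W \<Longrightarrow> x \<in> carrier M \<Longrightarrow> qc (h \<oplus>\<^bsub>M\<^esub> x) = qc x"
  unfolding qc_def
  by (rule M.M.a_repr_independence[symmetric]) (auto simp: a_r_coset_def' WM.a_subgroup)

lemma qc_zero_W: "h \<in> W \<Longrightarrow> qc h = \<zero>\<^bsub>Q\<^esub>"
  using qc_W[of h "\<zero>\<^bsub>M\<^esub>"] by (simp add: zero_Q WM.a_Hcarr)

text \<open>
  The operations of a quotient module are unions over representatives; this evaluates such a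
  union on a coset.
\<close>

lemma qc_UN:
  assumes "x \<in> carrier M" "\<And>y. y \<in> carrier M \<Longrightarrow> f y \<in> carrier M"
    "\<And>h y. h \<in> W \<Longrightarrow> y \<in> carrier M \<Longrightarrow> f (h \<oplus>\<^bsub>M\<^esub> y) = f h \<oplus>\<^bsub>M\<^esub> f y" "\<And>h. h \<in> W \<Longrightarrow> f h \<in> W"
  shows "(\<Union>y\<in>qc x. W +>\<^bsub>M\<^esub> f y) = qc (f x)"
proof -
  have "qc (f y) = qc (f x)" if y: "y \<in> qc x" for y
  proof -
    obtain h where h: "h \<in> W" "y = h \<oplus>\<^bsub>M\<^esub> x" using qc_rep[OF assms(1) y] by blast
    show ?thesis unfolding h(2) assms(3)[OF h(1) assms(1)]
      by (rule qc_W[OF assms(4)[OF h(1)] assms(2)[OF assms(1)]])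
  qed
  then have "(\<Union>y\<in>qc x. qc (f y)) = (\<Union>y\<in>qc x. qc (f x))" by simp
  also have "\<dots> = qc (f x)" using qc_self[OF assms(1)] by blast
  finally show ?thesis unfolding qc_def .
qed

lemma lact_Q: "b \<in> carrier B \<Longrightarrow> x \<in> carrier M \<Longrightarrow> b \<rhd>\<^bsub>Q\<^esub> qc x = qc (b \<rhd>\<^bsub>M\<^esub> x)"
  using qc_UN[where x = x and f = "\<lambda>x. b \<rhd>\<^bsub>M\<^esub> x", OF _ M.lact_closed M.lact_add_r W_lact]
  by (simp add: bimod_quot_def WM.a_Hcarr)

lemma smult_Q: "x \<in> carrier M \<Longrightarrow> c \<odot>\<^bsub>Q\<^esub> qc x = qc (c \<odot>\<^bsub>M\<^esub> x)"
  using qc_UN[where x = x and f = "\<lambda>x. c \<odot>\<^bsub>M\<^esub> x", OF _ M.M.smult_closed M.M.smult_r_distr W_smult]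
  by (simp add: bimod_quot_def WM.a_Hcarr)

lemma lmod_Q: "lmod B Q"
  by unfold_locales
    (unfold carrier_Q, (elim imageE, simp add: lact_Q smult_Q add_Q M.lact_add_r M.lact_add_l M.lact_assoc M.smult_lact)+)

end

locale bquot = M: bimd B M for B :: "(complex, 'b) module" and M :: "('b, 'm) bimod" +
  fixes W :: "'m set"
  assumes bW: "sub_bimodule B M W"
begin

sublocale lquot B M W
  using bW by unfold_locales (simp add: sub_bimodule_def)

lemma W_ract: "b \<in> carrier B \<Longrightarrow> x \<in> W \<Longrightarrow> x \<lhd>\<^bsub>M\<^esub> b \<in> W"
  using bW by (auto simp: sub_bimodule_def)

lemma ract_Q: "b \<in> carrier B \<Longrightarrow> x \<in> carrier M \<Longrightarrow> qc x \<lhd>\<^bsub>Q\<^esub> b = qc (x \<lhd>\<^bsub>M\<^esub> b)"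
  using qc_UN[where x = x and f = "\<lambda>x. x \<lhd>\<^bsub>M\<^esub> b", OF _ M.ract_closed M.ract_add_l W_ract]
  by (simp add: bimod_quot_def WM.a_Hcarr)

lemma bimd_Q: "bimd B Q"
proof -
  interpret Q: lmod B Q by (rule lmod_Q)
  show ?thesis
    by unfold_locales
      (unfold carrier_Q, (elim imageE, simp add: lact_Q ract_Q add_Q M.ract_add_r M.ract_add_l M.ract_assoc M.ract_sc M.lact_ract)+)
qed

end

text \<open>
  A span is an intersection of submodules, so it is itself one of them.
\<close>

lemma (in lmod) left_submodule_span:
  assumes "X \<subseteq> carrier M"
  shows "left_submodule B M (left_span B M X)" "X \<subseteq> left_span B M X"
proof -
  have c: "left_submodule B M (carrier M)" unfolding left_submodule_def by simp
  have sub: "left_span B M X \<subseteq> carrier M" unfolding left_span_def using c assms by blast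
  show "left_submodule B M (left_span B M X)"
    unfolding left_submodule_def using sub
    by (intro conjI ballI allI) (auto simp: left_span_def left_submodule_def)
  show "X \<subseteq> left_span B M X" unfolding left_span_def by blast
qed

lemma (in bimd) sub_bimodule_span:
  assumes "X \<subseteq> carrier M"
  shows "sub_bimodule B M (bimod_span B M X)" "X \<subseteq> bimod_span B M X"
proof -
  have c: "sub_bimodule B M (carrier M)" unfolding sub_bimodule_def left_submodule_def by simp
  have sub: "bimod_span B M X \<subseteq> carrier M" unfolding bimod_span_def using c assms by blast
  show "sub_bimodule B M (bimod_span B M X)"
    unfolding sub_bimodule_def left_submodule_def using sub
    by (intro conjI ballI allI) (auto simp: bimod_span_def sub_bimodule_def left_submodule_def)
  show "X \<subseteq> bimod_span B M X" unfolding bimod_span_def by blast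
qed

section \<open>The vector representation as a chain\<close>

lemma qpow_add: "0 < q \<Longrightarrow> qpow q (x + y) = qpow q x * qpow q y"
  by (simp add: qpow_def powr_add)

lemma qpow_0 [simp]: "0 < q \<Longrightarrow> qpow q 0 = 1"
  by (simp add: qpow_def)

lemma qpow_nonzero [simp]: "0 < q \<Longrightarrow> qpow q x \<noteq> 0"
  by (simp add: qpow_def)

lemma qpow_minus: "0 < q \<Longrightarrow> qpow q (- x) = inverse (qpow q x)"
  by (simp add: qpow_def powr_minus)

lemma qpow_nat: "0 < q \<Longrightarrow> qpow q (real n) = qpow q 1 ^ n"
  by (simp add: qpow_def powr_realpow)

lemma qpow_inj: "0 < q \<Longrightarrow> q < 1 \<Longrightarrow> qpow q x = qpow q y \<longleftrightarrow> x = y"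
  by (simp add: qpow_def powr_inj)

lemma qpow_square_neq_1: "0 < q \<Longrightarrow> q < 1 \<Longrightarrow> qpow q 1 - qpow q (- 1) \<noteq> 0"
  by (simp add: qpow_inj)

lemma wform_simple_root:
  assumes "i \<in> {1..r}"
  shows "wform r (simple_root i) \<mu> = \<mu> i - \<mu> (i + 1)"
proof -
  have "wform r (simple_root i) \<mu> = (\<Sum>k = 1..r + 1. (if k = i then \<mu> k else 0) - (if k = i + 1 then \<mu> k else 0))"
    unfolding wform_def simple_root_def by (intro sum.cong) auto
  also have "\<dots> = \<mu> i - \<mu> (i + 1)" using assms by (simp add: sum_subtractf)
  finally show ?thesis .
qed

definition cartan :: "nat \<Rightarrow> nat \<Rightarrow> real" where
  "cartan i j = (if i = j then 2 else if i = j + 1 \<or> j = i + 1 then - 1 else 0)"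

lemma wform_simple_roots: "i \<in> {1..r} \<Longrightarrow> wform r (simple_root i) (simple_root j) = cartan i j"
  by (subst wform_simple_root) (auto simp: simple_root_def cartan_def)

text \<open>
  The pairing of the \<open>j\<close>-th simple root with the weight of the \<open>k\<close>-th vector of the
  vector representation.
\<close>

definition chain_exp :: "nat \<Rightarrow> nat \<Rightarrow> real" where
  "chain_exp j k = (if k = j then 1 else if k = j + 1 then - 1 else 0)"

text \<open>
  The vector representation in a weight basis.  Basis vectors are numbered by \<open>pos\<close> in the order
  in which the lowering operators run through them, and the \<open>j\<close>-th step uses the node \<open>nd j\<close>.
  The basis vectors of a given weight basis are determined only up to a factor, which is
  why the lowering coefficients \<open>f j\<close> are arbitrary; the raising coefficients are then
  forced by the commutator of \<open>E\<close> and \<open>F\<close>.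
\<close>

definition chain_rep :: "nat \<Rightarrow> real \<Rightarrow> ('n::finite) uq_rep \<Rightarrow> (nat \<Rightarrow> nat) \<Rightarrow> ('n \<Rightarrow> nat) \<Rightarrow> (nat \<Rightarrow> complex) \<Rightarrow> bool" where
  "chain_rep r q X nd pos f \<longleftrightarrow> bij_betw pos UNIV {1..r + 1} \<and> bij_betw nd {1..r} {1..r} \<and>
     (\<forall>j\<in>{1..r}. f j \<noteq> 0 \<and> (\<forall>a b.
        Kact X (nd j) $ a $ b = (if a = b then qpow q (chain_exp j (pos a)) else 0) \<and>
        Kinv X (nd j) $ a $ b = (if a = b then qpow q (- chain_exp j (pos a)) else 0) \<and>
        Eact X (nd j) $ a $ b = (if pos a = j \<and> pos b = j + 1 then 1 / f j else 0) \<and>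
        Fact X (nd j) $ a $ b = (if pos a = j + 1 \<and> pos b = j then f j else 0)))"

text \<open>
  The weights of a chain are pairwise distinct.
\<close>

lemma chain_exp_inj:
  assumes "k \<in> {1..r+1}" "k' \<in> {1..r+1}" "\<And>j. j \<in> {1..r} \<Longrightarrow> chain_exp j k = chain_exp j k'"
  shows "k = k'"
proof (rule ccontr)
  assume "k \<noteq> k'"
  then consider "k < k'" | "k' < k" by linarith
  then show False
  proof cases
    case 1 then show False using assms(1,2) assms(3)[of k] by (auto simp: chain_exp_def split: if_splits)
  next
    case 2 then show False using assms(1,2) assms(3)[of k'] by (auto simp: chain_exp_def split: if_splits)
  qed
qed

text \<open>
  Two weights of a chain differ by a simple root only if they are neighbours, so the weights
  alone determine where \<open>E\<close> and \<open>F\<close> can have entries.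
\<close>

lemma chain_exp_root:
  assumes j: "j \<in> {1..r}" and a: "a \<in> {1..r+1}" and b: "b \<in> {1..r+1}"
    and eq: "\<And>l. l \<in> {1..r} \<Longrightarrow> chain_exp l a = chain_exp l b - cartan l j"
  shows "b = j \<and> a = j + 1"
proof -
  define g where "g l = (if l = a then 1 else 0) - (if l = b then 1 else 0)
     + (if l = j then 1 else 0) - (if l = j + 1 then 1 else (0::real))" for l
  have step: "g l = g (Suc l)" if "l \<in> {1..r}" for l
    using eq[OF that] unfolding g_def chain_exp_def cartan_def Suc_eq_plus1
    by (cases "l = a"; cases "l + 1 = a"; cases "l = b"; cases "l + 1 = b"; simp split: if_splits; linarith)
  have const: "g (Suc l) = g 1" if "l \<le> r" for l
    using that
  proof (induction l)
    case (Suc l) then show ?case using step[of "Suc l"] by simp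
  qed simp
  have "(\<Sum>l\<in>{1..r+1}. g l) = 0"
    using a b j by (simp add: g_def sum.distrib sum_subtractf)
  moreover have "(\<Sum>l\<in>{1..r+1}. g l) = (\<Sum>l\<in>{1..r+1}. g 1)"
    by (intro sum.cong refl) (metis const One_nat_def Suc_eq_plus1 Suc_le_mono atLeastAtMost_iff not0_implies_Suc not_one_le_zero)
  ultimately have "g 1 = 0" by simp
  then have g0: "g l = 0" if "l \<in> {1..r+1}" for l
    using const[of "l - 1"] that by auto
  show ?thesis using g0[of j] g0[of "j + 1"] g0[of a] j a b by (auto simp: g_def split: if_splits)
qed

lemma matrix_mult_entry: "(A ** B) $ a $ b = (\<Sum>c\<in>UNIV. A $ a $ c * B $ c $ b)"
  by (simp add: matrix_matrix_mult_def)

lemma mat_mult_entry: "(mat c ** (A :: complex ^ 'n ^ 'n)) $ a $ b = c * A $ a $ b"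
  by (simp add: matrix_mult_entry mat_def if_distrib[of "\<lambda>x. x * _"] cong: if_cong)

lemma mat_vec: "(mat c :: complex ^ 'n ^ 'n) *v x = c *s x"
  by (simp add: vec_eq_iff matrix_vector_mult_def mat_def if_distrib[of "\<lambda>x. x * _"] cong: if_cong)

lemma mv_axis: "((A :: complex ^ 'n ^ 'm) *v axis b 1) $ a = A $ a $ b"
  by (simp add: matrix_vector_mult_def axis_def if_distrib[of "\<lambda>x. _ * x"] cong: if_cong)

lemma diag_vec_entry: 
  assumes "\<And>a b. K $ a $ b = (if a = b then k a else 0)"
  shows "(K *v x) $ a = k a * (x $ a :: complex)"
  using assms by (simp add: matrix_vector_mult_def if_distrib[of "\<lambda>x. x * _"] cong: if_cong)

lemma diag_mult_l:
  assumes "\<And>a b. K $ a $ b = (if a = b then k a else 0)"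
  shows "(K ** (A :: complex ^ 'n ^ 'n)) $ a $ b = k a * A $ a $ b"
  using assms by (simp add: matrix_mult_entry if_distrib[of "\<lambda>x. x * _"] cong: if_cong)

lemma diag_mult_r:
  assumes "\<And>a b. K $ a $ b = (if a = b then k a else 0)"
  shows "((A :: complex ^ 'n ^ 'n) ** K) $ a $ b = A $ a $ b * k b"
  using assms by (simp add: matrix_mult_entry if_distrib[of "\<lambda>x. _ * x"] cong: if_cong)

text \<open>
  For the last fundamental weight, the chain meets the nodes of the Dynkin diagram in reverse order.
\<close>

definition node_order :: "'n qdata \<Rightarrow> nat \<Rightarrow> nat" where
  "node_order D j = (if node D = 1 then j else rank D + 1 - j)"

lemma bij_node_order: "bij_betw (node_order D) {1..rank D} {1..rank D}"
proof (cases "node D = 1")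
  case True then show ?thesis by (auto simp: node_order_def bij_betw_def inj_on_def)
next
  case False
  then show ?thesis
    by (intro bij_betwI[where g = "\<lambda>j. rank D + 1 - j"]) (auto simp: node_order_def)
qed

lemma cartan_node_order:
  "i \<in> {1..rank D} \<Longrightarrow> j \<in> {1..rank D} \<Longrightarrow> cartan (node_order D i) (node_order D j) = cartan i j"
proof (cases "node D = 1")
  case False
  assume "i \<in> {1..rank D}" "j \<in> {1..rank D}"
  then have "rank D + 1 - i = rank D + 1 - j \<longleftrightarrow> i = j" "rank D + 1 - i = rank D + 1 - j + 1 \<longleftrightarrow> j = i + 1"
    "rank D + 1 - j = rank D + 1 - i + 1 \<longleftrightarrow> i = j + 1" by auto
  with False show ?thesis unfolding node_order_def cartan_def by simp
qed (simp add: node_order_def)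

text \<open>
  Starting at a highest weight vector, apply the lowering operators one after the other.  No
  vector obtained in this way vanishes, since applying \<open>E\<close> recovers the previous
  one.  Their weights are distinct and there are as many of them as basis vectors, so
  every basis vector is a multiple of one of them; weights then leave no room for other entries of \<open>E\<close>
  and \<open>F\<close>.
\<close>

theorem quantum_data_chain:
  fixes D :: "('n::finite) qdata"
  assumes D: "quantum_data D"
  shows "\<exists>pos f. chain_rep (rank D) (qpar D) (Vmod D) (node_order D) pos f \<and>
     (\<forall>i. \<forall>j\<in>{1..rank D}. wform (rank D) (simple_root (node_order D j)) (wts D i) = chain_exp j (pos i))"
proof -
  define r q X nd where "r = rank D" and "q = qpar D" and "X = Vmod D" and "nd = node_order D"
  have r: "r \<ge> 1" and s: "node D = 1 \<or> node D = r" and q: "0 < q" "q < 1" and card: "CARD('n) = r + 1"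
    and rep: "is_uq_rep r q X" and "\<exists>v. highest_weight_vector r q X (omega_s D) v"
    and wv: "\<And>i. weight_vector r q X (wts D i) (axis i 1)"
    using D by (auto simp: quantum_data_def is_simple_highest_weight_rep_def r_def q_def X_def)
  then obtain v where hv: "highest_weight_vector r q X (omega_s D) v" by blast
  have nd_in: "nd j \<in> {1..r}" if "j \<in> {1..r}" for j
    using that bij_node_order[of D] by (auto simp: bij_betw_def nd_def r_def)
  have nd_inj: "nd i = nd j \<longleftrightarrow> i = j" if "i \<in> {1..r}" "j \<in> {1..r}" for i j
    using that bij_node_order[of D] unfolding nd_def r_def by (meson bij_betw_imp_inj_on inj_on_eq_iff)
  have cart: "wform r (simple_root (nd i)) (simple_root (nd j)) = cartan i j"
    if "i \<in> {1..r}" "j \<in> {1..r}" for i j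
    using that nd_in cartan_node_order[of i D j] by (simp add: wform_simple_roots nd_def r_def)
  have R: "Kact X (nd i) ** Kinv X (nd i) = mat 1" "Kinv X (nd i) ** Kact X (nd i) = mat 1"
    "Kact X (nd i) ** Eact X (nd j) ** Kinv X (nd i) = mat (qpow q (cartan i j)) ** Eact X (nd j)"
    "Kact X (nd i) ** Fact X (nd j) ** Kinv X (nd i) = mat (qpow q (- cartan i j)) ** Fact X (nd j)"
    "Eact X (nd i) ** Fact X (nd j) - Fact X (nd j) ** Eact X (nd i) =
       (if i = j then mat (1 / (qpow q 1 - qpow q (- 1))) ** (Kact X (nd i) - Kinv X (nd i)) else 0)"
    if "i \<in> {1..r}" "j \<in> {1..r}" for i j
    using rep nd_in[OF that(1)] nd_in[OF that(2)] cart[OF that] nd_inj[OF that]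
    unfolding is_uq_rep_def Let_def by metis+
  define lam where "lam j i = wform r (simple_root (nd j)) (wts D i)" for j i
  have K: "Kact X (nd j) $ a $ b = (if a = b then qpow q (lam j a) else 0)" if j: "j \<in> {1..r}" for j a b
  proof -
    have "Kact X (nd j) *v axis b 1 = qpow q (lam j b) *s axis b 1"
      using wv[of b] nd_in[OF j] by (simp add: weight_vector_def lam_def)
    then have "(Kact X (nd j) *v axis b 1) $ a = (qpow q (lam j b) *s axis b 1) $ a" by simp
    then show ?thesis by (simp add: mv_axis) (simp add: axis_def)
  qed
  have Ki: "Kinv X (nd j) $ a $ b = (if a = b then qpow q (- lam j a) else 0)" if j: "j \<in> {1..r}" for j a b
  proof -
    have "(Kact X (nd j) ** Kinv X (nd j)) $ a $ b = (mat 1 :: complex ^ 'n ^ 'n) $ a $ b" using R(1)[OF j j] by simp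
    then have "qpow q (lam j a) * Kinv X (nd j) $ a $ b = (if a = b then 1 else 0)"
      by (simp add: diag_mult_l[OF K[OF j]]) (simp add: mat_def)
    then show ?thesis using q by (auto simp: qpow_minus field_simps split: if_splits)
  qed
  have KF: "qpow q (lam l a - lam l b) * Fact X (nd j) $ a $ b = qpow q (- cartan l j) * Fact X (nd j) $ a $ b"
    if "l \<in> {1..r}" "j \<in> {1..r}" for l j a b
  proof -
    have "(Kact X (nd l) ** Fact X (nd j) ** Kinv X (nd l)) $ a $ b = (mat (qpow q (- cartan l j)) ** Fact X (nd j)) $ a $ b"
      using R(4)[OF that] by simp
    then show ?thesis using q(1)
      by (simp add: diag_mult_r[OF Ki[OF that(1)]] diag_mult_l[OF K[OF that(1)]] mat_mult_entry
          diff_conv_add_uminus qpow_add mult_ac del: add_uminus_conv_diff)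
  qed
  have KE: "qpow q (lam l a - lam l b) * Eact X (nd j) $ a $ b = qpow q (cartan l j) * Eact X (nd j) $ a $ b"
    if "l \<in> {1..r}" "j \<in> {1..r}" for l j a b
  proof -
    have "(Kact X (nd l) ** Eact X (nd j) ** Kinv X (nd l)) $ a $ b = (mat (qpow q (cartan l j)) ** Eact X (nd j)) $ a $ b"
      using R(3)[OF that] by simp
    then show ?thesis using q(1)
      by (simp add: diag_mult_r[OF Ki[OF that(1)]] diag_mult_l[OF K[OF that(1)]] mat_mult_entry
          diff_conv_add_uminus qpow_add mult_ac del: add_uminus_conv_diff)
  qed
  \<comment> \<open>The chain of lowered vectors; its weights are computed first.\<close>
  define x where "x k = rec_nat v (\<lambda>k y. Fact X (nd (Suc k)) *v y) k" for k
  have x0: "x 0 = v" and xSuc: "x (Suc k) = Fact X (nd (Suc k)) *v x k" for k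
    by (simp_all add: x_def)
  have xK: "x k $ a \<noteq> 0 \<longrightarrow> (\<forall>l\<in>{1..r}. lam l a = chain_exp l (Suc k))" if "k \<le> r" for k a
    using that
  proof (induction k arbitrary: a)
    case 0
    show ?case
    proof (intro impI ballI)
      fix l assume a: "x 0 $ a \<noteq> 0" and l: "l \<in> {1..r}"
      have "Kact X (nd l) *v v = qpow q (wform r (simple_root (nd l)) (omega_s D)) *s v"
        using hv nd_in[OF l] by (simp add: highest_weight_vector_def weight_vector_def)
      then have "(Kact X (nd l) *v v) $ a = (qpow q (wform r (simple_root (nd l)) (omega_s D)) *s v) $ a" by simp
      then have "lam l a = wform r (simple_root (nd l)) (omega_s D)"
        using a q by (simp add: diag_vec_entry[OF K[OF l]] x0 qpow_inj)
      also have "\<dots> = (if nd l = node D then 1 else 0)"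
        unfolding omega_s_def r_def[symmetric] using nd_in[OF l] s r
        by (intro simple_root_fund_weight) auto
      also have "\<dots> = chain_exp l (Suc 0)"
      proof -
        have "nd l = node D \<longleftrightarrow> l = 1"
        proof (cases "node D = 1")
          case False
          then have "node D = r" "nd l = r + 1 - l" using s by (simp_all add: nd_def node_order_def r_def)
          then show ?thesis using l r by auto
        qed (simp add: nd_def node_order_def)
        then show ?thesis using l by (simp add: chain_exp_def)
      qed
      finally show "lam l a = chain_exp l (Suc 0)" .
    qed
  next
    case (Suc k)
    show ?case
    proof (intro impI ballI)
      fix l assume a: "x (Suc k) $ a \<noteq> 0" and l: "l \<in> {1..r}"
      have k: "Suc k \<in> {1..r}" using Suc.prems by simp
      obtain b where b: "Fact X (nd (Suc k)) $ a $ b \<noteq> 0" "x k $ b \<noteq> 0"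
      proof -
        have "(\<Sum>b\<in>UNIV. Fact X (nd (Suc k)) $ a $ b * x k $ b) \<noteq> 0"
          using a by (simp add: xSuc matrix_vector_mult_def)
        then show ?thesis using that by (metis (no_types, lifting) mult_eq_0_iff sum.neutral)
      qed
      have "lam l a - lam l b = - cartan l (Suc k)"
        using KF[OF l k, of a b] b(1) q by (simp add: qpow_inj)
      moreover have "lam l b = chain_exp l (Suc k)" using Suc.IH[of b] Suc.prems b(2) l by simp
      ultimately have "lam l a = chain_exp l (Suc k) - cartan l (Suc k)" by simp
      also have "\<dots> = chain_exp l (Suc (Suc k))" by (auto simp: chain_exp_def cartan_def)
      finally show "lam l a = chain_exp l (Suc (Suc k))" .
    qed
  qed
  have Kx: "Kact X (nd l) *v x k = qpow q (chain_exp l (Suc k)) *s x k"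
    "Kinv X (nd l) *v x k = qpow q (- chain_exp l (Suc k)) *s x k" if "k \<le> r" "l \<in> {1..r}" for k l
  proof -
    have *: "x k $ a = 0 \<or> lam l a = chain_exp l (Suc k)" for a using xK[OF that(1), of a] that(2) by blast
    show "Kact X (nd l) *v x k = qpow q (chain_exp l (Suc k)) *s x k"
      "Kinv X (nd l) *v x k = qpow q (- chain_exp l (Suc k)) *s x k"
      unfolding vec_eq_iff diag_vec_entry[OF K[OF that(2)]] diag_vec_entry[OF Ki[OF that(2)]] vector_smult_component
      using * by fastforce+
  qed
  \<comment> \<open>A raising operator that kills one vector of the chain sees the next one through its commutator with the lowering operator, which is 1 on a vector whose weight pairs to 1 with the root.\<close>
  have EF: "Eact X (nd i) *v x (Suc k) = (if i = Suc k then x k else 0)"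
    if "k < r" "i \<in> {1..r}" "Eact X (nd i) *v x k = 0" for i k
  proof -
    have k: "Suc k \<in> {1..r}" using that by simp
    have "Eact X (nd i) *v x (Suc k) = (Eact X (nd i) ** Fact X (nd (Suc k)) - Fact X (nd (Suc k)) ** Eact X (nd i)) *v x k
      + Fact X (nd (Suc k)) *v (Eact X (nd i) *v x k)"
      by (simp add: xSuc matrix_vector_mul_assoc matrix_vector_mult_diff_rdistrib)
    also have "\<dots> = (if i = Suc k then x k else 0)"
    proof (cases "i = Suc k")
      case True
      have "chain_exp i (Suc k) = 1" using True by (simp add: chain_exp_def)
      then have "(mat (1 / (qpow q 1 - qpow q (- 1))) ** (Kact X (nd i) - Kinv X (nd i))) *v x k = x k"
      proof -
        have "(mat (1 / (qpow q 1 - qpow q (- 1))) ** (Kact X (nd i) - Kinv X (nd i))) *v x k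
          = (1 / (qpow q 1 - qpow q (- 1))) *s (qpow q 1 *s x k - qpow q (- 1) *s x k)"
          using Kx[of k i] that(1,2) \<open>chain_exp i (Suc k) = 1\<close>
          by (simp only: matrix_vector_mul_assoc[symmetric] matrix_vector_mult_diff_rdistrib mat_vec less_imp_le_nat)
        also have "\<dots> = x k"
          unfolding vector_sub_rdistrib[symmetric] vector_smult_assoc using qpow_square_neq_1[OF q] by simp
        finally show ?thesis .
      qed
      then show ?thesis using True that R(5)[OF that(2) k] by simp
    qed (use that R(5)[OF that(2) k] in simp)
    finally show ?thesis .
  qed
  have Ex: "Eact X (nd i) *v x k = 0" if "k \<le> r" "i \<in> {1..r}" "k < i" for k i
    using that
  proof (induction k)
    case 0 then show ?case using hv nd_in[of i] by (simp add: highest_weight_vector_def x0)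
  next
    case (Suc k) then show ?case using EF[of k i] by simp
  qed
  have Ex1: "Eact X (nd (Suc k)) *v x (Suc k) = x k" if "k < r" for k
    using EF[of k "Suc k"] Ex[of k "Suc k"] that by simp
  have xn: "x k \<noteq> 0" if "k \<le> r" for k
    using that
  proof (induction k)
    case 0 then show ?case using hv by (simp add: highest_weight_vector_def weight_vector_def x0)
  next
    case (Suc k) then show ?case using Ex1[of k] by auto
  qed
  \<comment> \<open>An index in the support of the vector number k; it is unique because weights in the chain are distinct.\<close>
  define g where "g k = (SOME i. x (k - 1) $ i \<noteq> 0)" for k
  have g: "x (k - 1) $ g k \<noteq> 0" if "k \<in> {1..r+1}" for k
  proof -
    have "\<exists>i. x (k - 1) $ i \<noteq> 0" using xn[of "k - 1"] that by (auto simp: vec_eq_iff)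
    then show ?thesis unfolding g_def by (rule someI_ex)
  qed
  have lamg: "lam l (g k) = chain_exp l k" if "k \<in> {1..r+1}" "l \<in> {1..r}" for k l
    using xK[of "k - 1" "g k"] g[OF that(1)] that by auto
  have g_inj: "inj_on g {1..r+1}"
  proof (rule inj_onI)
    fix k k' assume *: "k \<in> {1..r+1}" "k' \<in> {1..r+1}" "g k = g k'"
    then show "k = k'" using lamg by (intro chain_exp_inj[of k r k']) (auto, metis lamg * atLeastAtMost_iff Suc_eq_plus1)
  qed
  have g_bij: "bij_betw g {1..r+1} UNIV"
  proof -
    have "card (g ` {1..r+1}) = CARD('n)" using card_image[OF g_inj] card by simp
    then have "g ` {1..r+1} = UNIV" by (intro card_subset_eq) auto
    then show ?thesis using g_inj by (simp add: bij_betw_def)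
  qed
  define pos where "pos = the_inv_into {1..r+1} g"
  have pos_bij: "bij_betw pos UNIV {1..r+1}" unfolding pos_def by (rule bij_betw_the_inv_into[OF g_bij])
  have pos_g: "pos (g k) = k" if "k \<in> {1..r+1}" for k
    unfolding pos_def using that g_inj by (simp add: the_inv_into_f_f)
  have g_pos: "g (pos i) = i" for i
    unfolding pos_def using g_bij by (simp add: f_the_inv_into_f bij_betw_def)
  have pos_in: "pos i \<in> {1..r+1}" for i using pos_bij by (auto simp: bij_betw_def)
  have lam: "lam l i = chain_exp l (pos i)" if "l \<in> {1..r}" for l i
    using lamg[OF pos_in that, of i] g_pos by simp
  have x_supp: "x k $ i = (if i = g (Suc k) then x k $ g (Suc k) else 0)" if "k \<le> r" for k i
  proof (cases "x k $ i = 0")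
    case False
    then have "\<forall>l\<in>{1..r}. lam l i = chain_exp l (Suc k)"
      using xK[OF \<open>k \<le> r\<close>, of i] by blast
    then have "chain_exp l (pos i) = chain_exp l (Suc k)" if "l \<in> {1..r}" for l
      using lam[OF that, of i] that by metis
    then have "pos i = Suc k" using pos_in that by (intro chain_exp_inj) auto
    then show ?thesis using g_pos[of i] by auto
  qed (use g[of "Suc k"] that in auto)
  define c where "c k = x (k - 1) $ g k" for k
  have c: "c k \<noteq> 0" if "k \<in> {1..r+1}" for k using g[OF that] by (simp add: c_def)
  have Fsupp: "pos b = j \<and> pos a = j + 1" if "j \<in> {1..r}" "Fact X (nd j) $ a $ b \<noteq> 0" for j a b
  proof (rule chain_exp_root[OF that(1) pos_in pos_in])
    fix l assume l: "l \<in> {1..r}"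
    have "lam l a - lam l b = - cartan l j"
      using KF[OF l that(1), of a b] that(2) q by (simp add: qpow_inj)
    then show "chain_exp l (pos a) = chain_exp l (pos b) - cartan l j" by (simp add: lam[OF l])
  qed
  have Esupp: "pos a = j \<and> pos b = j + 1" if "j \<in> {1..r}" "Eact X (nd j) $ a $ b \<noteq> 0" for j a b
  proof (rule chain_exp_root[OF that(1) pos_in pos_in])
    fix l assume l: "l \<in> {1..r}"
    have "lam l a - lam l b = cartan l j"
      using KE[OF l that(1), of a b] that(2) q by (simp add: qpow_inj)
    then show "chain_exp l (pos b) = chain_exp l (pos a) - cartan l j" by (simp add: lam[OF l])
  qed
  \<comment> \<open>The lowering operator maps one chain vector to the next exactly; dividing by their coordinates gives its matrix entry.\<close>
  define f where "f j = c (j + 1) / c j" for j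
  have pos_iff: "pos i = k \<longleftrightarrow> i = g k" if "k \<in> {1..r+1}" for i k
    using pos_g[OF that] g_pos[of i] by auto
  have F: "Fact X (nd j) $ a $ b = (if pos a = j + 1 \<and> pos b = j then f j else 0)" if j: "j \<in> {1..r}" for j a b
  proof (cases "pos a = j + 1 \<and> pos b = j")
    case True
    then have ab: "a = g (j + 1)" "b = g j" using pos_iff j by auto
    have "x (Suc (j - 1)) $ a = (Fact X (nd (Suc (j - 1))) *v x (j - 1)) $ a" by (simp add: xSuc)
    then have "c (j + 1) = (\<Sum>i\<in>UNIV. Fact X (nd j) $ a $ i * x (j - 1) $ i)"
      using j by (simp add: matrix_vector_mult_def c_def ab)
    also have "\<dots> = Fact X (nd j) $ a $ b * c j"
      using j x_supp[of "j - 1"]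
      by (subst x_supp) (auto simp: c_def ab if_distrib[of "\<lambda>x. _ * x"] cong: if_cong)
    finally show ?thesis using True c[of j] j by (simp add: f_def)
  qed (use Fsupp[OF j, of a b] in auto)
  have E: "Eact X (nd j) $ a $ b = (if pos a = j \<and> pos b = j + 1 then 1 / f j else 0)" if j: "j \<in> {1..r}" for j a b
  proof (cases "pos a = j \<and> pos b = j + 1")
    case True
    then have ab: "a = g j" "b = g (j + 1)" using pos_iff j by auto
    have "x (j - 1) $ a = (Eact X (nd (Suc (j - 1))) *v x (Suc (j - 1))) $ a" using j by (subst Ex1) auto
    then have "c j = (\<Sum>i\<in>UNIV. Eact X (nd j) $ a $ i * x j $ i)"
      using j by (simp add: matrix_vector_mult_def c_def ab)
    also have "\<dots> = Eact X (nd j) $ a $ b * c (j + 1)"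
      using j by (subst x_supp) (auto simp: c_def ab if_distrib[of "\<lambda>x. _ * x"] cong: if_cong)
    finally show ?thesis using True c[of j] c[of "j + 1"] j by (simp add: f_def field_simps)
  qed (use Esupp[OF j, of a b] in auto)
  have fn: "f j \<noteq> 0" if "j \<in> {1..r}" for j using c[of j] c[of "j + 1"] that by (simp add: f_def)
  have "chain_rep r q X nd pos f"
    unfolding chain_rep_def using pos_bij bij_node_order[of D] fn K Ki E F lam
    by (auto simp: nd_def r_def)
  moreover have "\<forall>i. \<forall>j\<in>{1..r}. wform r (simple_root (nd j)) (wts D i) = chain_exp j (pos i)"
    using lam by (simp add: lam_def)
  ultimately show ?thesis unfolding r_def q_def X_def nd_def by blast
qed

section \<open>Intertwiners between chain modules\<close>

lemma sum_UNIV_pair: "(\<Sum>t\<in>(UNIV :: ('a::finite \<times> 'b::finite) set). g t) = (\<Sum>c\<in>UNIV. \<Sum>d\<in>UNIV. g (c, d))"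
  unfolding UNIV_Times_UNIV[symmetric] sum.cartesian_product by simp

text \<open>
  The standard solution of the braid relation of Hecke type, with eigenvalues \<open>c u\<close> and
  \<open>- c / u\<close>.  It does not involve the coefficients \<open>f\<close> of a chain, because rescaling basis vectors rescales
  \<open>v\<^sub>a \<otimes> v\<^sub>b\<close> and \<open>v\<^sub>b \<otimes> v\<^sub>a\<close> alike.
\<close>

definition hecke :: "('n::finite \<Rightarrow> nat) \<Rightarrow> complex \<Rightarrow> complex \<Rightarrow> complex ^ ('n \<times> 'n) ^ ('n \<times> 'n)" where
  "hecke pos u c = (\<chi> s t. (if s = prod.swap t then (if fst t = snd t then c * u else c) else 0) +
     (if s = t \<and> pos (snd t) < pos (fst t) then c * (u - 1 / u) else 0))"

text \<open>
  The zero weight part of \<open>V \<otimes> V*\<close> is mapped by a triangular matrix, whose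
  coefficients are those of the inverse Hecke braiding, weighted by powers of \<open>u\<close>.
\<close>

definition cross_coef :: "('n::finite \<Rightarrow> nat) \<Rightarrow> complex \<Rightarrow> complex \<Rightarrow> 'n \<Rightarrow> 'n \<Rightarrow> complex" where
  "cross_coef pos u c a b = (if a = b then c else
     if pos a < pos b then - c * (u\<^sup>2 - 1) * u ^ (2 * pos a) / u ^ (2 * pos b) else 0)"

text \<open>
  The braiding of \<open>V\<close> with its dual: pairs of different indices are swapped, and diagonal pairs are
  mapped into the span of diagonal pairs.
\<close>

definition crossd :: "('n::finite \<Rightarrow> nat) \<Rightarrow> complex \<Rightarrow> complex \<Rightarrow> complex ^ ('n \<times> 'n) ^ ('n \<times> 'n)" where
  "crossd pos u c = (\<chi> s t. (if s = prod.swap t \<and> fst t \<noteq> snd t then c * u else 0) +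
     (if fst s = snd s \<and> fst t = snd t then cross_coef pos u c (fst s) (fst t) else 0))"

lemma hecke_entry: "hecke pos u c $ (x, y) $ (a, b) =
    (if x = b \<and> y = a then (if a = b then c * u else c) else 0) +
    (if x = a \<and> y = b \<and> pos b < pos a then c * (u - 1 / u) else 0)"
  by (simp add: hecke_def)

lemma crossd_entry: "crossd pos u k $ (a, x) $ (b, c) =
    (if a = c \<and> x = b \<and> b \<noteq> c then k * u else 0) + (if a = x \<and> b = c then cross_coef pos u k a b else 0)"
  by (simp add: crossd_def)

lemma sum_if_const: "(\<Sum>d\<in>A. if P then g d else 0) = (if P then sum g A else (0 :: complex))"
  by simp

lemma sum_pair_delta2:
  fixes g :: "('n::finite) \<times> ('m::finite) \<Rightarrow> complex"
  assumes "\<And>a b. g (a, b) = (if a = x then if b = y then A else 0 else 0) + (if a = x' then if b = y' then C else 0 else 0)"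
  shows "(\<Sum>t\<in>UNIV. g t) = A + C"
  by (simp add: sum_UNIV_pair assms sum.distrib sum_if_const)

lemma sum_pair_delta_diag:
  fixes g :: "('n::finite) \<times> 'n \<Rightarrow> complex"
  assumes "\<And>a b. g (a, b) = (if a = x then if b = y then A else 0 else 0) + (if b = a then h a else 0)"
  shows "(\<Sum>t\<in>UNIV. g t) = A + (\<Sum>a\<in>UNIV. h a)"
  by (simp add: sum_UNIV_pair assms sum.distrib sum_if_const)

lemma hecke_mult_l: "(hecke pos u c ** (M :: complex ^ (('n::finite) \<times> 'n) ^ ('n \<times> 'n))) $ (x, y) $ t =
    (if x = y then c * u else c) * M $ (y, x) $ t + (if pos y < pos x then c * (u - 1 / u) else 0) * M $ (x, y) $ t"
  unfolding matrix_mult_entry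
  by (rule sum_pair_delta2[where x = y and y = x and x' = x and y' = y])
    (use distrib_right in \<open>auto simp: hecke_entry\<close>)

lemma hecke_mult_r: "((M :: complex ^ (('n::finite) \<times> 'n) ^ ('n \<times> 'n)) ** hecke pos u c) $ s $ (a, b) =
    (if a = b then c * u else c) * M $ s $ (b, a) + (if pos b < pos a then c * (u - 1 / u) else 0) * M $ s $ (a, b)"
  unfolding matrix_mult_entry
  by (rule sum_pair_delta2[where x = b and y = a and x' = a and y' = b])
    (use distrib_left in \<open>auto simp: hecke_entry\<close>)

lemma crossd_mult_l: "(crossd pos u c ** (M :: complex ^ (('n::finite) \<times> 'n) ^ ('n \<times> 'n))) $ (a, x) $ t =
    (if a = x then (\<Sum>b\<in>UNIV. cross_coef pos u c a b * M $ (b, b) $ t) else c * u * M $ (x, a) $ t)"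
proof (cases "a = x")
  case True
  show ?thesis unfolding matrix_mult_entry using True
    by (subst sum_pair_delta_diag[where x = x and y = a and A = 0
          and h = "\<lambda>b. cross_coef pos u c a b * M $ (b, b) $ t"]) (auto simp: crossd_entry)
next
  case False
  show ?thesis unfolding matrix_mult_entry using False
    by (subst sum_pair_delta_diag[where x = x and y = a and A = "c * u * M $ (x, a) $ t" and h = "\<lambda>b. 0"])
      (auto simp: crossd_entry)
qed

lemma crossd_mult_r: "((M :: complex ^ (('n::finite) \<times> 'n) ^ ('n \<times> 'n)) ** crossd pos u k) $ s $ (b, c) =
    (if b = c then (\<Sum>a\<in>UNIV. cross_coef pos u k a b * M $ s $ (a, a)) else k * u * M $ s $ (c, b))"
proof (cases "b = c")
  case True
  show ?thesis unfolding matrix_mult_entry using True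
    by (subst sum_pair_delta_diag[where x = c and y = b and A = 0
          and h = "\<lambda>a. cross_coef pos u k a b * M $ s $ (a, a)"]) (auto simp: crossd_entry)
next
  case False
  show ?thesis unfolding matrix_mult_entry using False
    by (subst sum_pair_delta_diag[where x = c and y = b and A = "k * u * M $ s $ (c, b)" and h = "\<lambda>b. 0"])
      (auto simp: crossd_entry)
qed

lemma kron_entry [simp]: "kron A B $ (x, y) $ (a, b) = A $ x $ a * B $ y $ b"
  by (simp add: kron_def)

lemma pair_matrix_eqI:
  "(\<And>x y a b. A $ (x, y) $ (a, b) = B $ (x, y) $ (a, b)) \<Longrightarrow> A = B"
  by (simp add: vec_eq_iff)

lemma chainD:
  assumes "chain_rep r q X nd pos f" "0 < q" "j \<in> {1..r}"
  shows "Kact X (nd j) $ a $ b = (if a = b then qpow q (chain_exp j (pos a)) else 0)"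
    "Kinv X (nd j) $ a $ b = (if a = b then inverse (qpow q (chain_exp j (pos a))) else 0)"
    "Eact X (nd j) $ a $ b = (if pos a = j \<and> pos b = j + 1 then 1 / f j else 0)"
    "Fact X (nd j) $ a $ b = (if pos a = j + 1 \<and> pos b = j then f j else 0)"
    "f j \<noteq> 0"
  using assms unfolding chain_rep_def by (simp_all add: qpow_minus)

lemma chain_bij: "chain_rep r q X nd pos f \<Longrightarrow> bij_betw pos UNIV {1..r + 1}"
  "chain_rep r q X nd pos f \<Longrightarrow> bij_betw nd {1..r} {1..r}"
  by (simp_all add: chain_rep_def)

lemma chain_pos: assumes "chain_rep r q X nd pos f"
  shows "pos x = pos y \<longleftrightarrow> x = y" "pos x \<ge> 1" "pos x \<le> r + 1" "k \<in> {1..r + 1} \<Longrightarrow> \<exists>x. pos x = k"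
  using chain_bij(1)[OF assms] by (auto simp: bij_betw_def inj_on_def) (metis UNIV_I atLeastAtMost_iff image_iff)+

lemma is_rep_hom_nd:
  assumes "bij_betw nd {1..r} {1..r}"
    "\<And>j. j \<in> {1..r} \<Longrightarrow> A ** Kact X (nd j) = Kact Y (nd j) ** A"
    "\<And>j. j \<in> {1..r} \<Longrightarrow> A ** Kinv X (nd j) = Kinv Y (nd j) ** A"
    "\<And>j. j \<in> {1..r} \<Longrightarrow> A ** Eact X (nd j) = Eact Y (nd j) ** A"
    "\<And>j. j \<in> {1..r} \<Longrightarrow> A ** Fact X (nd j) = Fact Y (nd j) ** A"
  shows "is_rep_hom r X Y A"
  unfolding is_rep_hom_def
proof
  fix i assume "i \<in> {1..r}"
  then have "i \<in> nd ` {1..r}" using assms(1) by (simp add: bij_betw_def)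
  then obtain j where "j \<in> {1..r}" "i = nd j" by blast
  then show "A ** Kact X i = Kact Y i ** A \<and> A ** Kinv X i = Kinv Y i ** A \<and>
     A ** Eact X i = Eact Y i ** A \<and> A ** Fact X i = Fact Y i ** A" using assms(2-) by blast
qed

lemma hecke_intertwines:
  fixes X :: "('n::finite) uq_rep"
  assumes ch: "chain_rep r q X nd pos f" and q: "0 < q"
  shows "is_rep_hom r (rep_tensor X X) (rep_tensor X X) (hecke pos (qpow q 1) c)"
proof (rule is_rep_hom_nd[OF chain_bij(2)[OF ch]])
  fix j assume j: "j \<in> {1..r}"
  define u where "u = qpow q 1"
  have u: "u \<noteq> 0" using q by (simp add: u_def)
  have k: "qpow q (chain_exp j k) = (if k = j then u else if k = j + 1 then 1 / u else 1)" for k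
    using q by (auto simp: chain_exp_def u_def qpow_minus divide_inverse)
  note D = chainD[OF ch q j] and inj = chain_pos(1)[OF ch]
  note e = hecke_mult_l hecke_mult_r rep_tensor_def
  show "hecke pos (qpow q 1) c ** Kact (rep_tensor X X) (nd j) = Kact (rep_tensor X X) (nd j) ** hecke pos (qpow q 1) c"
    by (rule pair_matrix_eqI) (auto simp: e D)
  show "hecke pos (qpow q 1) c ** Kinv (rep_tensor X X) (nd j) = Kinv (rep_tensor X X) (nd j) ** hecke pos (qpow q 1) c"
    by (rule pair_matrix_eqI) (auto simp: e D)
  show "hecke pos (qpow q 1) c ** Eact (rep_tensor X X) (nd j) = Eact (rep_tensor X X) (nd j) ** hecke pos (qpow q 1) c"
  proof (rule pair_matrix_eqI)
    fix x y a b
    show "(hecke pos (qpow q 1) c ** Eact (rep_tensor X X) (nd j)) $ (x, y) $ (a, b) =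
      (Eact (rep_tensor X X) (nd j) ** hecke pos (qpow q 1) c) $ (x, y) $ (a, b)"
      unfolding e using u D(5)
      apply (simp add: D(1-4) k mat_def flip: inj u_def)
      apply (cases "pos x = j"; cases "pos y = j"; cases "pos a = j + 1"; cases "pos b = j + 1"; simp)
      apply (auto simp: field_simps)
      done
  qed
  show "hecke pos (qpow q 1) c ** Fact (rep_tensor X X) (nd j) = Fact (rep_tensor X X) (nd j) ** hecke pos (qpow q 1) c"
  proof (rule pair_matrix_eqI)
    fix x y a b
    show "(hecke pos (qpow q 1) c ** Fact (rep_tensor X X) (nd j)) $ (x, y) $ (a, b) =
      (Fact (rep_tensor X X) (nd j) ** hecke pos (qpow q 1) c) $ (x, y) $ (a, b)"
      unfolding e using u D(5)
      apply (simp add: D(1-4) k mat_def flip: inj u_def)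
      apply (cases "pos x = j + 1"; cases "pos y = j + 1"; cases "pos a = j"; cases "pos b = j"; simp)
      apply (auto simp: field_simps)
      done
  qed
qed

text \<open>
  A highest weight vector tensored with a lowest weight vector generates the tensor product.  Raising
  operators kill the highest weight vector, so on the first column of pairs they act on the second
  factor alone and reach all of it.  Lowering operators then move the first factor, up to terms in
  which it stays where it was.
\<close>

lemma chain_intertwiner_zero:
  fixes X :: "('n::finite) uq_rep" and Y :: "('m::finite) uq_rep"
  assumes X: "chain_rep r q X nd pos f" and Y: "chain_rep r q Y nd' pos' f'" and q: "0 < q"
    and Z: "is_rep_hom r (rep_tensor X Y) (rep_tensor Y X) Z"
    and x1: "pos x1 = 1" and yN: "pos' yN = r + 1"
    and zero: "\<And>s. Z $ s $ (x1, yN) = 0"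
  shows "Z = 0"
proof -
  have nd: "nd j \<in> {1..r}" "nd' j \<in> {1..r}" if "j \<in> {1..r}" for j
    using that bij_betwE[OF chain_bij(2)[OF X]] bij_betwE[OF chain_bij(2)[OF Y]] by blast+
  \<comment> \<open>Columns whose first index is highest: raise the second factor step by step.\<close>
  have low: "\<forall>s y. pos' y = r + 1 - k \<longrightarrow> Z $ s $ (x1, y) = 0" if "k \<le> r" for k
    using that
  proof (induction k)
    case 0 then show ?case using zero yN chain_pos(1)[OF Y] by simp metis
  next
    case (Suc k)
    define j where "j = r - k"
    have j: "j \<in> {1..r}" "r + 1 - k = j + 1" "r + 1 - Suc k = j" using Suc.prems by (auto simp: j_def)
    obtain i where i: "i \<in> {1..r}" "nd i = nd' j" using nd(2)[OF j(1)] chain_bij(2)[OF X]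
      by (metis bij_betw_imp_surj_on imageE)
    obtain y' where y': "pos' y' = j + 1" using chain_pos(4)[OF Y, of "j + 1"] j by auto
    show ?case
    proof (intro allI impI)
      fix s y assume "pos' y = r + 1 - Suc k"
      then have y: "pos' y = j" using j by simp
      have "Z ** Eact (rep_tensor X Y) (nd' j) = Eact (rep_tensor Y X) (nd' j) ** Z"
        using Z nd(2)[OF j(1)] by (simp add: is_rep_hom_def)
      from arg_cong[OF this, of "\<lambda>A. A $ s $ (x1, y')"]
      have "(\<Sum>t\<in>UNIV. Z $ s $ t * Eact (rep_tensor X Y) (nd' j) $ t $ (x1, y'))
        = (\<Sum>t\<in>UNIV. Eact (rep_tensor Y X) (nd' j) $ s $ t * Z $ t $ (x1, y'))"
        unfolding matrix_mult_entry .
      also have "\<dots> = 0"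
      proof -
        have "Z $ t $ (x1, y') = 0" for t using Suc y' j(2) by (cases t) simp
        then show ?thesis by simp
      qed
      also have "(\<Sum>t\<in>UNIV. Z $ s $ t * Eact (rep_tensor X Y) (nd' j) $ t $ (x1, y')) = Z $ s $ (x1, y) / f' j + 0"
      proof (rule sum_pair_delta2[where x = x1 and y = y and x' = x1 and y' = y])
        fix a b
        have E1: "Eact X (nd' j) $ a $ x1 = 0" using chainD(3)[OF X q i(1), of a x1] i x1 by simp
        show "Z $ s $ (a, b) * Eact (rep_tensor X Y) (nd' j) $ (a, b) $ (x1, y') =
          (if a = x1 then if b = y then Z $ s $ (x1, y) / f' j else 0 else 0) + (if a = x1 then if b = y then 0 else 0 else 0)"
          using y y' chain_pos(1)[OF Y, of b y]
          by (auto simp: rep_tensor_def E1 chainD(3)[OF Y q j(1)] mat_def)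
      qed
      finally show "Z $ s $ (x1, y) = 0" using chainD(5)[OF Y q j(1)] by simp
    qed
  qed
  \<comment> \<open>All columns: lower the first factor, using that the columns of the previous step vanish.\<close>
  have all: "\<forall>s x y. pos x = Suc k \<longrightarrow> Z $ s $ (x, y) = 0" if "k \<le> r" for k
    using that
  proof (induction k)
    case 0
    have "Z $ s $ (x1, y) = 0" for s y
    proof -
      have "r + 1 - pos' y \<le> r" "pos' y = r + 1 - (r + 1 - pos' y)" using chain_pos(2,3)[OF Y, of y] by linarith+
      then show ?thesis using low by blast
    qed
    then show ?case using x1 chain_pos(1)[OF X] by simp metis
  next
    case (Suc k)
    define j where "j = Suc k"
    have j: "j \<in> {1..r}" using Suc.prems by (auto simp: j_def)
    obtain i where i: "i \<in> {1..r}" "nd' i = nd j" using nd(1)[OF j] chain_bij(2)[OF Y]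
      by (metis bij_betw_imp_surj_on imageE)
    obtain x' where x': "pos x' = j" using chain_pos(4)[OF X, of j] j by auto
    have zx': "Z $ s $ (x', y) = 0" for s y using Suc x' by (cases s) (simp add: j_def)
    show ?case
    proof (intro allI impI)
      fix s x y assume "pos x = Suc (Suc k)"
      then have x: "pos x = j + 1" by (simp add: j_def)
      have "Z ** Fact (rep_tensor X Y) (nd j) = Fact (rep_tensor Y X) (nd j) ** Z"
        using Z nd(1)[OF j] by (simp add: is_rep_hom_def)
      from arg_cong[OF this, of "\<lambda>A. A $ s $ (x', y)"]
      have "(\<Sum>t\<in>UNIV. Z $ s $ t * Fact (rep_tensor X Y) (nd j) $ t $ (x', y))
        = (\<Sum>t\<in>UNIV. Fact (rep_tensor Y X) (nd j) $ s $ t * Z $ t $ (x', y))"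
        unfolding matrix_mult_entry .
      also have "\<dots> = 0" by (simp add: zx')
      also have "(\<Sum>t\<in>UNIV. Z $ s $ t * Fact (rep_tensor X Y) (nd j) $ t $ (x', y)) = f j * Z $ s $ (x, y) + 0"
      proof (rule sum_pair_delta2[where x = x and y = y and x' = x and y' = y])
        fix a b
        show "Z $ s $ (a, b) * Fact (rep_tensor X Y) (nd j) $ (a, b) $ (x', y) =
          (if a = x then if b = y then f j * Z $ s $ (x, y) else 0 else 0) + (if a = x then if b = y then 0 else 0 else 0)"
          using x x' chain_pos(1)[OF X, of a x] zx'[of s b] i
          by (auto simp: rep_tensor_def chainD(2,4)[OF X q j] mat_def)
      qed
      finally show "Z $ s $ (x, y) = 0" using chainD(5)[OF X q j] by simp
    qed
  qed
  have "Z $ s $ (x, y) = 0" for s x y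
  proof -
    have "pos x - 1 \<le> r" "pos x = Suc (pos x - 1)" using chain_pos(2,3)[OF X, of x] by linarith+
    then show ?thesis using all by blast
  qed
  then show ?thesis by (simp add: vec_eq_iff)
qed

section \<open>The dual chain and the mixed braiding\<close>

text \<open>
  Dualising reverses the chain; the powers of \<open>q\<close> come from the \<open>K\<close> in the antipode of \<open>E\<close>
  and \<open>F\<close>.
\<close>

lemma chain_rep_dual:
  fixes X :: "('n::finite) uq_rep"
  assumes ch: "chain_rep r q X nd pos f" and q: "0 < q"
  shows "chain_rep r q (rep_dual X) (\<lambda>j. nd (r + 1 - j)) (\<lambda>i. r + 2 - pos i) (\<lambda>j. - f (r + 1 - j) / qpow q 1)"
  unfolding chain_rep_def
proof (intro conjI ballI allI)
  have "bij_betw (\<lambda>k. r + 2 - k) {1..r + 1} {1..r + 1}"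
    by (intro bij_betwI[where g = "\<lambda>k. r + 2 - k"]) auto
  from bij_betw_trans[OF chain_bij(1)[OF ch] this]
  show "bij_betw (\<lambda>i. r + 2 - pos i) UNIV {1..r + 1}" by (simp add: o_def)
  have "bij_betw (\<lambda>k. r + 1 - k) {1..r} {1..r}"
    by (intro bij_betwI[where g = "\<lambda>k. r + 1 - k"]) auto
  from bij_betw_trans[OF this chain_bij(2)[OF ch]]
  show "bij_betw (\<lambda>j. nd (r + 1 - j)) {1..r} {1..r}" by (simp add: o_def)
  fix j assume j: "j \<in> {1..r}"
  define j' where "j' = r + 1 - j"
  have j': "j' \<in> {1..r}" using j by (auto simp: j'_def)
  note D = chainD[OF ch q j']
  show "- f (r + 1 - j) / qpow q 1 \<noteq> 0" unfolding j'_def[symmetric] using D(5) q by simp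
  fix a b
  have p: "1 \<le> pos a" "pos a \<le> r + 1" "1 \<le> pos b" "pos b \<le> r + 1"
    using chain_pos(2,3)[OF ch] by blast+
  have ex: "chain_exp j (r + 2 - pos a) = - chain_exp j' (pos a)"
    using p j by (auto simp: chain_exp_def j'_def)
  show "Kact (rep_dual X) (nd (r + 1 - j)) $ a $ b = (if a = b then qpow q (chain_exp j (r + 2 - pos a)) else 0)"
    unfolding j'_def[symmetric] ex using q by (simp add: rep_dual_def transpose_def D qpow_minus)
  show "Kinv (rep_dual X) (nd (r + 1 - j)) $ a $ b = (if a = b then qpow q (- chain_exp j (r + 2 - pos a)) else 0)"
    unfolding j'_def[symmetric] ex using q by (simp add: rep_dual_def transpose_def D)
  have e1: "chain_exp j' j' = 1" and e2: "chain_exp j' (Suc j') = - 1"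
    by (simp_all add: chain_exp_def)
  have c1: "r + 2 - pos a = j \<longleftrightarrow> pos a = j' + 1" "r + 2 - pos b = j + 1 \<longleftrightarrow> pos b = j'"
    "r + 2 - pos a = j + 1 \<longleftrightarrow> pos a = j'" "r + 2 - pos b = j \<longleftrightarrow> pos b = j' + 1"
    using p j by (auto simp: j'_def)
  have "Eact (rep_dual X) (nd j') $ a $ b = - (Eact X (nd j') $ b $ a * inverse (qpow q (chain_exp j' (pos a))))"
    by (simp add: rep_dual_def transpose_def diag_mult_r[OF D(2)])
  then show "Eact (rep_dual X) (nd (r + 1 - j)) $ a $ b =
      (if r + 2 - pos a = j \<and> r + 2 - pos b = j + 1 then 1 / (- f (r + 1 - j) / qpow q 1) else 0)"
    unfolding c1 D(3) j'_def[symmetric] using q D(5)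
    by (cases "pos a = j' + 1"; cases "pos b = j'") (simp_all add: e2 qpow_minus)
  have "Fact (rep_dual X) (nd j') $ a $ b = - (qpow q (chain_exp j' (pos b)) * Fact X (nd j') $ b $ a)"
    by (simp add: rep_dual_def transpose_def diag_mult_l[OF D(1)])
  then show "Fact (rep_dual X) (nd (r + 1 - j)) $ a $ b =
      (if r + 2 - pos a = j + 1 \<and> r + 2 - pos b = j then - f (r + 1 - j) / qpow q 1 else 0)"
    unfolding c1 D(4) j'_def[symmetric] using q
    by (cases "pos a = j'"; cases "pos b = j' + 1") (simp_all add: e2 qpow_minus divide_inverse)
qed

text \<open>
  Both sides are compared entry by entry.  Only the operators at positions \<open>j\<close> and \<open>j + 1\<close> matter, and
  the coefficients on the diagonal pairs are chosen so that the contributions of these two positions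
  cancel.
\<close>

lemma crossd_intertwines:
  fixes X :: "('n::finite) uq_rep"
  assumes ch: "chain_rep r q X nd pos f" and q: "0 < q"
  shows "is_rep_hom r (rep_tensor X (rep_dual X)) (rep_tensor (rep_dual X) X) (crossd pos (qpow q 1) c)"
proof (rule is_rep_hom_nd[OF chain_bij(2)[OF ch]])
  fix j assume j: "j \<in> {1..r}"
  define u where "u = qpow q 1"
  have u: "u \<noteq> 0" using q by (simp add: u_def)
  have k: "qpow q (chain_exp j k) = (if k = j then u else if k = j + 1 then 1 / u else 1)" for k
    using q by (auto simp: chain_exp_def u_def qpow_minus divide_inverse)
  note D = chainD[OF ch q j] and inj = chain_pos(1)[OF ch]
  have DD: "Kact (rep_dual X) (nd j) $ a $ b = (if a = b then inverse (qpow q (chain_exp j (pos a))) else 0)"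
    "Kinv (rep_dual X) (nd j) $ a $ b = (if a = b then qpow q (chain_exp j (pos a)) else 0)"
    "Eact (rep_dual X) (nd j) $ a $ b = - (Eact X (nd j) $ b $ a * inverse (qpow q (chain_exp j (pos a))))"
    "Fact (rep_dual X) (nd j) $ a $ b = - (qpow q (chain_exp j (pos b)) * Fact X (nd j) $ b $ a)" for a b
    by (simp_all add: rep_dual_def transpose_def diag_mult_r[OF D(2)] diag_mult_l[OF D(1)] D(1,2))
  let ?R = "crossd pos u c"
  note e = crossd_mult_l crossd_mult_r rep_tensor_def
  have sl: "(\<Sum>b'\<in>UNIV. g b' * (A $ b' $ b * (if b' = c' then kk b' else 0) + (if b' = b then ll b' else 0) * C $ b' $ c'))
     = g c' * (A $ c' $ b * kk c') + g b * (ll b * C $ b $ c')"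
    for g kk ll :: "'n \<Rightarrow> complex" and A C :: "complex ^ 'n ^ 'n" and b c'
    by (simp add: distrib_left sum.distrib if_distrib[of "\<lambda>z. _ * z"] if_distrib[of "\<lambda>z. z * _"] cong: if_cong)
  have sr: "(\<Sum>a'\<in>UNIV. g a' * (A $ a $ a' * (if x = a' then kk a' else 0) + (if a = a' then ll a' else 0) * C $ x $ a'))
     = g x * (A $ a $ x * kk x) + g a * (ll a * C $ x $ a)"
    for g kk ll :: "'n \<Rightarrow> complex" and A C :: "complex ^ 'n ^ 'n" and a x
    by (simp add: distrib_left sum.distrib if_distrib[of "\<lambda>z. _ * z"] if_distrib[of "\<lambda>z. z * _"] cong: if_cong)
  show "crossd pos (qpow q 1) c ** Kact (rep_tensor X (rep_dual X)) (nd j) = Kact (rep_tensor (rep_dual X) X) (nd j) ** crossd pos (qpow q 1) c"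
    using q by (intro pair_matrix_eqI) (auto simp: e D DD if_distrib[of "\<lambda>z. _ * z"] if_distrib[of "\<lambda>z. z * _"] cong: if_cong)
  show "crossd pos (qpow q 1) c ** Kinv (rep_tensor X (rep_dual X)) (nd j) = Kinv (rep_tensor (rep_dual X) X) (nd j) ** crossd pos (qpow q 1) c"
    using q by (intro pair_matrix_eqI) (auto simp: e D DD if_distrib[of "\<lambda>z. _ * z"] if_distrib[of "\<lambda>z. z * _"] cong: if_cong)
  show "crossd pos (qpow q 1) c ** Eact (rep_tensor X (rep_dual X)) (nd j) = Eact (rep_tensor (rep_dual X) X) (nd j) ** crossd pos (qpow q 1) c"
  proof (rule pair_matrix_eqI)
    fix a x b c'
    have L: "(crossd pos (qpow q 1) c ** Eact (rep_tensor X (rep_dual X)) (nd j)) $ (a, x) $ (b, c') =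
      (if a = x then cross_coef pos u c a c' * (Eact X (nd j) $ c' $ b * inverse (qpow q (chain_exp j (pos c'))))
            + cross_coef pos u c a b * Eact (rep_dual X) (nd j) $ b $ c'
       else c * u * (Eact X (nd j) $ x $ b * (if a = c' then inverse (qpow q (chain_exp j (pos a))) else 0)
            + (if x = b then 1 else 0) * Eact (rep_dual X) (nd j) $ a $ c'))"
      unfolding e by (simp add: sl DD(1) mat_def u_def)
    have Rr: "(Eact (rep_tensor (rep_dual X) X) (nd j) ** crossd pos (qpow q 1) c) $ (a, x) $ (b, c') =
      (if b = c' then cross_coef pos u c x b * (Eact (rep_dual X) (nd j) $ a $ x * qpow q (chain_exp j (pos x)))
           + cross_coef pos u c a b * Eact X (nd j) $ x $ a
       else c * u * (Eact (rep_dual X) (nd j) $ a $ c' * (if x = b then qpow q (chain_exp j (pos x)) else 0)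
           + (if a = c' then 1 else 0) * Eact X (nd j) $ x $ b))"
      unfolding e by (simp add: sr D(1) mat_def u_def)
    show "(crossd pos (qpow q 1) c ** Eact (rep_tensor X (rep_dual X)) (nd j)) $ (a, x) $ (b, c') =
      (Eact (rep_tensor (rep_dual X) X) (nd j) ** crossd pos (qpow q 1) c) $ (a, x) $ (b, c')"
      unfolding L Rr DD D(3) k inj[symmetric] using u D(5)
      apply (cases "pos b = j + 1"; cases "pos c' = j"; cases "pos x = j"; cases "pos a = j + 1"; simp)
      apply (simp_all add: cross_coef_def inj[symmetric] field_simps power2_eq_square)
      apply (auto simp: field_simps power2_eq_square)
      subgoal premises p
      proof -
        have "pos c' = Suc (pos x)" using p by simp
        then show ?thesis by (simp add: algebra_simps)
      qed
      done
  qed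
  show "crossd pos (qpow q 1) c ** Fact (rep_tensor X (rep_dual X)) (nd j) = Fact (rep_tensor (rep_dual X) X) (nd j) ** crossd pos (qpow q 1) c"
  proof (rule pair_matrix_eqI)
    fix a x b c'
    have L: "(crossd pos (qpow q 1) c ** Fact (rep_tensor X (rep_dual X)) (nd j)) $ (a, x) $ (b, c') =
      (if a = x then cross_coef pos u c a c' * Fact X (nd j) $ c' $ b
            + cross_coef pos u c a b * (inverse (qpow q (chain_exp j (pos b))) * Fact (rep_dual X) (nd j) $ b $ c')
       else c * u * (Fact X (nd j) $ x $ b * (if a = c' then 1 else 0)
            + (if x = b then inverse (qpow q (chain_exp j (pos x))) else 0) * Fact (rep_dual X) (nd j) $ a $ c'))"
      unfolding e by (simp add: sl D(2) mat_def u_def)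
    have Rr: "(Fact (rep_tensor (rep_dual X) X) (nd j) ** crossd pos (qpow q 1) c) $ (a, x) $ (b, c') =
      (if b = c' then cross_coef pos u c x b * Fact (rep_dual X) (nd j) $ a $ x
           + cross_coef pos u c a b * (qpow q (chain_exp j (pos a)) * Fact X (nd j) $ x $ a)
       else c * u * (Fact (rep_dual X) (nd j) $ a $ c' * (if x = b then 1 else 0)
           + (if a = c' then qpow q (chain_exp j (pos a)) else 0) * Fact X (nd j) $ x $ b))"
      unfolding e by (simp add: sr DD(2) mat_def u_def)
    show "(crossd pos (qpow q 1) c ** Fact (rep_tensor X (rep_dual X)) (nd j)) $ (a, x) $ (b, c') =
      (Fact (rep_tensor (rep_dual X) X) (nd j) ** crossd pos (qpow q 1) c) $ (a, x) $ (b, c')"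
      unfolding L Rr DD D(4) k inj[symmetric] using u D(5)
      apply (cases "pos b = j"; cases "pos c' = j + 1"; cases "pos x = j + 1"; cases "pos a = j"; simp)
      apply (simp_all add: cross_coef_def inj[symmetric] field_simps power2_eq_square)
      done
  qed
qed

section \<open>Extremal vectors and uniqueness of the braiding\<close>

lemma wform_sum_left: "wform r (\<lambda>k. \<Sum>i\<in>A. c i * g i k) \<nu> = (\<Sum>i\<in>A. c i * wform r (g i) \<nu>)"
  unfolding wform_def sum_distrib_right sum_distrib_left
  by (subst sum.swap) (simp add: mult_ac)

lemma wform_sym: "wform r \<mu> \<nu> = wform r \<nu> \<mu>"
  by (simp add: wform_def mult_ac)

text \<open>
  The fundamental weights are dual to the simple roots.
\<close>

lemma weight_lattice_expand:
  assumes "\<nu> \<in> weight_lattice r"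
  shows "\<nu> = (\<lambda>k. \<Sum>i = 1..r. wform r (simple_root i) \<nu> * fund_weight r i k)"
proof -
  obtain n :: "nat \<Rightarrow> int" where n: "\<nu> = (\<lambda>k. \<Sum>i = 1..r. of_int (n i) * fund_weight r i k)"
    using assms by (auto simp: weight_lattice_def)
  have "wform r (simple_root j) \<nu> = of_int (n j)" if "j \<in> {1..r}" for j
  proof -
    have "wform r (simple_root j) \<nu> = (\<Sum>i = 1..r. of_int (n i) * wform r (simple_root j) (fund_weight r i))"
      unfolding n by (subst wform_sym, subst wform_sum_left) (simp add: wform_sym)
    also have "\<dots> = (\<Sum>i = 1..r. of_int (n i) * (if j = i then 1 else 0))"
      using that by (intro sum.cong refl) (simp add: simple_root_fund_weight)
    finally show ?thesis using that by (simp add: if_distrib[of "\<lambda>z. _ * z"] cong: if_cong)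
  qed
  then show ?thesis using n by (auto intro!: sum.cong)
qed

lemma weight_eq_fund_weight:
  assumes "\<nu> \<in> weight_lattice r" "s \<in> {1..r}"
    "\<And>i. i \<in> {1..r} \<Longrightarrow> wform r (simple_root i) \<nu> = (if i = s then 1 else 0)"
  shows "\<nu> = fund_weight r s"
proof
  fix k
  have "\<nu> k = (\<Sum>i = 1..r. (if i = s then 1 else 0) * fund_weight r i k)"
    by (subst weight_lattice_expand[OF assms(1)]) (auto intro!: sum.cong simp: assms(3))
  also have "\<dots> = fund_weight r s k" using assms(2) by (simp add: if_distrib[of "\<lambda>z. z * _"] cong: if_cong)
  finally show "\<nu> k = fund_weight r s k" .
qed

lemma fund_weight_lattice: assumes "s \<in> {1..r}" shows "fund_weight r s \<in> weight_lattice r" "(\<lambda>k. - fund_weight r s k) \<in> weight_lattice r"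
proof -
  have "fund_weight r s = (\<lambda>k. \<Sum>i = 1..r. of_int (if i = s then 1 else 0) * fund_weight r i k)"
    using assms by (simp add: if_distrib[of of_int] if_distrib[of "\<lambda>z. z * _"] cong: if_cong)
  then show "fund_weight r s \<in> weight_lattice r" unfolding weight_lattice_def
    by (intro CollectI exI[of _ "\<lambda>i. if i = s then 1 else 0"])
  have "(\<lambda>k. - fund_weight r s k) = (\<lambda>k. \<Sum>i = 1..r. of_int (if i = s then - 1 else 0) * fund_weight r i k)"
    using assms by (simp add: if_distrib[of of_int] if_distrib[of "\<lambda>z. z * _"] cong: if_cong)
  then show "(\<lambda>k. - fund_weight r s k) \<in> weight_lattice r" unfolding weight_lattice_def
    by (intro CollectI exI[of _ "\<lambda>i. if i = s then - 1 else 0"])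
qed

text \<open>
  A vector killed by the raising operators has only its first coordinate, because each
  raising operator detects the coordinate that follows its position.
\<close>

lemma chain_hw:
  fixes X :: "('n::finite) uq_rep"
  assumes ch: "chain_rep r q X nd pos f" and q: "0 < q" "q < 1" and r: "r \<ge> 1" and x1: "pos x1 = 1"
  shows "highest_weight_vector r q X (fund_weight r (nd 1)) (axis x1 1)"
    and "highest_weight_vector r q X \<nu> v \<Longrightarrow> \<nu> = fund_weight r (nd 1) \<and> (\<exists>c. v = c *s axis x1 1)"
proof -
  have nd: "nd j \<in> {1..r}" if "j \<in> {1..r}" for j
    using that bij_betwE[OF chain_bij(2)[OF ch]] by blast
  have nd_inj: "nd i = nd j \<longleftrightarrow> i = j" if "i \<in> {1..r}" "j \<in> {1..r}" for i j
    using that chain_bij(2)[OF ch] by (meson bij_betw_imp_inj_on inj_on_eq_iff)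
  have ex: "\<exists>j\<in>{1..r}. i = nd j" if "i \<in> {1..r}" for i
    using that chain_bij(2)[OF ch] by (metis bij_betw_imp_surj_on imageE)
  have one: "1 \<in> {1..r}" using r by simp
  have wf: "wform r (simple_root (nd j)) (fund_weight r (nd 1)) = chain_exp j 1" if "j \<in> {1..r}" for j
    using simple_root_fund_weight[OF nd[OF that] nd[OF one]] nd_inj[OF that one] that
    by (auto simp: chain_exp_def)
  show "highest_weight_vector r q X (fund_weight r (nd 1)) (axis x1 1)"
    unfolding highest_weight_vector_def weight_vector_def
  proof (intro conjI ballI)
    show "axis x1 1 \<noteq> (0 :: complex ^ 'n)" by simp
    show "fund_weight r (nd 1) \<in> weight_lattice r" using fund_weight_lattice nd one by blast
    fix i assume "i \<in> {1..r}"
    then obtain j where j: "j \<in> {1..r}" "i = nd j" using ex by blast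
    show "Kact X i *v axis x1 1 = qpow q (wform r (simple_root i) (fund_weight r (nd 1))) *s axis x1 1"
      unfolding j(2) wf[OF j(1)] vec_eq_iff mv_axis
      by (simp add: chainD(1)[OF ch q(1) j(1)] x1) (simp add: axis_def)
    show "Eact X i *v axis x1 1 = 0"
      unfolding j(2) vec_eq_iff mv_axis using j(1) by (simp add: chainD(3)[OF ch q(1) j(1)] x1)
  qed
  assume hv: "highest_weight_vector r q X \<nu> v"
  have supp: "v $ a = 0" if "a \<noteq> x1" for a
  proof -
    define j where "j = pos a - 1"
    have a1: "pos a \<noteq> 1" using chain_pos(1)[OF ch, of a x1] x1 that by simp
    have j: "j \<in> {1..r}" "pos a = j + 1"
      using chain_pos(2,3)[OF ch, of a] a1 by (auto simp: j_def)
    have pos_iff: "pos i = Suc j \<longleftrightarrow> i = a" for i using chain_pos(1)[OF ch, of i a] j(2) by simp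
    obtain b where b: "pos b = j" using chain_pos(4)[OF ch, of j] j by auto
    have "(Eact X (nd j) *v v) $ b = 0" using hv nd[OF j(1)] by (simp add: highest_weight_vector_def)
    then have "(\<Sum>i\<in>UNIV. (if i = a then 1 / f j else 0) * v $ i) = 0"
      unfolding matrix_vector_mult_def
      by (simp add: chainD(3)[OF ch q(1) j(1)] b pos_iff)
    then show ?thesis using chainD(5)[OF ch q(1) j(1)] by (simp add: if_distrib[of "\<lambda>z. z * _"] cong: if_cong)
  qed
  have v: "v = v $ x1 *s axis x1 1" using supp by (auto simp: vec_eq_iff axis_def)
  have v1: "v $ x1 \<noteq> 0" using hv v by (auto simp: highest_weight_vector_def weight_vector_def)
  have "\<nu> = fund_weight r (nd 1)"
  proof (rule weight_eq_fund_weight)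
    show "\<nu> \<in> weight_lattice r" using hv by (simp add: highest_weight_vector_def weight_vector_def)
    show "nd 1 \<in> {1..r}" using nd[OF one] .
    fix i assume i: "i \<in> {1..r}"
    then obtain j where j: "j \<in> {1..r}" "i = nd j" using ex by blast
    have "(Kact X i *v v) $ x1 = (qpow q (wform r (simple_root i) \<nu>) *s v) $ x1"
      using hv i by (simp add: highest_weight_vector_def weight_vector_def)
    then have "wform r (simple_root i) \<nu> = chain_exp j 1"
      using v1 q by (simp add: j(2) diag_vec_entry[OF chainD(1)[OF ch q(1) j(1)]] x1 qpow_inj)
    also have "\<dots> = (if i = nd 1 then 1 else 0)"
      using nd_inj[OF j(1) one] j by (auto simp: chain_exp_def)
    finally show "wform r (simple_root i) \<nu> = (if i = nd 1 then 1 else 0)" .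
  qed
  then show "\<nu> = fund_weight r (nd 1) \<and> (\<exists>c. v = c *s axis x1 1)" using v by blast
qed

lemma chain_lw:
  fixes X :: "('n::finite) uq_rep"
  assumes ch: "chain_rep r q X nd pos f" and q: "0 < q" "q < 1" and r: "r \<ge> 1" and xN: "pos xN = r + 1"
  shows "lowest_weight_vector r q X (axis xN 1)"
    and "lowest_weight_vector r q X v \<Longrightarrow> (\<exists>c. v = c *s axis xN 1)"
proof -
  have nd: "nd j \<in> {1..r}" if "j \<in> {1..r}" for j
    using that bij_betwE[OF chain_bij(2)[OF ch]] by blast
  have nd_inj: "nd i = nd j \<longleftrightarrow> i = j" if "i \<in> {1..r}" "j \<in> {1..r}" for i j
    using that chain_bij(2)[OF ch] by (meson bij_betw_imp_inj_on inj_on_eq_iff)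
  have ex: "\<exists>j\<in>{1..r}. i = nd j" if "i \<in> {1..r}" for i
    using that chain_bij(2)[OF ch] by (metis bij_betw_imp_surj_on imageE)
  have rr: "r \<in> {1..r}" using r by simp
  have wf: "wform r (simple_root (nd j)) (\<lambda>k. - fund_weight r (nd r) k) = chain_exp j (r + 1)" if "j \<in> {1..r}" for j
    using simple_root_fund_weight[OF nd[OF that] nd[OF rr]] nd_inj[OF that rr] that
    by (auto simp: chain_exp_def wform_def sum_negf)
  show "lowest_weight_vector r q X (axis xN 1)"
    unfolding lowest_weight_vector_def weight_vector_def
  proof (intro conjI ballI exI)
    show "axis xN 1 \<noteq> (0 :: complex ^ 'n)" by simp
    show "(\<lambda>k. - fund_weight r (nd r) k) \<in> weight_lattice r" using fund_weight_lattice nd rr by blast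
  next
    fix i assume "i \<in> {1..r}"
    then obtain j where j: "j \<in> {1..r}" "i = nd j" using ex by blast
    show "Kact X i *v axis xN 1 = qpow q (wform r (simple_root i) (\<lambda>k. - fund_weight r (nd r) k)) *s axis xN 1"
      unfolding j(2) wf[OF j(1)] vec_eq_iff mv_axis
      by (simp add: chainD(1)[OF ch q(1) j(1)] xN) (simp add: axis_def)
  next
    fix i assume "i \<in> {1..r}"
    then obtain j where j: "j \<in> {1..r}" "i = nd j" using ex by blast
    show "Fact X i *v axis xN 1 = 0"
      unfolding j(2) vec_eq_iff mv_axis using j(1) by (simp add: chainD(4)[OF ch q(1) j(1)] xN)
  qed
  assume hv: "lowest_weight_vector r q X v"
  have supp: "v $ a = 0" if "a \<noteq> xN" for a
  proof -
    define j where "j = pos a"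
    have a1: "pos a \<noteq> r + 1" using chain_pos(1)[OF ch, of a xN] xN that by simp
    have j: "j \<in> {1..r}"
      using chain_pos(2,3)[OF ch, of a] a1 by (auto simp: j_def)
    obtain b where b: "pos b = j + 1" using chain_pos(4)[OF ch, of "j + 1"] j by auto
    have "(Fact X (nd j) *v v) $ b = 0" using hv nd[OF j] by (simp add: lowest_weight_vector_def)
    then have "(\<Sum>i\<in>UNIV. (if i = a then f j else 0) * v $ i) = 0"
      unfolding matrix_vector_mult_def
      by (simp add: chainD(4)[OF ch q(1) j] b) (simp add: j_def chain_pos(1)[OF ch])
    then show ?thesis using chainD(5)[OF ch q(1) j] by (simp add: if_distrib[of "\<lambda>z. z * _"] cong: if_cong)
  qed
  have "v = v $ xN *s axis xN 1" using supp by (auto simp: vec_eq_iff axis_def)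
  then show "\<exists>c. v = c *s axis xN 1" by blast
qed

lemma matrix_diff_mult:
  "(A - B :: complex ^ 'n ^ 'm) ** C = A ** C - B ** C" "(D :: complex ^ 'm ^ 'k) ** (A - B) = D ** A - D ** B"
  by (simp_all add: vec_eq_iff matrix_mult_entry left_diff_distrib right_diff_distrib sum_subtractf)

lemma vkron_axis: "vkron (c *s axis x 1) (d *s axis y 1) = (c * d) *s (axis (x, y) 1 :: complex ^ (('n::finite) \<times> ('m::finite)))"
  by (auto simp: vkron_def vec_eq_iff axis_def)

text \<open>
  The braiding is introduced as the unique normalised intertwiner.  For chains, the normalisation
  fixes one column, and two intertwiners that agree in this column are equal.
\<close>

lemma braiding_chain:
  fixes X :: "('n::finite) uq_rep" and Y :: "('m::finite) uq_rep"
  assumes X: "chain_rep r q X nd pos f" and Y: "chain_rep r q Y nd' pos' f'"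
    and q: "0 < q" "q < 1" and r: "r \<ge> 1"
    and R: "is_rep_hom r (rep_tensor X Y) (rep_tensor Y X) R"
    and x1: "pos x1 = 1" and yN: "pos' yN = r + 1"
    and norm: "\<And>s. R $ s $ (x1, yN) =
      (if s = (yN, x1) then qpow q (wform r (fund_weight r (nd 1)) (longest r (fund_weight r (nd' 1)))) else 0)"
  shows "braiding r q X Y = R"
  unfolding braiding_def
proof (rule the_equality)
  obtain y1 where y1: "pos' y1 = 1" using chain_pos(4)[OF Y, of 1] by auto
  let ?k = "qpow q (wform r (fund_weight r (nd 1)) (longest r (fund_weight r (nd' 1))))"
  \<comment> \<open>Extremal vectors are unique up to a factor, so the normalisation is a condition on one column.\<close>
  have col: "R *v axis (x1, yN) 1 = ?k *s axis (yN, x1) 1"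
    unfolding vec_eq_iff mv_axis norm by (simp add: axis_def)
  show "is_rep_hom r (rep_tensor X Y) (rep_tensor Y X) R \<and>
    (\<forall>\<nu> \<mu> v v' u. highest_weight_vector r q X \<nu> v \<and> highest_weight_vector r q Y \<mu> v' \<and>
        lowest_weight_vector r q Y u \<longrightarrow>
        R *v vkron v u = qpow q (wform r \<nu> (longest r \<mu>)) *s vkron u v)"
  proof (intro conjI allI impI R, elim conjE)
    fix \<nu> \<mu> v v' u
    assume "highest_weight_vector r q X \<nu> v" "highest_weight_vector r q Y \<mu> v'" "lowest_weight_vector r q Y u"
    then obtain c d where "\<nu> = fund_weight r (nd 1)" "\<mu> = fund_weight r (nd' 1)"
      "v = c *s axis x1 1" "u = d *s axis yN 1"
      using chain_hw(2)[OF X q r x1] chain_hw(2)[OF Y q r y1] chain_lw(2)[OF Y q r yN] by blast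
    then show "R *v vkron v u = qpow q (wform r \<nu> (longest r \<mu>)) *s vkron u v"
      by (simp add: vkron_axis vector_scalar_commute col mult_ac vector_smult_assoc)
  qed
  fix R'
  assume R': "is_rep_hom r (rep_tensor X Y) (rep_tensor Y X) R' \<and>
    (\<forall>\<nu> \<mu> v v' u. highest_weight_vector r q X \<nu> v \<and> highest_weight_vector r q Y \<mu> v' \<and>
        lowest_weight_vector r q Y u \<longrightarrow>
        R' *v vkron v u = qpow q (wform r \<nu> (longest r \<mu>)) *s vkron u v)"
  then have "R' *v vkron (axis x1 1) (axis yN 1) = ?k *s vkron (axis yN 1) (axis x1 1)"
    using chain_hw(1)[OF X q r x1] chain_hw(1)[OF Y q r y1] chain_lw(1)[OF Y q r yN] by blast
  then have "R' *v axis (x1, yN) 1 = ?k *s axis (yN, x1) 1"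
    using vkron_axis[of 1 x1 1 yN] vkron_axis[of 1 yN 1 x1] by simp
  then have zero: "(R' - R) $ s $ (x1, yN) = 0" for s
    using col by (metis (no_types, lifting) mv_axis right_minus_eq vector_minus_component)
  have "is_rep_hom r (rep_tensor X Y) (rep_tensor Y X) (R' - R)"
    using R R' by (simp add: is_rep_hom_def matrix_diff_mult)
  then have "R' - R = 0"
    by (rule chain_intertwiner_zero[OF X Y q(1) _ x1 yN zero])
  then show "R' = R" by simp
qed

section \<open>The braidings of the vector representation\<close>

lemma sum_Icc_indicator: "i \<le> n \<Longrightarrow> (\<Sum>k = 1..n. if k \<le> i then 1 else 0) = real i"
proof -
  assume "i \<le> n"
  have "(\<Sum>k = 1..n. if k \<le> i then 1 else 0) = (\<Sum>k\<in>{1..n} \<inter> {k. k \<le> i}. 1 :: real)"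
    by (simp add: sum.If_cases)
  also have "{1..n} \<inter> {k. k \<le> i} = {1..i}" using \<open>i \<le> n\<close> by auto
  finally show ?thesis by simp
qed

lemma wform_fund_weights:
  assumes "i \<le> r" "j \<le> r"
  shows "wform r (fund_weight r i) (fund_weight r j) = real (min i j) - real i * real j / real (r + 1)"
proof -
  define n where "n = r + 1"
  have n: "real n > 0" "i \<le> n" "j \<le> n" "min i j \<le> n" using assms by (auto simp: n_def)
  have fw: "fund_weight r l k = (if k \<le> l then 1 else 0) - real l / real n" if "k \<in> {1..n}" for l k
    using that by (simp add: fund_weight_def n_def)
  define a b where "a = real i / real n" and "b = real j / real n"
  have "wform r (fund_weight r i) (fund_weight r j) =
    (\<Sum>k = 1..n. (if k \<le> min i j then 1 else 0) - (if k \<le> i then 1 else 0) * b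
       - (if k \<le> j then 1 else 0) * a + a * b)"
    unfolding wform_def n_def[symmetric]
    by (intro sum.cong refl) (auto simp: fw algebra_simps simp flip: a_def b_def)
  also have "\<dots> = real (min i j) - real i * b - real j * a + real n * (a * b)"
    unfolding sum.distrib sum_subtractf sum_distrib_right[symmetric]
      sum_Icc_indicator[OF n(2)] sum_Icc_indicator[OF n(3)] sum_Icc_indicator[OF n(4)] by simp
  also have "\<dots> = real (min i j) - real i * real j / real n"
    using n(1) by (simp add: a_def b_def field_simps)
  finally show ?thesis by (simp add: n_def)
qed

lemma longest_fund_weight:
  assumes "j \<le> r + 1"
  shows "longest r (fund_weight r j) = (\<lambda>k. - fund_weight r (r + 1 - j) k)"
proof
  fix k
  show "longest r (fund_weight r j) k = - fund_weight r (r + 1 - j) k"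
  proof (cases "k \<in> {1..r + 1}")
    case True
    then have "r + 2 - k \<in> {1..r + 1}" "r + 2 - k \<le> j \<longleftrightarrow> \<not> k \<le> r + 1 - j" using assms by auto
    moreover have "real (r + 1 - j) / real (r + 1) = 1 - real j / real (r + 1)"
      using assms by (simp add: of_nat_diff field_simps)
    ultimately show ?thesis using True by (simp add: longest_def fund_weight_def)
  qed (auto simp: longest_def fund_weight_def)
qed

lemma wform_longest:
  assumes "i \<le> r" "j \<le> r" "1 \<le> j"
  shows "wform r (fund_weight r i) (longest r (fund_weight r j)) =
    - (real (min i (r + 1 - j)) - real i * real (r + 1 - j) / real (r + 1))"
  using assms wform_fund_weights[of i r "r + 1 - j"]
  by (simp add: longest_fund_weight) (simp add: wform_def sum_negf)

lemma sum_min: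
  assumes "i \<le> r"
  shows "2 * (\<Sum>j = 1..r. real (min i j)) = real i * (2 * real r - real i + 1)"
  using assms
proof (induction r rule: dec_induct)
  case base
  have "(\<Sum>j = 1..i. real (min i j)) = (\<Sum>j = 1..i. real j)" by (intro sum.cong) auto
  moreover have "2 * (\<Sum>j = 1..i. real j) = real i * (real i + 1)"
    by (induction i) (auto simp: algebra_simps)
  ultimately show ?case by simp
next
  case (step n)
  then show ?case by (simp add: algebra_simps)
qed

lemma wform_two_rho:
  assumes "i \<le> r"
  shows "wform r (fund_weight r i) (two_rho r) = real i * real (r + 1 - i)"
proof -
  have "wform r (fund_weight r i) (two_rho r) = wform r (\<lambda>k. \<Sum>j = 1..r. 2 * fund_weight r j k) (fund_weight r i)"
    by (simp add: wform_sym two_rho_def[abs_def] rho_def sum_distrib_left)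
  also have "\<dots> = (\<Sum>j = 1..r. 2 * wform r (fund_weight r i) (fund_weight r j))"
    by (simp add: wform_sum_left wform_sym)
  also have "\<dots> = (\<Sum>j = 1..r. 2 * real (min i j) - (2 * real i / real (r + 1)) * real j)"
    using assms by (intro sum.cong) (auto simp: wform_fund_weights)
  also have "\<dots> = 2 * (\<Sum>j = 1..r. real (min i j)) - (2 * real i / real (r + 1)) * (\<Sum>j = 1..r. real j)"
    by (simp add: sum_subtractf sum_distrib_left)
  also have "(\<Sum>j = 1..r. real j) = real r * (real r + 1) / 2"
    by (induction r) (auto simp: field_simps)
  also have "(2 * real i / real (r + 1)) * (real r * (real r + 1) / 2) = real i * real r"
    by (simp add: field_simps)
  finally show ?thesis using assms sum_min[OF assms] by (simp add: of_nat_diff algebra_simps)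
qed

text \<open>
  Expanding the weight in fundamental weights leaves two neighbouring terms \<open>(\<omega>\<^sub>j, 2\<rho>) = j (r + 1 - j)\<close>.
  The direction of the chain is irrelevant, because this value is symmetric under reversal of the
  diagram.
\<close>

lemma wform_chain_two_rho:
  assumes nd: "bij_betw nd {1..r} {1..r}" and sq: "\<And>j. j \<in> {1..r} \<Longrightarrow> nd j = j \<or> nd j = r + 1 - j"
    and "\<nu> \<in> weight_lattice r" "k \<in> {1..r + 1}"
    and ex: "\<And>j. j \<in> {1..r} \<Longrightarrow> wform r (simple_root (nd j)) \<nu> = chain_exp j k"
  shows "wform r \<nu> (two_rho r) = real (r + 2) - 2 * real k"
proof -
  have "wform r \<nu> (two_rho r) = (\<Sum>i = 1..r. wform r (simple_root i) \<nu> * (real i * real (r + 1 - i)))"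
    by (subst weight_lattice_expand[OF assms(3)], subst wform_sum_left) (simp add: wform_two_rho)
  also have "\<dots> = (\<Sum>j = 1..r. wform r (simple_root (nd j)) \<nu> * (real (nd j) * real (r + 1 - nd j)))"
    by (rule sum.reindex_bij_betw[OF nd, symmetric])
  also have "\<dots> = (\<Sum>j = 1..r. chain_exp j k * (real j * real (r + 1 - j)))"
    using sq ex by (intro sum.cong refl) fastforce
  also have "\<dots> = (\<Sum>j = 1..r. (if j = k then real j * real (r + 1 - j) else 0) - (if j = k - 1 then real j * real (r + 1 - j) else 0))"
    using assms(4) by (intro sum.cong refl) (auto simp: chain_exp_def)
  also have "\<dots> = real k * real (r + 1 - k) - real (k - 1) * real (r + 1 - (k - 1))"
    unfolding sum_subtractf sum.delta[OF finite_atLeastAtMost]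
    using assms(4) by (cases "k = 1"; cases "k = r + 1") auto
  also have "\<dots> = real (r + 2) - 2 * real k"
    using assms(4) by (simp add: of_nat_diff algebra_simps)
  finally show ?thesis .
qed

text \<open>
  Explicit braidings for \<open>V\<close> and its dual, in terms of \<open>u = q\<close> and \<open>C = q^w\<close>.  The
  scalars follow from the normalisation on extremal vectors: \<open>w\<^sub>0\<close> maps \<open>\<omega>\<^sub>s\<close> to
  \<open>- \<omega>'\<close> with \<open>\<omega>'\<close> the highest weight of the dual; it pairs to \<open>w - 1\<close> with \<open>\<omega>\<^sub>s\<close> and to \<open>- w\<close> with
  \<open>\<omega>'\<close>.
\<close>

theorem quantum_data_R_matrices:
  fixes D :: "('n::finite) qdata"
  assumes D: "quantum_data D"
  defines "u \<equiv> qq D 1" and "C \<equiv> qq D (exp_w D)"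
  obtains pos where "bij_betw pos UNIV {1..rank D + 1}"
    "R_VV D = hecke pos u (C / u)"
    "R_VdVd D = hecke (\<lambda>i. rank D + 2 - pos i) u (C / u)"
    "R_VVd D = crossd pos u (1 / C)"
    "\<And>i. q2rho D i * u ^ (2 * pos i) = u ^ (rank D + 2)"
    "exp_a D = 2" "exp_m D = real (rank D)"
proof -
  define r q X nd s where "r = rank D" and "q = qpar D" and "X = Vmod D" and "nd = node_order D" and "s = node D"
  have r: "r \<ge> 1" and s: "s = 1 \<or> s = r" and q: "0 < q" "q < 1"
    and wv: "\<And>i. weight_vector r q X (wts D i) (axis i 1)"
    using D by (auto simp: quantum_data_def r_def q_def X_def s_def)
  have u: "u = qpow q 1" and u0: "u \<noteq> 0" and C0: "C \<noteq> 0" using q by (simp_all add: u_def C_def qq_def q_def)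
  obtain pos f where ch: "chain_rep r q X nd pos f"
    and ex: "\<And>i j. j \<in> {1..r} \<Longrightarrow> wform r (simple_root (nd j)) (wts D i) = chain_exp j (pos i)"
    using quantum_data_chain[OF D] unfolding r_def q_def X_def nd_def by blast
  note chd = chain_rep_dual[OF ch q(1)]
  have nd1: "nd 1 = s" "nd (r + 1 - 1) = r + 1 - s" using s by (auto simp: nd_def node_order_def r_def s_def)
  have w: "exp_w D = real s - real s * real s / real (r + 1)"
    unfolding exp_w_def omega_s_def r_def[symmetric] s_def[symmetric] using s r
    by (subst wform_fund_weights) auto
  have w1: "wform r (fund_weight r s) (longest r (fund_weight r s)) = exp_w D - 1"
    "wform r (fund_weight r s) (longest r (fund_weight r (r + 1 - s))) = - exp_w D"
    "wform r (fund_weight r (r + 1 - s)) (longest r (fund_weight r (r + 1 - s))) = exp_w D - 1"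
  proof -
    define n where "n = real (r + 1)"
    have n: "n > 0" "real r = n - 1" by (simp_all add: n_def)
    have s': "s \<le> r" "1 \<le> s" "r + 1 - s \<le> r" "1 \<le> r + 1 - s" "r + 1 - (r + 1 - s) = s" using s r by auto
    have m: "real (min s (r + 1 - s)) = 1" "real (min (r + 1 - s) s) = 1" "real (min s s) = real s"
      "real (r + 1 - s) = n - real s" "real s = 1 \<or> real s = n - 1"
      using s r n by (auto simp: of_nat_diff)
    show "wform r (fund_weight r s) (longest r (fund_weight r s)) = exp_w D - 1"
      "wform r (fund_weight r s) (longest r (fund_weight r (r + 1 - s))) = - exp_w D"
      "wform r (fund_weight r (r + 1 - s)) (longest r (fund_weight r (r + 1 - s))) = exp_w D - 1"
      unfolding w wform_longest[OF s'(1) s'(1,2)] wform_longest[OF s'(1) s'(3,4)] wform_longest[OF s'(3) s'(3,4)]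
        s'(5) m(1-4) n_def[symmetric]
      using m(5) n(1) by (auto simp: field_simps)
  qed
  have Cq: "qpow q (exp_w D - 1) = C / u" "qpow q (- exp_w D) = 1 / C"
    using q qpow_add[OF q(1), of "exp_w D" "- 1"]
    by (simp_all add: C_def qq_def q_def[symmetric] qpow_minus u divide_inverse)
  obtain x1 where x1: "pos x1 = 1" using chain_pos(4)[OF ch, of 1] by auto
  obtain xN where xN: "pos xN = r + 1" using chain_pos(4)[OF ch, of "r + 1"] by auto
  have ne: "x1 \<noteq> xN" using x1 xN r by auto
  have "R_VV D = hecke pos u (C / u)"
    unfolding R_VV_def r_def[symmetric] q_def[symmetric] X_def[symmetric] u
  proof (rule braiding_chain[OF ch ch q r hecke_intertwines[OF ch q(1)] x1 xN])
    fix t show "hecke pos (qpow q 1) (C / qpow q 1) $ t $ (x1, xN) =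
         (if t = (xN, x1) then qpow q (wform r (fund_weight r (nd 1)) (longest r (fund_weight r (nd 1)))) else 0)"
      unfolding nd1 w1 Cq using ne x1 xN by (cases t) (auto simp: hecke_entry u)
  qed
  moreover have "R_VdVd D = hecke (\<lambda>i. rank D + 2 - pos i) u (C / u)"
    unfolding R_VdVd_def r_def[symmetric] q_def[symmetric] X_def[symmetric] u
  proof (rule braiding_chain[OF chd chd q r hecke_intertwines[OF chd q(1)]])
    show "r + 2 - pos xN = 1" "r + 2 - pos x1 = r + 1" by (simp_all add: x1 xN)
    fix t show "hecke (\<lambda>i. r + 2 - pos i) (qpow q 1) (C / qpow q 1) $ t $ (xN, x1) =
         (if t = (x1, xN) then qpow q (wform r (fund_weight r (nd (r + 1 - 1))) (longest r (fund_weight r (nd (r + 1 - 1))))) else 0)"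
      unfolding nd1 w1 Cq using ne x1 xN by (cases t) (auto simp: hecke_entry u)
  qed
  moreover have "R_VVd D = crossd pos u (1 / C)"
    unfolding R_VVd_def r_def[symmetric] q_def[symmetric] X_def[symmetric] u
  proof (rule braiding_chain[OF ch chd q r crossd_intertwines[OF ch q(1)] x1])
    show "r + 2 - pos x1 = r + 1" by (simp add: x1)
    fix t show "crossd pos (qpow q 1) (1 / C) $ t $ (x1, x1) =
         (if t = (x1, x1) then qpow q (wform r (fund_weight r (nd 1)) (longest r (fund_weight r (nd (r + 1 - 1))))) else 0)"
      unfolding nd1 w1 Cq using x1 chain_pos(2)[OF ch]
      by (cases t) (auto simp: crossd_entry cross_coef_def dest: leD)
  qed
  moreover have "q2rho D i * u ^ (2 * pos i) = u ^ (rank D + 2)" for i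
  proof -
    have "wform r (wts D i) (two_rho r) = real (r + 2) - 2 * real (pos i)"
    proof (rule wform_chain_two_rho[OF chain_bij(2)[OF ch]])
      show "wts D i \<in> weight_lattice r" using wv by (simp add: weight_vector_def)
      show "pos i \<in> {1..r + 1}" using chain_pos(2,3)[OF ch] by simp
      show "nd j = j \<or> nd j = r + 1 - j" for j by (simp add: nd_def node_order_def r_def)
    qed (rule ex)
    then have "q2rho D i = qpow q (real (r + 2) - real (2 * pos i))"
      by (simp add: q2rho_def qq_def q_def r_def)
    moreover have "qpow q (real (r + 2) - real (2 * pos i)) * qpow q (real (2 * pos i)) = qpow q (real (r + 2))"
      by (subst qpow_add[OF q(1), symmetric]) simp
    ultimately show ?thesis unfolding r_def[symmetric] u by (metis qpow_nat[OF q(1)])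
  qed
  moreover have "exp_a D = 2" unfolding exp_a_def using s r
    by (subst wform_simple_roots) (auto simp: cartan_def r_def s_def)
  moreover have "exp_m D = real (rank D)"
    unfolding exp_m_def omega_s_def r_def[symmetric] s_def[symmetric] using s r
    by (subst wform_two_rho) auto
  ultimately show ?thesis using chain_bij(1)[OF ch] that unfolding r_def by blast
qed

section \<open>Scalar identities between the braidings\<close>

lemma matrix_inv_mult:
  assumes "invertible (A :: complex ^ 'n ^ 'n)"
  shows "A ** matrix_inv A = mat 1" "matrix_inv A ** A = mat 1"
  using someI_ex[OF assms[unfolded invertible_def]] by (simp_all add: matrix_inv_def)

lemma matrix_inv_eqI:
  assumes "(A :: complex ^ 'n ^ 'n) ** B = mat 1"
  shows "matrix_inv A = B"
proof -
  have "invertible A" using assms invertible_right_inverse by blast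
  then have "matrix_inv A ** A = mat 1" by (rule matrix_inv_mult(2))
  then have "B = matrix_inv A ** (A ** B)" by (simp add: matrix_mul_assoc)
  then show ?thesis by (simp add: assms)
qed

text \<open>
  The Hecke relation, in entries.
\<close>

lemma hecke_square:
  fixes pos :: "'n::finite \<Rightarrow> nat"
  assumes "inj pos" "u \<noteq> 0"
  shows "(hecke pos u c ** hecke pos u c) $ (x, y) $ (a, b) =
    c * (u - 1 / u) * hecke pos u c $ (x, y) $ (a, b) + (if x = a \<and> y = b then c\<^sup>2 else 0)"
proof -
  have lt: "pos x < pos y \<or> pos y < pos x" if "x \<noteq> y" for x y
    using assms(1) that by (metis injD linorder_neqE_nat)
  show ?thesis
    unfolding hecke_mult_l hecke_entry using lt[of x y] assms(2)
    by (cases "x = y"; cases "x = a"; cases "y = b"; cases "x = b"; cases "y = a")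
      (auto simp: field_simps power2_eq_square)
qed

lemma matrix_inv_hecke:
  fixes pos :: "'n::finite \<Rightarrow> nat"
  assumes "inj pos" "u \<noteq> 0" "c \<noteq> 0"
  shows "matrix_inv (hecke pos u c) $ (x, y) $ (a, b) =
    (hecke pos u c $ (x, y) $ (a, b) - (if x = a \<and> y = b then c * (u - 1 / u) else 0)) / c\<^sup>2"
proof -
  define J :: "complex ^ ('n \<times> 'n) ^ ('n \<times> 'n)" where
    "J = (\<chi> s t. (hecke pos u c $ s $ t - (if s = t then c * (u - 1 / u) else 0)) / c\<^sup>2)"
  have J: "J $ (x, y) $ (a, b) = (hecke pos u c $ (x, y) $ (a, b) - (if x = a \<and> y = b then c * (u - 1 / u) else 0)) / c\<^sup>2" for x y a b
    by (simp add: J_def)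
  obtain k where k: "c * (u - 1 / u) = k" by blast
  have "hecke pos u c ** J = mat 1"
  proof (rule pair_matrix_eqI)
    fix x y a b
    have "(hecke pos u c ** J) $ (x, y) $ (a, b) =
      ((hecke pos u c ** hecke pos u c) $ (x, y) $ (a, b) - c * (u - 1 / u) * hecke pos u c $ (x, y) $ (a, b)) / c\<^sup>2"
      unfolding matrix_mult_entry J_def k
      by (simp add: right_diff_distrib diff_divide_distrib sum_subtractf sum_divide_distrib
          if_distrib[of "\<lambda>z. _ * z"] if_distrib[of "\<lambda>z. z / _"] mult_ac cong: if_cong)
    then show "(hecke pos u c ** J) $ (x, y) $ (a, b) = (mat 1 :: complex ^ ('n \<times> 'n) ^ ('n \<times> 'n)) $ (x, y) $ (a, b)"
      unfolding hecke_square[OF assms(1,2)] using assms(3) by (simp add: mat_def)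
  qed
  then have "matrix_inv (hecke pos u c) = J"
    by (rule matrix_inv_eqI)
  then show ?thesis by (simp add: J)
qed

text \<open>
  Off the diagonal pairs the matrix is a permutation up to a factor, and on them it is triangular.
\<close>

lemma invertible_crossd:
  fixes pos :: "'n::finite \<Rightarrow> nat"
  assumes inj: "inj pos" and "u \<noteq> 0" "c \<noteq> 0"
  shows "invertible (crossd pos u c)"
proof -
  have ker: "v = 0" if v: "crossd pos u c *v v = 0" for v
  proof -
    have off: "v $ (a, b) = 0" if "a \<noteq> b" for a b
    proof -
      have "(crossd pos u c *v v) $ (b, a) = 0" using v by simp
      moreover have "(crossd pos u c *v v) $ (b, a) = c * u * v $ (a, b) + (\<Sum>a\<in>(UNIV :: 'n set). 0)"
        unfolding matrix_vector_mult_def vec_lambda_beta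
        by (rule sum_pair_delta_diag[where x = a and y = b]) (use that in \<open>auto simp: crossd_entry\<close>)
      ultimately show ?thesis using assms by simp
    qed
    define N where "N = Max (range pos)"
    have N: "pos b \<le> N" for b by (simp add: N_def)
    \<comment> \<open>Back substitution, from the last position down.\<close>
    have diag: "v $ (b, b) = 0" for b
    proof (induction b rule: measure_induct_rule[of "\<lambda>b. N - pos b"])
      case (less b)
      have le: "v $ (a, a) = 0" if "pos b < pos a" for a
        using that N[of a] by (intro less) linarith
      have "(crossd pos u c *v v) $ (b, b) = 0 + (\<Sum>a\<in>UNIV. cross_coef pos u c b a * v $ (a, a))"
        unfolding matrix_vector_mult_def vec_lambda_beta
        by (rule sum_pair_delta_diag[where x = b and y = b]) (auto simp: crossd_entry)
      also have "\<dots> = (\<Sum>a\<in>UNIV. if a = b then c * v $ (b, b) else 0)"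
      proof -
        have "cross_coef pos u c b a * v $ (a, a) = (if a = b then c * v $ (b, b) else 0)" for a
          using le by (auto simp: cross_coef_def)
        then show ?thesis by simp
      qed
      finally show ?case using v assms by simp
    qed
    show "v = 0" using off diag by (simp add: vec_eq_iff) metis
  qed
  then have "\<exists>B. B ** crossd pos u c = mat 1" using matrix_left_invertible_ker by blast
  then show ?thesis using invertible_left_inverse by blast
qed

lemma sum_pos_interval:
  fixes pos :: "'n::finite \<Rightarrow> nat"
  assumes "bij_betw pos UNIV {1..n}" "k \<le> n"
  shows "(\<Sum>j\<in>UNIV. if pos j < k then g (pos j) else (0 :: complex)) = (\<Sum>i = 1..<k. g i)"
proof -
  have "(\<Sum>j\<in>UNIV. if pos j < k then g (pos j) else 0) = (\<Sum>i\<in>{1..n}. if i < k then g i else 0)"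
    by (rule sum.reindex_bij_betw[OF assms(1), of "\<lambda>i. if i < k then g i else 0"])
  also have "\<dots> = (\<Sum>i = 1..<k. g i)"
    using assms(2) by (intro sum.mono_neutral_cong_right) auto
  finally show ?thesis .
qed

text \<open>
  Evaluates a mixed crossing whose outgoing strands are joined by a cap.
\<close>

lemma geometric_telescope: "k \<ge> 1 \<Longrightarrow> (\<Sum>i = 1..<k. ((u :: complex)\<^sup>2 - 1) * u ^ (2 * i)) = u ^ (2 * k) - u\<^sup>2"
  by (induction k rule: dec_induct) (auto simp: algebra_simps power2_eq_square)

lemma divide_neq_0: "(a :: complex) \<noteq> 0 \<Longrightarrow> b \<noteq> 0 \<Longrightarrow> a / b \<noteq> 0"
  by simp

text \<open>
  The properties of the braidings that enter the calculus.  The third one says that a cap over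
  \<open>V* \<otimes> V\<close> absorbs a crossing and becomes a cap over \<open>V \<otimes> V*\<close>.  The fourth and fifth express that a
  strand may be pulled round a cap: turning the mixed braiding by a quarter yields the inverse of the
  braiding of \<open>V\<close> (which the Hecke relation rewrites through the braiding itself), or of \<open>V*\<close>.
\<close>

theorem R_matrix_facts:
  fixes D :: "('n::finite) qdata"
  assumes D: "quantum_data D"
  shows "exp_a D = 2"
    and "invertible (R_VVd D)"
    and "(\<Sum>j\<in>UNIV. R_VVd D $ (j, j) $ (b, c)) = (if b = c then qq D (- exp_w D - exp_m D) * q2rho D b else 0)"
    and "q2rho D a * R_VVd D $ (a, x) $ (b, c) = q2rho D c * (qq D (2 - 2 * exp_w D) *
      (R_VV D $ (x, c) $ (a, b) - (if x = a \<and> c = b then qq D (exp_w D) - qq D (exp_w D - 2) else 0)))"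
    and "q2rho D b * matrix_inv (R_VdVd D) $ (b, x) $ (c, d) = q2rho D d * R_VVd D $ (x, d) $ (b, c)"
    and "q2rho D a \<noteq> 0"
proof -
  define u C r where "u = qq D 1" and "C = qq D (exp_w D)" and "r = rank D"
  obtain pos where pos: "bij_betw pos UNIV {1..r + 1}"
    and R: "R_VV D = hecke pos u (C / u)"
    "R_VdVd D = hecke (\<lambda>i. r + 2 - pos i) u (C / u)"
    "R_VVd D = crossd pos u (1 / C)"
    and rho: "\<And>i. q2rho D i * u ^ (2 * pos i) = u ^ (r + 2)"
    and a: "exp_a D = 2" and m: "exp_m D = real r"
    using quantum_data_R_matrices[OF D] unfolding u_def C_def r_def by metis
  have q: "0 < qpar D" using D by (simp add: quantum_data_def)
  have u: "u \<noteq> 0" and C: "C \<noteq> 0" using q by (simp_all add: u_def C_def qq_def)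
  have inj: "inj pos" using pos by (simp add: bij_betw_def)
  have inje: "pos x = pos y \<longleftrightarrow> x = y" for x y using inj by (simp add: inj_eq)
  have p: "1 \<le> pos i" "pos i \<le> r + 1" for i using bij_betwE[OF pos] by auto
  have inj2: "inj (\<lambda>i. r + 2 - pos i)"
  proof (rule injI)
    fix x y assume "r + 2 - pos x = r + 2 - pos y"
    then have "pos x = pos y" using p(2)[of x] p(2)[of y] by linarith
    then show "x = y" by (simp add: inje)
  qed
  have lt2: "r + 2 - pos x < r + 2 - pos y \<longleftrightarrow> pos y < pos x" for x y using p(2)[of x] p(2)[of y] by linarith
  have rho': "q2rho D i = u ^ (r + 2) / u ^ (2 * pos i)" for i using rho[of i] u by (simp add: field_simps)
  have e1: "qq D (- exp_w D - exp_m D) = 1 / (C * u ^ r)"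
    using q qpow_add[OF q, of "- exp_w D" "- exp_m D"]
    by (simp add: qq_def C_def u_def m qpow_minus qpow_nat divide_inverse)
  have u2: "qpow (qpar D) 2 = u\<^sup>2" using qpow_nat[OF q, of 2] by (simp add: u_def qq_def)
  have e2: "qq D (2 - 2 * exp_w D) = u\<^sup>2 / C\<^sup>2" "qq D (exp_w D - 2) = C / u\<^sup>2"
    using qpow_add[OF q, of 2 "- 2 * exp_w D"] qpow_add[OF q, of "exp_w D" "exp_w D"] qpow_add[OF q, of "exp_w D" "- 2"]
    by (simp_all add: qq_def C_def u2 qpow_minus[OF q] divide_inverse power2_eq_square flip: mult_2)
  show "exp_a D = 2" by (rule a)
  show "q2rho D a \<noteq> 0" using u by (simp add: rho')
  show "invertible (R_VVd D)" unfolding R using inj u C by (intro invertible_crossd) auto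
  show "(\<Sum>j\<in>UNIV. R_VVd D $ (j, j) $ (b, c)) = (if b = c then qq D (- exp_w D - exp_m D) * q2rho D b else 0)"
  proof (cases "b = c")
    case True
    have "(\<Sum>j\<in>UNIV. R_VVd D $ (j, j) $ (b, c)) = (\<Sum>j\<in>UNIV. (if j = b then 1 / C else 0) -
        (if pos j < pos b then (u\<^sup>2 - 1) * u ^ (2 * pos j) else 0) * (1 / (C * u ^ (2 * pos b))))"
      unfolding R using True by (intro sum.cong refl) (auto simp: crossd_entry cross_coef_def)
    also have "\<dots> = 1 / C - (u ^ (2 * pos b) - u\<^sup>2) * (1 / (C * u ^ (2 * pos b)))"
      unfolding sum_subtractf sum_distrib_right[symmetric]
        sum_pos_interval[where g = "\<lambda>i. (u\<^sup>2 - 1) * u ^ (2 * i)", OF pos p(2)] geometric_telescope[OF p(1)] by simp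
    also have "\<dots> = 1 / (C * u ^ r) * q2rho D b"
      using u C by (simp add: rho' field_simps power_add power2_eq_square)
    finally show ?thesis using True by (simp add: e1)
  next
    case False
    then show ?thesis unfolding R by (auto simp: crossd_entry intro!: sum.neutral)
  qed
  show "q2rho D a * R_VVd D $ (a, x) $ (b, c) = q2rho D c * (qq D (2 - 2 * exp_w D) *
      (R_VV D $ (x, c) $ (a, b) - (if x = a \<and> c = b then qq D (exp_w D) - qq D (exp_w D - 2) else 0)))"
    unfolding R crossd_entry hecke_entry e2 C_def[symmetric] rho'
    using u C inje[of a b] p[of a] p[of b]
    by (cases "a = x"; cases "b = c"; cases "a = b"; cases "pos a < pos b")
      (auto simp: cross_coef_def field_simps power2_eq_square)
  show "q2rho D b * matrix_inv (R_VdVd D) $ (b, x) $ (c, d) = q2rho D d * R_VVd D $ (x, d) $ (b, c)"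
    unfolding R matrix_inv_hecke[OF inj2 u divide_neq_0[OF C u]] crossd_entry hecke_entry lt2 rho'
    using u C inje[of b x]
    by (cases "x = d"; cases "b = c"; cases "x = b"; cases "pos x < pos b")
      (auto simp: cross_coef_def field_simps power2_eq_square)
qed

section \<open>Contracting legs\<close>

text \<open>
  Leg operators on scalar families.  An identity between them extends to families with values in any complex
  vector space, since such a family is a combination of its entries with scalar coefficients.
\<close>

type_synonym 'n leg4 = "'n \<Rightarrow> 'n \<Rightarrow> 'n \<Rightarrow> 'n \<Rightarrow> complex"

definition p12 :: "complex ^ ('n::finite \<times> 'n) ^ ('n \<times> 'n) \<Rightarrow> 'n leg4 \<Rightarrow> 'n leg4" where
  "p12 R y = (\<lambda>i j k l. \<Sum>c\<in>UNIV. R $ (i, j) $ c * y (fst c) (snd c) k l)"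

definition p23 :: "complex ^ ('n::finite \<times> 'n) ^ ('n \<times> 'n) \<Rightarrow> 'n leg4 \<Rightarrow> 'n leg4" where
  "p23 R y = (\<lambda>i j k l. \<Sum>c\<in>UNIV. R $ (j, k) $ c * y i (fst c) (snd c) l)"

definition p34 :: "complex ^ ('n::finite \<times> 'n) ^ ('n \<times> 'n) \<Rightarrow> 'n leg4 \<Rightarrow> 'n leg4" where
  "p34 R y = (\<lambda>i j k l. \<Sum>c\<in>UNIV. R $ (k, l) $ c * y i j (fst c) (snd c))"

definition pS :: "('n::finite) qdata \<Rightarrow> 'n leg4 \<Rightarrow> 'n leg4" where
  "pS D y = p23 (R_VVd D) (p12 (R_VV D) (p23 (matrix_inv (R_VVd D)) y))"

definition pSt :: "('n::finite) qdata \<Rightarrow> 'n leg4 \<Rightarrow> 'n leg4" where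
  "pSt D y = p23 (R_VVd D) (p34 (matrix_inv (R_VdVd D)) (p23 (matrix_inv (R_VVd D)) y))"

lemma p23_comp: "p23 A (p23 C y) = p23 (A ** C) y"
proof (intro ext)
  fix i j k l
  have "p23 A (p23 C y) i j k l = (\<Sum>c\<in>UNIV. \<Sum>e\<in>UNIV. A $ (j, k) $ c * C $ c $ e * y i (fst e) (snd e) l)"
    by (simp add: p23_def sum_distrib_left mult_ac)
  also have "\<dots> = (\<Sum>e\<in>UNIV. \<Sum>c\<in>UNIV. A $ (j, k) $ c * C $ c $ e * y i (fst e) (snd e) l)"
    by (rule sum.swap)
  also have "\<dots> = p23 (A ** C) y i j k l"
    by (simp add: p23_def matrix_mult_entry sum_distrib_right)
  finally show "p23 A (p23 C y) i j k l = p23 (A ** C) y i j k l" .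
qed

lemma p23_one: "p23 (mat 1) y = y"
  by (intro ext) (simp add: p23_def mat_def if_distrib[of "\<lambda>z. z * _"] cong: if_cong)

lemma p12_p34: "p12 A (p34 C y) = p34 C (p12 A y)"
  unfolding p12_def p34_def
  by (intro ext) (simp add: sum_distrib_left mult_ac, rule sum.swap)

context
  fixes D :: "('n::finite) qdata"
  assumes D: "quantum_data D"
begin

lemma p23_inv: "p23 (R_VVd D) (p23 (matrix_inv (R_VVd D)) y) = y"
  "p23 (matrix_inv (R_VVd D)) (p23 (R_VVd D) y) = y"
  by (simp_all add: p23_comp p23_one matrix_inv_mult[OF R_matrix_facts(2)[OF D]])

lemma pS_pSt: "pS D (pSt D y) = pSt D (pS D y)"
  by (simp add: pS_def pSt_def p23_inv p12_p34)

text \<open>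
  Closing the two outgoing strands of a mixed crossing.
\<close>

lemma cap_R_VVd: "(\<Sum>j\<in>UNIV. p23 (R_VVd D) y i j j l) =
    qq D (- exp_w D - exp_m D) * (\<Sum>b\<in>UNIV. q2rho D b * y i b b l)"
proof -
  have "(\<Sum>j\<in>UNIV. p23 (R_VVd D) y i j j l) =
      (\<Sum>c\<in>UNIV. (\<Sum>j\<in>UNIV. R_VVd D $ (j, j) $ c) * y i (fst c) (snd c) l)"
    unfolding p23_def sum_distrib_right by (rule sum.swap)
  also have "\<dots> = (\<Sum>b\<in>UNIV. \<Sum>c\<in>UNIV. (if b = c then qq D (- exp_w D - exp_m D) * q2rho D b else 0) * y i b c l)"
    by (simp add: sum_UNIV_pair R_matrix_facts(3)[OF D])
  also have "\<dots> = (\<Sum>b\<in>UNIV. qq D (- exp_w D - exp_m D) * q2rho D b * y i b b l)"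
    by (simp add: if_distrib[of "\<lambda>z. z * _"] cong: if_cong)
  finally show ?thesis by (simp add: sum_distrib_left mult_ac)
qed

lemma qq_simps: "qq D (x + y) = qq D x * qq D y" "qq D 0 = 1" "qq D x \<noteq> 0"
  using D by (simp_all add: quantum_data_def qq_def qpow_add)

text \<open>
  In \<open>S\<close>, the cap first absorbs the outer mixed crossing.  The braiding of \<open>V \<otimes> V\<close> under the new cap is
  turned into a mixed crossing, up to the Hecke term, and this crossing undoes the inner
  inverse crossing.
\<close>

lemma cap_S: "(\<Sum>j\<in>UNIV. pS D z i j j l) =
    qq D (exp_w D - 2 - exp_m D) * (\<Sum>a\<in>UNIV. q2rho D a * z a a i l) +
    (qq D (exp_w D) - qq D (exp_w D - 2)) * (\<Sum>j\<in>UNIV. z i j j l)"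
proof -
  define v where "v = p23 (matrix_inv (R_VVd D)) z"
  define k where "k = qq D (- exp_w D - exp_m D)"
  define be where "be = qq D (exp_w D) - qq D (exp_w D - 2)"
  \<comment> \<open>The inverse of the scalar of the quarter turn.\<close>
  define P where "P = qq D (2 * exp_w D - 2)"
  have P: "P * qq D (2 - 2 * exp_w D) = 1" unfolding P_def by (simp flip: qq_simps(1) add: qq_simps(2))
  have kP: "k * P = qq D (exp_w D - 2 - exp_m D)" unfolding k_def P_def qq_simps(1)[symmetric] by (simp add: algebra_simps)
  have z: "z = p23 (R_VVd D) v" by (simp add: v_def p23_inv)
  \<comment> \<open>A quarter turn of the crossing, with the scalar moved to the other side.\<close>
  have B: "q2rho D b * R_VV D $ (i, b) $ (a, c) =
      P * (q2rho D a * R_VVd D $ (a, i) $ (c, b)) + (if c = b then if a = i then q2rho D b * be else 0 else 0)" for a b c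
  proof -
    have "P * (q2rho D a * R_VVd D $ (a, i) $ (c, b)) =
        (P * qq D (2 - 2 * exp_w D)) * (q2rho D b * (R_VV D $ (i, b) $ (a, c) - (if i = a \<and> b = c then be else 0)))"
      unfolding R_matrix_facts(4)[OF D] be_def by (simp only: mult_ac)
    then show ?thesis unfolding P by (auto simp: algebra_simps)
  qed
  have "(\<Sum>j\<in>UNIV. pS D z i j j l) = k * (\<Sum>b\<in>UNIV. q2rho D b * p12 (R_VV D) v i b b l)"
    unfolding pS_def v_def[symmetric] k_def by (rule cap_R_VVd)
  also have "(\<Sum>b\<in>UNIV. q2rho D b * p12 (R_VV D) v i b b l) =
      (\<Sum>b\<in>UNIV. \<Sum>a\<in>UNIV. \<Sum>c\<in>UNIV. q2rho D b * R_VV D $ (i, b) $ (a, c) * v a c b l)"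
    by (simp add: p12_def sum_UNIV_pair sum_distrib_left mult_ac)
  also have "\<dots> = (\<Sum>b\<in>UNIV. \<Sum>a\<in>UNIV. \<Sum>c\<in>UNIV. P * (q2rho D a * R_VVd D $ (a, i) $ (c, b)) * v a c b l)
      + (\<Sum>b\<in>UNIV. \<Sum>a\<in>UNIV. \<Sum>c\<in>UNIV. if c = b then if a = i then q2rho D b * be * v i b b l else 0 else 0)"
    unfolding B sum.distrib[symmetric] by (intro sum.cong refl) (simp add: distrib_right)
  also have "(\<Sum>b\<in>UNIV. \<Sum>a\<in>UNIV. \<Sum>c\<in>UNIV. if c = b then if a = i then q2rho D b * be * v i b b l else 0 else 0)
      = be * (\<Sum>b\<in>UNIV. q2rho D b * v i b b l)"
    by (simp add: sum_distrib_left mult_ac)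
  also have "(\<Sum>b\<in>UNIV. \<Sum>a\<in>UNIV. \<Sum>c\<in>UNIV. P * (q2rho D a * R_VVd D $ (a, i) $ (c, b)) * v a c b l)
      = P * (\<Sum>a\<in>UNIV. q2rho D a * z a a i l)"
  proof -
    have "(\<Sum>b\<in>UNIV. \<Sum>a\<in>UNIV. \<Sum>c\<in>UNIV. P * (q2rho D a * R_VVd D $ (a, i) $ (c, b)) * v a c b l)
      = (\<Sum>a\<in>UNIV. \<Sum>b\<in>UNIV. \<Sum>c\<in>UNIV. P * (q2rho D a * R_VVd D $ (a, i) $ (c, b)) * v a c b l)"
      by (rule sum.swap)
    also have "\<dots> = (\<Sum>a\<in>UNIV. \<Sum>c\<in>UNIV. \<Sum>b\<in>UNIV. P * (q2rho D a * R_VVd D $ (a, i) $ (c, b)) * v a c b l)"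
      by (intro sum.cong refl sum.swap)
    finally show ?thesis unfolding z by (simp add: p23_def sum_UNIV_pair sum_distrib_left mult_ac)
  qed
  also have "k * (P * (\<Sum>a\<in>UNIV. q2rho D a * z a a i l) + be * (\<Sum>b\<in>UNIV. q2rho D b * v i b b l)) =
      k * P * (\<Sum>a\<in>UNIV. q2rho D a * z a a i l) + be * (\<Sum>j\<in>UNIV. z i j j l)"
    using cap_R_VVd[of v i l] by (simp add: z k_def algebra_simps)
  finally show ?thesis by (simp add: kP be_def)
qed

text \<open>
  As for \<open>S\<close>.  The middle crossing of \<open>S~\<close> is an inverse, which turns into a mixed crossing
  without a Hecke term.
\<close>

lemma cap_St: "(\<Sum>j\<in>UNIV. pSt D z i j j l) = qq D (- exp_w D - exp_m D) * (\<Sum>a\<in>UNIV. q2rho D a * z i l a a)"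
proof -
  define v where "v = p23 (matrix_inv (R_VVd D)) z"
  define k where "k = qq D (- exp_w D - exp_m D)"
  have z: "z = p23 (R_VVd D) v" by (simp add: v_def p23_inv)
  have "(\<Sum>j\<in>UNIV. pSt D z i j j l) = k * (\<Sum>b\<in>UNIV. q2rho D b * p34 (matrix_inv (R_VdVd D)) v i b b l)"
    unfolding pSt_def v_def[symmetric] k_def by (rule cap_R_VVd)
  also have "(\<Sum>b\<in>UNIV. q2rho D b * p34 (matrix_inv (R_VdVd D)) v i b b l) =
      (\<Sum>b\<in>UNIV. \<Sum>c\<in>UNIV. \<Sum>d\<in>UNIV. q2rho D d * R_VVd D $ (l, d) $ (b, c) * v i b c d)"
    by (simp add: p34_def sum_UNIV_pair sum_distrib_left mult.assoc[symmetric] R_matrix_facts(5)[OF D])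
  also have "\<dots> = (\<Sum>b\<in>UNIV. \<Sum>d\<in>UNIV. \<Sum>c\<in>UNIV. q2rho D d * R_VVd D $ (l, d) $ (b, c) * v i b c d)"
    by (intro sum.cong refl sum.swap)
  also have "\<dots> = (\<Sum>d\<in>UNIV. \<Sum>b\<in>UNIV. \<Sum>c\<in>UNIV. q2rho D d * R_VVd D $ (l, d) $ (b, c) * v i b c d)"
    by (rule sum.swap)
  also have "\<dots> = (\<Sum>d\<in>UNIV. q2rho D d * z i l d d)"
    unfolding z by (simp add: p23_def sum_UNIV_pair sum_distrib_left mult_ac)
  finally show ?thesis by (simp add: k_def)
qed

end

context cspace begin

text \<open>
  The evaluation of scalar coordinates at a finite family of vectors, through which scalar
  identities are transported.
\<close>

definition Lin :: "('t::finite \<Rightarrow> 'm) \<Rightarrow> ('t \<Rightarrow> complex) \<Rightarrow> 'm" where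
  "Lin X c = (\<Oplus>\<^bsub>M\<^esub>t\<in>UNIV. c t \<odot>\<^bsub>M\<^esub> X t)"

context
  fixes X :: "'t::finite \<Rightarrow> 'm"
  assumes X: "\<And>t. X t \<in> carrier M"
begin

lemma Lin_closed [simp]: "Lin X c \<in> carrier M"
  using X by (simp add: Lin_def Pi_def)

lemma Lin_add: "Lin X c \<oplus>\<^bsub>M\<^esub> Lin X d = Lin X (\<lambda>t. c t + d t)"
  unfolding Lin_def using X by (simp add: smult_l_distr finsum_addf Pi_def)

lemma Lin_smult: "r \<odot>\<^bsub>M\<^esub> Lin X c = Lin X (\<lambda>t. r * c t)"
  unfolding Lin_def using X by (simp add: smult_finsum smult_assoc)

lemma Lin_zero: "Lin X (\<lambda>t. 0) = \<zero>\<^bsub>M\<^esub>"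
  unfolding Lin_def using X by (simp add: finsum_zero)

lemma Lin_sum: "finite A \<Longrightarrow> (\<Oplus>\<^bsub>M\<^esub>i\<in>A. Lin X (c i)) = Lin X (\<lambda>t. \<Sum>i\<in>A. c i t)"
  by (induction A rule: finite_induct) (simp_all add: Lin_zero Lin_add Pi_def)

lemma Lin_unit: "Lin X (\<lambda>t. if t = s then 1 else 0) = X s"
proof -
  have "Lin X (\<lambda>t. if t = s then 1 else 0) = (\<Oplus>\<^bsub>M\<^esub>t\<in>UNIV. if s = t then X t else \<zero>\<^bsub>M\<^esub>)"
    unfolding Lin_def using X by (intro finsum_cong') auto
  also have "\<dots> = X s" using X by (intro finsum_singleton) auto
  finally show ?thesis .
qed

lemma leg12_Lin: "leg12 M R (\<lambda>i j k l. Lin X (\<lambda>t. y t i j k l)) = (\<lambda>i j k l. Lin X (\<lambda>t. p12 R (y t) i j k l))"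
  by (intro ext) (simp add: leg12_def Lin_smult Lin_sum p12_def)

lemma leg23_Lin: "leg23 M R (\<lambda>i j k l. Lin X (\<lambda>t. y t i j k l)) = (\<lambda>i j k l. Lin X (\<lambda>t. p23 R (y t) i j k l))"
  by (intro ext) (simp add: leg23_def Lin_smult Lin_sum p23_def)

lemma leg34_Lin: "leg34 M R (\<lambda>i j k l. Lin X (\<lambda>t. y t i j k l)) = (\<lambda>i j k l. Lin X (\<lambda>t. p34 R (y t) i j k l))"
  by (intro ext) (simp add: leg34_def Lin_smult Lin_sum p34_def)

lemma S123_Lin: "S123 D M (\<lambda>i j k l. Lin X (\<lambda>t. y t i j k l)) = (\<lambda>i j k l. Lin X (\<lambda>t. pS D (y t) i j k l))"
  unfolding S123_def pS_def leg23_Lin leg12_Lin ..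

lemma St234_Lin: "St234 D M (\<lambda>i j k l. Lin X (\<lambda>t. y t i j k l)) = (\<lambda>i j k l. Lin X (\<lambda>t. pSt D (y t) i j k l))"
  unfolding St234_def pSt_def leg23_Lin leg34_Lin ..

end

lemma fam4_Lin:
  fixes x :: "('n::finite, 'm) fam4"
  assumes "\<And>i j k l. x i j k l \<in> carrier M"
  shows "x = (\<lambda>i j k l. Lin (\<lambda>(i, j, k, l). x i j k l) (\<lambda>t. if t = (i, j, k, l) then 1 else 0))"
  by (intro ext, subst Lin_unit) (auto simp: assms)

context
  fixes D :: "('n::finite) qdata" and x :: "('n, 'm) fam4"
  assumes D: "quantum_data D" and x: "\<And>i j k l. x i j k l \<in> carrier M"
begin

text \<open>
  The coefficient of the second contraction is the Hecke term; for \<open>S~\<close> there is none.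
\<close>

lemma E23_S123: "E23 M (S123 D M x) i l =
    qq D (exp_w D - 2 - exp_m D) \<odot>\<^bsub>M\<^esub> E'12 D M (\<lambda>a b. x a b i l) \<oplus>\<^bsub>M\<^esub>
    (qq D (exp_w D) - qq D (exp_w D - 2)) \<odot>\<^bsub>M\<^esub> E23 M x i l"
proof -
  define X where "X = (\<lambda>(i, j, k, l). x i j k l)"
  have X: "X t \<in> carrier M" for t using x by (auto simp: X_def split: prod.split)
  have xl: "x = (\<lambda>i j k l. Lin X (\<lambda>t. (\<lambda>t i j k l. if t = (i, j, k, l) then 1 else 0) t i j k l))"
    using fam4_Lin[of x] x by (simp add: X_def)
  show ?thesis
    by (subst (1 2 3) xl) (simp add: E23_def E'12_def S123_Lin[OF X] Lin_sum[OF X] Lin_smult[OF X] Lin_add[OF X] cap_S[OF D])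
qed

lemma E23_St234: "E23 M (St234 D M x) i l =
    qq D (- exp_w D - exp_m D) \<odot>\<^bsub>M\<^esub> E'12 D M (\<lambda>a b. x i l a b)"
proof -
  define X where "X = (\<lambda>(i, j, k, l). x i j k l)"
  have X: "X t \<in> carrier M" for t using x by (auto simp: X_def split: prod.split)
  have xl: "x = (\<lambda>i j k l. Lin X (\<lambda>t. (\<lambda>t i j k l. if t = (i, j, k, l) then 1 else 0) t i j k l))"
    using fam4_Lin[of x] x by (simp add: X_def)
  show ?thesis
    by (subst (1 2) xl) (simp add: E23_def E'12_def St234_Lin[OF X] Lin_sum[OF X] Lin_smult[OF X] cap_St[OF D])
qed

text \<open>
  The outer crossings of \<open>S\<close> and of \<open>S~\<close> act on the same two legs and cancel each other in the middle;
  the inner ones act on disjoint legs.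
\<close>

lemma S123_St234: "S123 D M (St234 D M x) = St234 D M (S123 D M x)"
proof -
  define X where "X = (\<lambda>(i, j, k, l). x i j k l)"
  have X: "X t \<in> carrier M" for t using x by (auto simp: X_def split: prod.split)
  have xl: "x = (\<lambda>i j k l. Lin X (\<lambda>t. (\<lambda>t i j k l. if t = (i, j, k, l) then 1 else 0) t i j k l))"
    using fam4_Lin[of x] x by (simp add: X_def)
  show ?thesis
    by (subst (1 2) xl) (simp only: S123_Lin[OF X] St234_Lin[OF X] pS_pSt[OF D])
qed

end

lemma finsum_in:
  assumes "\<zero>\<^bsub>M\<^esub> \<in> W" "\<And>x y. x \<in> W \<Longrightarrow> y \<in> W \<Longrightarrow> x \<oplus>\<^bsub>M\<^esub> y \<in> W" "W \<subseteq> carrier M" "finite A"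
    "\<And>i. i \<in> A \<Longrightarrow> f i \<in> W"
  shows "finsum M f A \<in> W"
  using assms(4,5)
proof (induction A rule: finite_induct)
  case (insert a F)
  then have "f \<in> F \<rightarrow> carrier M" "f a \<in> carrier M" using assms(3) by auto
  with insert show ?case using assms(2) by simp
qed (simp add: assms(1))

text \<open>
  Complex subspaces.  Leg operators take linear combinations of entries, so a family with entries in a
  subspace stays in it; this is all that is needed of the leg operators in the vanishing arguments.
\<close>

definition csub :: "'m set \<Rightarrow> bool" where
  "csub W \<longleftrightarrow> \<zero>\<^bsub>M\<^esub> \<in> W \<and> (\<forall>x\<in>W. \<forall>y\<in>W. x \<oplus>\<^bsub>M\<^esub> y \<in> W) \<and> (\<forall>c. \<forall>x\<in>W. c \<odot>\<^bsub>M\<^esub> x \<in> W) \<and> W \<subseteq> carrier M"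

lemma csub_carrier: "csub (carrier M)"
  by (simp add: csub_def)

lemma csub_finsum: "csub W \<Longrightarrow> finite A \<Longrightarrow> (\<And>i. i \<in> A \<Longrightarrow> f i \<in> W) \<Longrightarrow> finsum M f A \<in> W"
  by (rule finsum_in) (auto simp: csub_def)

lemma csub_smult: "csub W \<Longrightarrow> x \<in> W \<Longrightarrow> c \<odot>\<^bsub>M\<^esub> x \<in> W"
  by (simp add: csub_def)

lemma legs_in:
  fixes x :: "('n::finite, 'm) fam4"
  assumes W: "csub W" and x: "\<And>i j k l. x i j k l \<in> W"
  shows "leg12 M R x i j k l \<in> W" "leg23 M R x i j k l \<in> W" "leg34 M R x i j k l \<in> W"
  unfolding leg12_def leg23_def leg34_def using x
  by (auto intro!: csub_finsum[OF W] csub_smult[OF W])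

lemma S123_in: fixes x :: "('n::finite, 'm) fam4"
  assumes W: "csub W" and x: "\<And>i j k l. x i j k l \<in> W"
  shows "S123 D M x i j k l \<in> W" "St234 D M x i j k l \<in> W"
    "S123_inv D M x i j k l \<in> W" "St234_inv D M x i j k l \<in> W"
  unfolding S123_def St234_def S123_inv_def St234_inv_def by (intro legs_in[OF W] x)+

lemma leg_scale:
  fixes x :: "('n::finite, 'm) fam4"
  assumes x: "\<And>i j k l. x i j k l \<in> carrier M"
  shows "leg12 M R (fscale4 M c x) = fscale4 M c (leg12 M R x)"
    "leg23 M R (fscale4 M c x) = fscale4 M c (leg23 M R x)"
    "leg34 M R (fscale4 M c x) = fscale4 M c (leg34 M R x)"
  unfolding leg12_def leg23_def leg34_def fscale4_def using x
  by (simp_all add: smult_finsum mult.commute[of c] flip: smult_assoc)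

lemma S123_scale:
  fixes x :: "('n::finite, 'm) fam4"
  assumes x: "\<And>i j k l. x i j k l \<in> carrier M"
  shows "S123 D M (fscale4 M c x) = fscale4 M c (S123 D M x)"
  unfolding S123_def by (subst leg_scale, (intro legs_in[OF csub_carrier] x)+)+ simp

end

lemma lin_map_add_map: "lin_map M N f \<Longrightarrow> add_map M N f"
  by (simp add: lin_map_def add_map_def)

lemma lin_map_finsum:
  assumes "cspace M" "cspace N" "lin_map M N f" "finite A" "\<And>i. i \<in> A \<Longrightarrow> x i \<in> carrier M"
  shows "f (\<Oplus>\<^bsub>M\<^esub>i\<in>A. c i \<odot>\<^bsub>M\<^esub> x i) = (\<Oplus>\<^bsub>N\<^esub>i\<in>A. c i \<odot>\<^bsub>N\<^esub> f (x i))"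
proof -
  interpret M: cspace M by fact
  interpret N: cspace N by fact
  have "f (\<Oplus>\<^bsub>M\<^esub>i\<in>A. c i \<odot>\<^bsub>M\<^esub> x i) = (\<Oplus>\<^bsub>N\<^esub>i\<in>A. f (c i \<odot>\<^bsub>M\<^esub> x i))"
    using assms(4,5) by (intro add_map_finsum[OF M.abelian_group_axioms N.abelian_group_axioms lin_map_add_map[OF assms(3)]]) auto
  also have "\<dots> = (\<Oplus>\<^bsub>N\<^esub>i\<in>A. c i \<odot>\<^bsub>N\<^esub> f (x i))"
    using assms(3,5) by (intro N.finsum_cong') (auto simp: lin_map_def)
  finally show ?thesis .
qed

lemma lin_map_legs:
  fixes x :: "('n::finite, 'm) fam4"
  assumes "cspace M" "cspace N" "lin_map M N f" "\<And>i j k l. x i j k l \<in> carrier M"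
  shows "(\<lambda>i j k l. f (leg12 M R x i j k l)) = leg12 N R (\<lambda>i j k l. f (x i j k l))"
    "(\<lambda>i j k l. f (leg23 M R x i j k l)) = leg23 N R (\<lambda>i j k l. f (x i j k l))"
    "(\<lambda>i j k l. f (leg34 M R x i j k l)) = leg34 N R (\<lambda>i j k l. f (x i j k l))"
  unfolding leg12_def leg23_def leg34_def
  by (intro ext lin_map_finsum[OF assms(1-3)]; simp add: assms(4))+

lemma lin_map_S123:
  fixes x :: "('n::finite, 'm) fam4"
  assumes "cspace M" "cspace N" "lin_map M N f" "\<And>i j k l. x i j k l \<in> carrier M"
  shows "(\<lambda>i j k l. f (S123 D M x i j k l)) = S123 D N (\<lambda>i j k l. f (x i j k l))"
    "(\<lambda>i j k l. f (St234 D M x i j k l)) = St234 D N (\<lambda>i j k l. f (x i j k l))"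
proof -
  interpret M: cspace M by fact
  note c = M.legs_in[OF M.csub_carrier]
  show "(\<lambda>i j k l. f (S123 D M x i j k l)) = S123 D N (\<lambda>i j k l. f (x i j k l))"
    unfolding S123_def by (simp add: lin_map_legs[OF assms(1-3)] c assms(4))
  show "(\<lambda>i j k l. f (St234 D M x i j k l)) = St234 D N (\<lambda>i j k l. f (x i j k l))"
    unfolding St234_def by (simp add: lin_map_legs[OF assms(1-3)] c assms(4))
qed

section \<open>The coordinate algebra\<close>

lemma ring_transfer:
  assumes "ring Q" "carrier R = carrier Q" "\<zero>\<^bsub>R\<^esub> = \<zero>\<^bsub>Q\<^esub>" "\<one>\<^bsub>R\<^esub> = \<one>\<^bsub>Q\<^esub>"
    "ring.add R = ring.add Q" "monoid.mult R = monoid.mult Q"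
  shows "ring R"
proof -
  interpret Q: ring Q by fact
  show ?thesis
  proof (rule ringI)
    show "abelian_group R" by (rule abelian_group_transfer[OF Q.abelian_group_axioms]) (simp_all add: assms)
    show "Group.monoid R" by (rule monoidI) (simp_all add: assms Q.m_assoc)
  qed (simp_all add: assms Q.l_distr Q.r_distr)
qed

lemma single_central: "Poly_Mapping.single 0 (c :: complex) * f = (f :: ('x free_word \<Rightarrow>\<^sub>0 complex)) * Poly_Mapping.single 0 c"
proof (induction f rule: update_induct)
  case const then show ?case by simp
next
  case (update f a b)
  have "Poly_Mapping.update a b f = f + Poly_Mapping.single a b"
    using update(1) by (intro poly_mapping_eqI) (auto simp: lookup_update lookup_add lookup_single when_def in_keys_iff)
  then show ?case using update(3)
    by (simp add: distrib_left distrib_right mult_single mult.commute[of c])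
qed

text \<open>
  The constant terms are central, although words do not commute.
\<close>

lemma calg_free_algebra: "calg (free_algebra :: (complex, 'a free_word \<Rightarrow>\<^sub>0 complex) module)"
proof -
  have "ring (free_algebra :: (complex, 'a free_word \<Rightarrow>\<^sub>0 complex) module)"
  proof (rule ringI)
    show "abelian_group (free_algebra :: (complex, 'a free_word \<Rightarrow>\<^sub>0 complex) module)"
    proof (rule abelian_groupI)
      fix x :: "'a free_word \<Rightarrow>\<^sub>0 complex"
      show "\<exists>y\<in>carrier free_algebra. y \<oplus>\<^bsub>free_algebra\<^esub> x = \<zero>\<^bsub>free_algebra\<^esub>"
        by (rule bexI[of _ "- x"]) (simp_all add: free_algebra_def)
    qed (simp_all add: free_algebra_def ac_simps)
    show "Group.monoid (free_algebra :: (complex, 'a free_word \<Rightarrow>\<^sub>0 complex) module)" by (rule monoidI) (auto simp: free_algebra_def mult.assoc)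
  qed (auto simp: free_algebra_def distrib_left distrib_right)
  then interpret F: ring "free_algebra :: (complex, 'a free_word \<Rightarrow>\<^sub>0 complex) module" .
  show ?thesis
  proof unfold_locales
    fix c c' :: complex and b :: "'a free_word \<Rightarrow>\<^sub>0 complex"
    show "b \<otimes>\<^bsub>free_algebra\<^esub> (c \<odot>\<^bsub>free_algebra\<^esub> \<one>\<^bsub>free_algebra\<^esub>) =
        (c \<odot>\<^bsub>free_algebra\<^esub> \<one>\<^bsub>free_algebra\<^esub>) \<otimes>\<^bsub>free_algebra\<^esub> b"
      using single_central[of c b] by (simp add: free_algebra_def)
    have "Poly_Mapping.single (0 :: 'a free_word) 1 = (1 :: _ \<Rightarrow>\<^sub>0 complex)" by (rule single_one)
    then show "1 \<odot>\<^bsub>free_algebra\<^esub> \<one>\<^bsub>free_algebra\<^esub> = (\<one>\<^bsub>free_algebra\<^esub> :: 'a free_word \<Rightarrow>\<^sub>0 complex)"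
      by (simp add: free_algebra_def)
  qed (simp_all add: free_algebra_def mult_single single_add)
qed

locale calg_quot = F: calg F for F :: "(complex, 'f) module" +
  fixes I :: "'f set"
  assumes I: "ideal I F"
begin

definition "BQ = \<lparr>carrier = carrier (F Quot I), monoid.mult = monoid.mult (F Quot I), monoid.one = \<one>\<^bsub>F Quot I\<^esub>,
  ring.zero = \<zero>\<^bsub>F Quot I\<^esub>, ring.add = ring.add (F Quot I),
  module.smult = (\<lambda>c X. \<Union>x\<in>X. I +>\<^bsub>F\<^esub> (c \<odot>\<^bsub>F\<^esub> x))\<rparr>"

sublocale I: ideal I F by (rule I)

definition pr where "pr x = I +>\<^bsub>F\<^esub> x"

lemma carrier_BQ: "carrier BQ = pr ` carrier F"
  by (auto simp: BQ_def FactRing_def A_RCOSETS_def' pr_def)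

lemma mult_BQ: "x \<in> carrier F \<Longrightarrow> y \<in> carrier F \<Longrightarrow> pr x \<otimes>\<^bsub>BQ\<^esub> pr y = pr (x \<otimes>\<^bsub>F\<^esub> y)"
  using I.rcoset_mult_add by (simp add: BQ_def FactRing_def pr_def)

lemma add_BQ: "x \<in> carrier F \<Longrightarrow> y \<in> carrier F \<Longrightarrow> pr x \<oplus>\<^bsub>BQ\<^esub> pr y = pr (x \<oplus>\<^bsub>F\<^esub> y)"
  using I.a_rcos_sum by (simp add: BQ_def FactRing_def pr_def)

lemma one_BQ: "\<one>\<^bsub>BQ\<^esub> = pr \<one>\<^bsub>F\<^esub>"
  by (simp add: BQ_def FactRing_def pr_def)

lemma ring_BQ: "ring BQ"
  by (rule ring_transfer[OF I.quotient_is_ring]) (simp_all add: BQ_def)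

lemma pr_I: "h \<in> I \<Longrightarrow> x \<in> carrier F \<Longrightarrow> pr (h \<oplus>\<^bsub>F\<^esub> x) = pr x"
  unfolding pr_def
  by (rule F.a_repr_independence[symmetric]) (auto simp: a_r_coset_def' I.a_subgroup)

lemma pr_I0: "h \<in> I \<Longrightarrow> pr h = \<zero>\<^bsub>BQ\<^esub>"
  using pr_I[of h "\<zero>\<^bsub>F\<^esub>"] I.a_Hcarr[of h] F.a_coset_add_zero[OF I.a_subset] by (simp add: BQ_def FactRing_def pr_def)

lemma smult_BQ: assumes x: "x \<in> carrier F" shows "c \<odot>\<^bsub>BQ\<^esub> pr x = pr (c \<odot>\<^bsub>F\<^esub> x)"
proof -
  interpret C: cspace F by (rule F.is_cspace)
  have "pr (c \<odot>\<^bsub>F\<^esub> y) = pr (c \<odot>\<^bsub>F\<^esub> x)" if y: "y \<in> pr x" for y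
  proof -
    obtain h where h: "h \<in> I" "y = h \<oplus>\<^bsub>F\<^esub> x" using y by (auto simp: pr_def a_r_coset_def')
    have hc: "h \<in> carrier F" using h(1) by (rule I.a_Hcarr)
    have "c \<odot>\<^bsub>F\<^esub> h = (c \<odot>\<^bsub>F\<^esub> \<one>\<^bsub>F\<^esub>) \<otimes>\<^bsub>F\<^esub> h" by (rule F.smult_sc[OF hc])
    also have "\<dots> \<in> I" using h(1) by (intro I.I_l_closed) auto
    finally show ?thesis unfolding h(2) C.smult_r_distr[OF hc x] using x by (intro pr_I) auto
  qed
  then have "(\<Union>y\<in>pr x. pr (c \<odot>\<^bsub>F\<^esub> y)) = (\<Union>y\<in>pr x. pr (c \<odot>\<^bsub>F\<^esub> x))" by simp
  also have "\<dots> = pr (c \<odot>\<^bsub>F\<^esub> x)" using I.a_rcos_self[OF x] unfolding pr_def by blast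
  finally show ?thesis by (simp add: BQ_def pr_def)
qed

lemma calg_BQ: "calg BQ"
proof -
  interpret C: cspace F by (rule F.is_cspace)
  interpret BQ: ring BQ by (rule ring_BQ)
  show ?thesis
  proof unfold_locales
    fix c c' b
    show "c \<odot>\<^bsub>BQ\<^esub> \<one>\<^bsub>BQ\<^esub> \<in> carrier BQ" by (simp add: one_BQ smult_BQ carrier_BQ)
    show "(c + c') \<odot>\<^bsub>BQ\<^esub> \<one>\<^bsub>BQ\<^esub> = c \<odot>\<^bsub>BQ\<^esub> \<one>\<^bsub>BQ\<^esub> \<oplus>\<^bsub>BQ\<^esub> c' \<odot>\<^bsub>BQ\<^esub> \<one>\<^bsub>BQ\<^esub>"
      by (simp add: one_BQ smult_BQ add_BQ F.sc_add)
    show "(c * c') \<odot>\<^bsub>BQ\<^esub> \<one>\<^bsub>BQ\<^esub> = (c \<odot>\<^bsub>BQ\<^esub> \<one>\<^bsub>BQ\<^esub>) \<otimes>\<^bsub>BQ\<^esub> (c' \<odot>\<^bsub>BQ\<^esub> \<one>\<^bsub>BQ\<^esub>)"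
      by (simp add: one_BQ smult_BQ mult_BQ F.sc_mult)
    show "1 \<odot>\<^bsub>BQ\<^esub> \<one>\<^bsub>BQ\<^esub> = \<one>\<^bsub>BQ\<^esub>" by (simp add: one_BQ smult_BQ F.sc_one)
    assume "b \<in> carrier BQ"
    then obtain x where x: "x \<in> carrier F" "b = pr x" by (auto simp: carrier_BQ)
    show "c \<odot>\<^bsub>BQ\<^esub> b = c \<odot>\<^bsub>BQ\<^esub> \<one>\<^bsub>BQ\<^esub> \<otimes>\<^bsub>BQ\<^esub> b"
      using x(1) by (simp add: x(2) one_BQ smult_BQ mult_BQ F.smult_sc[OF x(1), of c])
    show "b \<otimes>\<^bsub>BQ\<^esub> (c \<odot>\<^bsub>BQ\<^esub> \<one>\<^bsub>BQ\<^esub>) = c \<odot>\<^bsub>BQ\<^esub> \<one>\<^bsub>BQ\<^esub> \<otimes>\<^bsub>BQ\<^esub> b"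
      using x(1) by (simp add: x(2) one_BQ smult_BQ mult_BQ F.sc_central)
  qed
qed

lemma lin_map_pr: "lin_map F BQ pr"
  by (auto simp: lin_map_def carrier_BQ add_BQ smult_BQ)

end

lemma (in cspace) eq_if_diff_zero: "x \<in> carrier M \<Longrightarrow> y \<in> carrier M \<Longrightarrow> x \<ominus>\<^bsub>M\<^esub> y = \<zero>\<^bsub>M\<^esub> \<Longrightarrow> x = y"
proof -
  assume xy: "x \<in> carrier M" "y \<in> carrier M" and z: "x \<ominus>\<^bsub>M\<^esub> y = \<zero>\<^bsub>M\<^esub>"
  have "x = (x \<ominus>\<^bsub>M\<^esub> y) \<oplus>\<^bsub>M\<^esub> y" using xy by (simp add: minus_eq a_assoc l_neg)
  then show "x = y" using xy z by simp
qed

lemma lin_map_E'12: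
  fixes x :: "('n::finite, 'm) fam2"
  assumes "cspace M" "cspace N" "lin_map M N f" "\<And>i j. x i j \<in> carrier M"
  shows "f (E'12 D M x) = E'12 D N (\<lambda>i j. f (x i j))"
  unfolding E'12_def by (intro lin_map_finsum[OF assms(1-3)]) (auto simp: assms(4))

lemma lin_map_diff:
  assumes "cspace M" "cspace N" "lin_map M N f" "x \<in> carrier M" "y \<in> carrier M"
  shows "f (x \<ominus>\<^bsub>M\<^esub> y) = f x \<ominus>\<^bsub>N\<^esub> f y"
proof -
  interpret M: cspace M by fact
  interpret N: cspace N by fact
  show ?thesis by (rule add_map_diff[OF M.abelian_group_axioms N.abelian_group_axioms lin_map_add_map[OF assms(3)] assms(4,5)])
qed

lemma lin_map_closed: "lin_map M N f \<Longrightarrow> x \<in> carrier M \<Longrightarrow> f x \<in> carrier N"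
  by (auto simp: lin_map_def)

lemma lin_map_smult: "lin_map M N f \<Longrightarrow> x \<in> carrier M \<Longrightarrow> f (c \<odot>\<^bsub>M\<^esub> x) = c \<odot>\<^bsub>N\<^esub> f x"
  by (auto simp: lin_map_def)

lemma lin_map_eqI:
  assumes "cspace M" "cspace N" "lin_map M N f" "x \<in> carrier M" "y \<in> carrier M" "f (x \<ominus>\<^bsub>M\<^esub> y) = \<zero>\<^bsub>N\<^esub>"
  shows "f x = f y"
  by (rule cspace.eq_if_diff_zero[OF assms(2) lin_map_closed[OF assms(3,4)] lin_map_closed[OF assms(3,5)]])
    (use lin_map_diff[OF assms(1-5)] assms(6) in simp)

lemma entries4I: "x i j k l \<in> entries4 x"
  unfolding entries4_def by blast

text \<open>
  The defining relations are imposed entry by entry on a free object; in the quotient they become equations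
  between families.
\<close>

lemma lin_map_fam_relation:
  fixes x :: "('n::finite, 'm) fam4" and z :: "('n, 'k) fam4"
  assumes "cspace M" "cspace N" "lin_map M N f" "\<And>i j k l. x i j k l \<in> carrier M"
    and z: "(\<lambda>i j k l. f (x i j k l)) = z"
  shows "(\<And>e. e \<in> entries4 (fminus4 M (S123 D M x) (fscale4 M c x)) \<Longrightarrow> f e = \<zero>\<^bsub>N\<^esub>) \<Longrightarrow> S123 D N z = fscale4 N c z"
    "(\<And>e. e \<in> entries4 (fminus4 M (St234 D M x) (fscale4 M c x)) \<Longrightarrow> f e = \<zero>\<^bsub>N\<^esub>) \<Longrightarrow> St234 D N z = fscale4 N c z"
proof -
  interpret M: cspace M by fact
  interpret N: cspace N by fact
  note cl = M.S123_in[OF M.csub_carrier, of x, OF assms(4)]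
  have zz: "f (x i j k l) = z i j k l" for i j k l unfolding z[symmetric] ..
  have SS: "S123 D N z i j k l = f (S123 D M x i j k l)" "St234 D N z i j k l = f (St234 D M x i j k l)" for i j k l
    unfolding z[symmetric] lin_map_S123[OF assms(1-4), symmetric] by (rule refl)+
  { assume h: "\<And>e. e \<in> entries4 (fminus4 M (S123 D M x) (fscale4 M c x)) \<Longrightarrow> f e = \<zero>\<^bsub>N\<^esub>"
    show "S123 D N z = fscale4 N c z"
    proof (intro ext)
      fix i j k l
      have "f (S123 D M x i j k l \<ominus>\<^bsub>M\<^esub> c \<odot>\<^bsub>M\<^esub> x i j k l) = \<zero>\<^bsub>N\<^esub>"
        using h[OF entries4I[of _ i j k l]] by (simp only: fminus4_def fscale4_def)
      then have "f (S123 D M x i j k l) = f (c \<odot>\<^bsub>M\<^esub> x i j k l)"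
        by (rule lin_map_eqI[OF assms(1-3) cl(1) M.smult_closed[OF assms(4)]])
      also have "\<dots> = c \<odot>\<^bsub>N\<^esub> f (x i j k l)" by (rule lin_map_smult[OF assms(3,4)])
      finally show "S123 D N z i j k l = fscale4 N c z i j k l"
        by (simp add: fscale4_def zz SS(1))
    qed }
  { assume h: "\<And>e. e \<in> entries4 (fminus4 M (St234 D M x) (fscale4 M c x)) \<Longrightarrow> f e = \<zero>\<^bsub>N\<^esub>"
    show "St234 D N z = fscale4 N c z"
    proof (intro ext)
      fix i j k l
      have "f (St234 D M x i j k l \<ominus>\<^bsub>M\<^esub> c \<odot>\<^bsub>M\<^esub> x i j k l) = \<zero>\<^bsub>N\<^esub>"
        using h[OF entries4I[of _ i j k l]] by (simp only: fminus4_def fscale4_def)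
      then have "f (St234 D M x i j k l) = f (c \<odot>\<^bsub>M\<^esub> x i j k l)"
        by (rule lin_map_eqI[OF assms(1-3) cl(2) M.smult_closed[OF assms(4)]])
      also have "\<dots> = c \<odot>\<^bsub>N\<^esub> f (x i j k l)" by (rule lin_map_smult[OF assms(3,4)])
      finally show "St234 D N z i j k l = fscale4 N c z i j k l"
        by (simp add: fscale4_def zz SS(2))
    qed }
qed

lemma BB_facts:
  fixes D :: "('n::finite) qdata"
  shows "calg (BB D)" "\<And>i j. pgen D i j \<in> carrier (BB D)"
    "S123 D (BB D) (fprod (\<otimes>\<^bsub>BB D\<^esub>) (pgen D) (pgen D)) =
      fscale4 (BB D) (qq D (exp_w D)) (fprod (\<otimes>\<^bsub>BB D\<^esub>) (pgen D) (pgen D))"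
    "E'12 D (BB D) (pgen D) = qq D (exp_m D) \<odot>\<^bsub>BB D\<^esub> \<one>\<^bsub>BB D\<^esub>"
proof -
  let ?F = "free_algebra :: (complex, 'n free_alg) module"
  interpret F: calg ?F by (rule calg_free_algebra)
  have cF: "carrier ?F = UNIV" by (simp add: free_algebra_def)
  have id: "ideal (alg_ideal D) ?F"
    unfolding alg_ideal_def by (rule F.genideal_ideal) (simp add: cF)
  have rel: "alg_relations D \<subseteq> alg_ideal D"
    unfolding alg_ideal_def by (rule F.genideal_self) (simp add: cF)
  interpret Q: calg_quot ?F "alg_ideal D"
    by (rule calg_quot.intro[OF calg_free_algebra calg_quot_axioms.intro[OF id]])
  have B: "BB D = Q.BQ" by (simp add: BB_def Q.BQ_def Let_def)
  have p: "pgen D i j = Q.pr (gen0 i j)" for i j by (simp add: pgen_def Q.pr_def)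
  show "calg (BB D)" unfolding B by (rule Q.calg_BQ)
  show "pgen D i j \<in> carrier (BB D)" for i j unfolding B p Q.carrier_BQ by (simp add: cF)
  interpret BQ: calg Q.BQ by (rule Q.calg_BQ)
  note cs = F.is_cspace BQ.is_cspace Q.lin_map_pr
  have z: "(\<lambda>i j k l. Q.pr (fprod (\<otimes>\<^bsub>?F\<^esub>) gen0 gen0 i j k l)) = fprod (\<otimes>\<^bsub>BB D\<^esub>) (pgen D) (pgen D)"
    by (simp add: fprod_def B p Q.mult_BQ cF)
  show "S123 D (BB D) (fprod (\<otimes>\<^bsub>BB D\<^esub>) (pgen D) (pgen D)) =
      fscale4 (BB D) (qq D (exp_w D)) (fprod (\<otimes>\<^bsub>BB D\<^esub>) (pgen D) (pgen D))"
    unfolding B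
  proof (rule lin_map_fam_relation(1)[OF cs _ z[unfolded B]])
    fix e assume "e \<in> entries4 (fminus4 ?F (S123 D ?F (fprod (\<otimes>\<^bsub>?F\<^esub>) gen0 gen0))
      (fscale4 ?F (qq D (exp_w D)) (fprod (\<otimes>\<^bsub>?F\<^esub>) gen0 gen0)))"
    then have "e \<in> alg_ideal D" using rel unfolding alg_relations_def Let_def by blast
    then show "Q.pr e = \<zero>\<^bsub>Q.BQ\<^esub>" by (rule Q.pr_I0)
  qed (simp add: cF)
  have "E'12 D ?F gen0 \<ominus>\<^bsub>?F\<^esub> qq D (exp_m D) \<odot>\<^bsub>?F\<^esub> \<one>\<^bsub>?F\<^esub> \<in> alg_ideal D"
    using rel unfolding alg_relations_def Let_def by blast
  from lin_map_eqI[OF cs _ _ Q.pr_I0[OF this]]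
  have "Q.pr (E'12 D ?F gen0) = Q.pr (qq D (exp_m D) \<odot>\<^bsub>?F\<^esub> \<one>\<^bsub>?F\<^esub>)" by (simp add: cF)
  then show "E'12 D (BB D) (pgen D) = qq D (exp_m D) \<odot>\<^bsub>BB D\<^esub> \<one>\<^bsub>BB D\<^esub>"
    by (simp add: B p[abs_def] lin_map_E'12[OF cs] cF Q.one_BQ Q.smult_BQ)
qed

section \<open>The first-order calculus\<close>

context calg begin

lemma lmod_FM: "lmod B (free_left_module B :: ('b, 'g \<Rightarrow> 'b) bimod)"
proof -
  let ?F = "free_left_module B :: ('b, 'g \<Rightarrow> 'b) bimod"
  have c: "f \<in> carrier ?F \<longleftrightarrow> (\<forall>g. f g \<in> carrier B)" for f
    by (auto simp: free_left_module_def)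
  have ag: "abelian_group ?F"
  proof (rule abelian_groupI)
    fix f assume f: "f \<in> carrier ?F"
    show "\<exists>h\<in>carrier ?F. h \<oplus>\<^bsub>?F\<^esub> f = \<zero>\<^bsub>?F\<^esub>"
      by (rule bexI[of _ "\<lambda>g. \<ominus>\<^bsub>B\<^esub> f g"]) (use f in \<open>simp_all add: c l_neg, simp add: free_left_module_def c l_neg\<close>)
  qed (unfold c, simp_all add: free_left_module_def a_ac)
  interpret F: abelian_group ?F by (rule ag)
  show ?thesis
    by unfold_locales (unfold c, simp_all add: free_left_module_def r_distr l_distr m_assoc smult_sc[symmetric])
qed

end

text \<open>
  The coordinate vectors generate the free module.
\<close>

lemma FM_expand:
  assumes "calg B" "f \<in> carrier (free_left_module B :: ('b, ('g::finite) \<Rightarrow> 'b) bimod)"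
  shows "f = (\<Oplus>\<^bsub>free_left_module B\<^esub>g\<in>UNIV. f g \<rhd>\<^bsub>free_left_module B\<^esub> (\<lambda>h. if h = g then \<one>\<^bsub>B\<^esub> else \<zero>\<^bsub>B\<^esub>))"
proof -
  let ?F = "free_left_module B :: ('b, 'g \<Rightarrow> 'b) bimod"
  interpret B: calg B by fact
  interpret F: lmod B ?F by (rule B.lmod_FM)
  have c: "f \<in> carrier ?F \<longleftrightarrow> (\<forall>g. f g \<in> carrier B)" for f
    by (auto simp: free_left_module_def)
  have fc: "f g \<in> carrier B" for g using assms(2) c by blast
  have pt: "finsum ?F h A g' = (\<Oplus>\<^bsub>B\<^esub>g\<in>A. h g g')" if "finite A" "\<And>g. h g \<in> carrier ?F" for h A g'
    using that(1)
  proof (induction A rule: finite_induct)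
    case empty show ?case by (subst F.M.finsum_empty) (simp add: free_left_module_def)
  next
    case (insert a A)
    have "finsum ?F h (insert a A) g' = h a g' \<oplus>\<^bsub>B\<^esub> finsum ?F h A g'"
      using insert that(2) by (subst F.M.finsum_insert) (auto simp: free_left_module_def)
    then show ?case using insert that(2) by (simp add: Pi_def c)
  qed
  show ?thesis
  proof
    fix g'
    have "(\<Oplus>\<^bsub>?F\<^esub>g\<in>UNIV. f g \<rhd>\<^bsub>?F\<^esub> (\<lambda>h. if h = g then \<one>\<^bsub>B\<^esub> else \<zero>\<^bsub>B\<^esub>)) g' =
        (\<Oplus>\<^bsub>B\<^esub>g\<in>UNIV. (f g \<rhd>\<^bsub>?F\<^esub> (\<lambda>h. if h = g then \<one>\<^bsub>B\<^esub> else \<zero>\<^bsub>B\<^esub>)) g')"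
      using fc by (intro pt) (simp_all add: c, simp add: free_left_module_def)
    also have "\<dots> = (\<Oplus>\<^bsub>B\<^esub>g\<in>UNIV. if g' = g then f g else \<zero>\<^bsub>B\<^esub>)"
      using fc by (intro B.finsum_cong') (auto simp: free_left_module_def)
    also have "\<dots> = f g'" using fc by (intro B.finsum_singleton) auto
    finally show "f g' = (\<Oplus>\<^bsub>?F\<^esub>g\<in>UNIV. f g \<rhd>\<^bsub>?F\<^esub> (\<lambda>h. if h = g then \<one>\<^bsub>B\<^esub> else \<zero>\<^bsub>B\<^esub>)) g'" ..
  qed
qed

text \<open>
  The bimodule of one-forms.  Its right action is a parameter, known only through the relations that
  determine it on generators.
\<close>

locale hk =
  fixes D :: "('n::finite) qdata" and \<rho> :: "'n forms1 \<Rightarrow> 'n alg \<Rightarrow> 'n forms1"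
  assumes qd: "quantum_data D" and hkr: "hk_right_action D \<rho>"
begin

abbreviation "B \<equiv> BB D"
abbreviation "Om \<equiv> Omega D \<rho>"
abbreviation "F1 \<equiv> (free_left_module (BB D) :: ('n alg, 'n \<times> 'n \<Rightarrow> 'n alg) bimod)"
abbreviation "p \<equiv> pgen D"

sublocale B: calg B by (rule BB_facts(1))

lemmas p_closed [simp, intro] = BB_facts(2)

sublocale F1: lmod B F1 by (rule B.lmod_FM)

lemma F1_carrier: "f \<in> carrier F1 \<longleftrightarrow> (\<forall>g. f g \<in> carrier B)"
  by (auto simp: free_left_module_def)

lemma free_gen_closed: "free_gen D i j \<in> carrier F1"
  by (simp add: F1_carrier free_gen_def)

text \<open>
  The family \<open>p dp\<close> in the free module, before relations are imposed.
\<close>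

definition pdp0 where "pdp0 = fprod (\<rhd>\<^bsub>F1\<^esub>) p (free_gen D)"

lemma pdp0_closed: "pdp0 i j k l \<in> carrier F1"
  unfolding pdp0_def fprod_def by (rule F1.lact_closed[OF p_closed free_gen_closed])

definition "Xp = entries4 (fminus4 F1 (St234 D F1 pdp0) (fscale4 F1 (qq D (- exp_w D)) pdp0)) \<union> {E'12 D F1 (free_gen D)}"
definition "Xm = entries4 (fminus4 F1 (S123 D F1 pdp0) (fscale4 F1 (qq D (exp_w D)) pdp0)) \<union> {E'12 D F1 (free_gen D)}"

lemma relations_eq: "relations_plus D = left_span B F1 Xp" "relations_minus D = left_span B F1 Xm"
  by (simp_all only: relations_plus_def relations_minus_def Let_def Xp_def Xm_def pdp0_def)

lemma X_carrier: "Xp \<subseteq> carrier F1" "Xm \<subseteq> carrier F1"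
proof -
  note cl = F1.M.S123_in[OF F1.M.csub_carrier, of pdp0, OF pdp0_closed]
  have e: "E'12 D F1 (free_gen D) \<in> carrier F1"
    unfolding E'12_def using free_gen_closed by (intro F1.M.finsum_closed) auto
  have "fminus4 F1 (St234 D F1 pdp0) (fscale4 F1 (qq D (- exp_w D)) pdp0) i j k l \<in> carrier F1" for i j k l
    unfolding fminus4_def fscale4_def by (intro F1.M.minus_closed cl F1.M.smult_closed pdp0_closed)
  then show "Xp \<subseteq> carrier F1" unfolding Xp_def entries4_def using e by blast
  have "fminus4 F1 (S123 D F1 pdp0) (fscale4 F1 (qq D (exp_w D)) pdp0) i j k l \<in> carrier F1" for i j k l
    unfolding fminus4_def fscale4_def by (intro F1.M.minus_closed cl F1.M.smult_closed pdp0_closed)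
  then show "Xm \<subseteq> carrier F1" unfolding Xm_def entries4_def using e by blast
qed

lemma lq: "lquot B F1 (relations_plus D)" "lquot B F1 (relations_minus D)"
  unfolding relations_eq
  by (rule lquot.intro[OF F1.lmod_axioms lquot_axioms.intro[OF F1.left_submodule_span(1)]], rule X_carrier)+

sublocale P: lquot B F1 "relations_plus D" by (rule lq(1))
sublocale N: lquot B F1 "relations_minus D" by (rule lq(2))

lemma X_zero: "e \<in> Xp \<Longrightarrow> P.qc e = \<zero>\<^bsub>P.Q\<^esub>" "e \<in> Xm \<Longrightarrow> N.qc e = \<zero>\<^bsub>N.Q\<^esub>"
  using F1.left_submodule_span(2)[OF X_carrier(1)] F1.left_submodule_span(2)[OF X_carrier(2)]
  by (intro P.qc_zero_W N.qc_zero_W; auto simp: relations_eq)+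

lemma Om_simps:
  "carrier Om = carrier P.Q \<times> carrier N.Q" "\<zero>\<^bsub>Om\<^esub> = (\<zero>\<^bsub>P.Q\<^esub>, \<zero>\<^bsub>N.Q\<^esub>)"
  "x \<oplus>\<^bsub>Om\<^esub> y = (fst x \<oplus>\<^bsub>P.Q\<^esub> fst y, snd x \<oplus>\<^bsub>N.Q\<^esub> snd y)"
  "c \<odot>\<^bsub>Om\<^esub> x = (c \<odot>\<^bsub>P.Q\<^esub> fst x, c \<odot>\<^bsub>N.Q\<^esub> snd x)"
  "b \<rhd>\<^bsub>Om\<^esub> x = (b \<rhd>\<^bsub>P.Q\<^esub> fst x, b \<rhd>\<^bsub>N.Q\<^esub> snd x)"
  by (simp_all add: Omega_def dsum_def Omega_plus_def Omega_minus_def)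

lemma PQ: "lmod B P.Q" "lmod B N.Q" by (rule P.lmod_Q N.lmod_Q)+

lemma lmod_Om: "lmod B Om"
proof -
  interpret PP: lmod B P.Q by (rule PQ)
  interpret NN: lmod B N.Q by (rule PQ)
  have ag: "abelian_group Om"
  proof (rule abelian_groupI)
    fix x assume "x \<in> carrier Om"
    then show "\<exists>y\<in>carrier Om. y \<oplus>\<^bsub>Om\<^esub> x = \<zero>\<^bsub>Om\<^esub>"
      by (intro bexI[of _ "(\<ominus>\<^bsub>P.Q\<^esub> fst x, \<ominus>\<^bsub>N.Q\<^esub> snd x)"]) (auto simp: Om_simps P.Q.l_neg N.Q.l_neg)
  qed (auto simp: Om_simps P.Q.a_ac N.Q.a_ac)
  interpret OO: abelian_group Om by (rule ag)
  show ?thesis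
    by unfold_locales
      (auto simp: Om_simps PP.lact_add_r NN.lact_add_r PP.lact_add_l NN.lact_add_l PP.lact_assoc NN.lact_assoc
        PP.smult_lact NN.smult_lact)
qed

lemma ra: "is_right_action B Om"
  and dp_ract: "fprod (\<lhd>\<^bsub>Om\<^esub>) (dp D) p = fscale4 Om (qq D (exp_a D)) (T1234 D Om (fprod (\<rhd>\<^bsub>Om\<^esub>) p (dp D)))"
  and dbp_ract: "fprod (\<lhd>\<^bsub>Om\<^esub>) (dbp D) p = fscale4 Om (qq D (- exp_a D)) (T1234 D Om (fprod (\<rhd>\<^bsub>Om\<^esub>) p (dbp D)))"
  using hkr unfolding hk_right_action_def Let_def by blast+

lemma bimd_Om: "bimd B Om"
proof -
  interpret O: lmod B Om by (rule lmod_Om)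
  note r = ra[unfolded is_right_action_def, rule_format]
  show ?thesis
  proof unfold_locales
    fix x c assume x: "x \<in> carrier Om"
    have "x \<lhd>\<^bsub>Om\<^esub> (c \<odot>\<^bsub>B\<^esub> \<one>\<^bsub>B\<^esub>) = c \<odot>\<^bsub>Om\<^esub> (x \<lhd>\<^bsub>Om\<^esub> \<one>\<^bsub>B\<^esub>)" "x \<lhd>\<^bsub>Om\<^esub> \<one>\<^bsub>B\<^esub> = x"
      using r[OF x x B.one_closed B.one_closed] by blast+
    then show "x \<lhd>\<^bsub>Om\<^esub> (c \<odot>\<^bsub>B\<^esub> \<one>\<^bsub>B\<^esub>) = (c \<odot>\<^bsub>B\<^esub> \<one>\<^bsub>B\<^esub>) \<rhd>\<^bsub>Om\<^esub> x" using x by (simp add: O.smult_lact)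
  qed (use r in blast)+
qed

sublocale O: bimd B Om by (rule bimd_Om)

lemma d_qc: "dp D i j = (P.qc (free_gen D i j), \<zero>\<^bsub>N.Q\<^esub>)" "dbp D i j = (\<zero>\<^bsub>P.Q\<^esub>, N.qc (free_gen D i j))"
  by (simp_all add: dp_def dbp_def P.qc_def N.qc_def Omega_plus_def Omega_minus_def)

text \<open>
  The maps from the free module onto the two summands of the one-forms.
\<close>

definition "emb_plus x = (P.qc x, \<zero>\<^bsub>N.Q\<^esub>)"
definition "emb_minus x = (\<zero>\<^bsub>P.Q\<^esub>, N.qc x)"

lemma lin_map_i: "lin_map F1 Om emb_plus" "lin_map F1 Om emb_minus"
proof -
  interpret PP: lmod B P.Q by (rule PQ)
  interpret NN: lmod B N.Q by (rule PQ)
  show "lin_map F1 Om emb_plus" "lin_map F1 Om emb_minus"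
    unfolding lin_map_def emb_plus_def emb_minus_def by (auto simp: Om_simps P.add_Q N.add_Q P.smult_Q N.smult_Q)
qed

lemma d_i: "dp D i j = emb_plus (free_gen D i j)" "dbp D i j = emb_minus (free_gen D i j)"
  by (simp_all add: d_qc emb_plus_def emb_minus_def)

lemma i_lact: "b \<in> carrier B \<Longrightarrow> f \<in> carrier F1 \<Longrightarrow> emb_plus (b \<rhd>\<^bsub>F1\<^esub> f) = b \<rhd>\<^bsub>Om\<^esub> emb_plus f"
  "b \<in> carrier B \<Longrightarrow> f \<in> carrier F1 \<Longrightarrow> emb_minus (b \<rhd>\<^bsub>F1\<^esub> f) = b \<rhd>\<^bsub>Om\<^esub> emb_minus f"
proof -
  interpret PP: lmod B P.Q by (rule PQ)
  interpret NN: lmod B N.Q by (rule PQ)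
  show "b \<in> carrier B \<Longrightarrow> f \<in> carrier F1 \<Longrightarrow> emb_plus (b \<rhd>\<^bsub>F1\<^esub> f) = b \<rhd>\<^bsub>Om\<^esub> emb_plus f"
    "b \<in> carrier B \<Longrightarrow> f \<in> carrier F1 \<Longrightarrow> emb_minus (b \<rhd>\<^bsub>F1\<^esub> f) = b \<rhd>\<^bsub>Om\<^esub> emb_minus f"
    by (simp_all add: emb_plus_def emb_minus_def Om_simps P.lact_Q N.lact_Q)
qed

lemma dp_closed [simp, intro]: "dp D i j \<in> carrier Om" "dbp D i j \<in> carrier Om"
  unfolding d_i by (rule lin_map_closed[OF lin_map_i(1) free_gen_closed] lin_map_closed[OF lin_map_i(2) free_gen_closed])+

lemma pd_closed: "fprod (\<rhd>\<^bsub>Om\<^esub>) p (dp D) i j k l \<in> carrier Om" "fprod (\<rhd>\<^bsub>Om\<^esub>) p (dbp D) i j k l \<in> carrier Om"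
  by (simp_all add: fprod_def)

lemma emb_pdp: "(\<lambda>i j k l. emb_plus (pdp0 i j k l)) = fprod (\<rhd>\<^bsub>Om\<^esub>) p (dp D)" "(\<lambda>i j k l. emb_minus (pdp0 i j k l)) = fprod (\<rhd>\<^bsub>Om\<^esub>) p (dbp D)"
  by (simp_all add: pdp0_def fprod_def i_lact free_gen_closed d_i)

lemma i_zero: "e \<in> Xp \<Longrightarrow> emb_plus e = \<zero>\<^bsub>Om\<^esub>" "e \<in> Xm \<Longrightarrow> emb_minus e = \<zero>\<^bsub>Om\<^esub>"
  by (simp_all add: emb_plus_def emb_minus_def Om_simps X_zero)

lemma St_pdp: "St234 D Om (fprod (\<rhd>\<^bsub>Om\<^esub>) p (dp D)) = fscale4 Om (qq D (- exp_w D)) (fprod (\<rhd>\<^bsub>Om\<^esub>) p (dp D))"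
  by (rule lin_map_fam_relation(2)[where f = emb_plus and x = pdp0, OF F1.is_cspace O.is_cspace lin_map_i(1) pdp0_closed emb_pdp(1)])
    (rule i_zero(1), simp add: Xp_def)

lemma S_pdbp: "S123 D Om (fprod (\<rhd>\<^bsub>Om\<^esub>) p (dbp D)) = fscale4 Om (qq D (exp_w D)) (fprod (\<rhd>\<^bsub>Om\<^esub>) p (dbp D))"
  by (rule lin_map_fam_relation(1)[where f = emb_minus and x = pdp0, OF F1.is_cspace O.is_cspace lin_map_i(2) pdp0_closed emb_pdp(2)])
    (rule i_zero(2), simp add: Xm_def)

lemma E'_dp: "E'12 D Om (dp D) = \<zero>\<^bsub>Om\<^esub>" "E'12 D Om (dbp D) = \<zero>\<^bsub>Om\<^esub>"
proof -
  have "emb_plus (E'12 D F1 (free_gen D)) = E'12 D Om (\<lambda>i j. emb_plus (free_gen D i j))"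
    by (rule lin_map_E'12[OF F1.is_cspace O.is_cspace lin_map_i(1) free_gen_closed])
  then show "E'12 D Om (dp D) = \<zero>\<^bsub>Om\<^esub>" by (simp add: i_zero Xp_def d_i[abs_def])
  have "emb_minus (E'12 D F1 (free_gen D)) = E'12 D Om (\<lambda>i j. emb_minus (free_gen D i j))"
    by (rule lin_map_E'12[OF F1.is_cspace O.is_cspace lin_map_i(2) free_gen_closed])
  then show "E'12 D Om (dbp D) = \<zero>\<^bsub>Om\<^esub>" by (simp add: i_zero Xm_def d_i[abs_def])
qed

text \<open>
  One-forms are sums of left multiples of the generators.
\<close>

lemma Om_induct [consumes 1, case_names zero add dp dbp]:
  assumes x: "x \<in> carrier Om" and z: "P \<zero>\<^bsub>Om\<^esub>"
    and add: "\<And>x y. x \<in> carrier Om \<Longrightarrow> y \<in> carrier Om \<Longrightarrow> P x \<Longrightarrow> P y \<Longrightarrow> P (x \<oplus>\<^bsub>Om\<^esub> y)"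
    and d: "\<And>b i j. b \<in> carrier B \<Longrightarrow> P (b \<rhd>\<^bsub>Om\<^esub> dp D i j)" "\<And>b i j. b \<in> carrier B \<Longrightarrow> P (b \<rhd>\<^bsub>Om\<^esub> dbp D i j)"
  shows "P x"
proof -
  define W where "W = {x \<in> carrier Om. P x}"
  have fin: "finsum Om h UNIV \<in> W" if "\<And>g. h g \<in> W" for h :: "'n \<times> 'n \<Rightarrow> _"
    by (rule O.M.finsum_in) (use z add that in \<open>auto simp: W_def\<close>)
  have i: "emb_plus f \<in> W" "emb_minus f \<in> W" if f: "f \<in> carrier F1" for f
  proof -
    have fg: "(\<lambda>h. if h = g then \<one>\<^bsub>B\<^esub> else \<zero>\<^bsub>B\<^esub>) = free_gen D (fst g) (snd g)" for g
      by (auto simp: free_gen_def)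
    have fc: "f g \<in> carrier B" for g using f F1_carrier by blast
    have e: "f = (\<Oplus>\<^bsub>F1\<^esub>g\<in>UNIV. f g \<rhd>\<^bsub>F1\<^esub> free_gen D (fst g) (snd g))"
      using FM_expand[OF B.calg_axioms f] unfolding fg .
    have cl: "f g \<rhd>\<^bsub>F1\<^esub> free_gen D (fst g) (snd g) \<in> carrier F1" for g by (rule F1.lact_closed[OF fc free_gen_closed])
    note fs = add_map_finsum[OF F1.M.abelian_group_axioms O.M.abelian_group_axioms lin_map_add_map _ cl, OF _ finite]
    have "emb_plus f = (\<Oplus>\<^bsub>Om\<^esub>g\<in>UNIV. f g \<rhd>\<^bsub>Om\<^esub> dp D (fst g) (snd g))"
      by (subst e, subst fs[OF lin_map_i(1)]) (simp add: i_lact fc free_gen_closed d_i)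
    also have "\<dots> \<in> W" by (rule fin) (use d(1) fc in \<open>simp add: W_def\<close>)
    finally show "emb_plus f \<in> W" .
    have "emb_minus f = (\<Oplus>\<^bsub>Om\<^esub>g\<in>UNIV. f g \<rhd>\<^bsub>Om\<^esub> dbp D (fst g) (snd g))"
      by (subst e, subst fs[OF lin_map_i(2)]) (simp add: i_lact fc free_gen_closed d_i)
    also have "\<dots> \<in> W" by (rule fin) (use d(2) fc in \<open>simp add: W_def\<close>)
    finally show "emb_minus f \<in> W" .
  qed
  obtain f h where fh: "f \<in> carrier F1" "h \<in> carrier F1" "x = (P.qc f, N.qc h)"
    using x unfolding Om_simps P.carrier_Q N.carrier_Q by blast
  interpret PP: lmod B P.Q by (rule PQ)
  interpret NN: lmod B N.Q by (rule PQ)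
  have "x = emb_plus f \<oplus>\<^bsub>Om\<^esub> emb_minus h" using fh by (simp add: emb_plus_def emb_minus_def Om_simps)
  then show ?thesis using i[OF fh(1)] i[OF fh(2)] add by (auto simp: W_def)
qed

end

text \<open>
  Contracting a relation \<open>S x = q^w x\<close> produces the contraction of \<open>x\<close> on both sides, with
  different coefficients; this solves for it.
\<close>

lemma (in cspace) contraction_cancel:
  assumes e: "e \<in> carrier M" and y: "y \<in> carrier M" and a: "a \<noteq> 0"
    and eq: "c \<odot>\<^bsub>M\<^esub> e = a \<odot>\<^bsub>M\<^esub> y \<oplus>\<^bsub>M\<^esub> (c - a) \<odot>\<^bsub>M\<^esub> e"
  shows "e = y"
proof -
  have "c \<odot>\<^bsub>M\<^esub> e = (a + (c - a)) \<odot>\<^bsub>M\<^esub> e" by simp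
  also have "\<dots> = a \<odot>\<^bsub>M\<^esub> e \<oplus>\<^bsub>M\<^esub> (c - a) \<odot>\<^bsub>M\<^esub> e" by (rule smult_l_distr[OF e])
  finally have "a \<odot>\<^bsub>M\<^esub> e = a \<odot>\<^bsub>M\<^esub> y" using eq e y by simp
  then have "(1 / a) \<odot>\<^bsub>M\<^esub> (a \<odot>\<^bsub>M\<^esub> e) = (1 / a) \<odot>\<^bsub>M\<^esub> (a \<odot>\<^bsub>M\<^esub> y)" by simp
  then show ?thesis using e y a by (simp flip: smult_assoc)
qed

context hk begin

lemma qqs: "qq D (x + y) = qq D x * qq D y" "qq D 0 = 1" "qq D x \<noteq> 0" "qq D x * qq D (- x) = 1" "qq D (- x) * qq D x = 1"
  using qq_simps[OF qd] by (simp_all flip: qq_simps(1)[OF qd])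

lemma E'12_lact:
  assumes "lmod B M" "y \<in> carrier M"
  shows "E'12 D M (\<lambda>a b. p a b \<rhd>\<^bsub>M\<^esub> y) = qq D (exp_m D) \<odot>\<^bsub>M\<^esub> y"
proof -
  interpret M: lmod B M by fact
  have l: "lin_map B M (\<lambda>b. b \<rhd>\<^bsub>M\<^esub> y)"
    using assms(2) by (auto simp: lin_map_def M.lact_add_l M.smult_B_lact)
  have "E'12 D M (\<lambda>a b. p a b \<rhd>\<^bsub>M\<^esub> y) = E'12 D B p \<rhd>\<^bsub>M\<^esub> y"
    by (rule lin_map_E'12[OF B.is_cspace M.is_cspace l p_closed, symmetric])
  also have "\<dots> = qq D (exp_m D) \<odot>\<^bsub>M\<^esub> y" using assms(2) by (simp add: BB_facts(4) M.smult_lact)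
  finally show ?thesis .
qed

lemma E'12_lact': "lmod B M \<Longrightarrow> b \<in> carrier B \<Longrightarrow> (\<And>i j. x i j \<in> carrier M) \<Longrightarrow>
    E'12 D M (\<lambda>i j. b \<rhd>\<^bsub>M\<^esub> x i j) = b \<rhd>\<^bsub>M\<^esub> E'12 D M x"
proof -
  assume M: "lmod B M" and b: "b \<in> carrier B" and x: "\<And>i j. x i j \<in> carrier M"
  interpret M: lmod B M by fact
  have l: "lin_map M M (\<lambda>y. b \<rhd>\<^bsub>M\<^esub> y)"
    using b by (auto simp: lin_map_def M.lact_add_r M.lact_smult)
  show ?thesis by (rule lin_map_E'12[OF M.is_cspace M.is_cspace l x, symmetric])
qed

lemma wm: "qq D (exp_w D - 2 - exp_m D) * qq D (exp_m D) = qq D (exp_w D - 2)"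
  by (simp flip: qqs(1))

lemma E23_closed:
  assumes "cspace M" "\<And>i j k l. x i j k l \<in> carrier M"
  shows "E23 M x i l \<in> carrier M"
proof -
  interpret M: cspace M by fact
  show ?thesis unfolding E23_def using assms(2) by (intro M.finsum_closed) auto
qed

lemma E23_scale:
  assumes "cspace M" "\<And>i j k l. x i j k l \<in> carrier M"
  shows "E23 M (fscale4 M c x) i l = c \<odot>\<^bsub>M\<^esub> E23 M x i l"
proof -
  interpret M: cspace M by fact
  show ?thesis unfolding E23_def fscale4_def by (subst M.smult_finsum) (auto simp: assms(2))
qed

text \<open>
  The relation for \<open>S~\<close> closes the legs of the one-form itself, and \<open>E'\<^sub>1\<^sub>2 \<partial>p = 0\<close>.
\<close>

lemma E23_pdp: "E23 Om (fprod (\<rhd>\<^bsub>Om\<^esub>) p (dp D)) i l = \<zero>\<^bsub>Om\<^esub>"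
proof -
  let ?x = "fprod (\<rhd>\<^bsub>Om\<^esub>) p (dp D)"
  have "E23 Om (St234 D Om ?x) i l = qq D (- exp_w D) \<odot>\<^bsub>Om\<^esub> E23 Om ?x i l"
    unfolding St_pdp by (rule E23_scale[OF O.is_cspace pd_closed(1)])
  moreover have "E23 Om (St234 D Om ?x) i l = \<zero>\<^bsub>Om\<^esub>"
    by (subst O.M.E23_St234[OF qd pd_closed(1)], unfold fprod_def, subst E'12_lact'[OF lmod_Om]) (simp_all add: E'_dp)
  ultimately have z: "qq D (- exp_w D) \<odot>\<^bsub>Om\<^esub> E23 Om ?x i l = \<zero>\<^bsub>Om\<^esub>" by simp
  have "qq D (exp_w D) \<odot>\<^bsub>Om\<^esub> (qq D (- exp_w D) \<odot>\<^bsub>Om\<^esub> E23 Om ?x i l) = \<zero>\<^bsub>Om\<^esub>" by (simp add: z)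
  moreover have ec: "E23 Om ?x i l \<in> carrier Om" by (rule E23_closed[OF O.is_cspace pd_closed(1)])
  ultimately have "(qq D (exp_w D) * qq D (- exp_w D)) \<odot>\<^bsub>Om\<^esub> E23 Om ?x i l = \<zero>\<^bsub>Om\<^esub>"
    by (simp only: O.M.smult_assoc)
  then show ?thesis using ec by (simp add: qqs)
qed

text \<open>
  The relation for \<open>S\<close> closes the legs of \<open>p\<close>, and \<open>E'\<^sub>1\<^sub>2 p = q^m\<close>.
\<close>

lemma E23_pdbp: "E23 Om (fprod (\<rhd>\<^bsub>Om\<^esub>) p (dbp D)) i l = dbp D i l"
proof (rule O.M.contraction_cancel[where c = "qq D (exp_w D)" and a = "qq D (exp_w D - 2)"])
  let ?x = "fprod (\<rhd>\<^bsub>Om\<^esub>) p (dbp D)"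
  show "E23 Om ?x i l \<in> carrier Om" by (rule E23_closed[OF O.is_cspace pd_closed(2)])
  have "qq D (exp_w D) \<odot>\<^bsub>Om\<^esub> E23 Om ?x i l = E23 Om (S123 D Om ?x) i l"
    unfolding S_pdbp by (rule E23_scale[OF O.is_cspace pd_closed(2), symmetric])
  also have "\<dots> = qq D (exp_w D - 2 - exp_m D) \<odot>\<^bsub>Om\<^esub> E'12 D Om (\<lambda>a b. ?x a b i l) \<oplus>\<^bsub>Om\<^esub>
      (qq D (exp_w D) - qq D (exp_w D - 2)) \<odot>\<^bsub>Om\<^esub> E23 Om ?x i l"
    by (rule O.M.E23_S123[OF qd pd_closed(2)])
  also have "E'12 D Om (\<lambda>a b. ?x a b i l) = qq D (exp_m D) \<odot>\<^bsub>Om\<^esub> dbp D i l"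
    unfolding fprod_def by (rule E'12_lact[OF lmod_Om]) simp
  finally show "qq D (exp_w D) \<odot>\<^bsub>Om\<^esub> E23 Om ?x i l = qq D (exp_w D - 2) \<odot>\<^bsub>Om\<^esub> dbp D i l \<oplus>\<^bsub>Om\<^esub>
      (qq D (exp_w D) - qq D (exp_w D - 2)) \<odot>\<^bsub>Om\<^esub> E23 Om ?x i l"
    by (simp add: wm flip: O.M.smult_assoc)
qed (simp_all add: qqs)

lemma pp_closed: "fprod (\<otimes>\<^bsub>B\<^esub>) p p i j k l \<in> carrier B"
  by (simp add: fprod_def)

lemma E'12_pp: "E'12 D B (\<lambda>a b. p a b \<otimes>\<^bsub>B\<^esub> y) = qq D (exp_m D) \<odot>\<^bsub>B\<^esub> y" if y: "y \<in> carrier B"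
proof -
  have l: "lin_map B B (\<lambda>b. b \<otimes>\<^bsub>B\<^esub> y)"
  proof -
    have "(c \<odot>\<^bsub>B\<^esub> x) \<otimes>\<^bsub>B\<^esub> y = c \<odot>\<^bsub>B\<^esub> (x \<otimes>\<^bsub>B\<^esub> y)" if "x \<in> carrier B" for c x
      using that y by (simp add: B.smult_sc[of x] B.smult_sc[of "x \<otimes>\<^bsub>B\<^esub> y"] B.m_assoc)
    then show ?thesis using y by (auto simp: lin_map_def B.l_distr)
  qed
  have "E'12 D B (\<lambda>a b. p a b \<otimes>\<^bsub>B\<^esub> y) = E'12 D B p \<otimes>\<^bsub>B\<^esub> y"
    by (rule lin_map_E'12[OF B.is_cspace B.is_cspace l p_closed, symmetric])
  also have "\<dots> = qq D (exp_m D) \<odot>\<^bsub>B\<^esub> y" using y by (simp add: BB_facts(4) B.smult_sc[OF y])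
  finally show ?thesis .
qed

lemma E23_pp: "E23 B (fprod (\<otimes>\<^bsub>B\<^esub>) p p) i l = p i l"
proof -
  interpret C: cspace B by (rule B.is_cspace)
  show ?thesis
  proof (rule C.contraction_cancel[where c = "qq D (exp_w D)" and a = "qq D (exp_w D - 2)"])
    let ?x = "fprod (\<otimes>\<^bsub>B\<^esub>) p p"
    show "E23 B ?x i l \<in> carrier B" by (rule E23_closed[OF B.is_cspace pp_closed])
    have "qq D (exp_w D) \<odot>\<^bsub>B\<^esub> E23 B ?x i l = E23 B (S123 D B ?x) i l"
      unfolding BB_facts(3) by (rule E23_scale[OF B.is_cspace pp_closed, symmetric])
    also have "\<dots> = qq D (exp_w D - 2 - exp_m D) \<odot>\<^bsub>B\<^esub> E'12 D B (\<lambda>a b. ?x a b i l) \<oplus>\<^bsub>B\<^esub>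
        (qq D (exp_w D) - qq D (exp_w D - 2)) \<odot>\<^bsub>B\<^esub> E23 B ?x i l"
      by (rule C.E23_S123[OF qd pp_closed])
    also have "E'12 D B (\<lambda>a b. ?x a b i l) = qq D (exp_m D) \<odot>\<^bsub>B\<^esub> p i l"
      unfolding fprod_def by (rule E'12_pp) simp
    finally show "qq D (exp_w D) \<odot>\<^bsub>B\<^esub> E23 B ?x i l = qq D (exp_w D - 2) \<odot>\<^bsub>B\<^esub> p i l \<oplus>\<^bsub>B\<^esub>
        (qq D (exp_w D) - qq D (exp_w D - 2)) \<odot>\<^bsub>B\<^esub> E23 B ?x i l"
      by (simp add: wm flip: C.smult_assoc)
  qed (simp_all add: qqs)
qed

text \<open>
  Passing \<open>p\<close> to the left costs \<open>S S~\<close>.  Here \<open>S~\<close> is a scalar by the relations, and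
  \<open>S\<close> is contracted with the vanishing of the contraction of \<open>p \<partial>p\<close> in hand.
\<close>

lemma E23_dp_p: "E23 Om (fprod (\<lhd>\<^bsub>Om\<^esub>) (dp D) p) i l = dp D i l"
proof -
  let ?x = "fprod (\<rhd>\<^bsub>Om\<^esub>) p (dp D)"
  note Sc = O.M.S123_in(1)[OF O.M.csub_carrier, of ?x, OF pd_closed(1)]
  have "T1234 D Om ?x = fscale4 Om (qq D (- exp_w D)) (S123 D Om ?x)"
    unfolding T1234_def St_pdp by (rule O.M.S123_scale[OF pd_closed(1)])
  moreover have "fscale4 Om c (S123 D Om ?x) i j k l \<in> carrier Om" for c i j k l
    unfolding fscale4_def using Sc by simp
  ultimately have "E23 Om (fprod (\<lhd>\<^bsub>Om\<^esub>) (dp D) p) i l =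
      qq D (exp_a D) \<odot>\<^bsub>Om\<^esub> (qq D (- exp_w D) \<odot>\<^bsub>Om\<^esub> E23 Om (S123 D Om ?x) i l)"
    unfolding dp_ract using Sc by (simp add: E23_scale[OF O.is_cspace])
  also have "E23 Om (S123 D Om ?x) i l = qq D (exp_w D - 2 - exp_m D) \<odot>\<^bsub>Om\<^esub> E'12 D Om (\<lambda>a b. ?x a b i l)"
    using O.M.E23_S123[OF qd pd_closed(1), where i = i and l = l] E23_pdp by (simp add: E'12_def fprod_def)
  also have "E'12 D Om (\<lambda>a b. ?x a b i l) = qq D (exp_m D) \<odot>\<^bsub>Om\<^esub> dp D i l"
    unfolding fprod_def by (rule E'12_lact[OF lmod_Om]) simp
  finally have "E23 Om (fprod (\<lhd>\<^bsub>Om\<^esub>) (dp D) p) i l =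
      (qq D (exp_a D) * qq D (- exp_w D) * (qq D (exp_w D - 2 - exp_m D) * qq D (exp_m D))) \<odot>\<^bsub>Om\<^esub> dp D i l"
    by (simp add: mult.assoc flip: O.M.smult_assoc)
  also have "qq D (exp_a D) * qq D (- exp_w D) * (qq D (exp_w D - 2 - exp_m D) * qq D (exp_m D)) = 1"
    by (simp add: R_matrix_facts(1)[OF qd] qqs(2) flip: qqs(1))
  finally show ?thesis by simp
qed

text \<open>
  Passing \<open>p\<close> to the left costs \<open>S~ S\<close>.  Here \<open>S\<close> is a scalar by the relations, and the
  contraction of \<open>S~\<close> closes the legs of the one-form.
\<close>

lemma E23_dbp_p: "E23 Om (fprod (\<lhd>\<^bsub>Om\<^esub>) (dbp D) p) i l = \<zero>\<^bsub>Om\<^esub>"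
proof -
  let ?x = "fprod (\<rhd>\<^bsub>Om\<^esub>) p (dbp D)"
  note Sc = O.M.S123_in(1)[OF O.M.csub_carrier, of ?x, OF pd_closed(2)]
  note Tc = O.M.S123_in(2)[OF O.M.csub_carrier, of "S123 D Om ?x", OF Sc]
  have "T1234 D Om ?x = St234 D Om (S123 D Om ?x)"
    unfolding T1234_def by (rule O.M.S123_St234[OF qd pd_closed(2)])
  then have "E23 Om (fprod (\<lhd>\<^bsub>Om\<^esub>) (dbp D) p) i l = qq D (- exp_a D) \<odot>\<^bsub>Om\<^esub> E23 Om (St234 D Om (S123 D Om ?x)) i l"
    unfolding dbp_ract using Tc by (simp add: E23_scale[OF O.is_cspace])
  also have "E23 Om (St234 D Om (S123 D Om ?x)) i l =
      qq D (- exp_w D - exp_m D) \<odot>\<^bsub>Om\<^esub> E'12 D Om (\<lambda>a b. (qq D (exp_w D) \<odot>\<^bsub>B\<^esub> p i l) \<rhd>\<^bsub>Om\<^esub> dbp D a b)"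
    unfolding O.M.E23_St234[OF qd Sc] unfolding S_pdbp by (simp add: fscale4_def fprod_def O.smult_B_lact)
  also have "\<dots> = \<zero>\<^bsub>Om\<^esub>"
    using B.is_cspace by (subst E'12_lact'[OF lmod_Om]) (simp_all add: E'_dp cspace.smult_closed)
  finally show ?thesis by simp
qed

text \<open>
  By the commutation rule, right multiplication by generators stays within the complex span of left
  multiples.  Vanishing statements thus pass from \<open>p \<partial>p\<close> to \<open>(\<partial>p) p\<close>.
\<close>

lemma dp_p_in:
  assumes "O.M.csub W" "\<And>i j k l. p i j \<rhd>\<^bsub>Om\<^esub> dp D k l \<in> W"
  shows "dp D i j \<lhd>\<^bsub>Om\<^esub> p k l \<in> W"
proof -
  have "dp D i j \<lhd>\<^bsub>Om\<^esub> p k l = qq D (exp_a D) \<odot>\<^bsub>Om\<^esub> T1234 D Om (fprod (\<rhd>\<^bsub>Om\<^esub>) p (dp D)) i j k l"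
    using dp_ract by (simp add: fprod_def fscale4_def fun_eq_iff)
  then show ?thesis unfolding T1234_def
    using assms by (auto intro!: O.M.csub_smult O.M.S123_in simp: fprod_def)
qed

lemma parts: "dp D i j \<in> plus_part D" "dbp D i j \<in> minus_part D"
  unfolding d_qc plus_part_def minus_part_def Omega_plus_def Omega_minus_def
  using free_gen_closed by auto

end

section \<open>Curvature and contraction with the metric\<close>

lemma balancedI:
  assumes "\<And>x y. x \<in> carrier M \<Longrightarrow> y \<in> carrier N \<Longrightarrow> f x y \<in> carrier P"
    "\<And>x x' y. x \<in> carrier M \<Longrightarrow> x' \<in> carrier M \<Longrightarrow> y \<in> carrier N \<Longrightarrow> f (x \<oplus>\<^bsub>M\<^esub> x') y = f x y \<oplus>\<^bsub>P\<^esub> f x' y"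
    "\<And>x y y'. x \<in> carrier M \<Longrightarrow> y \<in> carrier N \<Longrightarrow> y' \<in> carrier N \<Longrightarrow> f x (y \<oplus>\<^bsub>N\<^esub> y') = f x y \<oplus>\<^bsub>P\<^esub> f x y'"
    "\<And>x b y. x \<in> carrier M \<Longrightarrow> b \<in> carrier B \<Longrightarrow> y \<in> carrier N \<Longrightarrow> f (x \<lhd>\<^bsub>M\<^esub> b) y = f x (b \<rhd>\<^bsub>N\<^esub> y)"
  shows "balanced B M N P f"
  unfolding balanced_def add_map_def using assms by (simp add: Pi_iff)

lemma add_mapI:
  assumes "\<And>x. x \<in> carrier M \<Longrightarrow> f x \<in> carrier P"
    "\<And>x y. x \<in> carrier M \<Longrightarrow> y \<in> carrier M \<Longrightarrow> f (x \<oplus>\<^bsub>M\<^esub> y) = f x \<oplus>\<^bsub>P\<^esub> f y"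
  shows "add_map M P f"
  unfolding add_map_def using assms by simp

lemma (in abelian_monoid) add_add_swap:
  "a \<in> carrier G \<Longrightarrow> b \<in> carrier G \<Longrightarrow> c \<in> carrier G \<Longrightarrow> e \<in> carrier G \<Longrightarrow>
    (a \<oplus> b) \<oplus> (c \<oplus> e) = (a \<oplus> c) \<oplus> (b \<oplus> e)"
  by (simp add: a_ac)

lemma (in abelian_group) diff_add_swap:
  "a \<in> carrier G \<Longrightarrow> b \<in> carrier G \<Longrightarrow> c \<in> carrier G \<Longrightarrow> e \<in> carrier G \<Longrightarrow>
    (a \<oplus> b) \<ominus> (c \<oplus> e) = (a \<ominus> c) \<oplus> (b \<ominus> e)"
  by (simp add: minus_eq minus_add a_ac)

text \<open>
  All maps are given by their characterising properties; the scalar \<open>cmp\<close> is the coefficient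
  \<open>c\<^sub>-\<^sub>+\<close>, and \<open>gi\<close> is the inverse metric.
\<close>

locale ricci = hk D \<rho>
  for D :: "('n::finite) qdata" and \<rho> :: "'n forms1 \<Rightarrow> 'n alg \<Rightarrow> 'n forms1" +
  fixes del delbar :: "'n alg \<Rightarrow> 'n forms1"
    and d1 :: "'n forms1 \<Rightarrow> 'n forms2"
    and gi :: "'n forms1_1 \<Rightarrow> 'n alg"
    and nab :: "'n forms1 \<Rightarrow> 'n forms1_1"
    and \<sigma> :: "'n forms1_1 \<Rightarrow> 'n forms1_1"
    and s :: "'n forms2 \<Rightarrow> 'n forms1_1"
    and cpm cmp :: complex
  assumes del: "hk_del D \<rho> del delbar"
    and ext: "is_exterior_d D \<rho> (total_d D \<rho> del delbar) d1"
    and inv: "is_inverse_metric D \<rho> gi"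
    and lc: "is_levi_civita D \<rho> (total_d D \<rho> del delbar) nab"
    and gb: "is_generalized_braiding D \<rho> \<sigma>"
    and sp: "is_splitting D \<rho> (total_d D \<rho> del delbar) \<sigma> cpm cmp s"
begin

abbreviation "d \<equiv> total_d D \<rho> del delbar"

sublocale T: tensp B Om Om
  by (rule tensp.intro[OF bimd_Om bimd_Om])

abbreviation "O2 \<equiv> tensor B Om Om"
abbreviation tt (infixl "\<^bold>\<otimes>\<^sub>1" 72) where "tt \<equiv> ptens B Om Om"

lemma Om11: "Omega11 D \<rho> = O2" and ot: "ot D \<rho> = ptens B Om Om"
  by (simp_all add: Omega11_def ot_def)

sublocale O2: bimd B O2 by (rule T.bimd_MN)

lemma del_facts:
  "lin_map B Om del" "lin_map B Om delbar"
  "a \<in> carrier B \<Longrightarrow> b \<in> carrier B \<Longrightarrow> del (a \<otimes>\<^bsub>B\<^esub> b) = del a \<lhd>\<^bsub>Om\<^esub> b \<oplus>\<^bsub>Om\<^esub> a \<rhd>\<^bsub>Om\<^esub> del b"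
  "a \<in> carrier B \<Longrightarrow> b \<in> carrier B \<Longrightarrow> delbar (a \<otimes>\<^bsub>B\<^esub> b) = delbar a \<lhd>\<^bsub>Om\<^esub> b \<oplus>\<^bsub>Om\<^esub> a \<rhd>\<^bsub>Om\<^esub> delbar b"
  "del (p i j) = dp D i j" "delbar (p i j) = dbp D i j"
  using del unfolding hk_del_def is_derivation_def by blast+

lemma d_closed [simp, intro]: "b \<in> carrier B \<Longrightarrow> d b \<in> carrier Om"
  unfolding total_d_def using lin_map_closed[OF del_facts(1)] lin_map_closed[OF del_facts(2)] by simp

lemma d_smult: "b \<in> carrier B \<Longrightarrow> d (c \<odot>\<^bsub>B\<^esub> b) = c \<odot>\<^bsub>Om\<^esub> d b"
  unfolding total_d_def using lin_map_closed[OF del_facts(1)] lin_map_closed[OF del_facts(2)]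
    lin_map_smult[OF del_facts(1)] lin_map_smult[OF del_facts(2)]
  by (simp add: O.M.smult_r_distr)

lemma d_mult: "a \<in> carrier B \<Longrightarrow> b \<in> carrier B \<Longrightarrow> d (a \<otimes>\<^bsub>B\<^esub> b) = d a \<lhd>\<^bsub>Om\<^esub> b \<oplus>\<^bsub>Om\<^esub> a \<rhd>\<^bsub>Om\<^esub> d b"
  unfolding total_d_def using lin_map_closed[OF del_facts(1)] lin_map_closed[OF del_facts(2)]
  by (simp add: del_facts(3,4) O.ract_add_l O.lact_add_r O.M.add_add_swap)

lemma d_p: "d (p i j) = dp D i j \<oplus>\<^bsub>Om\<^esub> dbp D i j"
  by (simp add: total_d_def del_facts)

lemma d_one: "d \<one>\<^bsub>B\<^esub> = \<zero>\<^bsub>Om\<^esub>"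
proof -
  have "d \<one>\<^bsub>B\<^esub> = d \<one>\<^bsub>B\<^esub> \<oplus>\<^bsub>Om\<^esub> d \<one>\<^bsub>B\<^esub>"
    using d_mult[of "\<one>\<^bsub>B\<^esub>" "\<one>\<^bsub>B\<^esub>"] by simp
  then show ?thesis using d_closed[of "\<one>\<^bsub>B\<^esub>"] by (metis B.one_closed O.M.add.l_cancel_one)
qed

abbreviation "UR \<equiv> universal_relations D \<rho> d"

sublocale U: bquot B O2 UR
proof (rule bquot.intro[OF T.bimd_MN bquot_axioms.intro])
  show "sub_bimodule B O2 UR"
    unfolding universal_relations_def Om11
    by (rule O2.sub_bimodule_span(1)) (auto simp: ot intro!: T.MN.finsum_closed T.pt_closed)
qed

abbreviation "W2 \<equiv> bimod_quot O2 UR"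

lemma Om2: "Omega2 D \<rho> d = W2"
  by (simp add: Omega2_def Om11)

sublocale W2: bimd B W2 by (rule U.bimd_Q)

abbreviation ww where "ww \<equiv> wedge D \<rho> d"

lemma ww_qc: "ww \<omega> \<eta> = U.qc (\<omega> \<^bold>\<otimes>\<^sub>1 \<eta>)"
  by (simp add: wedge_def U.qc_def Om11 ot)

lemma ww_closed [simp, intro]: "\<omega> \<in> carrier Om \<Longrightarrow> \<eta> \<in> carrier Om \<Longrightarrow> ww \<omega> \<eta> \<in> carrier W2"
  by (simp add: ww_qc)

lemma ww_add_l: "\<omega> \<in> carrier Om \<Longrightarrow> \<omega>' \<in> carrier Om \<Longrightarrow> \<eta> \<in> carrier Om \<Longrightarrow>
    ww (\<omega> \<oplus>\<^bsub>Om\<^esub> \<omega>') \<eta> = ww \<omega> \<eta> \<oplus>\<^bsub>W2\<^esub> ww \<omega>' \<eta>"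
  by (simp add: ww_qc T.pt_add_l U.add_Q)

lemma ww_add_r: "\<omega> \<in> carrier Om \<Longrightarrow> \<eta> \<in> carrier Om \<Longrightarrow> \<eta>' \<in> carrier Om \<Longrightarrow>
    ww \<omega> (\<eta> \<oplus>\<^bsub>Om\<^esub> \<eta>') = ww \<omega> \<eta> \<oplus>\<^bsub>W2\<^esub> ww \<omega> \<eta>'"
  by (simp add: ww_qc T.pt_add_r U.add_Q)

lemma ww_bal: "\<omega> \<in> carrier Om \<Longrightarrow> b \<in> carrier B \<Longrightarrow> \<eta> \<in> carrier Om \<Longrightarrow> ww (\<omega> \<lhd>\<^bsub>Om\<^esub> b) \<eta> = ww \<omega> (b \<rhd>\<^bsub>Om\<^esub> \<eta>)"
  by (simp add: ww_qc T.pt_bal)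

lemma ww_lact: "\<omega> \<in> carrier Om \<Longrightarrow> b \<in> carrier B \<Longrightarrow> \<eta> \<in> carrier Om \<Longrightarrow> ww (b \<rhd>\<^bsub>Om\<^esub> \<omega>) \<eta> = b \<rhd>\<^bsub>W2\<^esub> ww \<omega> \<eta>"
  by (simp add: ww_qc T.lact_pt[symmetric] U.lact_Q)

lemma ww_ract: "\<omega> \<in> carrier Om \<Longrightarrow> b \<in> carrier B \<Longrightarrow> \<eta> \<in> carrier Om \<Longrightarrow> ww \<omega> (\<eta> \<lhd>\<^bsub>Om\<^esub> b) = ww \<omega> \<eta> \<lhd>\<^bsub>W2\<^esub> b"
  by (simp add: ww_qc T.ract_pt[symmetric] U.ract_Q)

sublocale T2: tensp B W2 Om
  by (rule tensp.intro[OF U.bimd_Q bimd_Om])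

abbreviation "O21 \<equiv> tensor B W2 Om"
abbreviation tt2 (infixl "\<^bold>\<otimes>\<^sub>2" 72) where "tt2 \<equiv> ptens B W2 Om"

lemma Om21: "Omega21 D \<rho> d = O21" by (simp add: Omega21_def Om2)

sublocale O21: bimd B O21 by (rule T2.bimd_MN)

abbreviation wid where "wid \<equiv> wedge_id D \<rho> d"

lemma wid_bal: "\<omega> \<in> carrier Om \<Longrightarrow> balanced B Om Om O21 (\<lambda>\<alpha> \<beta>. ww \<omega> \<alpha> \<^bold>\<otimes>\<^sub>2 \<beta>)"
  by (rule balancedI) (simp_all add: ww_add_r T2.pt_add_l T2.pt_add_r ww_ract T2.pt_bal)

lemma wid_eq: "wid \<omega> X = tens_lift O21 (\<lambda>\<alpha> \<beta>. ww \<omega> \<alpha> \<^bold>\<otimes>\<^sub>2 \<beta>) X"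
  by (simp add: wedge_id_def Om21 Om2)

lemma wid_add_map: "\<omega> \<in> carrier Om \<Longrightarrow> add_map O2 O21 (wid \<omega>)"
  unfolding wid_eq[abs_def] by (rule T.tens_lift_add_map[OF T2.abelian_MN wid_bal])

lemma wid_pt: "\<omega> \<in> carrier Om \<Longrightarrow> \<alpha> \<in> carrier Om \<Longrightarrow> \<beta> \<in> carrier Om \<Longrightarrow> wid \<omega> (\<alpha> \<^bold>\<otimes>\<^sub>1 \<beta>) = ww \<omega> \<alpha> \<^bold>\<otimes>\<^sub>2 \<beta>"
  unfolding wid_eq by (rule T.tens_lift_pt[OF T2.abelian_MN wid_bal])

lemma wid_closed [simp, intro]: "\<omega> \<in> carrier Om \<Longrightarrow> X \<in> carrier O2 \<Longrightarrow> wid \<omega> X \<in> carrier O21"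
  by (rule add_map_closed[OF wid_add_map])

lemma wid_add: "\<omega> \<in> carrier Om \<Longrightarrow> X \<in> carrier O2 \<Longrightarrow> Y \<in> carrier O2 \<Longrightarrow> wid \<omega> (X \<oplus>\<^bsub>O2\<^esub> Y) = wid \<omega> X \<oplus>\<^bsub>O21\<^esub> wid \<omega> Y"
  by (rule add_map_add[OF wid_add_map])

lemma wid_add_l: "\<omega> \<in> carrier Om \<Longrightarrow> \<omega>' \<in> carrier Om \<Longrightarrow> X \<in> carrier O2 \<Longrightarrow>
    wid (\<omega> \<oplus>\<^bsub>Om\<^esub> \<omega>') X = wid \<omega> X \<oplus>\<^bsub>O21\<^esub> wid \<omega>' X"
  by (rule T.tens_ext[OF T2.abelian_MN wid_add_map add_map_add_maps[OF T2.abelian_MN wid_add_map wid_add_map]])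
    (simp_all add: wid_pt ww_add_l T2.pt_add_l)

lemma wid_bal_l: "\<omega> \<in> carrier Om \<Longrightarrow> b \<in> carrier B \<Longrightarrow> X \<in> carrier O2 \<Longrightarrow>
    wid (\<omega> \<lhd>\<^bsub>Om\<^esub> b) X = wid \<omega> (b \<rhd>\<^bsub>O2\<^esub> X)"
  by (rule T.tens_ext[OF T2.abelian_MN wid_add_map add_map_comp[OF T.add_map_lact wid_add_map]])
    (simp_all add: wid_pt T.lact_pt ww_bal)

lemma wid_lact: "\<omega> \<in> carrier Om \<Longrightarrow> b \<in> carrier B \<Longrightarrow> X \<in> carrier O2 \<Longrightarrow>
    wid (b \<rhd>\<^bsub>Om\<^esub> \<omega>) X = b \<rhd>\<^bsub>O21\<^esub> wid \<omega> X"
  by (rule T.tens_ext[OF T2.abelian_MN wid_add_map add_map_comp[OF wid_add_map T2.add_map_lact]])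
    (simp_all add: wid_pt T2.lact_pt ww_lact)

lemma d1_lin: "lin_map Om W2 d1"
  and d1_dd: "a \<in> carrier B \<Longrightarrow> b \<in> carrier B \<Longrightarrow> d1 (a \<rhd>\<^bsub>Om\<^esub> d b) = ww (d a) (d b)"
  using ext unfolding is_exterior_d_def Om2 by blast+

lemmas d1_closed [simp, intro] = lin_map_closed[OF d1_lin]
lemmas d1_add = add_map_add[OF lin_map_add_map[OF d1_lin]]
lemmas d1_zero = add_map_zero[OF O.M.abelian_group_axioms U.Q.abelian_group_axioms lin_map_add_map[OF d1_lin]]

lemma d1_d: "b \<in> carrier B \<Longrightarrow> d1 (d b) = \<zero>\<^bsub>W2\<^esub>"
proof -
  assume b: "b \<in> carrier B"
  have "d1 (d b) = ww \<zero>\<^bsub>Om\<^esub> (d b)" using d1_dd[OF B.one_closed b] b by (simp add: d_one)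
  moreover have "ww \<zero>\<^bsub>Om\<^esub> (d b) \<oplus>\<^bsub>W2\<^esub> ww \<zero>\<^bsub>Om\<^esub> (d b) = ww \<zero>\<^bsub>Om\<^esub> (d b)"
    using b by (simp flip: ww_add_l)
  ultimately show ?thesis using b by (metis O.M.zero_closed U.Q.add.l_cancel_one d_closed ww_closed)
qed

text \<open>
  The contractions of \<open>p \<partial>p\<close> and of \<open>p \<partial>'p\<close> add up to this.  It writes a generator in the form
  \<open>\<Sum> a db\<close>, on which the exterior derivative is known.
\<close>

lemma dbp_d: "dbp D i l = (\<Oplus>\<^bsub>Om\<^esub>j\<in>UNIV. p i j \<rhd>\<^bsub>Om\<^esub> d (p j l))"
proof -
  have "(\<Oplus>\<^bsub>Om\<^esub>j\<in>UNIV. p i j \<rhd>\<^bsub>Om\<^esub> d (p j l)) =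
      (\<Oplus>\<^bsub>Om\<^esub>j\<in>UNIV. p i j \<rhd>\<^bsub>Om\<^esub> dp D j l) \<oplus>\<^bsub>Om\<^esub> (\<Oplus>\<^bsub>Om\<^esub>j\<in>UNIV. p i j \<rhd>\<^bsub>Om\<^esub> dbp D j l)"
    by (subst O.M.finsum_addf[symmetric]) (auto simp: d_p O.lact_add_r)
  also have "\<dots> = dbp D i l"
    using E23_pdp[of i l] E23_pdbp[of i l] by (simp add: E23_def fprod_def)
  finally show ?thesis ..
qed

text \<open>
  Since \<open>\<partial>'p\<close>, and hence \<open>\<partial>p = dp - \<partial>'p\<close>, is a combination of terms \<open>a db\<close>, these terms generate the
  one-forms.
\<close>

lemma Om_induct_d [consumes 1, case_names zero add d]:
  assumes x: "x \<in> carrier Om" and z: "P \<zero>\<^bsub>Om\<^esub>"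
    and add: "\<And>x y. x \<in> carrier Om \<Longrightarrow> y \<in> carrier Om \<Longrightarrow> P x \<Longrightarrow> P y \<Longrightarrow> P (x \<oplus>\<^bsub>Om\<^esub> y)"
    and d: "\<And>a b. a \<in> carrier B \<Longrightarrow> b \<in> carrier B \<Longrightarrow> P (a \<rhd>\<^bsub>Om\<^esub> d b)"
  shows "P x"
proof -
  have bb: "P (b \<rhd>\<^bsub>Om\<^esub> dbp D i l)" if b: "b \<in> carrier B" for b i l
  proof -
    have "b \<rhd>\<^bsub>Om\<^esub> dbp D i l = (\<Oplus>\<^bsub>Om\<^esub>j\<in>UNIV. (b \<otimes>\<^bsub>B\<^esub> p i j) \<rhd>\<^bsub>Om\<^esub> d (p j l))"
      unfolding dbp_d
      by (subst add_map_finsum[OF O.M.abelian_group_axioms O.M.abelian_group_axioms, of "\<lambda>x. b \<rhd>\<^bsub>Om\<^esub> x"])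
        (use b in \<open>auto simp: O.lact_assoc O.lact_add_r intro!: add_mapI O.M.finsum_cong'\<close>)
    also have "\<dots> \<in> {x \<in> carrier Om. P x}"
      by (rule O.M.finsum_in) (use b z add d in auto)
    finally show ?thesis by simp
  qed
  show ?thesis using x
  proof (induction x rule: Om_induct)
    case (dp b i j)
    have m: "(- 1) \<odot>\<^bsub>B\<^esub> b \<in> carrier B" using dp by (rule cspace.smult_closed[OF B.is_cspace])
    have "b \<rhd>\<^bsub>Om\<^esub> dp D i j = b \<rhd>\<^bsub>Om\<^esub> d (p i j) \<oplus>\<^bsub>Om\<^esub> ((- 1) \<odot>\<^bsub>B\<^esub> b) \<rhd>\<^bsub>Om\<^esub> dbp D i j"
      using dp by (simp add: d_p O.lact_add_r O.smult_B_lact O.M.smult_minus_one O.M.a_assoc O.M.r_neg)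
    then show ?case using add[OF _ _ d[OF dp p_closed] bb[OF m]] dp m by simp
  qed (use z add bb in auto)
qed

lemma d1_lact:
  assumes "x \<in> carrier Om" "b \<in> carrier B"
  shows "d1 (b \<rhd>\<^bsub>Om\<^esub> x) = ww (d b) x \<oplus>\<^bsub>W2\<^esub> b \<rhd>\<^bsub>W2\<^esub> d1 x"
  using assms(1)
proof (induction x rule: Om_induct_d)
  case zero
  have "ww (d b) \<zero>\<^bsub>Om\<^esub> \<oplus>\<^bsub>W2\<^esub> ww (d b) \<zero>\<^bsub>Om\<^esub> = ww (d b) \<zero>\<^bsub>Om\<^esub>" using assms by (simp flip: ww_add_r)
  then have "ww (d b) \<zero>\<^bsub>Om\<^esub> = \<zero>\<^bsub>W2\<^esub>" using assms by (metis O.M.zero_closed U.Q.add.l_cancel_one d_closed ww_closed)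
  then show ?case using assms by (simp add: d1_zero)
next
  case (add x y)
  then show ?case using assms by (simp add: O.lact_add_r d1_add ww_add_r W2.lact_add_r U.Q.add_add_swap)
next
  case (d a c)
  have "b \<rhd>\<^bsub>Om\<^esub> (a \<rhd>\<^bsub>Om\<^esub> d c) = (b \<otimes>\<^bsub>B\<^esub> a) \<rhd>\<^bsub>Om\<^esub> d c" using d assms by (simp add: O.lact_assoc)
  then show ?case using d assms by (simp add: d1_dd d_mult ww_add_l ww_bal ww_lact)
qed

text \<open>
  The graded Leibniz rule on the right, which makes the curvature map below well-defined on the
  tensor product over the algebra.
\<close>

lemma d1_ract:
  assumes "x \<in> carrier Om" "b \<in> carrier B"
  shows "d1 (x \<lhd>\<^bsub>Om\<^esub> b) \<oplus>\<^bsub>W2\<^esub> ww x (d b) = d1 x \<lhd>\<^bsub>W2\<^esub> b"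
  using assms(1)
proof (induction x rule: Om_induct_d)
  case zero
  have z: "\<zero>\<^bsub>Om\<^esub> \<lhd>\<^bsub>Om\<^esub> b = \<zero>\<^bsub>Om\<^esub>"
    by (rule add_map_zero[OF O.M.abelian_group_axioms O.M.abelian_group_axioms])
      (use assms in \<open>auto intro!: add_mapI simp: O.ract_add_l\<close>)
  have z2: "\<zero>\<^bsub>W2\<^esub> \<lhd>\<^bsub>W2\<^esub> b = \<zero>\<^bsub>W2\<^esub>"
    by (rule add_map_zero[OF U.Q.abelian_group_axioms U.Q.abelian_group_axioms])
      (use assms in \<open>auto intro!: add_mapI simp: W2.ract_add_l\<close>)
  have z3: "ww \<zero>\<^bsub>Om\<^esub> (d b) = \<zero>\<^bsub>W2\<^esub>"
    by (rule add_map_zero[OF O.M.abelian_group_axioms U.Q.abelian_group_axioms])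
      (use assms in \<open>auto intro!: add_mapI simp: ww_add_l\<close>)
  show ?case by (simp add: z z2 z3 d1_zero)
next
  case (add x y)
  have "d1 ((x \<oplus>\<^bsub>Om\<^esub> y) \<lhd>\<^bsub>Om\<^esub> b) \<oplus>\<^bsub>W2\<^esub> ww (x \<oplus>\<^bsub>Om\<^esub> y) (d b) =
     (d1 (x \<lhd>\<^bsub>Om\<^esub> b) \<oplus>\<^bsub>W2\<^esub> ww x (d b)) \<oplus>\<^bsub>W2\<^esub> (d1 (y \<lhd>\<^bsub>Om\<^esub> b) \<oplus>\<^bsub>W2\<^esub> ww y (d b))"
    using add(1,2) assms by (simp add: O.ract_add_l d1_add ww_add_l U.Q.add_add_swap)
  then show ?case using add assms by (simp add: d1_add W2.ract_add_l)
next
  case (d a c)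
  have e: "(a \<rhd>\<^bsub>Om\<^esub> d c) \<lhd>\<^bsub>Om\<^esub> b \<oplus>\<^bsub>Om\<^esub> (a \<otimes>\<^bsub>B\<^esub> c) \<rhd>\<^bsub>Om\<^esub> d b = a \<rhd>\<^bsub>Om\<^esub> d (c \<otimes>\<^bsub>B\<^esub> b)"
    using d assms by (simp add: O.lact_ract O.lact_assoc d_mult O.lact_add_r)
  have "d1 ((a \<rhd>\<^bsub>Om\<^esub> d c) \<lhd>\<^bsub>Om\<^esub> b) \<oplus>\<^bsub>W2\<^esub> d1 ((a \<otimes>\<^bsub>B\<^esub> c) \<rhd>\<^bsub>Om\<^esub> d b) = d1 (a \<rhd>\<^bsub>Om\<^esub> d (c \<otimes>\<^bsub>B\<^esub> b))"
    unfolding e[symmetric] using d assms by (simp add: d1_add)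
  moreover have "d1 (a \<rhd>\<^bsub>Om\<^esub> d (c \<otimes>\<^bsub>B\<^esub> b)) = ww (d a) (d c) \<lhd>\<^bsub>W2\<^esub> b \<oplus>\<^bsub>W2\<^esub> ww (d a \<lhd>\<^bsub>Om\<^esub> c) (d b)"
    using d assms d1_dd[of a "c \<otimes>\<^bsub>B\<^esub> b"] by (simp add: d_mult ww_add_r ww_ract ww_bal)
  moreover have "d1 ((a \<otimes>\<^bsub>B\<^esub> c) \<rhd>\<^bsub>Om\<^esub> d b) = ww (d a \<lhd>\<^bsub>Om\<^esub> c) (d b) \<oplus>\<^bsub>W2\<^esub> ww (a \<rhd>\<^bsub>Om\<^esub> d c) (d b)"
    using d assms by (simp add: d1_dd d_mult ww_add_l)
  ultimately have "d1 ((a \<rhd>\<^bsub>Om\<^esub> d c) \<lhd>\<^bsub>Om\<^esub> b) \<oplus>\<^bsub>W2\<^esub> (ww (d a \<lhd>\<^bsub>Om\<^esub> c) (d b) \<oplus>\<^bsub>W2\<^esub> ww (a \<rhd>\<^bsub>Om\<^esub> d c) (d b)) =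
      ww (d a) (d c) \<lhd>\<^bsub>W2\<^esub> b \<oplus>\<^bsub>W2\<^esub> ww (d a \<lhd>\<^bsub>Om\<^esub> c) (d b)"
    by simp
  then have "(d1 ((a \<rhd>\<^bsub>Om\<^esub> d c) \<lhd>\<^bsub>Om\<^esub> b) \<oplus>\<^bsub>W2\<^esub> ww (a \<rhd>\<^bsub>Om\<^esub> d c) (d b)) \<oplus>\<^bsub>W2\<^esub> ww (d a \<lhd>\<^bsub>Om\<^esub> c) (d b) =
      ww (d a) (d c) \<lhd>\<^bsub>W2\<^esub> b \<oplus>\<^bsub>W2\<^esub> ww (d a \<lhd>\<^bsub>Om\<^esub> c) (d b)"
    using d assms by (simp add: U.Q.a_assoc U.Q.a_comm[of "ww (d a \<lhd>\<^bsub>Om\<^esub> c) (d b)"])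
  then show ?case using d assms by (simp add: d1_dd)
qed

lemma nab_lin: "lin_map Om O2 nab"
  and nab_lact: "b \<in> carrier B \<Longrightarrow> \<omega> \<in> carrier Om \<Longrightarrow> nab (b \<rhd>\<^bsub>Om\<^esub> \<omega>) = d b \<^bold>\<otimes>\<^sub>1 \<omega> \<oplus>\<^bsub>O2\<^esub> b \<rhd>\<^bsub>O2\<^esub> nab \<omega>"
  using lc unfolding is_levi_civita_def Let_def Om11 ot by blast+

lemmas nab_closed [simp, intro] = lin_map_closed[OF nab_lin]
lemmas nab_add = add_map_add[OF lin_map_add_map[OF nab_lin]]

text \<open>
  The Riemann tensor is a composite of this map with the connection.  The induced map lives on the tensor
  product over the algebra, so the Riemann tensor can be evaluated on sums of pure tensors.
\<close>

definition "curv_pt \<alpha> \<beta> = d1 \<alpha> \<^bold>\<otimes>\<^sub>2 \<beta> \<ominus>\<^bsub>O21\<^esub> wid \<alpha> (nab \<beta>)"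

lemma curv_pt_closed [simp, intro]: "\<alpha> \<in> carrier Om \<Longrightarrow> \<beta> \<in> carrier Om \<Longrightarrow> curv_pt \<alpha> \<beta> \<in> carrier O21"
  unfolding curv_pt_def by (intro T2.MN.minus_closed T2.pt_closed wid_closed d1_closed nab_closed)

lemma curv_pt_bal: "balanced B Om Om O21 curv_pt"
proof (rule balancedI)
  fix \<alpha> \<alpha>' \<beta> assume "\<alpha> \<in> carrier Om" "\<alpha>' \<in> carrier Om" "\<beta> \<in> carrier Om"
  then show "curv_pt (\<alpha> \<oplus>\<^bsub>Om\<^esub> \<alpha>') \<beta> = curv_pt \<alpha> \<beta> \<oplus>\<^bsub>O21\<^esub> curv_pt \<alpha>' \<beta>"
    unfolding curv_pt_def by (simp add: d1_add T2.pt_add_l wid_add_l T2.MN.diff_add_swap)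
next
  fix \<alpha> \<beta> \<beta>' assume "\<alpha> \<in> carrier Om" "\<beta> \<in> carrier Om" "\<beta>' \<in> carrier Om"
  then show "curv_pt \<alpha> (\<beta> \<oplus>\<^bsub>Om\<^esub> \<beta>') = curv_pt \<alpha> \<beta> \<oplus>\<^bsub>O21\<^esub> curv_pt \<alpha> \<beta>'"
    unfolding curv_pt_def by (simp add: nab_add T2.pt_add_r wid_add T2.MN.diff_add_swap)
next
  fix \<alpha> b \<beta> assume a: "\<alpha> \<in> carrier Om" "b \<in> carrier B" "\<beta> \<in> carrier Om"
  have "curv_pt \<alpha> (b \<rhd>\<^bsub>Om\<^esub> \<beta>) = (d1 (\<alpha> \<lhd>\<^bsub>Om\<^esub> b) \<^bold>\<otimes>\<^sub>2 \<beta> \<oplus>\<^bsub>O21\<^esub> ww \<alpha> (d b) \<^bold>\<otimes>\<^sub>2 \<beta>) \<ominus>\<^bsub>O21\<^esub>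
      (ww \<alpha> (d b) \<^bold>\<otimes>\<^sub>2 \<beta> \<oplus>\<^bsub>O21\<^esub> wid (\<alpha> \<lhd>\<^bsub>Om\<^esub> b) (nab \<beta>))"
    unfolding curv_pt_def using a
    by (simp add: nab_lact wid_add wid_pt wid_bal_l T2.pt_bal[symmetric] d1_ract[symmetric] T2.pt_add_l)
  also have "\<dots> = curv_pt (\<alpha> \<lhd>\<^bsub>Om\<^esub> b) \<beta>"
    unfolding curv_pt_def using a
    by (simp add: T2.MN.minus_eq T2.MN.minus_add T2.MN.a_assoc T2.MN.r_neg2)
  finally show "curv_pt (\<alpha> \<lhd>\<^bsub>Om\<^esub> b) \<beta> = curv_pt \<alpha> (b \<rhd>\<^bsub>Om\<^esub> \<beta>)" ..
qed simp

definition "curv = tens_lift O21 curv_pt"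

lemma curv_add_map: "add_map O2 O21 curv"
  unfolding curv_def by (rule T.tens_lift_add_map[OF T2.abelian_MN curv_pt_bal])

lemma curv_pt: "\<alpha> \<in> carrier Om \<Longrightarrow> \<beta> \<in> carrier Om \<Longrightarrow> curv (\<alpha> \<^bold>\<otimes>\<^sub>1 \<beta>) = curv_pt \<alpha> \<beta>"
  unfolding curv_def by (rule T.tens_lift_pt[OF T2.abelian_MN curv_pt_bal])

lemmas curv_closed [simp, intro] = add_map_closed[OF curv_add_map]

lemma curv_lact: "b \<in> carrier B \<Longrightarrow> X \<in> carrier O2 \<Longrightarrow> curv (b \<rhd>\<^bsub>O2\<^esub> X) = wid (d b) X \<oplus>\<^bsub>O21\<^esub> b \<rhd>\<^bsub>O21\<^esub> curv X"
proof (rule T.tens_ext[OF T2.abelian_MN add_map_comp[OF T.add_map_lact curv_add_map]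
      add_map_add_maps[OF T2.abelian_MN wid_add_map add_map_comp[OF curv_add_map T2.add_map_lact]]])
  fix \<alpha> \<beta> assume a: "b \<in> carrier B" "\<alpha> \<in> carrier Om" "\<beta> \<in> carrier Om"
  show "curv (b \<rhd>\<^bsub>O2\<^esub> (\<alpha> \<^bold>\<otimes>\<^sub>1 \<beta>)) = wid (d b) (\<alpha> \<^bold>\<otimes>\<^sub>1 \<beta>) \<oplus>\<^bsub>O21\<^esub> b \<rhd>\<^bsub>O21\<^esub> curv (\<alpha> \<^bold>\<otimes>\<^sub>1 \<beta>)"
    using a unfolding curv_pt_def
    by (simp add: T.lact_pt curv_pt curv_pt_def d1_lact T2.pt_add_l wid_pt wid_lact O21.lact_add_r O21.lact_minus T2.lact_pt
        T2.MN.minus_eq T2.MN.a_assoc)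
qed simp_all

abbreviation riem where "riem \<equiv> riemann D \<rho> d d1 nab"

lemma riem_eq: "riem \<omega> = curv (nab \<omega>)"
  by (simp add: riemann_def curv_def curv_pt_def[abs_def] Om21 Om2)

lemma riem_closed [simp, intro]: "\<omega> \<in> carrier Om \<Longrightarrow> riem \<omega> \<in> carrier O21"
  by (simp add: riem_eq)

lemma riem_add: "\<omega> \<in> carrier Om \<Longrightarrow> \<eta> \<in> carrier Om \<Longrightarrow> riem (\<omega> \<oplus>\<^bsub>Om\<^esub> \<eta>) = riem \<omega> \<oplus>\<^bsub>O21\<^esub> riem \<eta>"
  by (simp add: riem_eq nab_add add_map_add[OF curv_add_map])

text \<open>
  The inhomogeneous terms of \<open>\<nabla>\<close> and of the curvature map cancel: the Riemann tensor is left linear.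
\<close>

lemma riem_lact: "b \<in> carrier B \<Longrightarrow> \<omega> \<in> carrier Om \<Longrightarrow> riem (b \<rhd>\<^bsub>Om\<^esub> \<omega>) = b \<rhd>\<^bsub>O21\<^esub> riem \<omega>"
proof -
  assume a: "b \<in> carrier B" "\<omega> \<in> carrier Om"
  have z: "\<zero>\<^bsub>W2\<^esub> \<^bold>\<otimes>\<^sub>2 \<omega> = \<zero>\<^bsub>O21\<^esub>"
    by (rule add_map_zero[OF U.Q.abelian_group_axioms T2.abelian_MN])
      (use a in \<open>auto intro!: add_mapI simp: T2.pt_add_l\<close>)
  have "riem (b \<rhd>\<^bsub>Om\<^esub> \<omega>) = curv_pt (d b) \<omega> \<oplus>\<^bsub>O21\<^esub> (wid (d b) (nab \<omega>) \<oplus>\<^bsub>O21\<^esub> b \<rhd>\<^bsub>O21\<^esub> curv (nab \<omega>))"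
    using a by (simp add: riem_eq nab_lact add_map_add[OF curv_add_map] curv_pt curv_lact)
  also have "\<dots> = b \<rhd>\<^bsub>O21\<^esub> riem \<omega>"
    using a by (simp add: curv_pt_def d1_d z riem_eq T2.MN.minus_eq T2.MN.r_neg1)
  finally show ?thesis .
qed

lemma s_hom: "lin_map W2 O2 s"
  "b \<in> carrier B \<Longrightarrow> \<theta> \<in> carrier W2 \<Longrightarrow> s (b \<rhd>\<^bsub>W2\<^esub> \<theta>) = b \<rhd>\<^bsub>O2\<^esub> s \<theta>"
  "b \<in> carrier B \<Longrightarrow> \<theta> \<in> carrier W2 \<Longrightarrow> s (\<theta> \<lhd>\<^bsub>W2\<^esub> b) = s \<theta> \<lhd>\<^bsub>O2\<^esub> b"
  using sp unfolding is_splitting_def Let_def bimod_hom_def Om2 Om11 by blast+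

lemmas s_closed [simp, intro] = lin_map_closed[OF s_hom(1)]
lemmas s_add = add_map_add[OF lin_map_add_map[OF s_hom(1)]]

sublocale T3: tensp B O2 Om
  by (rule tensp.intro[OF T.bimd_MN bimd_Om])

abbreviation "O11_1 \<equiv> tensor B O2 Om"
abbreviation tt3 (infixl "\<^bold>\<otimes>\<^sub>3" 72) where "tt3 \<equiv> ptens B O2 Om"

sublocale O3: bimd B O11_1 by (rule T3.bimd_MN)

abbreviation "spl \<equiv> split_id D \<rho> s"

lemma spl_eq: "spl X = tens_lift O11_1 (\<lambda>\<theta> \<gamma>. s \<theta> \<^bold>\<otimes>\<^sub>3 \<gamma>) X"
  by (simp add: split_id_def Omega11_1_def Om11)

lemma spl_bal: "balanced B W2 Om O11_1 (\<lambda>\<theta> \<gamma>. s \<theta> \<^bold>\<otimes>\<^sub>3 \<gamma>)"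
  by (rule balancedI) (simp_all add: s_add T3.pt_add_l T3.pt_add_r s_hom(3) T3.pt_bal)

lemma spl_add_map: "add_map O21 O11_1 spl"
  unfolding spl_eq[abs_def] by (rule T2.tens_lift_add_map[OF T3.abelian_MN spl_bal])

lemma spl_pt: "\<theta> \<in> carrier W2 \<Longrightarrow> \<gamma> \<in> carrier Om \<Longrightarrow> spl (\<theta> \<^bold>\<otimes>\<^sub>2 \<gamma>) = s \<theta> \<^bold>\<otimes>\<^sub>3 \<gamma>"
  unfolding spl_eq by (rule T2.tens_lift_pt[OF T3.abelian_MN spl_bal])

lemmas spl_closed [simp, intro] = add_map_closed[OF spl_add_map]

lemma spl_lact: "b \<in> carrier B \<Longrightarrow> X \<in> carrier O21 \<Longrightarrow> spl (b \<rhd>\<^bsub>O21\<^esub> X) = b \<rhd>\<^bsub>O11_1\<^esub> spl X"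
  by (rule T2.tens_ext[OF T3.abelian_MN add_map_comp[OF T2.add_map_lact spl_add_map] add_map_comp[OF spl_add_map T3.add_map_lact]])
    (simp_all add: spl_pt T2.lact_pt T3.lact_pt s_hom(2))

lemma gi_hom: "X \<in> carrier O2 \<Longrightarrow> gi X \<in> carrier B"
  "X \<in> carrier O2 \<Longrightarrow> Y \<in> carrier O2 \<Longrightarrow> gi (X \<oplus>\<^bsub>O2\<^esub> Y) = gi X \<oplus>\<^bsub>B\<^esub> gi Y"
  "b \<in> carrier B \<Longrightarrow> X \<in> carrier O2 \<Longrightarrow> gi (b \<rhd>\<^bsub>O2\<^esub> X) = b \<otimes>\<^bsub>B\<^esub> gi X"
  "b \<in> carrier B \<Longrightarrow> X \<in> carrier O2 \<Longrightarrow> gi (X \<lhd>\<^bsub>O2\<^esub> b) = gi X \<otimes>\<^bsub>B\<^esub> b"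
  using inv unfolding is_inverse_metric_def Let_def bimod_hom_def lin_map_def Om11 self_bimod_def by auto

text \<open>
  The last step of the Ricci tensor, split up.  A form \<open>\<omega>\<close> is paired with the first factor of
  \<open>\<alpha> \<otimes> \<beta> \<otimes> \<gamma>\<close>; the lifts are taken first in \<open>\<alpha> \<otimes> \<beta>\<close> and then in \<open>\<gamma>\<close>, matching the
  bracketing of the triple tensor product.
\<close>

definition "contract_pt \<omega> \<gamma> \<alpha> \<beta> = (gi (\<omega> \<^bold>\<otimes>\<^sub>1 \<alpha>) \<rhd>\<^bsub>Om\<^esub> \<beta>) \<^bold>\<otimes>\<^sub>1 \<gamma>"
definition "contract_append \<omega> \<gamma> = tens_lift O2 (contract_pt \<omega> \<gamma>)"
definition "contract_tens \<omega> = tens_lift O2 (\<lambda>Y \<gamma>. contract_append \<omega> \<gamma> Y)"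

lemma contract_pt_bal: "\<omega> \<in> carrier Om \<Longrightarrow> \<gamma> \<in> carrier Om \<Longrightarrow> balanced B Om Om O2 (contract_pt \<omega> \<gamma>)"
  by (rule balancedI)
    (simp_all add: contract_pt_def gi_hom T.pt_add_l T.pt_add_r O.lact_add_l O.lact_add_r O.lact_assoc flip: T.ract_pt)

lemma contract_append_add_map: "\<omega> \<in> carrier Om \<Longrightarrow> \<gamma> \<in> carrier Om \<Longrightarrow> add_map O2 O2 (contract_append \<omega> \<gamma>)"
  unfolding contract_append_def by (rule T.tens_lift_add_map[OF T.abelian_MN contract_pt_bal])

lemma contract_append_pt: "\<omega> \<in> carrier Om \<Longrightarrow> \<gamma> \<in> carrier Om \<Longrightarrow> \<alpha> \<in> carrier Om \<Longrightarrow> \<beta> \<in> carrier Om \<Longrightarrow>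
    contract_append \<omega> \<gamma> (\<alpha> \<^bold>\<otimes>\<^sub>1 \<beta>) = (gi (\<omega> \<^bold>\<otimes>\<^sub>1 \<alpha>) \<rhd>\<^bsub>Om\<^esub> \<beta>) \<^bold>\<otimes>\<^sub>1 \<gamma>"
  unfolding contract_append_def by (subst T.tens_lift_pt[OF T.abelian_MN contract_pt_bal]) (simp_all add: contract_pt_def)

lemma contract_append_closed [simp, intro]: "\<omega> \<in> carrier Om \<Longrightarrow> \<gamma> \<in> carrier Om \<Longrightarrow> Y \<in> carrier O2 \<Longrightarrow> contract_append \<omega> \<gamma> Y \<in> carrier O2"
  by (rule add_map_closed[OF contract_append_add_map])

lemma contract_append_add_\<gamma>: "\<omega> \<in> carrier Om \<Longrightarrow> \<gamma> \<in> carrier Om \<Longrightarrow> \<gamma>' \<in> carrier Om \<Longrightarrow> Y \<in> carrier O2 \<Longrightarrow>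
    contract_append \<omega> (\<gamma> \<oplus>\<^bsub>Om\<^esub> \<gamma>') Y = contract_append \<omega> \<gamma> Y \<oplus>\<^bsub>O2\<^esub> contract_append \<omega> \<gamma>' Y"
  by (rule T.tens_ext[OF T.abelian_MN contract_append_add_map add_map_add_maps[OF T.abelian_MN contract_append_add_map contract_append_add_map]])
    (simp_all add: contract_append_pt gi_hom T.pt_add_r)

lemma contract_append_add_\<omega>: "\<omega> \<in> carrier Om \<Longrightarrow> \<omega>' \<in> carrier Om \<Longrightarrow> \<gamma> \<in> carrier Om \<Longrightarrow> Y \<in> carrier O2 \<Longrightarrow>
    contract_append (\<omega> \<oplus>\<^bsub>Om\<^esub> \<omega>') \<gamma> Y = contract_append \<omega> \<gamma> Y \<oplus>\<^bsub>O2\<^esub> contract_append \<omega>' \<gamma> Y"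
  by (rule T.tens_ext[OF T.abelian_MN contract_append_add_map add_map_add_maps[OF T.abelian_MN contract_append_add_map contract_append_add_map]])
    (simp_all add: contract_append_pt gi_hom T.pt_add_l O.lact_add_l)

lemma contract_append_ract: "\<omega> \<in> carrier Om \<Longrightarrow> b \<in> carrier B \<Longrightarrow> \<gamma> \<in> carrier Om \<Longrightarrow> Y \<in> carrier O2 \<Longrightarrow>
    contract_append \<omega> \<gamma> (Y \<lhd>\<^bsub>O2\<^esub> b) = contract_append \<omega> (b \<rhd>\<^bsub>Om\<^esub> \<gamma>) Y"
  by (rule T.tens_ext[OF T.abelian_MN add_map_comp[OF T.add_map_ract contract_append_add_map] contract_append_add_map])
    (simp_all add: T.ract_pt contract_append_pt gi_hom O.lact_ract flip: T.pt_bal)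

lemma contract_append_bal: "\<omega> \<in> carrier Om \<Longrightarrow> b \<in> carrier B \<Longrightarrow> \<gamma> \<in> carrier Om \<Longrightarrow> Y \<in> carrier O2 \<Longrightarrow>
    contract_append (\<omega> \<lhd>\<^bsub>Om\<^esub> b) \<gamma> Y = contract_append \<omega> \<gamma> (b \<rhd>\<^bsub>O2\<^esub> Y)"
  by (rule T.tens_ext[OF T.abelian_MN contract_append_add_map add_map_comp[OF T.add_map_lact contract_append_add_map]])
    (simp_all add: T.lact_pt contract_append_pt T.pt_bal)

lemma gi_lact_l: "b \<in> carrier B \<Longrightarrow> \<omega> \<in> carrier Om \<Longrightarrow> \<alpha> \<in> carrier Om \<Longrightarrow>
    gi ((b \<rhd>\<^bsub>Om\<^esub> \<omega>) \<^bold>\<otimes>\<^sub>1 \<alpha>) = b \<otimes>\<^bsub>B\<^esub> gi (\<omega> \<^bold>\<otimes>\<^sub>1 \<alpha>)"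
  by (subst T.lact_pt[symmetric]) (simp_all add: gi_hom)

lemma contract_append_lact: "\<omega> \<in> carrier Om \<Longrightarrow> b \<in> carrier B \<Longrightarrow> \<gamma> \<in> carrier Om \<Longrightarrow> Y \<in> carrier O2 \<Longrightarrow>
    contract_append (b \<rhd>\<^bsub>Om\<^esub> \<omega>) \<gamma> Y = b \<rhd>\<^bsub>O2\<^esub> contract_append \<omega> \<gamma> Y"
  by (rule T.tens_ext[OF T.abelian_MN contract_append_add_map add_map_comp[OF contract_append_add_map T.add_map_lact]])
    (simp_all add: contract_append_pt gi_lact_l gi_hom O.lact_assoc T.lact_pt)

lemma contract_tens_bal: "\<omega> \<in> carrier Om \<Longrightarrow> balanced B O2 Om O2 (\<lambda>Y \<gamma>. contract_append \<omega> \<gamma> Y)"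
  by (rule balancedI) (simp_all add: contract_append_add_\<gamma> add_map_add[OF contract_append_add_map] contract_append_ract)

lemma contract_tens_add_map: "\<omega> \<in> carrier Om \<Longrightarrow> add_map O11_1 O2 (contract_tens \<omega>)"
  unfolding contract_tens_def by (rule T3.tens_lift_add_map[OF T.abelian_MN contract_tens_bal])

lemma contract_tens_pt: "\<omega> \<in> carrier Om \<Longrightarrow> Y \<in> carrier O2 \<Longrightarrow> \<gamma> \<in> carrier Om \<Longrightarrow> contract_tens \<omega> (Y \<^bold>\<otimes>\<^sub>3 \<gamma>) = contract_append \<omega> \<gamma> Y"
  unfolding contract_tens_def by (rule T3.tens_lift_pt[OF T.abelian_MN contract_tens_bal])

lemma contract_tens_closed [simp, intro]: "\<omega> \<in> carrier Om \<Longrightarrow> X \<in> carrier O11_1 \<Longrightarrow> contract_tens \<omega> X \<in> carrier O2"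
  by (rule add_map_closed[OF contract_tens_add_map])

lemma contract_tens_add_\<omega>: "\<omega> \<in> carrier Om \<Longrightarrow> \<omega>' \<in> carrier Om \<Longrightarrow> X \<in> carrier O11_1 \<Longrightarrow>
    contract_tens (\<omega> \<oplus>\<^bsub>Om\<^esub> \<omega>') X = contract_tens \<omega> X \<oplus>\<^bsub>O2\<^esub> contract_tens \<omega>' X"
  by (rule T3.tens_ext[OF T.abelian_MN contract_tens_add_map add_map_add_maps[OF T.abelian_MN contract_tens_add_map contract_tens_add_map]])
    (simp_all add: contract_tens_pt contract_append_add_\<omega>)

lemma contract_tens_bal_l: "\<omega> \<in> carrier Om \<Longrightarrow> b \<in> carrier B \<Longrightarrow> X \<in> carrier O11_1 \<Longrightarrow>
    contract_tens (\<omega> \<lhd>\<^bsub>Om\<^esub> b) X = contract_tens \<omega> (b \<rhd>\<^bsub>O11_1\<^esub> X)"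
  by (rule T3.tens_ext[OF T.abelian_MN contract_tens_add_map add_map_comp[OF T3.add_map_lact contract_tens_add_map]])
    (simp_all add: contract_tens_pt T3.lact_pt contract_append_bal)

lemma contract_tens_lact: "\<omega> \<in> carrier Om \<Longrightarrow> b \<in> carrier B \<Longrightarrow> X \<in> carrier O11_1 \<Longrightarrow>
    contract_tens (b \<rhd>\<^bsub>Om\<^esub> \<omega>) X = b \<rhd>\<^bsub>O2\<^esub> contract_tens \<omega> X"
  by (rule T3.tens_ext[OF T.abelian_MN contract_tens_add_map add_map_comp[OF contract_tens_add_map T.add_map_lact]])
    (simp_all add: contract_tens_pt contract_append_lact)

text \<open>
  Split the two-form in the first factor, and pair its front with \<open>\<omega>\<close>.
\<close>

definition "contract \<omega> X = contract_tens \<omega> (spl X)"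

lemma contract_closed [simp, intro]: "\<omega> \<in> carrier Om \<Longrightarrow> X \<in> carrier O21 \<Longrightarrow> contract \<omega> X \<in> carrier O2"
  by (simp add: contract_def)

lemma contract_add_map: "\<omega> \<in> carrier Om \<Longrightarrow> add_map O21 O2 (contract \<omega>)"
  unfolding contract_def[abs_def] by (rule add_map_comp[OF spl_add_map contract_tens_add_map])

lemma contract_add_\<omega>: "\<omega> \<in> carrier Om \<Longrightarrow> \<omega>' \<in> carrier Om \<Longrightarrow> X \<in> carrier O21 \<Longrightarrow>
    contract (\<omega> \<oplus>\<^bsub>Om\<^esub> \<omega>') X = contract \<omega> X \<oplus>\<^bsub>O2\<^esub> contract \<omega>' X"
  by (simp add: contract_def contract_tens_add_\<omega>)

lemma contract_bal: "\<omega> \<in> carrier Om \<Longrightarrow> b \<in> carrier B \<Longrightarrow> X \<in> carrier O21 \<Longrightarrow> contract (\<omega> \<lhd>\<^bsub>Om\<^esub> b) X = contract \<omega> (b \<rhd>\<^bsub>O21\<^esub> X)"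
  by (simp add: contract_def contract_tens_bal_l spl_lact)

lemma contract_lact: "\<omega> \<in> carrier Om \<Longrightarrow> b \<in> carrier B \<Longrightarrow> X \<in> carrier O21 \<Longrightarrow> contract (b \<rhd>\<^bsub>Om\<^esub> \<omega>) X = b \<rhd>\<^bsub>O2\<^esub> contract \<omega> X"
  by (simp add: contract_def contract_tens_lact)

lemma contract_smult_\<omega>: "\<omega> \<in> carrier Om \<Longrightarrow> X \<in> carrier O21 \<Longrightarrow> contract (c \<odot>\<^bsub>Om\<^esub> \<omega>) X = c \<odot>\<^bsub>O2\<^esub> contract \<omega> X"
  by (simp add: O.smult_lact O2.smult_lact contract_lact)

lemma contract_smult: "\<omega> \<in> carrier Om \<Longrightarrow> X \<in> carrier O21 \<Longrightarrow> contract \<omega> (c \<odot>\<^bsub>O21\<^esub> X) = c \<odot>\<^bsub>O2\<^esub> contract \<omega> X"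
  by (simp add: O21.smult_lact O2.smult_lact contract_lact O.ract_sc flip: contract_bal)

lemma contract_lin: "\<omega> \<in> carrier Om \<Longrightarrow> lin_map O21 O2 (contract \<omega>)"
  using contract_add_map[of \<omega>] by (auto simp: lin_map_def add_map_def contract_smult)

lemma contract_lin_\<omega>: "X \<in> carrier O21 \<Longrightarrow> lin_map Om O2 (\<lambda>\<omega>. contract \<omega> X)"
  by (auto simp: lin_map_def contract_add_\<omega> contract_smult_\<omega>)

lemma wid_lin: "\<omega> \<in> carrier Om \<Longrightarrow> lin_map O2 O21 (wid \<omega>)"
  using wid_add_map[of \<omega>] by (auto simp: lin_map_def add_map_def O2.smult_lact O21.smult_lact O.ract_sc wid_lact simp flip: wid_bal_l)

lemma wid_lin_l: "X \<in> carrier O2 \<Longrightarrow> lin_map Om O21 (\<lambda>\<omega>. wid \<omega> X)"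
  by (auto simp: lin_map_def wid_add_l O.smult_lact O21.smult_lact wid_lact)

lemma contract_ww: "\<omega> \<in> carrier Om \<Longrightarrow> \<alpha> \<in> carrier Om \<Longrightarrow> \<beta> \<in> carrier Om \<Longrightarrow> \<gamma> \<in> carrier Om \<Longrightarrow>
    contract \<omega> (ww \<alpha> \<beta> \<^bold>\<otimes>\<^sub>2 \<gamma>) = contract_append \<omega> \<gamma> (s (ww \<alpha> \<beta>))"
  by (simp add: contract_def spl_pt contract_tens_pt)

sublocale T4: tensp B Om O21
  by (rule tensp.intro[OF bimd_Om T2.bimd_MN])
sublocale T5: tensp B Om O11_1
  by (rule tensp.intro[OF bimd_Om T3.bimd_MN])

abbreviation "PHI \<equiv> Phi D \<rho> d d1 gi nab s"

text \<open>
  The map that defines the Ricci tensor is a composite of three lifts, each of a balanced map; on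
  pure tensors they collapse.
\<close>

lemma PHI_add_map: "add_map O2 O2 PHI"
  and PHI_pt: "\<omega> \<in> carrier Om \<Longrightarrow> \<eta> \<in> carrier Om \<Longrightarrow> PHI (\<omega> \<^bold>\<otimes>\<^sub>1 \<eta>) = contract \<omega> (riem \<eta>)"
proof -
  define f1 where "f1 = (\<lambda>\<omega> \<eta>. ptens B Om O21 \<omega> (riem \<eta>))"
  define f2 where "f2 = (\<lambda>\<omega> X. ptens B Om O11_1 \<omega> (spl X))"
  have b1: "balanced B Om Om (tensor B Om O21) f1"
    unfolding f1_def by (rule balancedI) (simp_all add: riem_add riem_lact T4.pt_add_l T4.pt_add_r T4.pt_bal)
  have b2: "balanced B Om O21 (tensor B Om O11_1) f2"
    unfolding f2_def by (rule balancedI)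
      (simp_all add: spl_lact add_map_add[OF spl_add_map] T5.pt_add_l T5.pt_add_r T5.pt_bal)
  have b3: "balanced B Om O11_1 O2 contract_tens"
    by (rule balancedI) (simp_all add: contract_tens_add_\<omega> add_map_add[OF contract_tens_add_map] contract_tens_bal_l)
  have P: "PHI = (\<lambda>X. tens_lift O2 contract_tens (tens_lift (tensor B Om O11_1) f2 (tens_lift (tensor B Om O21) f1 X)))"
    unfolding Phi_def ip_id_id_def id_split_id_def id_riemann_def Omega1_21_def Omega1_11_1_def Omega11_1_def
      Om21 Om11 ot f1_def f2_def contract_tens_def contract_append_def contract_pt_def by (simp add: o_def)
  show "add_map O2 O2 PHI" unfolding P
    by (intro add_map_comp[OF T.tens_lift_add_map[OF T4.abelian_MN b1]]
      add_map_comp[OF T4.tens_lift_add_map[OF T5.abelian_MN b2] T5.tens_lift_add_map[OF T.abelian_MN b3]])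
  show "\<omega> \<in> carrier Om \<Longrightarrow> \<eta> \<in> carrier Om \<Longrightarrow> PHI (\<omega> \<^bold>\<otimes>\<^sub>1 \<eta>) = contract \<omega> (riem \<eta>)"
  proof -
    assume a: "\<omega> \<in> carrier Om" "\<eta> \<in> carrier Om"
    have 1: "tens_lift (tensor B Om O21) f1 (\<omega> \<^bold>\<otimes>\<^sub>1 \<eta>) = ptens B Om O21 \<omega> (riem \<eta>)"
      using T.tens_lift_pt[OF T4.abelian_MN b1 a] by (simp only: f1_def)
    have 2: "tens_lift (tensor B Om O11_1) f2 (ptens B Om O21 \<omega> (riem \<eta>)) = ptens B Om O11_1 \<omega> (spl (riem \<eta>))"
      using T4.tens_lift_pt[OF T5.abelian_MN b2 a(1) riem_closed[OF a(2)]] by (simp only: f2_def)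
    have 3: "tens_lift O2 contract_tens (ptens B Om O11_1 \<omega> (spl (riem \<eta>))) = contract_tens \<omega> (spl (riem \<eta>))"
      by (rule T5.tens_lift_pt[OF T.abelian_MN b3 a(1) spl_closed[OF riem_closed[OF a(2)]]])
    show "PHI (\<omega> \<^bold>\<otimes>\<^sub>1 \<eta>) = contract \<omega> (riem \<eta>)" unfolding P 1 2 3 contract_def ..
  qed
qed

end

section \<open>The terms that vanish\<close>

lemma (in abelian_monoid) finsum_swap:
  assumes "finite A" "finite C" "\<And>i j. i \<in> A \<Longrightarrow> j \<in> C \<Longrightarrow> f i j \<in> carrier G"
  shows "(\<Oplus>i\<in>A. \<Oplus>j\<in>C. f i j) = (\<Oplus>j\<in>C. \<Oplus>i\<in>A. f i j)"
  using assms(1,3)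
proof (induction A rule: finite_induct)
  case empty then show ?case by simp
next
  case (insert a A)
  have c: "(\<Oplus>i\<in>A. f i j) \<in> carrier G" if "j \<in> C" for j
    using insert.prems that by (intro finsum_closed) auto
  have "(\<Oplus>i\<in>insert a A. \<Oplus>j\<in>C. f i j) = (\<Oplus>j\<in>C. f a j) \<oplus> (\<Oplus>i\<in>A. \<Oplus>j\<in>C. f i j)"
    using insert by (intro finsum_insert) (auto intro!: finsum_closed)
  also have "\<dots> = (\<Oplus>j\<in>C. f a j \<oplus> (\<Oplus>i\<in>A. f i j))"
    using insert c by (subst finsum_addf) auto
  also have "\<dots> = (\<Oplus>j\<in>C. \<Oplus>i\<in>insert a A. f i j)"
    using insert c by (intro finsum_cong') (auto simp: finsum_insert Pi_def)
  finally show ?case .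
qed

context cspace begin

lemma csub_diff: "csub W \<Longrightarrow> x \<in> W \<Longrightarrow> y \<in> W \<Longrightarrow> x \<ominus>\<^bsub>M\<^esub> y \<in> W"
  by (subst minus_eq_smult) (auto simp: csub_def)

lemma csub_add: "csub W \<Longrightarrow> x \<in> W \<Longrightarrow> y \<in> W \<Longrightarrow> x \<oplus>\<^bsub>M\<^esub> y \<in> W"
  by (auto simp: csub_def)

lemma csub_zero: "csub {\<zero>\<^bsub>M\<^esub>}"
  by (simp add: csub_def)

lemma finsum_smult_left: "finite A \<Longrightarrow> x \<in> carrier M \<Longrightarrow> (\<Oplus>\<^bsub>M\<^esub>i\<in>A. c i \<odot>\<^bsub>M\<^esub> x) = (\<Sum>i\<in>A. c i) \<odot>\<^bsub>M\<^esub> x"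
  by (induction A rule: finite_induct) (simp_all add: smult_l_distr Pi_def)

lemma E23_diff:
  fixes x y :: "('n::finite, 'm) fam4"
  assumes "\<And>i j k l. x i j k l \<in> carrier M" "\<And>i j k l. y i j k l \<in> carrier M"
  shows "E23 M (fminus4 M x y) i l = E23 M x i l \<ominus>\<^bsub>M\<^esub> E23 M y i l"
proof -
  have "E23 M (fminus4 M x y) i l = (\<Oplus>\<^bsub>M\<^esub>j\<in>UNIV. x i j j l \<oplus>\<^bsub>M\<^esub> (- 1) \<odot>\<^bsub>M\<^esub> y i j j l)"
    by (simp add: E23_def fminus4_def minus_eq_smult assms)
  also have "\<dots> = E23 M x i l \<oplus>\<^bsub>M\<^esub> (- 1) \<odot>\<^bsub>M\<^esub> E23 M y i l"
    unfolding E23_def using assms by (subst finsum_addf) (auto simp: smult_finsum)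
  also have "\<dots> = E23 M x i l \<ominus>\<^bsub>M\<^esub> E23 M y i l"
    by (subst minus_eq_smult) (auto simp: E23_def assms intro!: finsum_closed)
  finally show ?thesis .
qed

end

lemma csub_vimage:
  assumes "cspace M" "cspace N" "lin_map M N f" "cspace.csub N W"
  shows "cspace.csub M {x \<in> carrier M. f x \<in> W}"
proof -
  interpret M: cspace M by fact
  interpret N: cspace N by fact
  have "f \<zero>\<^bsub>M\<^esub> = \<zero>\<^bsub>N\<^esub>"
    by (rule add_map_zero[OF M.abelian_group_axioms N.abelian_group_axioms lin_map_add_map[OF assms(3)]])
  then show ?thesis using assms(3,4) unfolding M.csub_def N.csub_def lin_map_def by auto
qed

lemma csub_eq:
  assumes "cspace M" "cspace N" "lin_map M N f" "lin_map M N f'"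
  shows "cspace.csub M {x \<in> carrier M. f x = f' x}"
proof -
  interpret M: cspace M by fact
  interpret N: cspace N by fact
  have "f \<zero>\<^bsub>M\<^esub> = \<zero>\<^bsub>N\<^esub>" "f' \<zero>\<^bsub>M\<^esub> = \<zero>\<^bsub>N\<^esub>"
    by (rule add_map_zero[OF M.abelian_group_axioms N.abelian_group_axioms lin_map_add_map], rule assms)+
  then show ?thesis using assms(3,4) unfolding M.csub_def lin_map_def by auto
qed

lemma lin_map_comp: "lin_map M N f \<Longrightarrow> lin_map N P g \<Longrightarrow> lin_map M P (\<lambda>x. g (f x))"
  by (auto simp: lin_map_def Pi_iff)

context ricci begin

lemmas csO = O.is_cspace and csO2 = O2.is_cspace and csO21 = O21.is_cspace and csB = B.is_cspace

sublocale BC: cspace "BB D" by (rule B.is_cspace)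

lemma lact_zero_l: "x \<in> carrier Om \<Longrightarrow> \<zero>\<^bsub>B\<^esub> \<rhd>\<^bsub>Om\<^esub> x = \<zero>\<^bsub>Om\<^esub>"
  by (rule add_map_zero[OF B.abelian_group_axioms O.M.abelian_group_axioms])
    (auto intro!: add_mapI simp: O.lact_add_l)

lemma tt_zero_l: "x \<in> carrier Om \<Longrightarrow> \<zero>\<^bsub>Om\<^esub> \<^bold>\<otimes>\<^sub>1 x = \<zero>\<^bsub>O2\<^esub>"
  by (rule add_map_zero[OF O.M.abelian_group_axioms T.abelian_MN])
    (auto intro!: add_mapI simp: T.pt_add_l)

abbreviation g where "g \<equiv> g_pm D \<rho>"
abbreviation cm where "cm \<equiv> qq D (- exp_m D)"

lemma g_eq: "g = (\<Oplus>\<^bsub>O2\<^esub>i\<in>UNIV. q2rho D i \<odot>\<^bsub>O2\<^esub> (\<Oplus>\<^bsub>O2\<^esub>j\<in>UNIV. dp D i j \<^bold>\<otimes>\<^sub>1 dbp D j i))"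
  by (simp add: g_pm_def Om11 ot E'12_def E23_def fprod_def)

lemma g_in:
  assumes W: "O2.M.csub W" and x: "\<And>i j k l. dp D i j \<^bold>\<otimes>\<^sub>1 dbp D k l \<in> W"
  shows "g \<in> W"
  unfolding g_eq by (intro O2.M.csub_finsum[OF W] O2.M.csub_smult[OF W] x) auto

lemma g_closed [simp, intro]: "g \<in> carrier O2"
  by (rule g_in[OF O2.M.csub_carrier]) simp

lemma gi_dp_dp: "gi (dp D i j \<^bold>\<otimes>\<^sub>1 dp D k l) = \<zero>\<^bsub>B\<^esub>"
proof -
  have "fprod (\<lambda>\<omega> \<eta>. gi (\<omega> \<^bold>\<otimes>\<^sub>1 \<eta>)) (dp D) (dp D) = (\<lambda>i j k l. \<zero>\<^bsub>B\<^esub>)"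
    using inv unfolding is_inverse_metric_def Let_def ot by blast
  then show ?thesis unfolding fprod_def by metis
qed

lemma gi_dp_dbp: "(\<lambda>i j k l. gi (dp D i j \<^bold>\<otimes>\<^sub>1 dbp D k l)) =
    fminus4 B (fscale4 B (qq D (exp_a D) * qq D (- exp_w D - exp_m D)) (S123 D B (C3 B p)))
      (fscale4 B (qq D (exp_a D) * cm) (fprod (\<otimes>\<^bsub>B\<^esub>) p p))"
proof -
  have "fprod (\<lambda>\<omega> \<eta>. gi (\<omega> \<^bold>\<otimes>\<^sub>1 \<eta>)) (dp D) (dbp D) =
    fminus4 B (fscale4 B (qq D (exp_a D) * qq D (- exp_w D - exp_m D)) (S123 D B (C3 B p)))
      (fscale4 B (qq D (exp_a D) * cm) (fprod (\<otimes>\<^bsub>B\<^esub>) p p))"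
    using inv unfolding is_inverse_metric_def Let_def ot by blast
  then show ?thesis unfolding fprod_def[of _ "dp D"] .
qed

lemma gi_closed [simp, intro]: "gi (dp D i j \<^bold>\<otimes>\<^sub>1 dbp D k l) \<in> carrier B"
  by (simp add: gi_hom)

text \<open>
  Contracting the inverse metric turns the \<open>S\<close> in its definition into an evaluation of \<open>p\<close>.  The
  Hecke term and the term \<open>p p\<close> combine, with \<open>q^a = q^2\<close>, to the coefficient \<open>- q^(-m)\<close> of \<open>p\<close>.
\<close>

lemma metric_contraction: "(\<Oplus>\<^bsub>B\<^esub>j\<in>UNIV. gi (dp D i j \<^bold>\<otimes>\<^sub>1 dbp D j l)) =
    cm \<odot>\<^bsub>B\<^esub> (if i = l then \<one>\<^bsub>B\<^esub> else \<zero>\<^bsub>B\<^esub>) \<oplus>\<^bsub>B\<^esub> (- cm) \<odot>\<^bsub>B\<^esub> p i l"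
proof -
  let ?C = "C3 B p"
  let ?de = "if i = l then \<one>\<^bsub>B\<^esub> else \<zero>\<^bsub>B\<^esub>"
  let ?k = "qq D (exp_a D) * qq D (- exp_w D - exp_m D)" and ?k' = "qq D (exp_a D) * cm"
  have C: "?C i j k l \<in> carrier B" for i j k l by (simp add: C3_def)
  note SC = BC.S123_in(1)[OF BC.csub_carrier, of ?C, OF C]
  have de: "?de \<in> carrier B" by simp
  \<comment> \<open>The inserted cup joins the two free legs.\<close>
  have E: "E'12 D B (\<lambda>a b. ?C a b i l) = qq D (exp_m D) \<odot>\<^bsub>B\<^esub> ?de"
  proof (cases "i = l")
    case True
    then show ?thesis using BB_facts(4)[of D] by (simp add: C3_def)
  next
    case False
    then show ?thesis by (simp add: C3_def E'12_def)
  qed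
  have "E23 B ?C i l = (\<Oplus>\<^bsub>B\<^esub>j\<in>UNIV. if l = j then p i j else \<zero>\<^bsub>B\<^esub>)"
    unfolding E23_def C3_def by (intro B.finsum_cong') auto
  also have "\<dots> = p i l" by (intro B.finsum_singleton) auto
  finally have EC: "E23 B ?C i l = p i l" .
  have ES: "E23 B (S123 D B ?C) i l = qq D (exp_w D - 2) \<odot>\<^bsub>B\<^esub> ?de \<oplus>\<^bsub>B\<^esub> (qq D (exp_w D) - qq D (exp_w D - 2)) \<odot>\<^bsub>B\<^esub> p i l"
    unfolding BC.E23_S123[OF qd C] E EC using de by (simp only: BC.smult_assoc[symmetric] wm)
  have "(\<Oplus>\<^bsub>B\<^esub>j\<in>UNIV. gi (dp D i j \<^bold>\<otimes>\<^sub>1 dbp D j l)) = E23 B (\<lambda>i j k l. gi (dp D i j \<^bold>\<otimes>\<^sub>1 dbp D k l)) i l"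
    by (simp add: E23_def)
  also have "\<dots> = ?k \<odot>\<^bsub>B\<^esub> E23 B (S123 D B ?C) i l \<ominus>\<^bsub>B\<^esub> ?k' \<odot>\<^bsub>B\<^esub> E23 B (fprod (\<otimes>\<^bsub>B\<^esub>) p p) i l"
    unfolding gi_dp_dbp
    by (subst BC.E23_diff) (simp_all add: E23_scale[OF csB] SC pp_closed, simp_all add: fscale4_def SC pp_closed)
  also have "\<dots> = (?k * qq D (exp_w D - 2)) \<odot>\<^bsub>B\<^esub> ?de \<oplus>\<^bsub>B\<^esub>
      (?k * (qq D (exp_w D) - qq D (exp_w D - 2)) + (- 1) * ?k') \<odot>\<^bsub>B\<^esub> p i l"
    unfolding ES E23_pp using de
    by (simp only: BC.minus_eq_smult BC.smult_closed BC.smult_r_distr BC.smult_l_distr BC.smult_assoc B.a_assoc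
        B.a_closed p_closed)
  also have "?k * qq D (exp_w D - 2) = cm"
    unfolding R_matrix_facts(1)[OF qd] by (simp flip: qqs(1))
  also have "?k * (qq D (exp_w D) - qq D (exp_w D - 2)) + (- 1) * ?k' = - cm"
    unfolding R_matrix_facts(1)[OF qd] right_diff_distrib mult.assoc qqs(1)[symmetric] by simp
  finally show ?thesis .
qed

lemma contract_append_lin: "\<omega> \<in> carrier Om \<Longrightarrow> \<gamma> \<in> carrier Om \<Longrightarrow> lin_map O2 O2 (contract_append \<omega> \<gamma>)"
  using contract_append_add_map[of \<omega> \<gamma>]
  by (auto simp: lin_map_def add_map_def O2.smult_lact O.ract_sc contract_append_lact simp flip: contract_append_bal)

lemma contract_append_lin_\<omega>: "Y \<in> carrier O2 \<Longrightarrow> \<gamma> \<in> carrier Om \<Longrightarrow> lin_map Om O2 (\<lambda>\<omega>. contract_append \<omega> \<gamma> Y)"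
  by (auto simp: lin_map_def contract_append_add_\<omega> O.smult_lact O2.smult_lact contract_append_lact)

text \<open>
  Tensors killed by pairing their front with \<open>\<partial>p\<close>.  The third argument is carried along.
\<close>

definition "contract_kernel i j \<gamma> = {Y \<in> carrier O2. contract_append (dp D i j) \<gamma> Y \<in> {\<zero>\<^bsub>O2\<^esub>}}"

lemma contract_kernel_csub: "\<gamma> \<in> carrier Om \<Longrightarrow> O2.M.csub (contract_kernel i j \<gamma>)"
  unfolding contract_kernel_def by (rule csub_vimage[OF csO2 csO2 contract_append_lin O2.M.csub_zero]) simp

lemma contract_kernel_dp: "\<gamma> \<in> carrier Om \<Longrightarrow> \<beta> \<in> carrier Om \<Longrightarrow> dp D k l \<^bold>\<otimes>\<^sub>1 \<beta> \<in> contract_kernel i j \<gamma>"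
  by (simp add: contract_kernel_def contract_append_pt gi_dp_dp lact_zero_l tt_zero_l)

text \<open>
  A coefficient \<open>p\<close> in front moves over to the paired form, where \<open>(\<partial>p) p\<close> is a combination of
  \<open>p \<partial>p\<close>.
\<close>

lemma contract_kernel_p_dp:
  assumes "\<gamma> \<in> carrier Om" "\<beta> \<in> carrier Om"
  shows "(p a b \<rhd>\<^bsub>Om\<^esub> dp D k l) \<^bold>\<otimes>\<^sub>1 \<beta> \<in> contract_kernel i j \<gamma>"
proof -
  define W where "W = {\<omega> \<in> carrier Om. contract_append \<omega> \<gamma> (dp D k l \<^bold>\<otimes>\<^sub>1 \<beta>) \<in> {\<zero>\<^bsub>O2\<^esub>}}"
  have W: "O.M.csub W" unfolding W_def
    using assms by (intro csub_vimage[OF csO csO2 contract_append_lin_\<omega> O2.M.csub_zero]) auto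
  have "contract_append (dp D i j) \<gamma> (dp D k l \<^bold>\<otimes>\<^sub>1 \<beta>) = \<zero>\<^bsub>O2\<^esub>" for i j
    using contract_kernel_dp[OF assms] by (simp add: contract_kernel_def)
  then have "p a b \<rhd>\<^bsub>Om\<^esub> dp D i j \<in> W" for a b i j
    using assms by (simp add: W_def contract_append_lact)
  then have "dp D i j \<lhd>\<^bsub>Om\<^esub> p a b \<in> W" by (intro dp_p_in[OF W])
  then have "contract_append (dp D i j) \<gamma> (p a b \<rhd>\<^bsub>O2\<^esub> (dp D k l \<^bold>\<otimes>\<^sub>1 \<beta>)) = \<zero>\<^bsub>O2\<^esub>"
    using assms by (simp add: W_def contract_append_bal)
  then show ?thesis using assms by (simp add: contract_kernel_def T.lact_pt)
qed

text \<open>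
  Only the coefficients in the mixed case matter later, so the first statement leaves them open.
\<close>

lemma s_split:
  "\<omega> \<in> plus_part D \<Longrightarrow> \<eta> \<in> plus_part D \<Longrightarrow> \<exists>c c'. s (ww \<omega> \<eta>) = c \<odot>\<^bsub>O2\<^esub> (\<omega> \<^bold>\<otimes>\<^sub>1 \<eta>) \<ominus>\<^bsub>O2\<^esub> c' \<odot>\<^bsub>O2\<^esub> \<sigma> (\<omega> \<^bold>\<otimes>\<^sub>1 \<eta>)"
  "\<omega> \<in> minus_part D \<Longrightarrow> \<eta> \<in> plus_part D \<Longrightarrow> s (ww \<omega> \<eta>) = cmp \<odot>\<^bsub>O2\<^esub> (\<omega> \<^bold>\<otimes>\<^sub>1 \<eta>) \<ominus>\<^bsub>O2\<^esub> cpm \<odot>\<^bsub>O2\<^esub> \<sigma> (\<omega> \<^bold>\<otimes>\<^sub>1 \<eta>)"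
proof -
  note sp' = sp[unfolded is_splitting_def Let_def ot Om11]
  have "\<forall>\<omega>\<in>plus_part D. \<forall>\<eta>\<in>plus_part D. s (ww \<omega> \<eta>) =
      (1 / (1 + qq D (- exp_a D))) \<odot>\<^bsub>O2\<^esub> (\<omega> \<^bold>\<otimes>\<^sub>1 \<eta>) \<ominus>\<^bsub>O2\<^esub>
      (qq D (- exp_a D) / (1 + qq D (- exp_a D))) \<odot>\<^bsub>O2\<^esub> \<sigma> (\<omega> \<^bold>\<otimes>\<^sub>1 \<eta>)"
    using sp' by blast
  then show "\<omega> \<in> plus_part D \<Longrightarrow> \<eta> \<in> plus_part D \<Longrightarrow>
      \<exists>c c'. s (ww \<omega> \<eta>) = c \<odot>\<^bsub>O2\<^esub> (\<omega> \<^bold>\<otimes>\<^sub>1 \<eta>) \<ominus>\<^bsub>O2\<^esub> c' \<odot>\<^bsub>O2\<^esub> \<sigma> (\<omega> \<^bold>\<otimes>\<^sub>1 \<eta>)"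
    by blast
  show "\<omega> \<in> minus_part D \<Longrightarrow> \<eta> \<in> plus_part D \<Longrightarrow>
      s (ww \<omega> \<eta>) = cmp \<odot>\<^bsub>O2\<^esub> (\<omega> \<^bold>\<otimes>\<^sub>1 \<eta>) \<ominus>\<^bsub>O2\<^esub> cpm \<odot>\<^bsub>O2\<^esub> \<sigma> (\<omega> \<^bold>\<otimes>\<^sub>1 \<eta>)"
    using sp' by blast
qed

lemma smult_ract: "Y \<in> carrier O2 \<Longrightarrow> b \<in> carrier B \<Longrightarrow> (c \<odot>\<^bsub>O2\<^esub> Y) \<lhd>\<^bsub>O2\<^esub> b = c \<odot>\<^bsub>O2\<^esub> (Y \<lhd>\<^bsub>O2\<^esub> b)"
  by (simp add: O2.smult_lact O2.lact_ract)

lemma sigma_dp_dp: "\<sigma> (dp D i j \<^bold>\<otimes>\<^sub>1 dp D k l) =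
    qq D (exp_a D) \<odot>\<^bsub>O2\<^esub> S123 D O2 (St234 D O2 (fprod tt (dp D) (dp D))) i j k l"
proof -
  have "fprod (\<lambda>\<omega> \<eta>. \<sigma> (\<omega> \<^bold>\<otimes>\<^sub>1 \<eta>)) (dp D) (dp D) =
      fscale4 O2 (qq D (exp_a D)) (S123 D O2 (St234 D O2 (fprod tt (dp D) (dp D))))"
    using gb unfolding is_generalized_braiding_def Let_def ot Om11 by blast
  then show ?thesis unfolding fprod_def[of "\<lambda>\<omega> \<eta>. \<sigma> (\<omega> \<^bold>\<otimes>\<^sub>1 \<eta>)"] fscale4_def by metis
qed

lemma sigma_dbp_dp: "\<exists>c c'. \<sigma> (dbp D i j \<^bold>\<otimes>\<^sub>1 dp D k l) =
    c \<odot>\<^bsub>O2\<^esub> S123_inv D O2 (St234 D O2 (fprod tt (dp D) (dbp D))) i j k l \<oplus>\<^bsub>O2\<^esub>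
    c' \<odot>\<^bsub>O2\<^esub> ((p i j \<rhd>\<^bsub>O2\<^esub> g) \<lhd>\<^bsub>O2\<^esub> p k l)"
proof -
  have "fprod (\<lambda>\<omega> \<eta>. \<sigma> (\<omega> \<^bold>\<otimes>\<^sub>1 \<eta>)) (dbp D) (dp D) = fadd4 O2
        (fscale4 O2 (qq D (2 * exp_w D - 2 * exp_a D)) (S123_inv D O2 (St234 D O2 (fprod tt (dp D) (dbp D)))))
        (fscale4 O2 ((1 - qq D (- exp_a D)) * qq D (- exp_m D))
          (\<lambda>i j k l. (p i j \<rhd>\<^bsub>O2\<^esub> g) \<lhd>\<^bsub>O2\<^esub> p k l))"
    using gb unfolding is_generalized_braiding_def Let_def ot Om11 by blast
  from fun_cong[OF fun_cong[OF fun_cong[OF fun_cong[OF this, of i], of j], of k], of l] show ?thesis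
    unfolding fprod_def[of "\<lambda>\<omega> \<eta>. \<sigma> (\<omega> \<^bold>\<otimes>\<^sub>1 \<eta>)"] fscale4_def fadd4_def by blast
qed

text \<open>
  The braiding of \<open>\<partial>p \<otimes> \<partial>p\<close> is again a combination of such tensors, and \<open>(\<partial>p, \<partial>p) = 0\<close>.
\<close>

lemma contract_dp_dp: assumes y: "y \<in> carrier Om"
  shows "contract (dp D i j) (ww (dp D k l) (dp D a b) \<^bold>\<otimes>\<^sub>2 y) = \<zero>\<^bsub>O2\<^esub>"
proof -
  note K = contract_kernel_csub[OF y, of i j]
  have e: "fprod tt (dp D) (dp D) i' j' k' l' \<in> contract_kernel i j y" for i' j' k' l'
    unfolding fprod_def using y by (intro contract_kernel_dp) auto
  have "\<sigma> (dp D k l \<^bold>\<otimes>\<^sub>1 dp D a b) \<in> contract_kernel i j y"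
    unfolding sigma_dp_dp by (intro O2.M.csub_smult[OF K] O2.M.S123_in[OF K] e)
  moreover obtain c c' where "s (ww (dp D k l) (dp D a b)) =
      c \<odot>\<^bsub>O2\<^esub> (dp D k l \<^bold>\<otimes>\<^sub>1 dp D a b) \<ominus>\<^bsub>O2\<^esub> c' \<odot>\<^bsub>O2\<^esub> \<sigma> (dp D k l \<^bold>\<otimes>\<^sub>1 dp D a b)"
    using s_split(1)[OF parts(1) parts(1)] by blast
  ultimately have "s (ww (dp D k l) (dp D a b)) \<in> contract_kernel i j y"
    using y by (auto intro!: O2.M.csub_diff[OF K] O2.M.csub_smult[OF K] contract_kernel_dp)
  then show ?thesis using y by (simp add: contract_ww contract_kernel_def)
qed

text \<open>
  The braided part of the splitting consists of tensors that start with \<open>\<partial>p\<close>, including the metric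
  term, and is killed; the identity part survives with the factor \<open>c\<^sub>-\<^sub>+\<close>.
\<close>

lemma contract_dbp_dp: assumes y: "y \<in> carrier Om"
  shows "contract (dp D i j) (ww (dbp D k l) (dp D a b) \<^bold>\<otimes>\<^sub>2 y) =
    cmp \<odot>\<^bsub>O2\<^esub> ((gi (dp D i j \<^bold>\<otimes>\<^sub>1 dbp D k l) \<rhd>\<^bsub>Om\<^esub> dp D a b) \<^bold>\<otimes>\<^sub>1 y)"
proof -
  note K = contract_kernel_csub[OF y, of i j]
  let ?t = "dbp D k l \<^bold>\<otimes>\<^sub>1 dp D a b"
  have e: "fprod tt (dp D) (dbp D) i' j' k' l' \<in> contract_kernel i j y" for i' j' k' l'
    unfolding fprod_def using y by (intro contract_kernel_dp) auto
  have pgp: "(p k l \<rhd>\<^bsub>O2\<^esub> g) \<lhd>\<^bsub>O2\<^esub> p a b \<in> contract_kernel i j y"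
  proof -
    define W where "W = {X \<in> carrier O2. (p k l \<rhd>\<^bsub>O2\<^esub> X) \<lhd>\<^bsub>O2\<^esub> p a b \<in> contract_kernel i j y}"
    have l: "lin_map O2 O2 (\<lambda>X. (p k l \<rhd>\<^bsub>O2\<^esub> X) \<lhd>\<^bsub>O2\<^esub> p a b)"
      by (auto simp: lin_map_def O2.lact_add_r O2.ract_add_l O2.lact_smult smult_ract)
    have W: "O2.M.csub W" unfolding W_def by (rule csub_vimage[OF csO2 csO2 l K])
    have "g \<in> W"
      by (rule g_in[OF W]) (use y in \<open>simp add: W_def T.lact_pt T.ract_pt contract_kernel_p_dp\<close>)
    then show ?thesis by (simp add: W_def)
  qed
  obtain c c' where "\<sigma> ?t = c \<odot>\<^bsub>O2\<^esub> S123_inv D O2 (St234 D O2 (fprod tt (dp D) (dbp D))) k l a b \<oplus>\<^bsub>O2\<^esub>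
      c' \<odot>\<^bsub>O2\<^esub> ((p k l \<rhd>\<^bsub>O2\<^esub> g) \<lhd>\<^bsub>O2\<^esub> p a b)"
    using sigma_dbp_dp by blast
  then have s: "\<sigma> ?t \<in> contract_kernel i j y"
    by (simp only:) (intro O2.M.csub_add[OF K] O2.M.csub_smult[OF K] O2.M.S123_in[OF K] e pgp)
  then have sc: "\<sigma> ?t \<in> carrier O2" and s0: "contract_append (dp D i j) y (\<sigma> ?t) = \<zero>\<^bsub>O2\<^esub>" by (simp_all add: contract_kernel_def)
  note Hl = contract_append_lin[OF dp_closed(1) y, of i j]
  have "contract_append (dp D i j) y (s (ww (dbp D k l) (dp D a b))) = cmp \<odot>\<^bsub>O2\<^esub> contract_append (dp D i j) y ?t"
  proof -
    have t: "?t \<in> carrier O2" by simp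
    have "contract_append (dp D i j) y (cmp \<odot>\<^bsub>O2\<^esub> ?t \<ominus>\<^bsub>O2\<^esub> cpm \<odot>\<^bsub>O2\<^esub> \<sigma> ?t) =
        contract_append (dp D i j) y (cmp \<odot>\<^bsub>O2\<^esub> ?t) \<ominus>\<^bsub>O2\<^esub> contract_append (dp D i j) y (cpm \<odot>\<^bsub>O2\<^esub> \<sigma> ?t)"
      by (rule lin_map_diff[OF csO2 csO2 Hl]) (use sc t in auto)
    also have "\<dots> = cmp \<odot>\<^bsub>O2\<^esub> contract_append (dp D i j) y ?t \<ominus>\<^bsub>O2\<^esub> \<zero>\<^bsub>O2\<^esub>"
      unfolding lin_map_smult[OF Hl t] lin_map_smult[OF Hl sc] s0 by simp
    also have "\<dots> = cmp \<odot>\<^bsub>O2\<^esub> contract_append (dp D i j) y ?t"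
      using lin_map_closed[OF Hl t] by (simp add: T.MN.minus_eq)
    finally show ?thesis unfolding s_split(2)[OF parts(2) parts(1)] .
  qed
  then show ?thesis using y by (simp add: contract_ww contract_append_pt)
qed

text \<open>
  Elements invisible to every pairing with \<open>\<partial>p\<close>.
\<close>

definition "del_null = {X \<in> carrier O21. \<forall>i j. contract (dp D i j) X = \<zero>\<^bsub>O2\<^esub>}"

lemma del_null_csub: "O21.M.csub del_null"
proof -
  have "O21.M.csub {X \<in> carrier O21. contract (dp D i j) X \<in> {\<zero>\<^bsub>O2\<^esub>}}" for i j
    by (rule csub_vimage[OF csO21 csO2 contract_lin O2.M.csub_zero]) simp
  then show ?thesis unfolding O21.M.csub_def del_null_def by simp
qed

lemma del_null_p: "X \<in> del_null \<Longrightarrow> p a b \<rhd>\<^bsub>O21\<^esub> X \<in> del_null"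
proof -
  assume X: "X \<in> del_null"
  then have Xc: "X \<in> carrier O21" by (simp add: del_null_def)
  define W where "W = {\<omega> \<in> carrier Om. contract \<omega> X \<in> {\<zero>\<^bsub>O2\<^esub>}}"
  have W: "O.M.csub W" unfolding W_def
    by (rule csub_vimage[OF csO csO2 contract_lin_\<omega>[OF Xc] O2.M.csub_zero])
  have "p a b \<rhd>\<^bsub>Om\<^esub> dp D i j \<in> W" for a b i j
    using X by (simp add: W_def contract_lact del_null_def)
  then have "dp D i j \<lhd>\<^bsub>Om\<^esub> p a b \<in> W" for i j by (intro dp_p_in[OF W])
  then show ?thesis using Xc by (simp add: W_def del_null_def contract_bal)
qed

text \<open>
  A leading \<open>\<partial>p\<close> meets the \<open>\<partial>p\<close> of the next factor; a coefficient \<open>p\<close> between them is moved past the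
  first one.
\<close>

lemma del_null_wid:
  shows "wid (dp D k l) (dp D a b \<^bold>\<otimes>\<^sub>1 dbp D a' b') \<in> del_null"
    and "wid (dp D k l) (p i j \<rhd>\<^bsub>O2\<^esub> (dp D a b \<^bold>\<otimes>\<^sub>1 dbp D a' b')) \<in> del_null"
    and "wid (dp D k l) g \<in> del_null" and "wid (dp D k l) (p i j \<rhd>\<^bsub>O2\<^esub> g) \<in> del_null"
proof -
  show 1: "wid (dp D k l) (dp D a b \<^bold>\<otimes>\<^sub>1 dbp D a' b') \<in> del_null" for k l a b a' b'
    by (simp add: del_null_def wid_pt contract_dp_dp)
  show 2: "wid (dp D k l) (p i j \<rhd>\<^bsub>O2\<^esub> (dp D a b \<^bold>\<otimes>\<^sub>1 dbp D a' b')) \<in> del_null" for a b a' b'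
  proof -
    let ?X = "dp D a b \<^bold>\<otimes>\<^sub>1 dbp D a' b'"
    define W where "W = {\<omega> \<in> carrier Om. wid \<omega> ?X \<in> del_null}"
    have W: "O.M.csub W" unfolding W_def
      by (rule csub_vimage[OF csO csO21 wid_lin_l del_null_csub]) simp
    have "p i j \<rhd>\<^bsub>Om\<^esub> dp D k l \<in> W" for i j k l by (simp add: W_def wid_lact del_null_p 1)
    then have "dp D k l \<lhd>\<^bsub>Om\<^esub> p i j \<in> W" by (intro dp_p_in[OF W])
    then show ?thesis by (simp add: W_def wid_bal_l)
  qed
  have c: "O2.M.csub {X \<in> carrier O2. wid (dp D k l) X \<in> del_null}"
    by (rule csub_vimage[OF csO2 csO21 wid_lin del_null_csub]) simp
  show "wid (dp D k l) g \<in> del_null" using g_in[OF c] 1 by simp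
  have l: "lin_map O2 O2 (\<lambda>X. p i j \<rhd>\<^bsub>O2\<^esub> X)"
    by (auto simp: lin_map_def O2.lact_add_r O2.lact_smult)
  have "g \<in> {X \<in> carrier O2. p i j \<rhd>\<^bsub>O2\<^esub> X \<in> {X \<in> carrier O2. wid (dp D k l) X \<in> del_null}}"
    by (rule g_in[OF csub_vimage[OF csO2 csO2 l c]]) (use 2 in simp)
  then show "wid (dp D k l) (p i j \<rhd>\<^bsub>O2\<^esub> g) \<in> del_null" by simp
qed

lemma nab_dbp: "nab (dbp D i l) = (\<Oplus>\<^bsub>O2\<^esub>k\<in>UNIV. dp D i k \<^bold>\<otimes>\<^sub>1 dbp D k l) \<ominus>\<^bsub>O2\<^esub> cm \<odot>\<^bsub>O2\<^esub> (p i l \<rhd>\<^bsub>O2\<^esub> g)"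
proof -
  have "(\<lambda>i j. nab (dbp D i j)) = fminus2 O2 (E23 O2 (fprod tt (dp D) (dbp D)))
        (fscale2 O2 cm (\<lambda>i j. p i j \<rhd>\<^bsub>O2\<^esub> g))"
    using lc unfolding is_levi_civita_def Let_def Om11 ot by blast
  from fun_cong[OF fun_cong[OF this, of i], of l] show ?thesis
    by (simp add: fminus2_def fscale2_def E23_def fprod_def)
qed

text \<open>
  Every term of \<open>\<nabla>(\<partial>'p)\<close> starts with \<open>\<partial>p\<close>, up to a coefficient from the algebra.
\<close>

lemma contract_wid_nab: "contract (dp D i j) (wid (dp D k l) (nab (dbp D a b))) = \<zero>\<^bsub>O2\<^esub>"
proof -
  have c: "O2.M.csub {X \<in> carrier O2. wid (dp D k l) X \<in> del_null}"
    by (rule csub_vimage[OF csO2 csO21 wid_lin del_null_csub]) simp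
  have "nab (dbp D a b) \<in> {X \<in> carrier O2. wid (dp D k l) X \<in> del_null}"
    unfolding nab_dbp
    by (intro O2.M.csub_diff[OF c] O2.M.csub_finsum[OF c] O2.M.csub_smult[OF c]) (auto intro: del_null_wid)
  then show ?thesis by (simp add: del_null_def)
qed

text \<open>
  Write the second \<open>\<partial>'p\<close> as a contraction of \<open>p \<partial>'p\<close> and move \<open>p\<close> across the tensor sign; then
  \<open>E\<^sub>2\<^sub>3 (\<partial>'p) p = 0\<close> applies to the first one.
\<close>

lemma ww_dbp_contract:
  assumes x: "x \<in> carrier Om"
  shows "(\<Oplus>\<^bsub>O21\<^esub>k\<in>UNIV. ww x (dbp D l k) \<^bold>\<otimes>\<^sub>2 dbp D k i) = \<zero>\<^bsub>O21\<^esub>"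
proof -
  have am: "add_map Om O21 (\<lambda>z. ww x z \<^bold>\<otimes>\<^sub>2 dbp D n i)" for n
    using x by (auto intro!: add_mapI simp: ww_add_r T2.pt_add_l)
  have am2: "add_map Om O21 (\<lambda>y. ww x (dbp D l k) \<^bold>\<otimes>\<^sub>2 y)" for k
    using x by (auto intro!: add_mapI simp: T2.pt_add_r)
  have e: "dbp D k i = (\<Oplus>\<^bsub>Om\<^esub>n\<in>UNIV. p k n \<rhd>\<^bsub>Om\<^esub> dbp D n i)" for k
    using E23_pdbp[of k i] by (simp add: E23_def fprod_def)
  have z: "(\<Oplus>\<^bsub>Om\<^esub>k\<in>UNIV. dbp D l k \<lhd>\<^bsub>Om\<^esub> p k n) = \<zero>\<^bsub>Om\<^esub>" for n
    using E23_dbp_p[of l n] by (simp add: E23_def fprod_def)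
  have "ww x (dbp D l k) \<^bold>\<otimes>\<^sub>2 dbp D k i = (\<Oplus>\<^bsub>O21\<^esub>n\<in>UNIV. ww x (dbp D l k \<lhd>\<^bsub>Om\<^esub> p k n) \<^bold>\<otimes>\<^sub>2 dbp D n i)" for k
    by (subst e, subst add_map_finsum[OF O.M.abelian_group_axioms T2.abelian_MN am2])
      (use x in \<open>simp_all add: ww_ract T2.pt_bal\<close>)
  then have "(\<Oplus>\<^bsub>O21\<^esub>k\<in>UNIV. ww x (dbp D l k) \<^bold>\<otimes>\<^sub>2 dbp D k i) =
      (\<Oplus>\<^bsub>O21\<^esub>k\<in>UNIV. \<Oplus>\<^bsub>O21\<^esub>n\<in>UNIV. ww x (dbp D l k \<lhd>\<^bsub>Om\<^esub> p k n) \<^bold>\<otimes>\<^sub>2 dbp D n i)" by simp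
  also have "\<dots> = (\<Oplus>\<^bsub>O21\<^esub>n\<in>UNIV. \<Oplus>\<^bsub>O21\<^esub>k\<in>UNIV. ww x (dbp D l k \<lhd>\<^bsub>Om\<^esub> p k n) \<^bold>\<otimes>\<^sub>2 dbp D n i)"
    by (rule T2.MN.finsum_swap) (use x in auto)
  also have "\<dots> = (\<Oplus>\<^bsub>O21\<^esub>n\<in>(UNIV :: 'n set). \<zero>\<^bsub>O21\<^esub>)"
  proof (rule T2.MN.finsum_cong')
    fix n
    have "(\<Oplus>\<^bsub>O21\<^esub>k\<in>UNIV. ww x (dbp D l k \<lhd>\<^bsub>Om\<^esub> p k n) \<^bold>\<otimes>\<^sub>2 dbp D n i) = ww x \<zero>\<^bsub>Om\<^esub> \<^bold>\<otimes>\<^sub>2 dbp D n i"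
      unfolding z[of n, symmetric]
      by (rule add_map_finsum[OF O.M.abelian_group_axioms T2.abelian_MN am, symmetric]) auto
    then show "(\<Oplus>\<^bsub>O21\<^esub>k\<in>UNIV. ww x (dbp D l k \<lhd>\<^bsub>Om\<^esub> p k n) \<^bold>\<otimes>\<^sub>2 dbp D n i) = \<zero>\<^bsub>O21\<^esub>"
      using add_map_zero[OF O.M.abelian_group_axioms T2.abelian_MN am] by simp
  qed auto
  finally show ?thesis by simp
qed

text \<open>
  From \<open>d(\<partial>'p) = E\<^sub>2\<^sub>3 dp \<and> dp\<close> and \<open>d(\<partial>p + \<partial>'p) = d(dp) = 0\<close>.
\<close>

lemma d1_dp: "d1 (dp D j k) = \<ominus>\<^bsub>W2\<^esub> (\<Oplus>\<^bsub>W2\<^esub>l\<in>UNIV. ww (d (p j l)) (d (p l k)))"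
proof -
  have "d1 (dbp D j k) = (\<Oplus>\<^bsub>W2\<^esub>l\<in>UNIV. ww (d (p j l)) (d (p l k)))"
    unfolding dbp_d
    by (subst add_map_finsum[OF O.M.abelian_group_axioms U.Q.abelian_group_axioms lin_map_add_map[OF d1_lin]])
      (auto simp: d1_dd)
  moreover have "d1 (dp D j k) \<oplus>\<^bsub>W2\<^esub> d1 (dbp D j k) = \<zero>\<^bsub>W2\<^esub>"
    using d1_d[OF p_closed, of j k] by (simp add: d_p d1_add)
  from U.Q.minus_equality[OF this d1_closed[OF dp_closed(2)] d1_closed[OF dp_closed(1)]]
  have "d1 (dp D j k) = \<ominus>\<^bsub>W2\<^esub> d1 (dbp D j k)" by simp
  ultimately show ?thesis by simp
qed

end

section \<open>The Ricci tensor\<close>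

context ricci begin

definition "metric_trace i l = (\<Oplus>\<^bsub>B\<^esub>j\<in>UNIV. gi (dp D i j \<^bold>\<otimes>\<^sub>1 dbp D j l))"

lemma metric_trace_closed [simp, intro]: "metric_trace i l \<in> carrier B"
  unfolding metric_trace_def by (intro B.finsum_closed) auto

lemma metric_trace_lact:
  assumes "lmod B M" "x \<in> carrier M"
  shows "metric_trace i l \<rhd>\<^bsub>M\<^esub> x = cm \<odot>\<^bsub>M\<^esub> (if i = l then x else \<zero>\<^bsub>M\<^esub>) \<oplus>\<^bsub>M\<^esub> (- cm) \<odot>\<^bsub>M\<^esub> (p i l \<rhd>\<^bsub>M\<^esub> x)"
proof -
  interpret M: lmod B M by fact
  have z: "\<zero>\<^bsub>B\<^esub> \<rhd>\<^bsub>M\<^esub> x = \<zero>\<^bsub>M\<^esub>"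
    by (rule add_map_zero[OF B.abelian_group_axioms M.M.abelian_group_axioms])
      (use assms in \<open>auto intro!: add_mapI simp: M.lact_add_l\<close>)
  show ?thesis using assms(2)
    unfolding metric_trace_def metric_contraction
    by (auto simp: M.lact_add_l M.smult_B_lact z)
qed

text \<open>
  The part \<open>p \<partial>p\<close> of \<open>(1 - p) \<partial>p\<close> contracts to zero.
\<close>

lemma metric_trace_dp: "(\<Oplus>\<^bsub>Om\<^esub>l\<in>UNIV. metric_trace i l \<rhd>\<^bsub>Om\<^esub> dp D l k) = cm \<odot>\<^bsub>Om\<^esub> dp D i k"
proof -
  have s: "(\<Oplus>\<^bsub>Om\<^esub>l\<in>UNIV. if i = l then dp D l k else \<zero>\<^bsub>Om\<^esub>) = dp D i k"
    by (intro O.M.finsum_singleton) auto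
  have z: "(\<Oplus>\<^bsub>Om\<^esub>l\<in>UNIV. p i l \<rhd>\<^bsub>Om\<^esub> dp D l k) = \<zero>\<^bsub>Om\<^esub>"
    using E23_pdp[of i k] by (simp add: E23_def fprod_def)
  have "(\<Oplus>\<^bsub>Om\<^esub>l\<in>UNIV. metric_trace i l \<rhd>\<^bsub>Om\<^esub> dp D l k) =
    (\<Oplus>\<^bsub>Om\<^esub>l\<in>UNIV. cm \<odot>\<^bsub>Om\<^esub> (if i = l then dp D l k else \<zero>\<^bsub>Om\<^esub>) \<oplus>\<^bsub>Om\<^esub> (- cm) \<odot>\<^bsub>Om\<^esub> (p i l \<rhd>\<^bsub>Om\<^esub> dp D l k))"
    by (intro O.M.finsum_cong' refl metric_trace_lact[OF lmod_Om]) auto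
  also have "\<dots> = (\<Oplus>\<^bsub>Om\<^esub>l\<in>UNIV. cm \<odot>\<^bsub>Om\<^esub> (if i = l then dp D l k else \<zero>\<^bsub>Om\<^esub>)) \<oplus>\<^bsub>Om\<^esub>
      (\<Oplus>\<^bsub>Om\<^esub>l\<in>UNIV. (- cm) \<odot>\<^bsub>Om\<^esub> (p i l \<rhd>\<^bsub>Om\<^esub> dp D l k))"
    by (rule O.M.finsum_addf) auto
  also have "\<dots> = cm \<odot>\<^bsub>Om\<^esub> dp D i k \<oplus>\<^bsub>Om\<^esub> (- cm) \<odot>\<^bsub>Om\<^esub> \<zero>\<^bsub>Om\<^esub>"
    by (subst (1 2) O.M.smult_finsum[symmetric]) (auto simp: s z)
  finally show ?thesis by simp
qed

text \<open>
  The part of the curvature coming from \<open>d(\<partial>p) \<otimes> \<partial>'p\<close>.  Of the four products in \<open>dp \<and> dp\<close>, only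
  \<open>\<partial>'p \<and> \<partial>p\<close> contributes.
\<close>

lemma contract_d1:
  "contract (dp D i j) (\<Oplus>\<^bsub>O21\<^esub>k\<in>UNIV. curv_pt (dp D j k) (dbp D k i')) =
    (- cmp) \<odot>\<^bsub>O2\<^esub> (\<Oplus>\<^bsub>O2\<^esub>k\<in>UNIV. \<Oplus>\<^bsub>O2\<^esub>l\<in>UNIV. (gi (dp D i j \<^bold>\<otimes>\<^sub>1 dbp D j l) \<rhd>\<^bsub>Om\<^esub> dp D l k) \<^bold>\<otimes>\<^sub>1 dbp D k i')"
proof -
  note psf = add_map_finsum[OF T2.abelian_MN T.abelian_MN contract_add_map[OF dp_closed(1)]]
  let ?contract = "contract (dp D i j)"
  let ?t = "\<lambda>k l. ww (d (p j l)) (dp D l k) \<^bold>\<otimes>\<^sub>2 dbp D k i'"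
  let ?u = "\<lambda>k l. ww (d (p j l)) (dbp D l k) \<^bold>\<otimes>\<^sub>2 dbp D k i'"
  let ?v = "\<lambda>k l. (gi (dp D i j \<^bold>\<otimes>\<^sub>1 dbp D j l) \<rhd>\<^bsub>Om\<^esub> dp D l k) \<^bold>\<otimes>\<^sub>1 dbp D k i'"
  have curv_pt: "?contract (curv_pt (dp D j k) (dbp D k i')) = (- 1) \<odot>\<^bsub>O2\<^esub> ?contract (\<Oplus>\<^bsub>O21\<^esub>l\<in>UNIV. ?t k l \<oplus>\<^bsub>O21\<^esub> ?u k l)" for k
  proof -
    have am: "add_map W2 O21 (\<lambda>\<theta>. \<theta> \<^bold>\<otimes>\<^sub>2 dbp D k i')"
      by (auto intro!: add_mapI simp: T2.pt_add_l)
    have "d1 (dp D j k) \<^bold>\<otimes>\<^sub>2 dbp D k i' = \<ominus>\<^bsub>O21\<^esub> ((\<Oplus>\<^bsub>W2\<^esub>l\<in>UNIV. ww (d (p j l)) (d (p l k))) \<^bold>\<otimes>\<^sub>2 dbp D k i')"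
      unfolding d1_dp by (rule add_map_minus[OF U.Q.abelian_group_axioms T2.abelian_MN am]) (auto intro!: U.Q.finsum_closed)
    also have "(\<Oplus>\<^bsub>W2\<^esub>l\<in>UNIV. ww (d (p j l)) (d (p l k))) \<^bold>\<otimes>\<^sub>2 dbp D k i' =
        (\<Oplus>\<^bsub>O21\<^esub>l\<in>UNIV. ww (d (p j l)) (d (p l k)) \<^bold>\<otimes>\<^sub>2 dbp D k i')"
      by (rule add_map_finsum[OF U.Q.abelian_group_axioms T2.abelian_MN am]) auto
    also have "\<dots> = (\<Oplus>\<^bsub>O21\<^esub>l\<in>UNIV. ?t k l \<oplus>\<^bsub>O21\<^esub> ?u k l)"
      by (intro T2.MN.finsum_cong') (auto simp: d_p[of _ k] ww_add_r T2.pt_add_l)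
    finally have d1: "d1 (dp D j k) \<^bold>\<otimes>\<^sub>2 dbp D k i' = \<ominus>\<^bsub>O21\<^esub> (\<Oplus>\<^bsub>O21\<^esub>l\<in>UNIV. ?t k l \<oplus>\<^bsub>O21\<^esub> ?u k l)" .
    have c: "(\<Oplus>\<^bsub>O21\<^esub>l\<in>UNIV. ?t k l \<oplus>\<^bsub>O21\<^esub> ?u k l) \<in> carrier O21" by (intro T2.MN.finsum_closed) auto
    have "?contract (curv_pt (dp D j k) (dbp D k i')) = ?contract (d1 (dp D j k) \<^bold>\<otimes>\<^sub>2 dbp D k i') \<ominus>\<^bsub>O2\<^esub> ?contract (wid (dp D j k) (nab (dbp D k i')))"
      unfolding curv_pt_def by (rule add_map_diff[OF T2.abelian_MN T.abelian_MN contract_add_map]) auto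
    also have "\<dots> = ?contract (d1 (dp D j k) \<^bold>\<otimes>\<^sub>2 dbp D k i')"
      by (simp add: contract_wid_nab T.MN.minus_eq)
    also have "\<dots> = \<ominus>\<^bsub>O2\<^esub> ?contract (\<Oplus>\<^bsub>O21\<^esub>l\<in>UNIV. ?t k l \<oplus>\<^bsub>O21\<^esub> ?u k l)"
      unfolding d1 by (rule add_map_minus[OF T2.abelian_MN T.abelian_MN contract_add_map c]) simp
    finally show ?thesis using c by (simp add: O2.M.smult_minus_one)
  qed
  have tt: "?contract (?t k l) = cmp \<odot>\<^bsub>O2\<^esub> ?v k l" for k l
    by (simp add: d_p ww_add_l T2.pt_add_l add_map_add[OF contract_add_map] contract_dp_dp contract_dbp_dp)
  \<comment> \<open>These terms vanish only after the sum over the leg shared with the last factor.\<close>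
  have u0: "(\<Oplus>\<^bsub>O21\<^esub>k\<in>UNIV. \<Oplus>\<^bsub>O21\<^esub>l\<in>UNIV. ?u k l) = \<zero>\<^bsub>O21\<^esub>"
  proof -
    have "(\<Oplus>\<^bsub>O21\<^esub>k\<in>UNIV. \<Oplus>\<^bsub>O21\<^esub>l\<in>UNIV. ?u k l) = (\<Oplus>\<^bsub>O21\<^esub>l\<in>UNIV. \<Oplus>\<^bsub>O21\<^esub>k\<in>UNIV. ?u k l)"
      by (rule T2.MN.finsum_swap) auto
    then show ?thesis by (simp add: ww_dbp_contract)
  qed
  have contract_sum: "?contract (\<Oplus>\<^bsub>O21\<^esub>l\<in>UNIV. ?t k l \<oplus>\<^bsub>O21\<^esub> ?u k l) =
      cmp \<odot>\<^bsub>O2\<^esub> (\<Oplus>\<^bsub>O2\<^esub>l\<in>UNIV. ?v k l) \<oplus>\<^bsub>O2\<^esub> ?contract (\<Oplus>\<^bsub>O21\<^esub>l\<in>UNIV. ?u k l)" for k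
  proof -
    have "(\<Oplus>\<^bsub>O21\<^esub>l\<in>UNIV. ?t k l \<oplus>\<^bsub>O21\<^esub> ?u k l) = (\<Oplus>\<^bsub>O21\<^esub>l\<in>UNIV. ?t k l) \<oplus>\<^bsub>O21\<^esub> (\<Oplus>\<^bsub>O21\<^esub>l\<in>UNIV. ?u k l)"
      by (rule T2.MN.finsum_addf) auto
    then have "?contract (\<Oplus>\<^bsub>O21\<^esub>l\<in>UNIV. ?t k l \<oplus>\<^bsub>O21\<^esub> ?u k l) =
        ?contract (\<Oplus>\<^bsub>O21\<^esub>l\<in>UNIV. ?t k l) \<oplus>\<^bsub>O2\<^esub> ?contract (\<Oplus>\<^bsub>O21\<^esub>l\<in>UNIV. ?u k l)"
      by (simp only:) (rule add_map_add[OF contract_add_map], auto intro!: T2.MN.finsum_closed)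
    also have "?contract (\<Oplus>\<^bsub>O21\<^esub>l\<in>UNIV. ?t k l) = (\<Oplus>\<^bsub>O2\<^esub>l\<in>UNIV. cmp \<odot>\<^bsub>O2\<^esub> ?v k l)"
      by (subst psf) (auto simp: tt)
    also have "\<dots> = cmp \<odot>\<^bsub>O2\<^esub> (\<Oplus>\<^bsub>O2\<^esub>l\<in>UNIV. ?v k l)"
      by (rule O2.M.smult_finsum[symmetric]) auto
    finally show ?thesis .
  qed
  have vc: "(\<Oplus>\<^bsub>O2\<^esub>l\<in>UNIV. ?v k l) \<in> carrier O2" for k by (intro T.MN.finsum_closed) auto
  have uc: "(\<Oplus>\<^bsub>O21\<^esub>l\<in>UNIV. ?u k l) \<in> carrier O21" for k by (intro T2.MN.finsum_closed) auto
  have puc: "?contract (\<Oplus>\<^bsub>O21\<^esub>l\<in>UNIV. ?u k l) \<in> carrier O2" for k using uc by (intro contract_closed) auto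
  have "?contract (\<Oplus>\<^bsub>O21\<^esub>k\<in>UNIV. curv_pt (dp D j k) (dbp D k i')) =
      (\<Oplus>\<^bsub>O2\<^esub>k\<in>UNIV. (- 1) \<odot>\<^bsub>O2\<^esub> (cmp \<odot>\<^bsub>O2\<^esub> (\<Oplus>\<^bsub>O2\<^esub>l\<in>UNIV. ?v k l) \<oplus>\<^bsub>O2\<^esub> ?contract (\<Oplus>\<^bsub>O21\<^esub>l\<in>UNIV. ?u k l)))"
  proof -
    have kc: "curv_pt (dp D j k) (dbp D k i') \<in> carrier O21" for k by simp
    have "?contract (\<Oplus>\<^bsub>O21\<^esub>k\<in>UNIV. curv_pt (dp D j k) (dbp D k i')) = (\<Oplus>\<^bsub>O2\<^esub>k\<in>UNIV. ?contract (curv_pt (dp D j k) (dbp D k i')))"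
      by (rule psf) (use kc in auto)
    then show ?thesis unfolding curv_pt contract_sum .
  qed
  also have "\<dots> = (- 1) \<odot>\<^bsub>O2\<^esub> (\<Oplus>\<^bsub>O2\<^esub>k\<in>UNIV. cmp \<odot>\<^bsub>O2\<^esub> (\<Oplus>\<^bsub>O2\<^esub>l\<in>UNIV. ?v k l) \<oplus>\<^bsub>O2\<^esub> ?contract (\<Oplus>\<^bsub>O21\<^esub>l\<in>UNIV. ?u k l))"
    using vc puc by (intro O2.M.smult_finsum[symmetric]) auto
  also have "(\<Oplus>\<^bsub>O2\<^esub>k\<in>UNIV. cmp \<odot>\<^bsub>O2\<^esub> (\<Oplus>\<^bsub>O2\<^esub>l\<in>UNIV. ?v k l) \<oplus>\<^bsub>O2\<^esub> ?contract (\<Oplus>\<^bsub>O21\<^esub>l\<in>UNIV. ?u k l)) =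
      (\<Oplus>\<^bsub>O2\<^esub>k\<in>UNIV. cmp \<odot>\<^bsub>O2\<^esub> (\<Oplus>\<^bsub>O2\<^esub>l\<in>UNIV. ?v k l)) \<oplus>\<^bsub>O2\<^esub> (\<Oplus>\<^bsub>O2\<^esub>k\<in>UNIV. ?contract (\<Oplus>\<^bsub>O21\<^esub>l\<in>UNIV. ?u k l))"
    using vc puc by (intro T.MN.finsum_addf) auto
  also have "(\<Oplus>\<^bsub>O2\<^esub>k\<in>UNIV. ?contract (\<Oplus>\<^bsub>O21\<^esub>l\<in>UNIV. ?u k l)) = \<zero>\<^bsub>O2\<^esub>"
  proof -
    have "(\<Oplus>\<^bsub>O2\<^esub>k\<in>UNIV. ?contract (\<Oplus>\<^bsub>O21\<^esub>l\<in>UNIV. ?u k l)) = ?contract (\<Oplus>\<^bsub>O21\<^esub>k\<in>UNIV. \<Oplus>\<^bsub>O21\<^esub>l\<in>UNIV. ?u k l)"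
      by (rule psf[symmetric]) (use uc in auto)
    then show ?thesis unfolding u0
      by (simp add: add_map_zero[OF T2.abelian_MN T.abelian_MN contract_add_map[OF dp_closed(1)]])
  qed
  also have "(\<Oplus>\<^bsub>O2\<^esub>k\<in>UNIV. cmp \<odot>\<^bsub>O2\<^esub> (\<Oplus>\<^bsub>O2\<^esub>l\<in>UNIV. ?v k l)) = cmp \<odot>\<^bsub>O2\<^esub> (\<Oplus>\<^bsub>O2\<^esub>k\<in>UNIV. \<Oplus>\<^bsub>O2\<^esub>l\<in>UNIV. ?v k l)"
    using vc by (intro O2.M.smult_finsum[symmetric]) auto
  finally show ?thesis using vc by (simp add: T.MN.finsum_closed flip: O2.M.smult_assoc)
qed

text \<open>
  Both sides are linear in the metric, which is a sum of tensors \<open>\<partial>p \<otimes> \<partial>'p\<close>.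
\<close>

lemma contract_wid_dbp_g: "contract (dp D i j) (wid (dbp D k l) g) =
    cmp \<odot>\<^bsub>O2\<^esub> (gi (dp D i j \<^bold>\<otimes>\<^sub>1 dbp D k l) \<rhd>\<^bsub>O2\<^esub> g)"
proof -
  have l1: "lin_map O2 O2 (\<lambda>X. contract (dp D i j) (wid (dbp D k l) X))"
    by (rule lin_map_comp[OF wid_lin contract_lin]) auto
  have l2: "lin_map O2 O2 (\<lambda>X. cmp \<odot>\<^bsub>O2\<^esub> (gi (dp D i j \<^bold>\<otimes>\<^sub>1 dbp D k l) \<rhd>\<^bsub>O2\<^esub> X))"
    by (auto simp: lin_map_def O2.lact_add_r O2.lact_smult O2.M.smult_r_distr mult.commute simp flip: O2.M.smult_assoc)
  have "g \<in> {X \<in> carrier O2. contract (dp D i j) (wid (dbp D k l) X) = cmp \<odot>\<^bsub>O2\<^esub> (gi (dp D i j \<^bold>\<otimes>\<^sub>1 dbp D k l) \<rhd>\<^bsub>O2\<^esub> X)}"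
    by (rule g_in[OF csub_eq[OF csO2 csO2 l1 l2]]) (simp add: wid_pt contract_dbp_dp T.lact_pt)
  then show ?thesis by simp
qed

text \<open>
  The three terms are the curvature of \<open>E\<^sub>2\<^sub>3 \<partial>p \<otimes> \<partial>'p\<close>, the term \<open>dp \<and> g\<close>, and \<open>p K(g)\<close>, where
  the coefficient \<open>p\<close> of the last one has been moved to the form that is paired.
\<close>

lemma contract_riem: "contract (dp D i j) (riem (dbp D j i)) =
    (- cmp) \<odot>\<^bsub>O2\<^esub> (\<Oplus>\<^bsub>O2\<^esub>k\<in>UNIV. \<Oplus>\<^bsub>O2\<^esub>l\<in>UNIV. (gi (dp D i j \<^bold>\<otimes>\<^sub>1 dbp D j l) \<rhd>\<^bsub>Om\<^esub> dp D l k) \<^bold>\<otimes>\<^sub>1 dbp D k i) \<oplus>\<^bsub>O2\<^esub>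
    ((- (cm * cmp)) \<odot>\<^bsub>O2\<^esub> (gi (dp D i j \<^bold>\<otimes>\<^sub>1 dbp D j i) \<rhd>\<^bsub>O2\<^esub> g) \<oplus>\<^bsub>O2\<^esub>
     (- cm) \<odot>\<^bsub>O2\<^esub> contract (dp D i j \<lhd>\<^bsub>Om\<^esub> p j i) (curv g))"
proof -
  let ?A = "\<Oplus>\<^bsub>O21\<^esub>k\<in>UNIV. curv_pt (dp D j k) (dbp D k i)"
  have Ac: "?A \<in> carrier O21" by (intro T2.MN.finsum_closed) auto
  have cp: "cm \<odot>\<^bsub>B\<^esub> p j i \<in> carrier B" by simp
  have "cm \<odot>\<^bsub>O2\<^esub> (p j i \<rhd>\<^bsub>O2\<^esub> g) = (cm \<odot>\<^bsub>B\<^esub> p j i) \<rhd>\<^bsub>O2\<^esub> g" by (simp add: O2.smult_B_lact)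
  then have "curv (cm \<odot>\<^bsub>O2\<^esub> (p j i \<rhd>\<^bsub>O2\<^esub> g)) = wid (cm \<odot>\<^bsub>Om\<^esub> d (p j i)) g \<oplus>\<^bsub>O21\<^esub> (cm \<odot>\<^bsub>B\<^esub> p j i) \<rhd>\<^bsub>O21\<^esub> curv g"
    using curv_lact[OF cp g_closed] by (simp add: d_smult)
  also have "\<dots> = cm \<odot>\<^bsub>O21\<^esub> (wid (d (p j i)) g \<oplus>\<^bsub>O21\<^esub> p j i \<rhd>\<^bsub>O21\<^esub> curv g)"
    by (simp add: O21.smult_B_lact O21.M.smult_r_distr lin_map_smult[OF wid_lin_l[OF g_closed]])
  finally have K: "curv (cm \<odot>\<^bsub>O2\<^esub> (p j i \<rhd>\<^bsub>O2\<^esub> g)) = cm \<odot>\<^bsub>O21\<^esub> (wid (d (p j i)) g \<oplus>\<^bsub>O21\<^esub> p j i \<rhd>\<^bsub>O21\<^esub> curv g)" .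
  have "riem (dbp D j i) = curv (\<Oplus>\<^bsub>O2\<^esub>k\<in>UNIV. dp D j k \<^bold>\<otimes>\<^sub>1 dbp D k i) \<ominus>\<^bsub>O21\<^esub> curv (cm \<odot>\<^bsub>O2\<^esub> (p j i \<rhd>\<^bsub>O2\<^esub> g))"
    unfolding riem_eq nab_dbp by (rule add_map_diff[OF T.abelian_MN T2.abelian_MN curv_add_map]) (auto intro!: T.MN.finsum_closed)
  also have "curv (\<Oplus>\<^bsub>O2\<^esub>k\<in>UNIV. dp D j k \<^bold>\<otimes>\<^sub>1 dbp D k i) = ?A"
    by (subst add_map_finsum[OF T.abelian_MN T2.abelian_MN curv_add_map]) (auto simp: curv_pt)
  finally have "riem (dbp D j i) = ?A \<oplus>\<^bsub>O21\<^esub> (- cm) \<odot>\<^bsub>O21\<^esub> (wid (d (p j i)) g \<oplus>\<^bsub>O21\<^esub> p j i \<rhd>\<^bsub>O21\<^esub> curv g)"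
    using Ac by (simp add: K O21.M.minus_eq_smult flip: O21.M.smult_assoc)
  then have "contract (dp D i j) (riem (dbp D j i)) = contract (dp D i j) ?A \<oplus>\<^bsub>O2\<^esub>
      (- cm) \<odot>\<^bsub>O2\<^esub> (contract (dp D i j) (wid (d (p j i)) g) \<oplus>\<^bsub>O2\<^esub> contract (dp D i j) (p j i \<rhd>\<^bsub>O21\<^esub> curv g))"
    using Ac by (simp add: add_map_add[OF contract_add_map] contract_smult)
  also have "contract (dp D i j) (wid (d (p j i)) g) = cmp \<odot>\<^bsub>O2\<^esub> (gi (dp D i j \<^bold>\<otimes>\<^sub>1 dbp D j i) \<rhd>\<^bsub>O2\<^esub> g)"
    using del_null_wid(3)[of j i] by (simp add: d_p wid_add_l add_map_add[OF contract_add_map] contract_wid_dbp_g del_null_def)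
  also have "contract (dp D i j) (p j i \<rhd>\<^bsub>O21\<^esub> curv g) = contract (dp D i j \<lhd>\<^bsub>Om\<^esub> p j i) (curv g)"
    by (simp add: contract_bal)
  finally show ?thesis unfolding contract_d1 by (simp add: O2.M.smult_r_distr flip: O2.M.smult_assoc)
qed

text \<open>
  Summing over the inner leg brings in the contracted inverse metric, and turns \<open>(\<partial>p) p\<close> into \<open>\<partial>p\<close> in
  the last term.
\<close>

lemma PHI_row:
  "(\<Oplus>\<^bsub>O2\<^esub>j\<in>UNIV. contract (dp D i j) (riem (dbp D j i))) =
    (- (cmp * cm)) \<odot>\<^bsub>O2\<^esub> (\<Oplus>\<^bsub>O2\<^esub>k\<in>UNIV. dp D i k \<^bold>\<otimes>\<^sub>1 dbp D k i) \<oplus>\<^bsub>O2\<^esub>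
    ((- (cm * cmp)) \<odot>\<^bsub>O2\<^esub> (metric_trace i i \<rhd>\<^bsub>O2\<^esub> g) \<oplus>\<^bsub>O2\<^esub> (- cm) \<odot>\<^bsub>O2\<^esub> contract (dp D i i) (curv g))"
proof -
  let ?v = "\<lambda>j k l. (gi (dp D i j \<^bold>\<otimes>\<^sub>1 dbp D j l) \<rhd>\<^bsub>Om\<^esub> dp D l k) \<^bold>\<otimes>\<^sub>1 dbp D k i"
  have vc: "?v j k l \<in> carrier O2" for j k l by simp
  have vc1: "(\<Oplus>\<^bsub>O2\<^esub>l\<in>UNIV. ?v j k l) \<in> carrier O2" for j k by (intro T.MN.finsum_closed) auto
  have vc2: "(\<Oplus>\<^bsub>O2\<^esub>k\<in>UNIV. \<Oplus>\<^bsub>O2\<^esub>l\<in>UNIV. ?v j k l) \<in> carrier O2" for j using vc1 by (intro T.MN.finsum_closed) auto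
  have pc: "contract (dp D i j \<lhd>\<^bsub>Om\<^esub> p j i) (curv g) \<in> carrier O2" for j by (intro contract_closed) auto
  have "(\<Oplus>\<^bsub>O2\<^esub>j\<in>UNIV. contract (dp D i j) (riem (dbp D j i))) =
     (\<Oplus>\<^bsub>O2\<^esub>j\<in>UNIV. (- cmp) \<odot>\<^bsub>O2\<^esub> (\<Oplus>\<^bsub>O2\<^esub>k\<in>UNIV. \<Oplus>\<^bsub>O2\<^esub>l\<in>UNIV. ?v j k l)) \<oplus>\<^bsub>O2\<^esub>
     ((\<Oplus>\<^bsub>O2\<^esub>j\<in>UNIV. (- (cm * cmp)) \<odot>\<^bsub>O2\<^esub> (gi (dp D i j \<^bold>\<otimes>\<^sub>1 dbp D j i) \<rhd>\<^bsub>O2\<^esub> g)) \<oplus>\<^bsub>O2\<^esub>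
      (\<Oplus>\<^bsub>O2\<^esub>j\<in>UNIV. (- cm) \<odot>\<^bsub>O2\<^esub> contract (dp D i j \<lhd>\<^bsub>Om\<^esub> p j i) (curv g)))"
    unfolding contract_riem using vc2 pc by (simp add: T.MN.finsum_addf Pi_def)
  also have "(\<Oplus>\<^bsub>O2\<^esub>j\<in>UNIV. (- cm) \<odot>\<^bsub>O2\<^esub> contract (dp D i j \<lhd>\<^bsub>Om\<^esub> p j i) (curv g)) = (- cm) \<odot>\<^bsub>O2\<^esub> contract (dp D i i) (curv g)"
  proof -
    have "dp D i i = (\<Oplus>\<^bsub>Om\<^esub>j\<in>UNIV. dp D i j \<lhd>\<^bsub>Om\<^esub> p j i)"
      using E23_dp_p[of i i] by (simp add: E23_def fprod_def)
    then have "contract (dp D i i) (curv g) = (\<Oplus>\<^bsub>O2\<^esub>j\<in>UNIV. contract (dp D i j \<lhd>\<^bsub>Om\<^esub> p j i) (curv g))"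
      by (simp only:) (rule add_map_finsum[OF O.M.abelian_group_axioms T.abelian_MN lin_map_add_map[OF contract_lin_\<omega>]], auto)
    then show ?thesis using pc by (simp add: O2.M.smult_finsum)
  qed
  also have "(\<Oplus>\<^bsub>O2\<^esub>j\<in>UNIV. (- (cm * cmp)) \<odot>\<^bsub>O2\<^esub> (gi (dp D i j \<^bold>\<otimes>\<^sub>1 dbp D j i) \<rhd>\<^bsub>O2\<^esub> g)) =
      (- (cm * cmp)) \<odot>\<^bsub>O2\<^esub> (metric_trace i i \<rhd>\<^bsub>O2\<^esub> g)"
  proof -
    have "metric_trace i i \<rhd>\<^bsub>O2\<^esub> g = (\<Oplus>\<^bsub>O2\<^esub>j\<in>UNIV. gi (dp D i j \<^bold>\<otimes>\<^sub>1 dbp D j i) \<rhd>\<^bsub>O2\<^esub> g)"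
      unfolding metric_trace_def
      by (rule add_map_finsum[OF B.abelian_group_axioms T.abelian_MN]) (auto intro!: add_mapI simp: O2.lact_add_l)
    then show ?thesis by (simp add: O2.M.smult_finsum)
  qed
  also have "(\<Oplus>\<^bsub>O2\<^esub>j\<in>UNIV. (- cmp) \<odot>\<^bsub>O2\<^esub> (\<Oplus>\<^bsub>O2\<^esub>k\<in>UNIV. \<Oplus>\<^bsub>O2\<^esub>l\<in>UNIV. ?v j k l)) =
      (- (cmp * cm)) \<odot>\<^bsub>O2\<^esub> (\<Oplus>\<^bsub>O2\<^esub>k\<in>UNIV. dp D i k \<^bold>\<otimes>\<^sub>1 dbp D k i)"
  proof -
    have inner: "(\<Oplus>\<^bsub>O2\<^esub>l\<in>UNIV. \<Oplus>\<^bsub>O2\<^esub>j\<in>UNIV. ?v j k l) = cm \<odot>\<^bsub>O2\<^esub> (dp D i k \<^bold>\<otimes>\<^sub>1 dbp D k i)" for k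
    proof -
      have am: "add_map Om O2 (\<lambda>\<omega>. \<omega> \<^bold>\<otimes>\<^sub>1 dbp D k i)" by (auto intro!: add_mapI simp: T.pt_add_l)
      have am2: "add_map B O2 (\<lambda>b. (b \<rhd>\<^bsub>Om\<^esub> dp D l k) \<^bold>\<otimes>\<^sub>1 dbp D k i)" for l
        by (auto intro!: add_mapI simp: T.pt_add_l O.lact_add_l)
      have "(\<Oplus>\<^bsub>O2\<^esub>j\<in>UNIV. ?v j k l) = (metric_trace i l \<rhd>\<^bsub>Om\<^esub> dp D l k) \<^bold>\<otimes>\<^sub>1 dbp D k i" for l
        unfolding metric_trace_def by (rule add_map_finsum[OF B.abelian_group_axioms T.abelian_MN am2, symmetric]) auto
      then have "(\<Oplus>\<^bsub>O2\<^esub>l\<in>UNIV. \<Oplus>\<^bsub>O2\<^esub>j\<in>UNIV. ?v j k l) = (\<Oplus>\<^bsub>O2\<^esub>l\<in>UNIV. (metric_trace i l \<rhd>\<^bsub>Om\<^esub> dp D l k) \<^bold>\<otimes>\<^sub>1 dbp D k i)"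
        by simp
      also have "\<dots> = (cm \<odot>\<^bsub>Om\<^esub> dp D i k) \<^bold>\<otimes>\<^sub>1 dbp D k i"
        unfolding metric_trace_dp[symmetric]
        by (rule add_map_finsum[OF O.M.abelian_group_axioms T.abelian_MN am, symmetric]) auto
      finally show ?thesis by (simp add: T.smult_pt)
    qed
    have "(\<Oplus>\<^bsub>O2\<^esub>j\<in>UNIV. \<Oplus>\<^bsub>O2\<^esub>k\<in>UNIV. \<Oplus>\<^bsub>O2\<^esub>l\<in>UNIV. ?v j k l) = (\<Oplus>\<^bsub>O2\<^esub>k\<in>UNIV. \<Oplus>\<^bsub>O2\<^esub>j\<in>UNIV. \<Oplus>\<^bsub>O2\<^esub>l\<in>UNIV. ?v j k l)"
      by (rule T.MN.finsum_swap) (auto intro: vc1)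
    also have "\<dots> = (\<Oplus>\<^bsub>O2\<^esub>k\<in>UNIV. \<Oplus>\<^bsub>O2\<^esub>l\<in>UNIV. \<Oplus>\<^bsub>O2\<^esub>j\<in>UNIV. ?v j k l)"
      by (intro T.MN.finsum_cong' refl T.MN.finsum_swap) (auto intro!: T.MN.finsum_closed)
    also have "\<dots> = cm \<odot>\<^bsub>O2\<^esub> (\<Oplus>\<^bsub>O2\<^esub>k\<in>UNIV. dp D i k \<^bold>\<otimes>\<^sub>1 dbp D k i)"
      unfolding inner by (rule O2.M.smult_finsum[symmetric]) auto
    finally have "(\<Oplus>\<^bsub>O2\<^esub>j\<in>UNIV. \<Oplus>\<^bsub>O2\<^esub>k\<in>UNIV. \<Oplus>\<^bsub>O2\<^esub>l\<in>UNIV. ?v j k l) = cm \<odot>\<^bsub>O2\<^esub> (\<Oplus>\<^bsub>O2\<^esub>k\<in>UNIV. dp D i k \<^bold>\<otimes>\<^sub>1 dbp D k i)" .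
    moreover have "(\<Oplus>\<^bsub>O2\<^esub>k\<in>UNIV. dp D i k \<^bold>\<otimes>\<^sub>1 dbp D k i) \<in> carrier O2" by (intro T.MN.finsum_closed) auto
    ultimately show ?thesis using vc2
      by (simp flip: O2.M.smult_finsum O2.M.smult_assoc)
  qed
  finally show ?thesis .
qed

lemma PHI_lin: "lin_map O2 O2 PHI"
proof -
  have "PHI (c \<odot>\<^bsub>O2\<^esub> X) = c \<odot>\<^bsub>O2\<^esub> PHI X" if "X \<in> carrier O2" for c X
    by (rule T.tens_ext[OF T.abelian_MN add_map_comp[OF T.add_map_smult PHI_add_map]
          add_map_comp[OF PHI_add_map T.add_map_smult] _ that])
      (simp add: T.smult_pt PHI_pt contract_smult_\<omega>)
  then show ?thesis using PHI_add_map by (auto simp: lin_map_def add_map_def)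
qed

text \<open>
  The outer contraction \<open>E'\<close> of the rows.  The last term of each row is linear in \<open>\<partial>p\<close> and sums to a value at
  \<open>E'\<^sub>1\<^sub>2 \<partial>p = 0\<close>.
\<close>

theorem Ricci_plus_minus: "PHI g = (- cmp * qq D (- 2 * exp_m D) * qdim D) \<odot>\<^bsub>O2\<^esub> g"
proof -
  let ?G = "\<lambda>i. \<Oplus>\<^bsub>O2\<^esub>j\<in>UNIV. dp D i j \<^bold>\<otimes>\<^sub>1 dbp D j i"
  let ?K = "\<lambda>i. contract (dp D i i) (curv g)"
  have Gc: "?G i \<in> carrier O2" for i by (intro T.MN.finsum_closed) auto
  have Kc: "?K i \<in> carrier O2" for i by simp
  have row: "PHI (?G i) = (- (cmp * cm)) \<odot>\<^bsub>O2\<^esub> ?G i \<oplus>\<^bsub>O2\<^esub>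
      ((- (cm * cmp)) \<odot>\<^bsub>O2\<^esub> (metric_trace i i \<rhd>\<^bsub>O2\<^esub> g) \<oplus>\<^bsub>O2\<^esub> (- cm) \<odot>\<^bsub>O2\<^esub> ?K i)" for i
    unfolding PHI_row[symmetric]
    by (subst add_map_finsum[OF T.abelian_MN T.abelian_MN PHI_add_map]) (auto simp: PHI_pt)
  have eg: "metric_trace i i \<rhd>\<^bsub>O2\<^esub> g = cm \<odot>\<^bsub>O2\<^esub> g \<oplus>\<^bsub>O2\<^esub> (- cm) \<odot>\<^bsub>O2\<^esub> (p i i \<rhd>\<^bsub>O2\<^esub> g)" for i
    using metric_trace_lact[OF O2.lmod_axioms g_closed, of i i] by simp
  have "PHI g = (\<Oplus>\<^bsub>O2\<^esub>i\<in>UNIV. q2rho D i \<odot>\<^bsub>O2\<^esub> PHI (?G i))"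
    by (subst g_eq) (rule lin_map_finsum[OF csO2 csO2 PHI_lin], auto intro: Gc)
  also have "\<dots> = (\<Oplus>\<^bsub>O2\<^esub>i\<in>UNIV. (- (cmp * cm)) \<odot>\<^bsub>O2\<^esub> (q2rho D i \<odot>\<^bsub>O2\<^esub> ?G i) \<oplus>\<^bsub>O2\<^esub>
      ((- (cm * cmp) * cm) \<odot>\<^bsub>O2\<^esub> (q2rho D i \<odot>\<^bsub>O2\<^esub> g) \<oplus>\<^bsub>O2\<^esub>
      ((cm * cmp * cm) \<odot>\<^bsub>O2\<^esub> (q2rho D i \<odot>\<^bsub>O2\<^esub> (p i i \<rhd>\<^bsub>O2\<^esub> g)) \<oplus>\<^bsub>O2\<^esub>
       (- cm) \<odot>\<^bsub>O2\<^esub> (q2rho D i \<odot>\<^bsub>O2\<^esub> ?K i))))"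
  proof (intro T.MN.finsum_cong' refl)
    fix i
    show "q2rho D i \<odot>\<^bsub>O2\<^esub> PHI (?G i) = (- (cmp * cm)) \<odot>\<^bsub>O2\<^esub> (q2rho D i \<odot>\<^bsub>O2\<^esub> ?G i) \<oplus>\<^bsub>O2\<^esub>
      ((- (cm * cmp) * cm) \<odot>\<^bsub>O2\<^esub> (q2rho D i \<odot>\<^bsub>O2\<^esub> g) \<oplus>\<^bsub>O2\<^esub>
      ((cm * cmp * cm) \<odot>\<^bsub>O2\<^esub> (q2rho D i \<odot>\<^bsub>O2\<^esub> (p i i \<rhd>\<^bsub>O2\<^esub> g)) \<oplus>\<^bsub>O2\<^esub>
       (- cm) \<odot>\<^bsub>O2\<^esub> (q2rho D i \<odot>\<^bsub>O2\<^esub> ?K i)))"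
      unfolding row eg using Gc[of i] Kc[of i]
      by (simp add: O2.M.smult_r_distr T.MN.a_assoc mult_ac flip: O2.M.smult_assoc)
  qed (use Gc Kc in auto)
  also have "\<dots> = (- (cmp * cm)) \<odot>\<^bsub>O2\<^esub> (\<Oplus>\<^bsub>O2\<^esub>i\<in>UNIV. q2rho D i \<odot>\<^bsub>O2\<^esub> ?G i) \<oplus>\<^bsub>O2\<^esub>
      ((- (cm * cmp) * cm) \<odot>\<^bsub>O2\<^esub> (\<Oplus>\<^bsub>O2\<^esub>i\<in>UNIV. q2rho D i \<odot>\<^bsub>O2\<^esub> g) \<oplus>\<^bsub>O2\<^esub>
      ((cm * cmp * cm) \<odot>\<^bsub>O2\<^esub> (\<Oplus>\<^bsub>O2\<^esub>i\<in>UNIV. q2rho D i \<odot>\<^bsub>O2\<^esub> (p i i \<rhd>\<^bsub>O2\<^esub> g)) \<oplus>\<^bsub>O2\<^esub>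
       (- cm) \<odot>\<^bsub>O2\<^esub> (\<Oplus>\<^bsub>O2\<^esub>i\<in>UNIV. q2rho D i \<odot>\<^bsub>O2\<^esub> ?K i)))"
    using Gc Kc by (simp add: T.MN.finsum_addf O2.M.smult_finsum Pi_def)
  also have "(\<Oplus>\<^bsub>O2\<^esub>i\<in>UNIV. q2rho D i \<odot>\<^bsub>O2\<^esub> ?G i) = g" by (rule g_eq[symmetric])
  also have "(\<Oplus>\<^bsub>O2\<^esub>i\<in>UNIV. q2rho D i \<odot>\<^bsub>O2\<^esub> g) = qdim D \<odot>\<^bsub>O2\<^esub> g"
    by (simp add: O2.M.finsum_smult_left qdim_def)
  also have "(\<Oplus>\<^bsub>O2\<^esub>i\<in>UNIV. q2rho D i \<odot>\<^bsub>O2\<^esub> (p i i \<rhd>\<^bsub>O2\<^esub> g)) = qq D (exp_m D) \<odot>\<^bsub>O2\<^esub> g"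
    using E'12_lact[OF O2.lmod_axioms g_closed] by (simp add: E'12_def)
  also have "(\<Oplus>\<^bsub>O2\<^esub>i\<in>UNIV. q2rho D i \<odot>\<^bsub>O2\<^esub> ?K i) = \<zero>\<^bsub>O2\<^esub>"
  proof -
    have kc: "curv g \<in> carrier O21" by simp
    note l = contract_lin_\<omega>[OF kc]
    have "(\<Oplus>\<^bsub>O2\<^esub>i\<in>UNIV. q2rho D i \<odot>\<^bsub>O2\<^esub> ?K i) = contract (E'12 D Om (dp D)) (curv g)"
      using lin_map_E'12[OF csO csO2 l, of "dp D" D] by (simp add: E'12_def)
    also have "\<dots> = \<zero>\<^bsub>O2\<^esub>" unfolding E'_dp
      by (rule add_map_zero[OF O.M.abelian_group_axioms T.abelian_MN lin_map_add_map[OF l]])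
    finally show ?thesis .
  qed
  finally have "PHI g = (- (cmp * cm)) \<odot>\<^bsub>O2\<^esub> g \<oplus>\<^bsub>O2\<^esub>
      ((- (cm * cmp) * cm * qdim D) \<odot>\<^bsub>O2\<^esub> g \<oplus>\<^bsub>O2\<^esub> (cm * cmp * cm * qq D (exp_m D)) \<odot>\<^bsub>O2\<^esub> g)"
    by (simp flip: O2.M.smult_assoc)
  also have "\<dots> = (- (cmp * cm) + (- (cm * cmp) * cm * qdim D + cm * cmp * cm * qq D (exp_m D))) \<odot>\<^bsub>O2\<^esub> g"
    unfolding O2.M.smult_l_distr[OF g_closed] ..
  finally have "PHI g = (- (cmp * cm) + (- (cm * cmp) * cm * qdim D + cm * cmp * cm * qq D (exp_m D))) \<odot>\<^bsub>O2\<^esub> g" .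
  also have "- (cmp * cm) + (- (cm * cmp) * cm * qdim D + cm * cmp * cm * qq D (exp_m D)) = - cmp * (cm * cm) * qdim D"
    using qqs(5)[of "exp_m D"] by (simp add: algebra_simps)
  also have "cm * cm = qq D (- 2 * exp_m D)"
    by (simp flip: qqs(1))
  finally show ?thesis .
qed

end

theorem lemma6p2:
  fixes D :: "('n::finite) qdata"
    and \<rho> :: "'n forms1 \<Rightarrow> 'n alg \<Rightarrow> 'n forms1"
    and del delbar d :: "'n alg \<Rightarrow> 'n forms1"
    and d1 :: "'n forms1 \<Rightarrow> 'n forms2"
    and ip :: "'n forms1_1 \<Rightarrow> 'n alg"
    and nab :: "'n forms1 \<Rightarrow> 'n forms1_1"
    and \<sigma> :: "'n forms1_1 \<Rightarrow> 'n forms1_1"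
    and s :: "'n forms2 \<Rightarrow> 'n forms1_1"
    and cpm cmp :: complex
  assumes "quantum_data D"
    and "hk_right_action D \<rho>"
    and "hk_del D \<rho> del delbar"
    and "d = total_d D \<rho> del delbar"
    and "is_exterior_d D \<rho> d d1"
    and "is_inverse_metric D \<rho> ip"
    and "is_levi_civita D \<rho> d nab"
    and "is_generalized_braiding D \<rho> \<sigma>"
    and "cpm + cmp = 1"
    and "is_splitting D \<rho> d \<sigma> cpm cmp s"
  shows "Ricci_pm D \<rho> d d1 ip nab s =
    (- cmp * qq D (- 2 * exp_m D) * qdim D) \<odot>\<^bsub>Omega11 D \<rho>\<^esub> g_pm D \<rho>"
proof -
  interpret hk: hk D \<rho>
    by (rule hk.intro[OF assms(1,2)])
  interpret ricci D \<rho> del delbar d1 ip nab \<sigma> s cpm cmp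
    using assms(3,5-8,10) unfolding assms(4)
    by (intro ricci.intro ricci_axioms.intro hk.hk_axioms)
  show ?thesis
    unfolding Ricci_pm_def assms(4) Omega11_def by (rule Ricci_plus_minus)
qed

end
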